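(* Let $n$ and $r$ be integers such that $n\geq 2$ and $1\leq r\leq n-1$. For each $a=0,1,\ldots,\lfloor r/2\rfloor$, write $a=(n-r)\alpha+s$ with integers $\alpha\ge 0$ and $0\le s<n-r$ (Euclidean division of $a$ by $n-r$), and define the following $n\times n$ complex symmetric matrix pencil in canonical form, of rank $r$: $$ \mathcal{K}_a(\lambda):=\operatorname{diag}\bigl(\underbrace{\mathcal{M}_{\alpha+1},\ldots,\mathcal{M}_{\alpha+1}}_{s},\underbrace{\mathcal{M}_{\alpha},\ldots,\mathcal{M}_{\alpha}}_{n-r-s},\mathcal{J}^s_1(\mu_1),\ldots,\mathcal{J}^s_1(\mu_{r-2a})\bigr), $$ where $\mu_1,\ldots,\mu_{r-2a}$ are arbitrary complex numbers, different from each other. (This gives $\lfloor r/2\rfloor+1$ canonical forms.) Let $\overline{\mathrm{B}^c}(\cdot)$ denote the closure, in the Euclidean topology, of the congruence bundle $\mathrm{B}^c(\cdot)$. Then: (i) For every $n\times n$ complex symmetric pencil $\mathcal{S}(\lambda)$ with rank at most $r$, there exists an integer $a\in\{0,1,\ldots,\lfloor r/2\rfloor\}$ such that $\overline{\mathrm{B}^c}(\mathcal{K}_a)\supseteq\overline{\mathrm{B}^c}(\mathcal{S})$. (ii) For all $a,a'\in\{0,1,\ldots,\lfloor r/2\rfloor\}$ with $a\neq a'$, $\overline{\mathrm{B}^c}(\mathcal{K}_a)\not\supseteq\overline{\mathrm{B}^c}(\mathcal{K}_{a'})$. (iii) The set $\mathrm{PENCIL}^s_{n\times n}(r)$ of $n\times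 n$ complex symmetric matrix pencils of rank at most $r$ is a closed subset of $\mathrm{PENCIL}^s_{n\times n}$, and $$\mathrm{PENCIL}^s_{n\times n}(r)=\bigcup_{0\leq a\leq\lfloor r/2\rfloor}\overline{\mathrm{B}^c}(\mathcal{K}_a).$$
   Context: All matrices have complex entries. An $n\times n$ matrix pencil is $\lambda A+B$ with $A,B\in\mathbb{C}^{n\times n}$; it is symmetric if $A^\top=A$ and $B^\top=B$. The set of all $n\times n$ pencils is identified with $\mathbb{C}^{2n^2}$; $\mathrm{PENCIL}^s_{n\times n}$ is the subspace of symmetric pencils, with the subspace topology induced by the Euclidean topology. The rank of a pencil is the size of its largest non-identically-zero minor (i.e. its rank over the field of rational functions in $\lambda$). $\mathrm{PENCIL}^s_{n\times n}(r)$ is the set of $n\times n$ symmetric pencils of rank at most $r$. Blocks. For $d\ge 0$, let $F_d=[\,0\ \ I_d\,]$ and $G_d=[\,I_d\ \ 0\,]$, both of size $d\times(d+1)$, $\mathcal{L}_d(\lambda)=\lambda G_d+F_d$, and $$\mathcal{M}_d(\lambda)=\begin{bmatrix}0&\mathcal{L}_d(\lambda)^\top\\ \mathcal{L}_d(\lambda)&0\end{bmatrix}\quad\text{of size }(2d+1)\times(2d+1);$$ $\mathcal{M}_0$ is the $1\times1$ zero matrix. For $\mu\in\mathbb{C}$, $\mathcal{J}^s_\ell(\mu)$ is the $\ell\times\ell$ symmetric pencil with entries $\lambda-\mu$ at positions $(i,j)$ with $i+j=\ell+1$, entries $1$ at positions with $i+j=\ell$, and zeros elsewhere; so $\mathcal{J}^s_1(\mu)=\lambda-\mu$.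 $\mathcal{J}^s_k(\infty)$ is the $k\times k$ symmetric pencil with entries $1$ at positions with $i+j=k+1$, entries $\lambda$ at positions with $i+j=k$, and zeros elsewhere; so $\mathcal{J}^s_1(\infty)=1$. Canonical form (known result). The congruence orbit of a symmetric pencil is $\mathrm{O}^c(\lambda A+B)=\{W^\top(\lambda A+B)W: W\in \mathrm{GL}_n(\mathbb{C})\}$. Every symmetric pencil is congruent to a direct sum of blocks of the forms $\mathcal{M}_d$, $\mathcal{J}^s_\ell(\mu)$ ($\mu\in\mathbb{C}$) and $\mathcal{J}^s_k(\infty)$, unique up to the order of the blocks. Bundle. For a symmetric pencil $\mathcal{S}(\lambda)$, the congruence bundle $\mathrm{B}^c(\mathcal{S})$ is the union of all congruence orbits of symmetric pencils whose canonical form has the same block structure (same block sizes) as that of $\mathcal{S}$, but where the values of the eigenvalues are unspecified: that is, the distinct eigenvalues of $\mathcal{S}$ in $\mathbb{C}\cup\{\infty\}$ may be replaced by any other distinct elements of $\mathbb{C}\cup\{\infty\}$, keeping the sizes of the blocks attached to each of them. In particular $\mathrm{B}^c(\mathcal{K}_a)$ does not depend on the choice of the distinct $\mu_i$. *)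

theory Defs
  imports
    "HOL-Analysis.Function_Topology"
    "HOL-Computational_Algebra.Polynomial"
    "Jordan_Normal_Form.Matrix"
    "Jordan_Normal_Form.Determinant"
    "Jordan_Normal_Form.DL_Submatrix"
begin

section \<open>Matrix pencils\<close>

text \<open>
  A pencil is represented as a matrix over the polynomial ring in the variable \<open>\<lambda>\<close>,
  i.e. \<open>\<lambda>\<close> is \<^term>\<open>[:0, 1:] :: complex poly\<close>.
\<close>

abbreviation const_mat :: "complex mat \<Rightarrow> complex poly mat" where
  "const_mat A \<equiv> map_mat (\<lambda>c. [:c:]) A"

definition pencil :: "complex mat \<Rightarrow> complex mat \<Rightarrow> complex poly mat" where
  "pencil A B = [:0, 1:] \<cdot>\<^sub>m const_mat A + const_mat B"

definition pencils :: "nat \<Rightarrow> complex poly mat set" where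
  "pencils n = {pencil A B | A B. A \<in> carrier_mat n n \<and> B \<in> carrier_mat n n}"

definition sym_pencils :: "nat \<Rightarrow> complex poly mat set" where
  "sym_pencils n = {pencil A B | A B. A \<in> carrier_mat n n \<and> B \<in> carrier_mat n n \<and>
     transpose_mat A = A \<and> transpose_mat B = B}"

text \<open>
  Since minors are polynomials in \<open>\<lambda>\<close>, \<open>\<noteq> 0\<close> below means ``not identically zero''.
  The empty minor is \<open>1\<close>, so the maximum is always over a nonempty finite set.
\<close>

definition pencil_rank :: "complex poly mat \<Rightarrow> nat" where
  "pencil_rank P = Max {k. \<exists>I J. I \<subseteq> {..<dim_row P} \<and> J \<subseteq> {..<dim_col P} \<and>
     card I = k \<and> card J = k \<and> Determinant.det (submatrix P I J) \<noteq> 0}"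

definition sym_pencils_rank_le :: "nat \<Rightarrow> nat \<Rightarrow> complex poly mat set" where
  "sym_pencils_rank_le n r = {P \<in> sym_pencils n. pencil_rank P \<le> r}"

section \<open>Euclidean topology\<close>

text \<open>
  The pencil \<open>\<lambda>A + B\<close> is identified with the \<open>2n\<^sup>2\<close> complex coordinates given by the entries
  of \<open>B\<close> (index \<open>k = 0\<close>) and of \<open>A\<close> (index \<open>k = 1\<close>).  The topology on \<^term>\<open>pencils n\<close> is
  the one carried over from \<open>\<complex>\<close> to the power \<open>2n\<^sup>2\<close>, written as a finite product of copies of
  \<open>\<complex>\<close>.
\<close>

definition coord_index :: "nat \<Rightarrow> (nat \<times> nat \<times> nat) set" where
  "coord_index n = {..<2} \<times> {..<n} \<times> {..<n}"

definition pencil_coords :: "nat \<Rightarrow> complex poly mat \<Rightarrow> nat \<times> nat \<times> nat \<Rightarrow> complex" where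
  "pencil_coords n P = (\<lambda>(k, i, j)\<in>coord_index n. coeff (P $$ (i, j)) k)"

definition pencil_topology :: "nat \<Rightarrow> complex poly mat topology" where
  "pencil_topology n = pullback_topology (pencils n) (pencil_coords n)
     (product_topology (\<lambda>_. euclidean) (coord_index n))"

definition sym_pencil_topology :: "nat \<Rightarrow> complex poly mat topology" where
  "sym_pencil_topology n = subtopology (pencil_topology n) (sym_pencils n)"

section \<open>Canonical blocks\<close>

text \<open>Indices start at \<open>0\<close> here, so e.g. the antidiagonal of an \<open>l \<times> l\<close> matrix is \<open>i + j + 1 = l\<close>.\<close>

definition F_mat :: "nat \<Rightarrow> complex mat" where
  "F_mat d = mat d (d + 1) (\<lambda>(i, j). if j = i + 1 then 1 else 0)"

definition G_mat :: "nat \<Rightarrow> complex mat" where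
  "G_mat d = mat d (d + 1) (\<lambda>(i, j). if j = i then 1 else 0)"

definition L_block :: "nat \<Rightarrow> complex poly mat" where
  "L_block d = pencil (G_mat d) (F_mat d)"

definition M_block :: "nat \<Rightarrow> complex poly mat" where
  "M_block d = four_block_mat
     (0\<^sub>m (d + 1) (d + 1)) (transpose_mat (L_block d))
     (L_block d)           (0\<^sub>m d d)"

definition J_block :: "nat \<Rightarrow> complex \<Rightarrow> complex poly mat" where
  "J_block l \<mu> = mat l l (\<lambda>(i, j).
     if i + j + 1 = l then [:- \<mu>, 1:] else if i + j + 2 = l then 1 else 0)"

definition J_inf_block :: "nat \<Rightarrow> complex poly mat" where
  "J_inf_block k = mat k k (\<lambda>(i, j).
     if i + j + 1 = k then 1 else if i + j + 2 = k then [:0, 1:] else 0)"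

datatype eigval = Finite complex | Infinite

datatype 'e block = Block_M nat | Block_J 'e nat

fun block_pencil :: "eigval block \<Rightarrow> complex poly mat" where
  "block_pencil (Block_M d) = M_block d"
| "block_pencil (Block_J (Finite \<mu>) l) = J_block l \<mu>"
| "block_pencil (Block_J Infinite k) = J_inf_block k"

fun proper_block :: "'e block \<Rightarrow> bool" where
  "proper_block (Block_M d) \<longleftrightarrow> True"
| "proper_block (Block_J e l) \<longleftrightarrow> l \<ge> 1"

definition block_diag :: "eigval block list \<Rightarrow> complex poly mat" where
  "block_diag bs = diag_block_mat (map block_pencil bs)"

definition eigvals :: "eigval block list \<Rightarrow> eigval set" where
  "eigvals bs = (\<Union>b\<in>set bs. set_block b)"

section \<open>Congruence orbits and bundles\<close>

definition congruence_orbit :: "complex poly mat \<Rightarrow> complex poly mat set" where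
  "congruence_orbit P = {const_mat (transpose_mat W) * P * const_mat W | W.
     W \<in> carrier_mat (dim_row P) (dim_row P) \<and> invertible_mat W}"

text \<open>The list \<open>bs\<close> of blocks is determined by \<open>S\<close> only up to order.\<close>

definition canonical_form_of :: "complex poly mat \<Rightarrow> eigval block list \<Rightarrow> bool" where
  "canonical_form_of S bs \<longleftrightarrow> list_all proper_block bs \<and> S \<in> congruence_orbit (block_diag bs)"

text \<open>
  The map \<open>f\<close> replaces the distinct eigenvalues by other distinct elements of
  \<open>\<complex> \<union> {\<infinity>}\<close>; \<^const>\<open>map_block\<close> leaves the kind and the size of each block unchanged.
\<close>

definition congruence_bundle :: "complex poly mat \<Rightarrow> complex poly mat set" where
  "congruence_bundle S = \<Union>{congruence_orbit (block_diag (map (map_block f) bs)) | bs f.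
     canonical_form_of S bs \<and> inj_on f (eigvals bs)}"

definition bundle_closure :: "nat \<Rightarrow> complex poly mat \<Rightarrow> complex poly mat set" where
  "bundle_closure n S = sym_pencil_topology n closure_of congruence_bundle S"

definition K_pencil :: "nat \<Rightarrow> nat \<Rightarrow> nat \<Rightarrow> (nat \<Rightarrow> complex) \<Rightarrow> complex poly mat" where
  "K_pencil n r a \<mu> = (let \<alpha> = a div (n - r); s = a mod (n - r) in
     block_diag (replicate s (Block_M (\<alpha> + 1)) @ replicate (n - r - s) (Block_M \<alpha>) @
       map (\<lambda>i. Block_J (Finite (\<mu> i)) 1) [1..<r - 2 * a + 1]))"

end

theory Submission
  imports "HOL-Analysis.Topology_Euclidean_Space" Defs "Jordan_Normal_Form.Spectral_Radius" "Jordan_Normal_Form.DL_Rank"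
begin

text \<open>
  A symmetric pencil \<open>\<lambda>A + B\<close> has rank at most \<open>n - m\<close> iff for some \<open>a\<close> it has the \<^emph>\<open>pattern\<close> of
  \<open>m\<close> and \<open>a\<close>: there are subspaces \<open>I \<subseteq> J\<close> of dimensions \<open>m + a\<close> and \<open>n - a\<close> such that both forms
  vanish on \<open>I \<times> J\<close>.  The pattern is found by induction on \<open>n\<close>, splitting off vectors of the kernel of
  \<open>A\<close>, where low rank is used in the form that \<open>det (z A + B + U U\<^sup>T) = 0\<close> for all \<open>U\<close> with fewer than
  \<open>m\<close> columns.  Every pencil with the pattern of \<open>m\<close> and \<open>a\<close> is a limit of pencils congruent to \<open>K\<^sub>a\<close>
  with varying simple eigenvalues; conversely the bundle of \<open>K\<^sub>a\<close> consists of pencils with that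
  pattern.  This gives (i) and (iii).

  For (ii), the pattern of \<open>m\<close> and \<open>a\<close> forces \<open>det (\<lambda>A + B + U U\<^sup>T) = g p\<^sub>U\<^sup>2\<close> for all \<open>U\<close> with \<open>m\<close> columns,
  where \<open>g\<close> does not depend on \<open>U\<close>, \<open>deg g \<le> n - m - 2a\<close> and \<open>deg p\<^sub>U \<le> a\<close>.  After normalizing the
  factors, this passes to limits.  For \<open>K\<close> with parameter \<open>a'\<close> two such determinants are, up to a
  constant, \<open>\<Prod> (\<lambda> - \<mu>\<^sub>i)\<close> and \<open>\<lambda>\<close> to the power \<open>2a'\<close> times it; as the \<open>\<mu>\<^sub>i\<close> are distinct, the first forces
  \<open>a \<le> a'\<close> and the second \<open>a' \<le> a\<close>.
\<close>


section \<open>Congruence and block matrices\<close>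

text \<open>Testing with \<open>U U^T\<close> suits symmetric pencils: it is a symmetric
  perturbation, a congruence by W carries it to the same kind of matrix with \<open>W^T U\<close>,
  and identities between determinants survive limits. The square in the factorization is due to
  symmetry: the zero block on I \<times> J occurs a second time transposed, so the two corners of
  the bordered matrix are transposes of each other up to sign, while g comes from the core between
  them, which the border does not touch. A large a leaves little degree to g, a small a leaves
  little to the squared factor; this opposition separates the bundles. Density is delicate because
  perturbations must stay inside the pattern. The outer coordinates are peeled off in layers of
  width min a m: removing such a layer from the staircase form leaves a staircase with the same m
  and a smaller a. A bundle refers to an arbitrary canonical form of its pencil, so the number and
  the total degree of the blocks M must be known to depend on the orbit alone; pairs of bordered
  determinants certify this too.\<close>

definition cmat :: "'a::comm_ring_1 mat \<Rightarrow> 'a mat \<Rightarrow> 'a mat" where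
  "cmat W A = transpose_mat W * A * W"

lemma cmat_carrier[simp]: "W \<in> carrier_mat n k \<Longrightarrow> cmat W A \<in> carrier_mat k k"
  unfolding cmat_def by auto

lemma cmat_dim[simp]: "dim_row (cmat W A) = dim_col W" "dim_col (cmat W A) = dim_col W"
  unfolding cmat_def by auto

lemma cmat_cmat:
  assumes "A \<in> carrier_mat n n" "W \<in> carrier_mat n k" "V \<in> carrier_mat k l"
  shows "cmat V (cmat W A) = cmat (W * V) A"
proof -
  have "cmat V (cmat W A) = transpose_mat V * (transpose_mat W * A * W) * V" by (simp add: cmat_def)
  also have "\<dots> = transpose_mat V * (transpose_mat W * A) * (W * V)"
    using assms by (smt (verit) assoc_mult_mat carrier_matD mult_carrier_mat transpose_carrier_mat)
  also have "transpose_mat V * (transpose_mat W * A) = transpose_mat (W * V) * A"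
    using assms by (simp add: transpose_mult[of W n k V l] assoc_mult_mat[of _ l k _ n _ n])
  finally show ?thesis by (simp add: cmat_def)
qed

lemma cmat_one[simp]: "A \<in> carrier_mat n n \<Longrightarrow> cmat (1\<^sub>m n) A = A"
  by (simp add: cmat_def)

lemma cmat_sym:
  assumes "A \<in> carrier_mat n n" "W \<in> carrier_mat n k" "transpose_mat A = A"
  shows "transpose_mat (cmat W A) = cmat W A"
proof -
  have "transpose_mat (transpose_mat W * A * W) = transpose_mat W * transpose_mat (transpose_mat W * A)"
    using assms by (intro transpose_mult) auto
  also have "transpose_mat (transpose_mat W * A) = transpose_mat A * transpose_mat (transpose_mat W)"
    using assms by (intro transpose_mult) auto
  also have "transpose_mat W * (transpose_mat A * transpose_mat (transpose_mat W)) = transpose_mat W * A * W"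
    using assms(3) assoc_mult_mat[OF _ assms(1,2), of "transpose_mat W" k] assms(2) by auto
  finally show ?thesis by (simp add: cmat_def)
qed

lemma cmat_det:
  assumes "A \<in> carrier_mat n n" "W \<in> carrier_mat n n"
  shows "det (cmat W A) = (det W)^2 * det A"
  using assms unfolding cmat_def
  by (simp add: det_mult[of _ n] det_transpose power2_eq_square)

lemma cmat_add:
  assumes "A \<in> carrier_mat n n" "B \<in> carrier_mat n n" "W \<in> carrier_mat n k"
  shows "cmat W (A + B) = cmat W A + cmat W B"
proof -
  have "transpose_mat W * (A + B) = transpose_mat W * A + transpose_mat W * B"
    using assms by (intro mult_add_distrib_mat) auto
  then show ?thesis unfolding cmat_def
    using assms by (simp add: add_mult_distrib_mat[of _ k n _ W k])
qed

lemma cmat_smult: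
  assumes "A \<in> carrier_mat n n" "W \<in> carrier_mat n k"
  shows "cmat W (c \<cdot>\<^sub>m A) = c \<cdot>\<^sub>m cmat W A"
  unfolding cmat_def using assms
  by (simp add: mult_smult_distrib[of _ k n _ n] mult_smult_assoc_mat[of _ k n _ k])

lemma mult_index:
  assumes "A \<in> carrier_mat n k" "B \<in> carrier_mat k l" "i < n" "j < l"
  shows "(A * B) $$ (i,j) = (\<Sum>x<k. A $$ (i,x) * B $$ (x,j))"
  using assms by (auto simp: scalar_prod_def atLeast0LessThan intro!: sum.cong)

lemma cmat_index:
  assumes "A \<in> carrier_mat n n" "W \<in> carrier_mat n k" "i < k" "j < k"
  shows "cmat W A $$ (i,j) = (\<Sum>y<n. (\<Sum>x<n. W $$ (x,i) * A $$ (x,y)) * W $$ (y,j))"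
  unfolding cmat_def using assms
  by (subst mult_index[of _ k n _ k])
    (auto intro!: sum.cong simp: mult_index[of _ k n _ n] simp del: index_mult_mat(1))

section \<open>Inverses and permutation matrices\<close>

lemma det_nz_inverse:
  fixes W :: "'a::field mat"
  assumes "W \<in> carrier_mat n n" "det W \<noteq> 0"
  obtains V where "V \<in> carrier_mat n n" "W * V = 1\<^sub>m n" "V * W = 1\<^sub>m n" "det V \<noteq> 0"
proof -
  from det_non_zero_imp_unit[OF assms, unfolded Units_def, of "()"]
  obtain V where Vc: "V \<in> carrier_mat n n" and WV: "W * V = 1\<^sub>m n" "V * W = 1\<^sub>m n"
    by (auto simp: ring_mat_def)
  have "V * W = 1\<^sub>m n" by fact
  moreover have "det V \<noteq> 0" using calculation det_mult[OF Vc assms(1)] by auto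
  ultimately show ?thesis using that Vc \<open>W * V = 1\<^sub>m n\<close> by blast
qed

lemma inverse_det_nz:
  fixes W :: "'a::field mat"
  assumes "W \<in> carrier_mat n n" "V \<in> carrier_mat n n" "W * V = 1\<^sub>m n"
  shows "det W \<noteq> 0"
  using det_mult[OF assms(1,2)] assms(3) by auto

definition perm_mat :: "nat \<Rightarrow> (nat \<Rightarrow> nat) \<Rightarrow> 'a::comm_ring_1 mat" where
  "perm_mat n \<sigma> = mat n n (\<lambda>(i,j). if i = \<sigma> j then 1 else 0)"

lemma perm_mat_carrier[simp]: "perm_mat n \<sigma> \<in> carrier_mat n n"
  by (simp add: perm_mat_def)

lemma cmat_perm:
  assumes "A \<in> carrier_mat n n" "\<sigma> ` {..<n} \<subseteq> {..<n}"
  shows "cmat (perm_mat n \<sigma>) A = mat n n (\<lambda>(i,j). A $$ (\<sigma> i, \<sigma> j))"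
proof (rule eq_matI)
  fix i j assume ij: "i < dim_row (mat n n (\<lambda>(i,j). A $$ (\<sigma> i, \<sigma> j)))" "j < dim_col (mat n n (\<lambda>(i,j). A $$ (\<sigma> i, \<sigma> j)))"
  then have ij': "i < n" "j < n" and s: "\<sigma> i < n" "\<sigma> j < n" using assms by auto
  show "cmat (perm_mat n \<sigma>) A $$ (i,j) = mat n n (\<lambda>(i,j). A $$ (\<sigma> i, \<sigma> j)) $$ (i,j)"
    using ij' s assms
    by (simp add: cmat_index[of _ n _ n] perm_mat_def if_distrib[where f="\<lambda>x. x * _"] if_distrib[where f="\<lambda>x. _ * x"]
       sum.delta' cong: if_cong)
qed (auto simp: perm_mat_def)

text \<open>Permuting the rows and columns of the identity simultaneously gives the identity again.
  The determinant of this congruence is the square, so no permutation sign has to be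
  computed.\<close>

lemma det_perm_mat_sq:
  assumes "bij_betw \<sigma> {..<n} {..<n}"
  shows "(det (perm_mat n \<sigma> :: 'a::idom mat))^2 = 1"
proof -
  have inj: "\<And>i j. i < n \<Longrightarrow> j < n \<Longrightarrow> \<sigma> i = \<sigma> j \<Longrightarrow> i = j"
    using assms unfolding bij_betw_def inj_on_def by auto
  have img: "\<sigma> ` {..<n} \<subseteq> {..<n}" using assms unfolding bij_betw_def by auto
  have "cmat (perm_mat n \<sigma>) (1\<^sub>m n :: 'a mat) = 1\<^sub>m n"
    unfolding cmat_perm[OF one_carrier_mat img]
  proof (rule eq_matI)
    fix i j assume "i < dim_row (1\<^sub>m n :: 'a mat)" "j < dim_col (1\<^sub>m n :: 'a mat)"
    then have ij: "i < n" "j < n" "\<sigma> i < n" "\<sigma> j < n" using img by auto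
    then show "mat n n (\<lambda>(i,j). 1\<^sub>m n $$ (\<sigma> i, \<sigma> j)) $$ (i,j) = (1\<^sub>m n :: 'a mat) $$ (i,j)"
      using inj[of i j] by auto
  qed auto
  from arg_cong[OF this, of det] show ?thesis
    using cmat_det[of "1\<^sub>m n" n "perm_mat n \<sigma> :: 'a mat"] by auto
qed

lemma det_perm_mat_nz:
  assumes "bij_betw \<sigma> {..<n} {..<n}"
  shows "det (perm_mat n \<sigma> :: 'a::idom mat) \<noteq> 0"
  using det_perm_mat_sq[OF assms, where 'a='a] by auto

text \<open>Three diagonal blocks suit the antitriangular shapes that arise: two outer layers and a
  core between them. With \<open>p = 0\<close> the same definition serves for splitting into two
  blocks.\<close>

definition blk :: "nat \<Rightarrow> nat \<Rightarrow> nat \<Rightarrow> 'a mat \<Rightarrow> 'a mat \<Rightarrow> 'a mat \<Rightarrow> 'a mat \<Rightarrow> 'a mat \<Rightarrow> 'a mat \<Rightarrow> 'a mat \<Rightarrow> 'a mat \<Rightarrow> 'a mat \<Rightarrow> 'a mat" where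
  "blk p q s a b c d e f g h k = mat (p+q+s) (p+q+s) (\<lambda>(i,j).
     if i < p then (if j < p then a $$ (i,j) else if j < p+q then b $$ (i,j-p) else c $$ (i,j-p-q))
     else if i < p+q then (if j < p then d $$ (i-p,j) else if j < p+q then e $$ (i-p,j-p) else f $$ (i-p,j-p-q))
     else (if j < p then g $$ (i-p-q,j) else if j < p+q then h $$ (i-p-q,j-p) else k $$ (i-p-q,j-p-q)))"

lemma blk_carrier[simp]: "blk p q s a b c d e f g h k \<in> carrier_mat (p+q+s) (p+q+s)"
  by (simp add: blk_def)

lemma blk_dim[simp]: "dim_row (blk p q s a b c d e f g h k) = p+q+s" "dim_col (blk p q s a b c d e f g h k) = p+q+s"
  by (simp_all add: blk_def)

definition sub_blk :: "'a mat \<Rightarrow> nat \<Rightarrow> nat \<Rightarrow> nat \<Rightarrow> nat \<Rightarrow> 'a mat" where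
  "sub_blk M i0 j0 k l = mat k l (\<lambda>(i,j). M $$ (i0+i, j0+j))"

lemma sub_blk_carrier[simp]: "sub_blk M i0 j0 k l \<in> carrier_mat k l"
  by (simp add: sub_blk_def)

lemma blk_split:
  assumes "M \<in> carrier_mat (p+q+s) (p+q+s)"
  shows "M = blk p q s (sub_blk M 0 0 p p) (sub_blk M 0 p p q) (sub_blk M 0 (p+q) p s)
    (sub_blk M p 0 q p) (sub_blk M p p q q) (sub_blk M p (p+q) q s)
    (sub_blk M (p+q) 0 s p) (sub_blk M (p+q) p s q) (sub_blk M (p+q) (p+q) s s)"
  by (rule eq_matI) (use assms in \<open>auto simp: blk_def sub_blk_def\<close>)

lemma transpose_sub_blk:
  assumes "M \<in> carrier_mat n n" "transpose_mat M = M" "i0 + k \<le> n" "j0 + l \<le> n"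
  shows "transpose_mat (sub_blk M i0 j0 k l) = sub_blk M j0 i0 l k"
proof (rule eq_matI)
  fix i j assume "i < dim_row (sub_blk M j0 i0 l k)" "j < dim_col (sub_blk M j0 i0 l k)"
  then have ij: "i < l" "j < k" by (auto simp: sub_blk_def)
  have "M $$ (i0 + j, j0 + i) = transpose_mat M $$ (j0 + i, i0 + j)"
    using assms ij by (subst index_transpose_mat) auto
  then show "transpose_mat (sub_blk M i0 j0 k l) $$ (i,j) = sub_blk M j0 i0 l k $$ (i,j)"
    using ij assms by (simp add: sub_blk_def)
qed (auto simp: sub_blk_def)

lemma sum3: "(\<Sum>l<p+q+s. f l) = (\<Sum>l<p. f l) + (\<Sum>l<q. f (p+l)) + (\<Sum>l<(s::nat). f (p+q+l) :: 'a::comm_monoid_add)"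
proof -
  have *: "(\<Sum>l<x+y. g l) = (\<Sum>l<x. g l) + (\<Sum>l<y. g (x+l))" for x y and g :: "nat \<Rightarrow> 'a"
    by (induction y) (auto simp: add.assoc)
  show ?thesis by (simp add: * add.assoc)
qed

lemma blk_mult:
  fixes a :: "'a::comm_ring_1 mat"
  assumes "a \<in> carrier_mat p p" "b \<in> carrier_mat p q" "c \<in> carrier_mat p s"
    "d \<in> carrier_mat q p" "e \<in> carrier_mat q q" "f \<in> carrier_mat q s"
    "g \<in> carrier_mat s p" "h \<in> carrier_mat s q" "k \<in> carrier_mat s s"
    "a' \<in> carrier_mat p p" "b' \<in> carrier_mat p q" "c' \<in> carrier_mat p s"
    "d' \<in> carrier_mat q p" "e' \<in> carrier_mat q q" "f' \<in> carrier_mat q s"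
    "g' \<in> carrier_mat s p" "h' \<in> carrier_mat s q" "k' \<in> carrier_mat s s"
  shows "blk p q s a b c d e f g h k * blk p q s a' b' c' d' e' f' g' h' k' =
   blk p q s (a*a'+b*d'+c*g') (a*b'+b*e'+c*h') (a*c'+b*f'+c*k')
     (d*a'+e*d'+f*g') (d*b'+e*e'+f*h') (d*c'+e*f'+f*k')
     (g*a'+h*d'+k*g') (g*b'+h*e'+k*h') (g*c'+h*f'+k*k')" (is "?L * ?R = ?X")
proof (rule eq_matI)
  fix i j assume "i < dim_row ?X" "j < dim_col ?X"
  then have ij: "i < p+q+s" "j < p+q+s" by auto
  have L: "(?L * ?R) $$ (i,j) = (\<Sum>l<p. ?L $$ (i,l) * ?R $$ (l,j)) + (\<Sum>l<q. ?L $$ (i,p+l) * ?R $$ (p+l,j))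
     + (\<Sum>l<s. ?L $$ (i,p+q+l) * ?R $$ (p+q+l,j))"
    using ij by (subst mult_index[of _ "p+q+s" "p+q+s" _ "p+q+s"]) (auto simp: sum3)
  note mi = mult_index[of _ p p] mult_index[of _ p q] mult_index[of _ p s]
    mult_index[of _ q p] mult_index[of _ q q] mult_index[of _ q s]
    mult_index[of _ s p] mult_index[of _ s q] mult_index[of _ s s]
  consider "i < p" | "p \<le> i" "i < p+q" | "p+q \<le> i" by linarith
  then show "(?L * ?R) $$ (i,j) = ?X $$ (i,j)"
  proof cases
    case 1
    consider "j < p" | "p \<le> j" "j < p+q" | "p+q \<le> j" by linarith
    then show ?thesis unfolding L using 1 ij assms
      by cases (simp_all add: blk_def mi[where l=p] mi[where l=q] mi[where l=s] del: index_mult_mat(1))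
  next
    case 2
    then have i: "i - p < q" "\<not> i < p" by auto
    consider "j < p" | "p \<le> j" "j < p+q" | "p+q \<le> j" by linarith
    then show ?thesis unfolding L using 2 i ij assms
      by cases (simp_all add: blk_def mi[where l=p] mi[where l=q] mi[where l=s] del: index_mult_mat(1))
  next
    case 3
    then have i: "i - p - q < s" "i - (p+q) < s" "\<not> i < p" "\<not> i < p+q" using ij by auto
    consider "j < p" | "p \<le> j" "j < p+q" | "p+q \<le> j" by linarith
    then show ?thesis unfolding L using 3 i ij assms
      by cases (simp_all add: blk_def mi[where l=p] mi[where l=q] mi[where l=s] del: index_mult_mat(1))
  qed
qed auto

lemma blk_transpose:
  assumes "a \<in> carrier_mat p p" "b \<in> carrier_mat p q" "c \<in> carrier_mat p s"
    "d \<in> carrier_mat q p" "e \<in> carrier_mat q q" "f \<in> carrier_mat q s"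
    "g \<in> carrier_mat s p" "h \<in> carrier_mat s q" "k \<in> carrier_mat s s"
  shows "transpose_mat (blk p q s a b c d e f g h k) =
    blk p q s (transpose_mat a) (transpose_mat d) (transpose_mat g) (transpose_mat b) (transpose_mat e) (transpose_mat h)
      (transpose_mat c) (transpose_mat f) (transpose_mat k)"
  by (rule eq_matI) (use assms in \<open>auto simp: blk_def\<close>)

lemma blk_det_upper:
  fixes a :: "'a::idom mat"
  assumes "a \<in> carrier_mat p p" "b \<in> carrier_mat p q" "c \<in> carrier_mat p s"
    "e \<in> carrier_mat q q" "f \<in> carrier_mat q s" "k \<in> carrier_mat s s"
  shows "det (blk p q s a b c (0\<^sub>m q p) e f (0\<^sub>m s p) (0\<^sub>m s q) k) = det a * det e * det k"
proof -
  have "blk p q s a b c (0\<^sub>m q p) e f (0\<^sub>m s p) (0\<^sub>m s q) k =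
    four_block_mat (four_block_mat a b (0\<^sub>m q p) e) (mat (p+q) s (\<lambda>(i,j). if i < p then c $$ (i,j) else f $$ (i-p,j)))
      (0\<^sub>m s (p+q)) k"
    by (rule eq_matI) (use assms in \<open>auto simp: blk_def\<close>)
  also have "det \<dots> = det (four_block_mat a b (0\<^sub>m q p) e) * det k"
    by (rule det_four_block_mat_lower_left_zero) (use assms in auto)
  also have "det (four_block_mat a b (0\<^sub>m q p) e) = det a * det e"
    by (rule det_four_block_mat_lower_left_zero) (use assms in auto)
  finally show ?thesis .
qed

lemma blk_one: "blk p q s (1\<^sub>m p) (0\<^sub>m p q) (0\<^sub>m p s) (0\<^sub>m q p) (1\<^sub>m q) (0\<^sub>m q s) (0\<^sub>m s p) (0\<^sub>m s q) (1\<^sub>m s) = 1\<^sub>m (p+q+s)"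
  by (rule eq_matI) (auto simp: blk_def)

text \<open>The sign of the permutation that exchanges the first and the last p coordinates. It is
  kept as a determinant, since what matters about it is that its square is 1.\<close>

definition anti_sign :: "nat \<Rightarrow> nat \<Rightarrow> 'a::idom" where
  "anti_sign p q = det (blk p q p (0\<^sub>m p p) (0\<^sub>m p q) (1\<^sub>m p) (0\<^sub>m q p) (1\<^sub>m q) (0\<^sub>m q p) (1\<^sub>m p) (0\<^sub>m p q) (0\<^sub>m p p))"

lemma anti_sign_sq: "(anti_sign p q :: 'a::idom)^2 = 1"
proof -
  let ?P = "blk p q p (0\<^sub>m p p) (0\<^sub>m p q) (1\<^sub>m p) (0\<^sub>m q p) (1\<^sub>m q) (0\<^sub>m q p) (1\<^sub>m p) (0\<^sub>m p q) (0\<^sub>m p p) :: 'a mat"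
  have "?P * ?P = 1\<^sub>m (p+q+p)"
    by (subst blk_mult) (auto simp: blk_one)
  from arg_cong[OF this, of det] show ?thesis
    by (simp add: det_mult[of _ "p+q+p"] power2_eq_square anti_sign_def)
qed

text \<open>Multiplication by the block permutation behind \<open>anti_sign\<close> exchanges the
  outer block rows and leaves a block upper triangular matrix.\<close>

lemma blk_det_anti:
  fixes c :: "'a::idom mat"
  assumes c: "c \<in> carrier_mat p p" "e \<in> carrier_mat q q" "f \<in> carrier_mat q p" "g \<in> carrier_mat p p"
    "h \<in> carrier_mat p q" "k \<in> carrier_mat p p"
  shows "det (blk p q p (0\<^sub>m p p) (0\<^sub>m p q) c (0\<^sub>m q p) e f g h k) = anti_sign p q * det c * det e * det g"
proof -
  let ?P = "blk p q p (0\<^sub>m p p) (0\<^sub>m p q) (1\<^sub>m p) (0\<^sub>m q p) (1\<^sub>m q) (0\<^sub>m q p) (1\<^sub>m p) (0\<^sub>m p q) (0\<^sub>m p p) :: 'a mat"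
  let ?M = "blk p q p (0\<^sub>m p p) (0\<^sub>m p q) c (0\<^sub>m q p) e f g h k"
  have "?P * ?M = blk p q p g h k (0\<^sub>m q p) e f (0\<^sub>m p p) (0\<^sub>m p q) c"
    using c by (subst blk_mult) auto
  from arg_cong[OF this, of det] have "det ?P * det ?M = det g * det e * det c"
    using c by (simp add: det_mult[of _ "p+q+p"] blk_det_upper)
  moreover have "x * y = z \<Longrightarrow> x^2 = 1 \<Longrightarrow> y = x * z" for x y z :: 'a
    by (metis mult.assoc mult.left_neutral power2_eq_square)
  ultimately have "det ?M = det ?P * (det g * det e * det c)"
    using anti_sign_sq[of p q, where 'a='a] unfolding anti_sign_def by blast
  then show ?thesis unfolding anti_sign_def by (simp only: mult_ac)
qed

text \<open>A block upper triangular W maps the first block of coordinates into itself, and the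
  first two together into themselves; hence the zero blocks survive. The shears, scalings and core
  changes of later sections are instances.\<close>

lemma cmat_blk_upper:
  fixes K :: "'a::comm_ring_1 mat"
  assumes "V1 \<in> carrier_mat p p" "Y2 \<in> carrier_mat p q" "Y3 \<in> carrier_mat p s"
    "V2 \<in> carrier_mat q q" "X \<in> carrier_mat q s" "V3 \<in> carrier_mat s s"
    "K \<in> carrier_mat q q" "c \<in> carrier_mat p s" "c' \<in> carrier_mat s p" "h' \<in> carrier_mat q s" "h \<in> carrier_mat s q" "t \<in> carrier_mat s s"
  shows "cmat (blk p q s V1 Y2 Y3 (0\<^sub>m q p) V2 X (0\<^sub>m s p) (0\<^sub>m s q) V3)
     (blk p q s (0\<^sub>m p p) (0\<^sub>m p q) c (0\<^sub>m q p) K h' c' h t) =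
    blk p q s (0\<^sub>m p p) (0\<^sub>m p q) (transpose_mat V1 * c * V3)
      (0\<^sub>m q p) (transpose_mat V2 * K * V2) (transpose_mat Y2 * c * V3 + transpose_mat V2 * (K * X + h' * V3))
      (transpose_mat V3 * c' * V1) (transpose_mat X * K * V2 + transpose_mat V3 * (c' * Y2 + h * V2))
      (transpose_mat Y3 * c * V3 + transpose_mat X * (K * X + h' * V3) + transpose_mat V3 * (c' * Y3 + h * X + t * V3))"
proof -
  let ?W = "blk p q s V1 Y2 Y3 (0\<^sub>m q p) V2 X (0\<^sub>m s p) (0\<^sub>m s q) V3"
  let ?M = "blk p q s (0\<^sub>m p p) (0\<^sub>m p q) c (0\<^sub>m q p) K h' c' h t"
  have "cmat ?W ?M = transpose_mat ?W * (?M * ?W)"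
    unfolding cmat_def by (rule assoc_mult_mat[of _ "p+q+s" "p+q+s" _ "p+q+s" _ "p+q+s"]) auto
  also have "?M * ?W = blk p q s (0\<^sub>m p p) (0\<^sub>m p q) (c * V3) (0\<^sub>m q p) (K * V2) (K * X + h' * V3)
      (c' * V1) (c' * Y2 + h * V2) (c' * Y3 + h * X + t * V3)"
    using assms by (subst blk_mult) auto
  also have "transpose_mat ?W = blk p q s (transpose_mat V1) (0\<^sub>m p q) (0\<^sub>m p s) (transpose_mat Y2) (transpose_mat V2) (0\<^sub>m q s)
     (transpose_mat Y3) (transpose_mat X) (transpose_mat V3)"
    using assms by (subst blk_transpose) auto
  finally show ?thesis
    using assms by (subst (asm) blk_mult)
     (auto simp: assoc_mult_mat[of _ p p _ s _ s] assoc_mult_mat[of _ q q _ q _ q] assoc_mult_mat[of _ q p _ s _ s]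
      assoc_mult_mat[of _ s s _ p _ p] assoc_mult_mat[of _ s q _ q _ q] assoc_mult_mat[of _ s p _ s _ s])
qed


lemma blk_det_unit:
  fixes V1 :: "'a::idom mat"
  assumes "V1 \<in> carrier_mat p p" "Y2 \<in> carrier_mat p q" "Y3 \<in> carrier_mat p s"
    "V2 \<in> carrier_mat q q" "X \<in> carrier_mat q s" "V3 \<in> carrier_mat s s" "det V1 \<noteq> 0" "det V2 \<noteq> 0" "det V3 \<noteq> 0"
  shows "det (blk p q s V1 Y2 Y3 (0\<^sub>m q p) V2 X (0\<^sub>m s p) (0\<^sub>m s q) V3) \<noteq> 0"
  using assms by (simp add: blk_det_upper)

section \<open>Rank of a pencil\<close>

text \<open>Padding both factors with zeros to size n keeps the product and gives the left factor a
  zero column.\<close>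

lemma det_mult_narrow:
  fixes X :: "'a::idom mat"
  assumes "X \<in> carrier_mat n k" "Y \<in> carrier_mat k n" "k < n"
  shows "det (X * Y) = 0"
proof -
  let ?X = "mat n n (\<lambda>(i,j). if j < k then X $$ (i,j) else 0)"
  let ?Y = "mat n n (\<lambda>(i,j). if i < k then Y $$ (i,j) else 0)"
  have "X * Y = ?X * ?Y"
  proof (rule eq_matI)
    fix i j assume "i < dim_row (?X * ?Y)" "j < dim_col (?X * ?Y)"
    then have ij: "i < n" "j < n" by auto
    have "(\<Sum>x<k. X $$ (i,x) * Y $$ (x,j)) = (\<Sum>x<n. ?X $$ (i,x) * ?Y $$ (x,j))"
      using assms ij by (intro sum.mono_neutral_cong_left) auto
    then show "(X * Y) $$ (i,j) = (?X * ?Y) $$ (i,j)"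
      using ij assms mult_index[OF assms(1,2) ij] mult_index[of ?X n n ?Y n i j] by simp
  qed (use assms in auto)
  moreover have "det ?X = 0"
  proof -
    have "?X *\<^sub>v unit_vec n k = 0\<^sub>v n"
      by (rule eq_vecI) (use assms in \<open>auto simp: scalar_prod_def unit_vec_def if_distrib[where f="\<lambda>x. _ * x"] cong: if_cong\<close>)
    moreover have "unit_vec n k \<noteq> (0\<^sub>v n :: 'a vec)" using assms by (auto dest!: arg_cong[of _ _ "\<lambda>v. v $ k"])
    ultimately have "\<exists>v. v \<in> carrier_vec n \<and> v \<noteq> 0\<^sub>v n \<and> ?X *\<^sub>v v = 0\<^sub>v n"
      by (intro exI[of _ "unit_vec n k"]) auto
    then show ?thesis using det_0_iff_vec_prod_zero[of ?X n] by simp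
  qed
  ultimately show ?thesis by (simp add: det_mult[of _ n])
qed

text \<open>Rows and columns are selected by arbitrary maps, in any order and possibly with
  repetitions: a minor can then be bordered by one more row and column without re-sorting index
  sets.\<close>

definition minors_zero :: "'a::comm_ring_1 mat \<Rightarrow> nat \<Rightarrow> bool" where
  "minors_zero M k \<longleftrightarrow> (\<forall>f g. f ` {..<k} \<subseteq> {..<dim_row M} \<longrightarrow> g ` {..<k} \<subseteq> {..<dim_col M} \<longrightarrow>
      det (mat k k (\<lambda>(i,j). M $$ (f i, g j))) = 0)"

text \<open>Gaussian elimination: a nonzero entry p at (i0,j0) splits off a matrix of rank one. A
  minor of M bordered by row i0 and column j0 is p times the corresponding minor of the remainder,
  so the remainder satisfies the hypothesis with r lowered by one.\<close>

lemma rank_factorization: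
  fixes M :: "'a::field mat"
  assumes "M \<in> carrier_mat n l" "minors_zero M (Suc r)"
  shows "\<exists>X\<in>carrier_mat n r. \<exists>Y\<in>carrier_mat r l. M = X * Y"
  using assms
proof (induction r arbitrary: M)
  case 0
  have "M $$ (i,j) = 0" if "i < n" "j < l" for i j
  proof -
    have "det (mat 1 1 (\<lambda>(x,y). M $$ (i, j))) = 0"
    proof -
      have "(\<lambda>_. i) ` {..<Suc 0} \<subseteq> {..<dim_row M}" "(\<lambda>_. j) ` {..<Suc 0} \<subseteq> {..<dim_col M}"
        using 0 that by auto
      then have "det (mat (Suc 0) (Suc 0) (\<lambda>(x,y). M $$ ((\<lambda>_. i) x, (\<lambda>_. j) y))) = 0"
        using 0(2) unfolding minors_zero_def by blast
      then show ?thesis by simp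
    qed
    then show ?thesis by (simp add: det_single)
  qed
  then have "M = 0\<^sub>m n 0 * 0\<^sub>m 0 l" using 0 by (intro eq_matI) (auto simp: scalar_prod_def)
  then show ?case by (metis zero_carrier_mat)
next
  case (Suc r)
  show ?case
  proof (cases "\<exists>i<n. \<exists>j<l. M $$ (i,j) \<noteq> 0")
    case False
    then have "M = 0\<^sub>m n (Suc r) * 0\<^sub>m (Suc r) l" using Suc.prems by (intro eq_matI) auto
    then show ?thesis by (metis zero_carrier_mat)
  next
    case True
    then obtain i0 j0 where ij0: "i0 < n" "j0 < l" and p: "M $$ (i0,j0) \<noteq> 0" by auto
    define p where "p = M $$ (i0,j0)"
    have p0: "p \<noteq> 0" using p p_def by simp
    define M' where "M' = mat n l (\<lambda>(i,j). M $$ (i,j) - M $$ (i,j0) * M $$ (i0,j) / p)"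
    have "minors_zero M' (Suc r)"
      unfolding minors_zero_def
    proof (intro allI impI)
      fix f g assume fg: "f ` {..<Suc r} \<subseteq> {..<dim_row M'}" "g ` {..<Suc r} \<subseteq> {..<dim_col M'}"
      \<comment> \<open>Position 0 is reserved for the pivot row and column, and the given selection
        is shifted by one.\<close>
      define f' where "f' = (\<lambda>k. if k = 0 then i0 else f (k - 1))"
      define g' where "g' = (\<lambda>k. if k = 0 then j0 else g (k - 1))"
      let ?k = "Suc r"
      let ?D = "mat ?k ?k (\<lambda>(i,j). M $$ (f i, g j))"
      let ?D' = "mat ?k ?k (\<lambda>(i,j). M' $$ (f i, g j))"
      let ?c = "mat ?k 1 (\<lambda>(i,j). M $$ (f i, j0))"
      let ?r = "mat 1 ?k (\<lambda>(i,j). M $$ (i0, g j))"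
      let ?r' = "mat 1 ?k (\<lambda>(i,j). - M $$ (i0, g j) / p)"
      have fg': "\<And>i. i < ?k \<Longrightarrow> f i < n" "\<And>i. i < ?k \<Longrightarrow> g i < l" using fg by (auto simp: M'_def)
      have "det (mat (Suc ?k) (Suc ?k) (\<lambda>(i,j). M $$ (f' i, g' j))) = 0"
        using Suc.prems fg' ij0 unfolding minors_zero_def
        by (elim allE[of _ f'] allE[of _ g']) (auto simp: f'_def g'_def less_Suc_eq_0_disj)
      also have "mat (Suc ?k) (Suc ?k) (\<lambda>(i,j). M $$ (f' i, g' j)) = four_block_mat (mat 1 1 (\<lambda>_. p)) ?r ?c ?D"
        by (rule eq_matI) (auto simp: f'_def g'_def p_def)
      finally have z: "det (four_block_mat (mat 1 1 (\<lambda>_. p)) ?r ?c ?D) = 0" .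
      let ?E = "four_block_mat (1\<^sub>m 1) ?r' (0\<^sub>m ?k 1) (1\<^sub>m ?k)"
      have "four_block_mat (mat 1 1 (\<lambda>_. p)) ?r ?c ?D * ?E = four_block_mat (mat 1 1 (\<lambda>_. p) * 1\<^sub>m 1 + ?r * 0\<^sub>m ?k 1) (mat 1 1 (\<lambda>_. p) * ?r' + ?r * 1\<^sub>m ?k)
          (?c * 1\<^sub>m 1 + ?D * 0\<^sub>m ?k 1) (?c * ?r' + ?D * 1\<^sub>m ?k)"
        by (rule mult_four_block_mat) auto
      also have "mat 1 1 (\<lambda>_. p) * ?r' + ?r * 1\<^sub>m ?k = 0\<^sub>m 1 ?k"
        by (rule eq_matI) (use p0 in \<open>auto simp: scalar_prod_def\<close>)
      also have "?c * ?r' + ?D * 1\<^sub>m ?k = ?D'"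
        by (rule eq_matI) (use p0 fg' in \<open>auto simp: scalar_prod_def M'_def\<close>)
      also have "mat 1 1 (\<lambda>_. p) * 1\<^sub>m 1 + ?r * 0\<^sub>m ?k 1 = mat 1 1 (\<lambda>_. p)" by (subst right_mult_zero_mat[of _ 1]) auto
      finally have eq: "four_block_mat (mat 1 1 (\<lambda>_. p)) ?r ?c ?D * ?E =
        four_block_mat (mat 1 1 (\<lambda>_. p)) (0\<^sub>m 1 ?k) (?c * 1\<^sub>m 1 + ?D * 0\<^sub>m ?k 1) ?D'" .
      have "det (four_block_mat (mat 1 1 (\<lambda>_. p)) ?r ?c ?D * ?E) = det (four_block_mat (mat 1 1 (\<lambda>_. p)) ?r ?c ?D) * det ?E"
        by (rule det_mult[of _ "1 + ?k"]) (rule four_block_carrier_mat; simp)+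
      then have "det (four_block_mat (mat 1 1 (\<lambda>_. p)) (0\<^sub>m 1 ?k) (?c * 1\<^sub>m 1 + ?D * 0\<^sub>m ?k 1) ?D') = 0"
        unfolding eq z by simp
      then have "det (mat 1 1 (\<lambda>_. p)) * det ?D' = 0"
        by (subst (asm) det_four_block_mat_upper_right_zero[of _ 1 _ ?k]) (auto intro!: carrier_matI)
      then show "det ?D' = 0" using p0 by (simp add: det_single)
    qed
    then obtain X Y where XY: "X \<in> carrier_mat n r" "Y \<in> carrier_mat r l" "M' = X * Y"
      using Suc.IH[of M'] by (auto simp: M'_def)
    let ?X = "mat n (Suc r) (\<lambda>(i,j). if j < r then X $$ (i,j) else M $$ (i,j0) / p)"
    let ?Y = "mat (Suc r) l (\<lambda>(i,j). if i < r then Y $$ (i,j) else M $$ (i0,j))"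
    have "M = ?X * ?Y"
    proof (rule eq_matI)
      fix i j assume "i < dim_row (?X * ?Y)" "j < dim_col (?X * ?Y)"
      then have ij: "i < n" "j < l" by auto
      have "(?X * ?Y) $$ (i,j) = (\<Sum>x<r. X $$ (i,x) * Y $$ (x,j)) + M $$ (i,j0) / p * M $$ (i0,j)"
        using ij by (subst mult_index[of _ n "Suc r" _ l]) auto
      also have "(\<Sum>x<r. X $$ (i,x) * Y $$ (x,j)) = M' $$ (i,j)"
        using XY ij mult_index[OF XY(1,2) ij] by simp
      finally show "M $$ (i,j) = (?X * ?Y) $$ (i,j)" using ij by (simp add: M'_def)
    qed (use Suc.prems in auto)
    then show ?thesis by (intro bexI[of _ ?X] bexI[of _ ?Y]) auto
  qed
qed

text \<open>The sum is the product of \<open>[X U]\<close> with \<open>Y\<close> stacked on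
  \<open>U^T\<close>, a factorization through dimension r + k < n.\<close>

lemma low_rank_det:
  fixes X :: "'a::idom mat"
  assumes "X \<in> carrier_mat n r" "Y \<in> carrier_mat r n" "U \<in> carrier_mat n k" "r + k < n"
  shows "det (X * Y + U * transpose_mat U) = 0"
proof -
  let ?X = "mat n (r+k) (\<lambda>(i,j). if j < r then X $$ (i,j) else U $$ (i,j-r))"
  let ?Y = "mat (r+k) n (\<lambda>(i,j). if i < r then Y $$ (i,j) else U $$ (j,i-r))"
  have "X * Y + U * transpose_mat U = ?X * ?Y"
  proof (rule eq_matI)
    fix i j assume "i < dim_row (?X * ?Y)" "j < dim_col (?X * ?Y)"
    then have ij: "i < n" "j < n" by auto
    have "(?X * ?Y) $$ (i,j) = (\<Sum>x<r+k+0. ?X $$ (i,x) * ?Y $$ (x,j))"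
      using ij by (subst mult_index[of _ n "r+k" _ n]) auto
    also have "\<dots> = (\<Sum>x<r. X $$ (i,x) * Y $$ (x,j)) + (\<Sum>x<k. U $$ (i,x) * U $$ (j,x))"
      unfolding sum3 using ij by simp
    also have "\<dots> = (X * Y) $$ (i,j) + (U * transpose_mat U) $$ (i,j)"
      using assms ij by (subst (1 2) mult_index[of _ n _ _ n]) (auto simp del: index_mult_mat(1))
    finally show "(X * Y + U * transpose_mat U) $$ (i,j) = (?X * ?Y) $$ (i,j)" using ij assms by simp
  qed (use assms in auto)
  then show ?thesis using det_mult_narrow[of ?X n "r+k" ?Y] assms by simp
qed

lemma perm_mat_rows_cols:
  assumes "A \<in> carrier_mat n n" "\<pi> ` {..<n} \<subseteq> {..<n}" "\<sigma> ` {..<n} \<subseteq> {..<n}"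
  shows "transpose_mat (perm_mat n \<pi>) * A * perm_mat n \<sigma> = mat n n (\<lambda>(i,j). A $$ (\<pi> i, \<sigma> j))" (is "?L = ?R")
proof (rule eq_matI)
  fix i j assume "i < dim_row ?R" "j < dim_col ?R"
  then have ij: "i < n" "j < n" "\<pi> i < n" "\<sigma> j < n" using assms by auto
  show "?L $$ (i,j) = ?R $$ (i,j)"
    using ij assms
    by (subst mult_index[of _ n n _ n])
      (auto simp: mult_index[of _ n n _ n] perm_mat_def if_distrib[where f="\<lambda>x. x * _"] if_distrib[where f="\<lambda>x. _ * x"]
       sum.delta' simp del: index_mult_mat(1) cong: if_cong)
qed (auto simp: perm_mat_def)

lemma pick_card_less:
  assumes "finite I" "x \<in> I"
  shows "pick I (card {y\<in>I. y < x}) = x"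
  using pick_card_in_set[OF assms(2)] by (simp add: conj_commute Collect_conj_eq Int_commute)

text \<open>\<open>pencil_rank\<close> speaks of submatrices selected by sets, in increasing order.
  An injective selection is such a submatrix with rows and columns permuted; a selection with a
  repetition has two equal rows or columns.\<close>

lemma pencil_rank_le_minors:
  fixes P :: "complex poly mat"
  assumes "pencil_rank P \<le> r" "r < k"
  shows "minors_zero P k"
  unfolding minors_zero_def
proof (intro allI impI)
  fix f g assume fg: "f ` {..<k} \<subseteq> {..<dim_row P}" "g ` {..<k} \<subseteq> {..<dim_col P}"
  let ?M = "mat k k (\<lambda>(i,j). P $$ (f i, g j))"
  let ?S = "{k. \<exists>I J. I \<subseteq> {..<dim_row P} \<and> J \<subseteq> {..<dim_col P} \<and>
     card I = k \<and> card J = k \<and> Determinant.det (submatrix P I J) \<noteq> 0}"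
  have finS: "finite ?S"
  proof (rule finite_subset)
    show "?S \<subseteq> {..dim_row P}" using card_mono[of "{..<dim_row P}"] by fastforce
  qed auto
  show "det ?M = 0"
  proof (cases "inj_on f {..<k} \<and> inj_on g {..<k}")
    case True
    let ?I = "f ` {..<k}" and ?J = "g ` {..<k}"
    have card: "card ?I = k" "card ?J = k" using True by (auto simp: card_image)
    have z: "det (submatrix P ?I ?J) = 0"
    proof (rule ccontr)
      assume "\<not> ?thesis"
      then have "k \<in> ?S" using fg card by blast
      then have "k \<le> Max ?S" using finS by simp
      then show False using assms unfolding pencil_rank_def by simp
    qed
    have dims: "{i. i < dim_row P \<and> i \<in> ?I} = ?I" "{i. i < dim_col P \<and> i \<in> ?J} = ?J" using fg by auto
    let ?N = "submatrix P ?I ?J"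
    have Nc: "?N \<in> carrier_mat k k" using dims card by (intro carrier_matI) (auto simp: dim_submatrix)
    \<comment> \<open>The number of selected indices below \<open>f i\<close> is the position from
      which \<open>pick\<close> recovers \<open>f i\<close>.\<close>
    define \<pi> where "\<pi> i = card {y\<in>?I. y < f i}" for i
    define \<sigma> where "\<sigma> i = card {y\<in>?J. y < g i}" for i
    have pi: "\<pi> i < k" "pick ?I (\<pi> i) = f i" if "i < k" for i
    proof -
      have "{y\<in>?I. y < f i} \<subset> ?I" using that by auto
      then show "\<pi> i < k" unfolding \<pi>_def using psubset_card_mono[of ?I] card by auto
      show "pick ?I (\<pi> i) = f i" unfolding \<pi>_def using that by (intro pick_card_less) auto
    qed
    have sg: "\<sigma> i < k" "pick ?J (\<sigma> i) = g i" if "i < k" for i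
    proof -
      have "{y\<in>?J. y < g i} \<subset> ?J" using that by auto
      then show "\<sigma> i < k" unfolding \<sigma>_def using psubset_card_mono[of ?J] card by auto
      show "pick ?J (\<sigma> i) = g i" unfolding \<sigma>_def using that by (intro pick_card_less) auto
    qed
    have "?M = mat k k (\<lambda>(i,j). ?N $$ (\<pi> i, \<sigma> j))"
    proof (rule eq_matI)
      fix i j assume "i < dim_row (mat k k (\<lambda>(i,j). ?N $$ (\<pi> i, \<sigma> j)))" "j < dim_col (mat k k (\<lambda>(i,j). ?N $$ (\<pi> i, \<sigma> j)))"
      then have ij: "i < k" "j < k" by auto
      have "?N $$ (\<pi> i, \<sigma> j) = P $$ (pick ?I (\<pi> i), pick ?J (\<sigma> j))"
        by (rule submatrix_index) (use pi(1)[OF ij(1)] sg(1)[OF ij(2)] card dims in auto)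
      then show "?M $$ (i,j) = mat k k (\<lambda>(i,j). ?N $$ (\<pi> i, \<sigma> j)) $$ (i,j)" using ij pi sg by simp
    qed auto
    also have "\<dots> = transpose_mat (perm_mat k \<pi>) * ?N * perm_mat k \<sigma>"
      by (rule perm_mat_rows_cols[symmetric]) (use Nc pi sg in auto)
    also have "det \<dots> = det (transpose_mat (perm_mat k \<pi>) * ?N) * det (perm_mat k \<sigma> :: complex poly mat)"
      by (rule det_mult[of _ k]) (use Nc in \<open>auto intro!: mult_carrier_mat\<close>)
    also have "det (transpose_mat (perm_mat k \<pi>) * ?N) = 0"
      using z Nc by (simp add: det_mult[of _ k])
    finally show ?thesis by simp
  next
    case False
    then consider (f) i j where "i < k" "j < k" "i \<noteq> j" "f i = f j" | (g) i j where "i < k" "j < k" "i \<noteq> j" "g i = g j"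
      unfolding inj_on_def by auto
    then show ?thesis
    proof cases
      case f
      show ?thesis by (rule det_identical_rows[of _ k i j]) (use f in \<open>auto intro!: eq_vecI\<close>)
    next
      case g
      show ?thesis by (rule det_identical_columns[of _ k i j]) (use g in \<open>auto intro!: eq_vecI\<close>)
    qed
  qed
qed

text \<open>Every submatrix factors through dimension r as well, so minors of larger order vanish.
  The empty minor keeps the set under the maximum nonempty.\<close>

lemma pencil_rank_le_factor:
  assumes "P \<in> carrier_mat n n" "P = X * Y" "X \<in> carrier_mat n r" "Y \<in> carrier_mat r n"
  shows "pencil_rank P \<le> r"
proof -
  let ?S = "{k. \<exists>I J. I \<subseteq> {..<dim_row P} \<and> J \<subseteq> {..<dim_col P} \<and>
     card I = k \<and> card J = k \<and> Determinant.det (submatrix P I J) \<noteq> 0}"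
  have finS: "finite ?S"
  proof (rule finite_subset)
    show "?S \<subseteq> {..dim_row P}" using card_mono[of "{..<dim_row P}"] by fastforce
  qed auto
  have "submatrix P {} {} \<in> carrier_mat 0 0" by (intro carrier_matI) (auto simp: dim_submatrix)
  then have "det (submatrix P {} {}) = 1" by simp
  then have "0 \<in> ?S" by (intro CollectI exI[of _ "{}"]) auto
  moreover have "k \<le> r" if "k \<in> ?S" for k
  proof (rule ccontr)
    assume "\<not> k \<le> r"
    from that obtain I J where IJ: "I \<subseteq> {..<n}" "J \<subseteq> {..<n}" "card I = k" "card J = k" "det (submatrix P I J) \<noteq> 0"
      using assms(1) by auto
    have dims: "{i. i < n \<and> i \<in> I} = I" "{i. i < n \<and> i \<in> J} = J" using IJ by auto
    let ?X = "mat k r (\<lambda>(i,j). X $$ (pick I i, j))" and ?Y = "mat r k (\<lambda>(i,j). Y $$ (i, pick J j))"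
    have "submatrix P I J = ?X * ?Y"
    proof (rule eq_matI)
      fix i j assume "i < dim_row (?X * ?Y)" "j < dim_col (?X * ?Y)"
      then have ij: "i < k" "j < k" by auto
      have pk: "pick I i < n" "pick J j < n" using ij IJ pick_in_set_le[of i I] pick_in_set_le[of j J] by auto
      have "submatrix P I J $$ (i,j) = P $$ (pick I i, pick J j)"
        by (rule submatrix_index) (use ij dims IJ assms in auto)
      also have "\<dots> = (?X * ?Y) $$ (i,j)"
        unfolding assms(2) using ij pk mult_index[OF assms(3,4) pk] mult_index[of ?X k r ?Y k i j] by simp
      finally show "submatrix P I J $$ (i,j) = (?X * ?Y) $$ (i,j)" .
    qed (use dims IJ assms(1) in \<open>auto simp: dim_submatrix\<close>)
    then show False using IJ(5) det_mult_narrow[of ?X k r ?Y] \<open>\<not> k \<le> r\<close> by simp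
  qed
  ultimately show ?thesis unfolding pencil_rank_def using finS by (subst Max_le_iff) auto
qed

section \<open>Evaluation of pencils and low rank in terms of determinants\<close>

definition eval_mat :: "complex \<Rightarrow> complex poly mat \<Rightarrow> complex mat" where
  "eval_mat z P = map_mat (\<lambda>p. poly p z) P"

lemma det_eval_mat: "P \<in> carrier_mat n n \<Longrightarrow> det (eval_mat z P) = poly (det P) z"
  unfolding eval_mat_def
  by (subst comm_ring_hom.hom_det) (unfold_locales, auto)

lemma pencil_carrier[simp]: "A \<in> carrier_mat n l \<Longrightarrow> B \<in> carrier_mat n l \<Longrightarrow> pencil A B \<in> carrier_mat n l"
  by (auto simp: pencil_def)

lemma pencil_index:
  assumes "A \<in> carrier_mat n l" "B \<in> carrier_mat n l" "i < n" "j < l"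
  shows "pencil A B $$ (i,j) = [:B $$ (i,j), A $$ (i,j):]"
  using assms by (simp add: pencil_def)

lemma eval_pencil:
  assumes "A \<in> carrier_mat n l" "B \<in> carrier_mat n l"
  shows "eval_mat z (pencil A B) = z \<cdot>\<^sub>m A + B"
  by (rule eq_matI) (use assms in \<open>auto simp: eval_mat_def pencil_index pencil_carrier[THEN carrier_matD(1)] pencil_carrier[THEN carrier_matD(2)] add.commute\<close>)

text \<open>Fewer than m symmetric rank one terms cannot make the pencil invertible anywhere. Being
  a family of polynomial equations in the entries, the condition passes to limits; the free choice
  of U lets it pass to the pair that remains when coordinates are split off.\<close>

definition rank_defect :: "nat \<Rightarrow> nat \<Rightarrow> complex mat \<Rightarrow> complex mat \<Rightarrow> bool" where
  "rank_defect n m A B \<longleftrightarrow> (\<forall>z. \<forall>k<m. \<forall>U\<in>carrier_mat n k. det (z \<cdot>\<^sub>m A + B + U * transpose_mat U) = 0)"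

text \<open>Factoring through dimension r needs a field, so the vanishing minors are evaluated at z
  first.\<close>

lemma rank_defect_pencil:
  assumes "A \<in> carrier_mat n n" "B \<in> carrier_mat n n" "pencil_rank (pencil A B) \<le> r"
  shows "rank_defect n (n - r) A B"
  unfolding rank_defect_def
proof (intro allI impI ballI)
  fix z k and U :: "complex mat" assume k: "k < n - r" and U: "U \<in> carrier_mat n k"
  have P: "pencil A B \<in> carrier_mat n n" using assms by simp
  have E: "z \<cdot>\<^sub>m A + B = eval_mat z (pencil A B)" using assms by (simp add: eval_pencil)
  have "minors_zero (z \<cdot>\<^sub>m A + B) (Suc r)"
    unfolding minors_zero_def
  proof (intro allI impI)
    fix f g assume fg: "f ` {..<Suc r} \<subseteq> {..<dim_row (z \<cdot>\<^sub>m A + B)}" "g ` {..<Suc r} \<subseteq> {..<dim_col (z \<cdot>\<^sub>m A + B)}"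
    then have fg': "\<And>i. i < Suc r \<Longrightarrow> f i < n" "\<And>i. i < Suc r \<Longrightarrow> g i < n" using assms by auto
    have "mat (Suc r) (Suc r) (\<lambda>(i,j). (z \<cdot>\<^sub>m A + B) $$ (f i, g j)) = eval_mat z (mat (Suc r) (Suc r) (\<lambda>(i,j). pencil A B $$ (f i, g j)))"
      unfolding E by (rule eq_matI) (use fg' P in \<open>auto simp: eval_mat_def\<close>)
    moreover have "det (mat (Suc r) (Suc r) (\<lambda>(i,j). pencil A B $$ (f i, g j))) = 0"
    proof -
      have "f ` {..<Suc r} \<subseteq> {..<dim_row (pencil A B)}" "g ` {..<Suc r} \<subseteq> {..<dim_col (pencil A B)}"
        using fg' P by auto
      then show ?thesis using pencil_rank_le_minors[OF assms(3), of "Suc r"] unfolding minors_zero_def by blast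
    qed
    ultimately show "det (mat (Suc r) (Suc r) (\<lambda>(i,j). (z \<cdot>\<^sub>m A + B) $$ (f i, g j))) = 0"
      by (simp add: det_eval_mat[of _ "Suc r"])
  qed
  then obtain X Y where "X \<in> carrier_mat n r" "Y \<in> carrier_mat r n" "z \<cdot>\<^sub>m A + B = X * Y"
    using rank_factorization[of "z \<cdot>\<^sub>m A + B" n n r] assms by auto
  then show "det (z \<cdot>\<^sub>m A + B + U * transpose_mat U) = 0" using low_rank_det[of X n r Y U k] U k by auto
qed

text \<open>A test matrix U for the congruent pair comes from \<open>V^T U\<close> for the original
  one, where V is the inverse of W.\<close>

lemma rank_defect_cmat:
  assumes "A \<in> carrier_mat n n" "B \<in> carrier_mat n n" "W \<in> carrier_mat n n" "det W \<noteq> 0" "rank_defect n m A B"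
  shows "rank_defect n m (cmat W A) (cmat W B)"
  unfolding rank_defect_def
proof (intro allI impI ballI)
  fix z k and U :: "complex mat" assume k: "k < m" and U: "U \<in> carrier_mat n k"
  obtain V where V: "V \<in> carrier_mat n n" "W * V = 1\<^sub>m n" "V * W = 1\<^sub>m n" using det_nz_inverse[OF assms(3,4)] by metis
  let ?U = "transpose_mat V * U"
  have Uc: "?U \<in> carrier_mat n k" using U V by auto
  have WU: "transpose_mat W * ?U = U"
  proof -
    have "transpose_mat W * ?U = transpose_mat W * transpose_mat V * U"
      using assms V U by (subst assoc_mult_mat[of _ n n _ n _ k]) auto
    also have "transpose_mat W * transpose_mat V = transpose_mat (V * W)" using transpose_mult[OF V(1) assms(3)] by simp
    finally show ?thesis using V U by simp
  qed
  have "cmat W (?U * transpose_mat ?U) = transpose_mat W * ?U * (transpose_mat ?U * W)"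
    unfolding cmat_def using assms Uc 
    by (smt (verit) assoc_mult_mat mult_carrier_mat transpose_carrier_mat)
  also have "transpose_mat ?U * W = transpose_mat (transpose_mat W * ?U)"
    using transpose_mult[of "transpose_mat W" n n ?U k] assms Uc by simp
  finally have "cmat W (?U * transpose_mat ?U) = U * transpose_mat U" unfolding WU .
  then have "z \<cdot>\<^sub>m cmat W A + cmat W B + U * transpose_mat U = cmat W (z \<cdot>\<^sub>m A + B + ?U * transpose_mat ?U)"
    using assms Uc by (simp add: cmat_add[of _ n] cmat_smult[of _ n])
  then show "det (z \<cdot>\<^sub>m cmat W A + cmat W B + U * transpose_mat U) = 0"
    using assms Uc k by (simp add: cmat_det[of _ n] rank_defect_def)
qed

text \<open>Basis completion puts v into column 0, and a transposition of columns moves it to column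
  l.\<close>

lemma column_completion:
  fixes v :: "complex vec"
  assumes "v \<in> carrier_vec n" "v \<noteq> 0\<^sub>v n" "l < n"
  obtains W where "W \<in> carrier_mat n n" "det W \<noteq> 0" "col W l = v"
proof -
  interpret vec_space "TYPE(complex)" n .
  note bc = basis_completion[OF assms(1,2)]
  let ?W = "mat_of_cols n (basis_completion v)"
  have Wc: "?W \<in> carrier_mat n n" using bc by auto
  have cols: "cols ?W = basis_completion v" using bc by (simp add: cols_mat_of_cols)
  have dW: "det ?W \<noteq> 0"
    using lin_indpt_full_rank[OF Wc] det_rank_iff[OF Wc] bc cols by auto
  have c0: "col ?W 0 = v" using bc assms cols
    by (metis bot_nat_0.extremum_strict cols_length cols_nth hd_conv_nth length_0_conv linorder_neqE_nat nat_less_le Wc carrier_matD(2))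
  let ?t = "Transposition.transpose 0 l :: nat \<Rightarrow> nat"
  have bij: "bij_betw ?t {..<n} {..<n}"
    by (rule bij_betwI[of _ _ _ ?t]) (use assms in \<open>auto simp: Transposition.transpose_def\<close>)
  let ?V = "?W * perm_mat n ?t"
  have "col ?V l = col ?W 0"
  proof (rule eq_vecI)
    fix i assume "i < dim_vec (col ?W 0)"
    then have i: "i < n" using Wc by auto
    show "col ?V l $ i = col ?W 0 $ i"
      using i assms Wc bc(6) mult_index[OF Wc perm_mat_carrier i assms(3), of ?t]
      by (simp add: perm_mat_def if_distrib[where f="\<lambda>x. _ * x"] cong: if_cong)
  qed (use Wc in auto)
  moreover have "det ?V \<noteq> 0" using dW det_perm_mat_nz[OF bij, where 'a=complex] det_mult[OF Wc perm_mat_carrier, of ?t] by simp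
  ultimately show ?thesis using that[of ?V] c0 Wc by (metis mult_carrier_mat perm_mat_carrier)
qed

section \<open>The zero pattern of a symmetric pencil of low rank\<close>

text \<open>Index sets instead of initial segments let the induction below adjoin coordinates
  without reordering them; \<open>has_pattern_initial\<close> sorts them once afterwards.\<close>

definition has_pattern :: "nat \<Rightarrow> nat \<Rightarrow> nat \<Rightarrow> complex mat \<Rightarrow> complex mat \<Rightarrow> bool" where
  "has_pattern n m a A B \<longleftrightarrow> m + 2 * a \<le> n \<and>
    (\<exists>W\<in>carrier_mat n n. det W \<noteq> 0 \<and> (\<exists>I J. I \<subseteq> J \<and> J \<subseteq> {..<n} \<and> card I = m + a \<and> card J = n - a \<and>
      (\<forall>i\<in>I. \<forall>j\<in>J. cmat W A $$ (i,j) = 0 \<and> cmat W B $$ (i,j) = 0)))"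

lemma has_patternE:
  assumes "has_pattern n m a A B"
  obtains W I J where "W \<in> carrier_mat n n" "det W \<noteq> 0" "I \<subseteq> J" "J \<subseteq> {..<n}" "card I = m + a"
    "card J = n - a" "m + 2 * a \<le> n" "\<forall>i\<in>I. \<forall>j\<in>J. cmat W A $$ (i,j) = 0 \<and> cmat W B $$ (i,j) = 0"
  using assms unfolding has_pattern_def by (elim conjE bexE exE) (rule that; assumption)

lemma has_patternI:
  assumes "W \<in> carrier_mat n n" "det W \<noteq> 0" "I \<subseteq> J" "J \<subseteq> {..<n}" "card I = m + a"
    "card J = n - a" "m + 2 * a \<le> n" "\<forall>i\<in>I. \<forall>j\<in>J. cmat W A $$ (i,j) = 0 \<and> cmat W B $$ (i,j) = 0"
  shows "has_pattern n m a A B"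
  unfolding has_pattern_def using assms by blast

lemma has_pattern_cmat:
  assumes "A \<in> carrier_mat n n" "B \<in> carrier_mat n n" "V \<in> carrier_mat n n" "det V \<noteq> 0"
    "has_pattern n m a (cmat V A) (cmat V B)"
  shows "has_pattern n m a A B"
proof -
  from assms(5) obtain W I J where W: "W \<in> carrier_mat n n" "det W \<noteq> 0" and IJ: "I \<subseteq> J" "J \<subseteq> {..<n}" "card I = m + a"
     "card J = n - a" "m + 2 * a \<le> n" "\<forall>i\<in>I. \<forall>j\<in>J. cmat W (cmat V A) $$ (i,j) = 0 \<and> cmat W (cmat V B) $$ (i,j) = 0"
    by (rule has_patternE)
  have "det (V * W) \<noteq> 0" using W assms by (simp add: det_mult[of _ n])
  moreover have "cmat W (cmat V A) = cmat (V * W) A" "cmat W (cmat V B) = cmat (V * W) B"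
    using cmat_cmat[OF assms(1,3) W(1)] cmat_cmat[OF assms(2,3) W(1)] by auto
  ultimately show ?thesis using IJ mult_carrier_mat[OF assms(3) W(1)]
    by (intro has_patternI[of "V * W" n I J]) auto
qed

text \<open>Enumerate I first, then the rest of J, then all other indices.\<close>

lemma nested_bij:
  assumes "I \<subseteq> J" "J \<subseteq> {..<n}"
  obtains \<sigma> where "bij_betw \<sigma> {..<n} {..<n}" "\<And>i. i < card I \<Longrightarrow> \<sigma> i \<in> I" "\<And>i. i < card J \<Longrightarrow> \<sigma> i \<in> J"
proof -
  have fin: "finite J" "finite I" using finite_subset[OF assms(2)] finite_subset[OF assms(1)] by auto
  let ?xs = "sorted_list_of_set I @ sorted_list_of_set (J - I) @ sorted_list_of_set ({..<n} - J)"
  have d: "distinct ?xs" and st: "set ?xs = {..<n}" using assms fin by auto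
  have ln: "length ?xs = n" using distinct_card[OF d] st by simp
  have cJ: "card J = card I + card (J - I)" using card_Diff_subset[OF fin(2) assms(1)] card_mono[OF fin(1) assms(1)] by simp
  show ?thesis
  proof
    show "bij_betw ((!) ?xs) {..<n} {..<n}" using bij_betw_nth[OF d] ln st by auto
    fix i assume "i < card I"
    then show "?xs ! i \<in> I" using nth_mem[of i "sorted_list_of_set I"] fin by (simp add: nth_append del: nth_mem)
  next
    fix i assume i: "i < card J"
    have "?xs ! i = (sorted_list_of_set I @ sorted_list_of_set (J - I)) ! i"
      using i cJ fin by (auto simp: nth_append)
    also have "\<dots> \<in> set (sorted_list_of_set I @ sorted_list_of_set (J - I))" using i cJ fin by (intro nth_mem) simp
    finally show "?xs ! i \<in> J" using assms fin by auto
  qed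
qed

lemma has_pattern_initial:
  assumes "A \<in> carrier_mat n n" "B \<in> carrier_mat n n" "has_pattern n m a A B"
  obtains W where "W \<in> carrier_mat n n" "det W \<noteq> 0"
    "\<And>i j. i < m + a \<Longrightarrow> j < n - a \<Longrightarrow> cmat W A $$ (i,j) = 0 \<and> cmat W B $$ (i,j) = 0" "m + 2 * a \<le> n"
proof -
  from assms(3) obtain W I J where W: "W \<in> carrier_mat n n" "det W \<noteq> 0" and IJ: "I \<subseteq> J" "J \<subseteq> {..<n}" "card I = m + a"
     "card J = n - a" "m + 2 * a \<le> n" and z: "\<forall>i\<in>I. \<forall>j\<in>J. cmat W A $$ (i,j) = 0 \<and> cmat W B $$ (i,j) = 0"
    by (rule has_patternE)
  obtain \<sigma> where s: "bij_betw \<sigma> {..<n} {..<n}" "\<And>i. i < card I \<Longrightarrow> \<sigma> i \<in> I" "\<And>i. i < card J \<Longrightarrow> \<sigma> i \<in> J"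
    using nested_bij[OF IJ(1,2)] by metis
  have img: "\<sigma> ` {..<n} \<subseteq> {..<n}" using s(1) by (simp add: bij_betw_def)
  let ?P = "perm_mat n \<sigma> :: complex mat"
  have c: "cmat (W * ?P) A = mat n n (\<lambda>(i,j). cmat W A $$ (\<sigma> i, \<sigma> j))" "cmat (W * ?P) B = mat n n (\<lambda>(i,j). cmat W B $$ (\<sigma> i, \<sigma> j))"
    using cmat_cmat[OF assms(1) W(1) perm_mat_carrier, of \<sigma>] cmat_cmat[OF assms(2) W(1) perm_mat_carrier, of \<sigma>]
      cmat_perm[OF cmat_carrier[OF W(1)] img] by simp_all
  show ?thesis
  proof (rule that[of "W * ?P"])
    show "W * ?P \<in> carrier_mat n n" using W by (intro mult_carrier_mat) auto
    show "det (W * ?P) \<noteq> 0" using W det_perm_mat_nz[OF s(1), where 'a=complex] by (simp add: det_mult[of _ n])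
    show "m + 2 * a \<le> n" by fact
    fix i j assume ij: "i < m + a" "j < n - a"
    then show "cmat (W * ?P) A $$ (i,j) = 0 \<and> cmat (W * ?P) B $$ (i,j) = 0"
      unfolding c using IJ s(2)[of i] s(3)[of j] z by auto
  qed
qed

text \<open>A is the value of the pencil at infinity: for nonzero t, \<open>t B + A\<close> is t
  times the pencil at \<open>1/t\<close>, so its determinant is a polynomial in t with infinitely
  many zeros, and t = 0 gives A.\<close>

lemma rank_defect_det_lead:
  assumes "A \<in> carrier_mat n n" "B \<in> carrier_mat n n" "rank_defect n m A B" "0 < m"
  shows "det A = 0"
proof -
  have z: "det (z \<cdot>\<^sub>m A + B) = 0" for z
  proof -
    \<comment> \<open>The test matrix without columns is allowed because 0 < m.\<close>
    have "det (z \<cdot>\<^sub>m A + B + 0\<^sub>m n 0 * transpose_mat (0\<^sub>m n 0)) = 0"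
      using assms(3,4) zero_carrier_mat[of n 0] unfolding rank_defect_def by blast
    moreover have "z \<cdot>\<^sub>m A + B + 0\<^sub>m n 0 * transpose_mat (0\<^sub>m n 0) = z \<cdot>\<^sub>m A + B"
      using assms by (intro eq_matI) (auto simp: scalar_prod_def)
    ultimately show ?thesis by simp
  qed
  let ?p = "det (pencil B A)"
  have "poly ?p t = 0" if "t \<noteq> 0" for t
  proof -
    have "poly ?p t = det (t \<cdot>\<^sub>m B + A)"
      using assms det_eval_mat[of "pencil B A" n t] by (simp add: eval_pencil)
    also have "t \<cdot>\<^sub>m B + A = t \<cdot>\<^sub>m ((1/t) \<cdot>\<^sub>m A + B)"
      using that assms by (intro eq_matI) (auto simp: field_simps)
    also have "det \<dots> = 0" using assms z by (subst det_smult) auto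
    finally show ?thesis .
  qed
  then have "UNIV - {0} \<subseteq> {t. poly ?p t = 0}" by auto
  moreover have "infinite (UNIV - {0} :: complex set)" by (simp add: infinite_UNIV_char_0)
  ultimately have "?p = 0" using poly_roots_finite[of ?p] finite_subset by blast
  then have "det (0 \<cdot>\<^sub>m B + A) = 0"
    using assms det_eval_mat[of "pencil B A" n 0] by (simp add: eval_pencil)
  moreover have "0 \<cdot>\<^sub>m B + A = A" using assms by (intro eq_matI) auto
  ultimately show ?thesis by simp
qed

section \<open>Splitting off coordinates from a pair\<close>

lemma cmat_split_one:
  fixes W :: "complex mat"
  assumes "W \<in> carrier_mat q q" "M \<in> carrier_mat (Suc q) (Suc q)"
    "\<And>i. i < q \<Longrightarrow> M $$ (0, Suc i) = 0" "\<And>i. i < q \<Longrightarrow> M $$ (Suc i, 0) = 0"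
  shows "cmat (blk 0 1 q (0\<^sub>m 0 0) (0\<^sub>m 0 1) (0\<^sub>m 0 q) (0\<^sub>m 1 0) (1\<^sub>m 1) (0\<^sub>m 1 q) (0\<^sub>m q 0) (0\<^sub>m q 1) W) M =
     blk 0 1 q (0\<^sub>m 0 0) (0\<^sub>m 0 1) (0\<^sub>m 0 q) (0\<^sub>m 1 0) (mat 1 1 (\<lambda>_. M $$ (0,0))) (0\<^sub>m 1 q) (0\<^sub>m q 0) (0\<^sub>m q 1) (cmat W (sub_blk M 1 1 q q))"
proof -
  have "M = blk 0 1 q (0\<^sub>m 0 0) (0\<^sub>m 0 1) (0\<^sub>m 0 q) (0\<^sub>m 1 0) (mat 1 1 (\<lambda>_. M $$ (0,0))) (0\<^sub>m 1 q) (0\<^sub>m q 0) (0\<^sub>m q 1) (sub_blk M 1 1 q q)"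
    (is "M = ?M")
  proof (rule eq_matI)
    fix i j assume "i < dim_row ?M" "j < dim_col ?M"
    then show "M $$ (i,j) = ?M $$ (i,j)" using assms(3)[of "j-1"] assms(4)[of "i-1"]
      by (cases i; cases j) (auto simp: blk_def sub_blk_def)
  qed (use assms in auto)
  then show ?thesis
    using assms cmat_blk_upper[of "0\<^sub>m 0 0" 0 "0\<^sub>m 0 1" 1 "0\<^sub>m 0 q" q "1\<^sub>m 1" "0\<^sub>m 1 q" W "mat 1 1 (\<lambda>_. M $$ (0,0))" "0\<^sub>m 0 q" "0\<^sub>m q 0" "0\<^sub>m 1 q" "0\<^sub>m q 1" "sub_blk M 1 1 q q"]
      mult_carrier_mat[OF sub_blk_carrier assms(1), of M 1 1 q]
      mult_carrier_mat[OF transpose_carrier_mat[THEN iffD2, OF assms(1)] mult_carrier_mat[OF sub_blk_carrier assms(1), of M 1 1 q]]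
    by (simp add: cmat_def assoc_mult_mat[of _ q q _ q _ q])
qed

lemma blk_01q_index:
  "blk 0 (Suc 0) q a b c d e f g h k $$ (0,0) = e $$ (0,0)"
  "j < q \<Longrightarrow> blk 0 (Suc 0) q a b c d e f g h k $$ (0,Suc j) = f $$ (0,j)"
  "i < q \<Longrightarrow> blk 0 (Suc 0) q a b c d e f g h k $$ (Suc i,0) = h $$ (i,0)"
  "i < q \<Longrightarrow> j < q \<Longrightarrow> blk 0 (Suc 0) q a b c d e f g h k $$ (Suc i,Suc j) = k $$ (i,j)"
  by (auto simp: blk_def)

lemma blk_1q1_index:
  "blk (Suc 0) q (Suc 0) a b c d e f g h k $$ (0,0) = a $$ (0,0)"
  "j < q \<Longrightarrow> blk (Suc 0) q (Suc 0) a b c d e f g h k $$ (0,Suc j) = b $$ (0,j)"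
  "i < q \<Longrightarrow> blk (Suc 0) q (Suc 0) a b c d e f g h k $$ (Suc i,0) = d $$ (i,0)"
  "i < q \<Longrightarrow> j < q \<Longrightarrow> blk (Suc 0) q (Suc 0) a b c d e f g h k $$ (Suc i,Suc j) = e $$ (i,j)"
  by (auto simp: blk_def)

lemma sym_index: "transpose_mat A = A \<Longrightarrow> A \<in> carrier_mat n n \<Longrightarrow> i < n \<Longrightarrow> j < n \<Longrightarrow> A $$ (i,j) = A $$ (j,i)"
  by (metis carrier_matD index_transpose_mat(1))

text \<open>Coordinate 0 is in the kernel of A and orthogonal to all others for B. In general it can
  join J only; if it is isotropic for B too, it joins I as well, as a zero summand, and m
  grows.\<close>

lemma has_pattern_split:
  assumes A: "A \<in> carrier_mat (Suc q) (Suc q)" and B: "B \<in> carrier_mat (Suc q) (Suc q)"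
    and zA: "\<And>i. i < Suc q \<Longrightarrow> A $$ (0,i) = 0" "\<And>i. i < Suc q \<Longrightarrow> A $$ (i,0) = 0"
    and zB: "\<And>i. i < q \<Longrightarrow> B $$ (0,Suc i) = 0" "\<And>i. i < q \<Longrightarrow> B $$ (Suc i,0) = 0"
    and pat: "has_pattern q m a (sub_blk A 1 1 q q) (sub_blk B 1 1 q q)"
  shows "has_pattern (Suc q) m a A B" "B $$ (0,0) = 0 \<Longrightarrow> has_pattern (Suc q) (Suc m) a A B"
proof -
  from pat obtain W I J where W: "W \<in> carrier_mat q q" "det W \<noteq> 0" and IJ: "I \<subseteq> J" "J \<subseteq> {..<q}" "card I = m + a"
     "card J = q - a" "m + 2 * a \<le> q" and z: "\<forall>i\<in>I. \<forall>j\<in>J. cmat W (sub_blk A 1 1 q q) $$ (i,j) = 0 \<and> cmat W (sub_blk B 1 1 q q) $$ (i,j) = 0"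
    by (rule has_patternE)
  let ?W = "blk 0 1 q (0\<^sub>m 0 0) (0\<^sub>m 0 1) (0\<^sub>m 0 q) (0\<^sub>m 1 0) (1\<^sub>m 1) (0\<^sub>m 1 q) (0\<^sub>m q 0) (0\<^sub>m q 1) W"
  have Wc: "?W \<in> carrier_mat (Suc q) (Suc q)" using blk_carrier[of 0 1 q] by simp
  have dW: "det ?W \<noteq> 0" using W by (intro blk_det_unit) auto
  have cA: "cmat ?W A = blk 0 1 q (0\<^sub>m 0 0) (0\<^sub>m 0 1) (0\<^sub>m 0 q) (0\<^sub>m 1 0) (mat 1 1 (\<lambda>_. A $$ (0,0))) (0\<^sub>m 1 q) (0\<^sub>m q 0) (0\<^sub>m q 1) (cmat W (sub_blk A 1 1 q q))"
    by (rule cmat_split_one) (use W A zA in auto)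
  have cB: "cmat ?W B = blk 0 1 q (0\<^sub>m 0 0) (0\<^sub>m 0 1) (0\<^sub>m 0 q) (0\<^sub>m 1 0) (mat 1 1 (\<lambda>_. B $$ (0,0))) (0\<^sub>m 1 q) (0\<^sub>m q 0) (0\<^sub>m q 1) (cmat W (sub_blk B 1 1 q q))"
    by (rule cmat_split_one) (use W B zB in auto)
  have fin: "finite I" "finite J" using finite_subset[OF IJ(2)] finite_subset[OF IJ(1)] by auto
  have lt: "\<And>i. i \<in> I \<Longrightarrow> i < q" "\<And>i. i \<in> J \<Longrightarrow> i < q" using IJ by auto
  have cd: "card (Suc ` I) = m + a" "card (insert 0 (Suc ` I)) = Suc (m + a)" "card (insert 0 (Suc ` J)) = Suc (q - a)"
    using IJ fin by (auto simp: card_image card_insert_if)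
  show "has_pattern (Suc q) m a A B"
  proof (rule has_patternI[of ?W _ "Suc ` I" "insert 0 (Suc ` J)"])
    show "\<forall>i\<in>Suc ` I. \<forall>j\<in>insert 0 (Suc ` J). cmat ?W A $$ (i,j) = 0 \<and> cmat ?W B $$ (i,j) = 0"
      unfolding cA cB using lt z by (auto simp: blk_01q_index)
  qed (use IJ dW Wc cd in auto)
  assume B0: "B $$ (0,0) = 0"
  show "has_pattern (Suc q) (Suc m) a A B"
  proof (rule has_patternI[of ?W _ "insert 0 (Suc ` I)" "insert 0 (Suc ` J)"])
    show "\<forall>i\<in>insert 0 (Suc ` I). \<forall>j\<in>insert 0 (Suc ` J). cmat ?W A $$ (i,j) = 0 \<and> cmat ?W B $$ (i,j) = 0"
      unfolding cA cB using lt z B0 zA by (auto simp: blk_01q_index)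
  qed (use IJ dW Wc cd in auto)
qed

text \<open>Row 0 of A is zero and row 0 of B is zero except possibly in the last place. So
  coordinate 0 joins both I and J, the last coordinate joins neither: n grows by 2 and a by 1, while
  m stays.\<close>

lemma has_pattern_hyperbolic:
  assumes A: "A \<in> carrier_mat (Suc (Suc q)) (Suc (Suc q))" "transpose_mat A = A"
    and B: "B \<in> carrier_mat (Suc (Suc q)) (Suc (Suc q))" "transpose_mat B = B"
    and zA: "\<And>i. i < Suc (Suc q) \<Longrightarrow> A $$ (0,i) = 0"
    and zB: "\<And>i. i < Suc q \<Longrightarrow> B $$ (0,i) = 0"
    and pat: "has_pattern q m a (sub_blk A 1 1 q q) (sub_blk B 1 1 q q)"
  shows "has_pattern (Suc (Suc q)) m (Suc a) A B"
proof -
  from pat obtain W I J where W: "W \<in> carrier_mat q q" "det W \<noteq> 0" and IJ: "I \<subseteq> J" "J \<subseteq> {..<q}" "card I = m + a"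
     "card J = q - a" "m + 2 * a \<le> q" and z: "\<forall>i\<in>I. \<forall>j\<in>J. cmat W (sub_blk A 1 1 q q) $$ (i,j) = 0 \<and> cmat W (sub_blk B 1 1 q q) $$ (i,j) = 0"
    by (rule has_patternE)
  let ?W = "blk 1 q 1 (1\<^sub>m 1) (0\<^sub>m 1 q) (0\<^sub>m 1 1) (0\<^sub>m q 1) W (0\<^sub>m q 1) (0\<^sub>m 1 1) (0\<^sub>m 1 q) (1\<^sub>m 1)"
  have Wc: "?W \<in> carrier_mat (Suc (Suc q)) (Suc (Suc q))" using blk_carrier[of 1 q 1] by simp
  have dW: "det ?W \<noteq> 0" using W by (intro blk_det_unit) auto
  have *: "\<exists>c h' c' h t. cmat ?W M = blk 1 q 1 (0\<^sub>m 1 1) (0\<^sub>m 1 q) c (0\<^sub>m q 1) (cmat W (sub_blk M 1 1 q q)) h' c' h t"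
    if "M \<in> carrier_mat (Suc (Suc q)) (Suc (Suc q))" "transpose_mat M = M" "\<And>i. i < Suc q \<Longrightarrow> M $$ (0,i) = 0" for M
  proof -
    have "M $$ (i,0) = 0" if "i < Suc q" for i
      using sym_index[of M "Suc (Suc q)" i 0] that \<open>\<And>i. i < Suc q \<Longrightarrow> M $$ (0,i) = 0\<close> \<open>M \<in> _\<close> \<open>transpose_mat M = M\<close> by auto
    then have e: "sub_blk M 0 0 1 1 = 0\<^sub>m 1 1" "sub_blk M 0 1 1 q = 0\<^sub>m 1 q" "sub_blk M 1 0 q 1 = 0\<^sub>m q 1"
      using that by (auto intro!: eq_matI simp: sub_blk_def)
    have "M = blk 1 q 1 (0\<^sub>m 1 1) (0\<^sub>m 1 q) (sub_blk M 0 (1+q) 1 1) (0\<^sub>m q 1) (sub_blk M 1 1 q q) (sub_blk M 1 (1+q) q 1)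
        (sub_blk M (1+q) 0 1 1) (sub_blk M (1+q) 1 1 q) (sub_blk M (1+q) (1+q) 1 1)"
      using blk_split[of M 1 q 1] that(1) e by simp
    then have "cmat ?W M = cmat ?W (blk 1 q 1 (0\<^sub>m 1 1) (0\<^sub>m 1 q) (sub_blk M 0 (1+q) 1 1) (0\<^sub>m q 1) (sub_blk M 1 1 q q) (sub_blk M 1 (1+q) q 1)
        (sub_blk M (1+q) 0 1 1) (sub_blk M (1+q) 1 1 q) (sub_blk M (1+q) (1+q) 1 1))" by simp
    then show ?thesis
      using W unfolding cmat_def[of W]
      by (subst (asm) cmat_blk_upper) (auto intro!: exI)
  qed
  have fin: "finite I" "finite J" using finite_subset[OF IJ(2)] finite_subset[OF IJ(1)] by auto
  have lt: "\<And>i. i \<in> I \<Longrightarrow> i < q" "\<And>i. i \<in> J \<Longrightarrow> i < q" using IJ by auto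
  have cd: "card (insert 0 (Suc ` I)) = Suc (m + a)" "card (insert 0 (Suc ` J)) = Suc (q - a)"
    using IJ fin by (auto simp: card_image card_insert_if)
  obtain c h' c' h t where cA: "cmat ?W A = blk 1 q 1 (0\<^sub>m 1 1) (0\<^sub>m 1 q) c (0\<^sub>m q 1) (cmat W (sub_blk A 1 1 q q)) h' c' h t"
    using *[OF A zA] by auto
  obtain d k' d' k s where cB: "cmat ?W B = blk 1 q 1 (0\<^sub>m 1 1) (0\<^sub>m 1 q) d (0\<^sub>m q 1) (cmat W (sub_blk B 1 1 q q)) k' d' k s"
    using *[OF B zB] by auto
  show ?thesis
  proof (rule has_patternI[of ?W _ "insert 0 (Suc ` I)" "insert 0 (Suc ` J)"])
    show "\<forall>i\<in>insert 0 (Suc ` I). \<forall>j\<in>insert 0 (Suc ` J). cmat ?W A $$ (i,j) = 0 \<and> cmat ?W B $$ (i,j) = 0"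
      unfolding cA cB using lt z by (auto simp: blk_1q1_index)
  qed (use IJ dW Wc cd in auto)
qed

lemma rank_defectD:
  assumes "rank_defect n m A B" "k < m" "U \<in> carrier_mat n k"
  shows "det (z \<cdot>\<^sub>m A + B + U * transpose_mat U) = 0"
  using assms unfolding rank_defect_def by blast

text \<open>If \<open>B $$ (0,0)\<close> is nonzero, it is a factor of the determinant for any U
  that avoids coordinate 0. If it is zero, one column of U is spent on coordinate 0 to create the
  factor 1, which costs one unit of m.\<close>

lemma rank_defect_split:
  assumes A: "A \<in> carrier_mat (Suc q) (Suc q)" and B: "B \<in> carrier_mat (Suc q) (Suc q)"
    and zA: "\<And>i. i < Suc q \<Longrightarrow> A $$ (0,i) = 0" "\<And>i. i < Suc q \<Longrightarrow> A $$ (i,0) = 0"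
    and zB: "\<And>i. i < q \<Longrightarrow> B $$ (0,Suc i) = 0" "\<And>i. i < q \<Longrightarrow> B $$ (Suc i,0) = 0"
    and rd: "rank_defect (Suc q) m A B"
  shows "B $$ (0,0) \<noteq> 0 \<Longrightarrow> rank_defect q m (sub_blk A 1 1 q q) (sub_blk B 1 1 q q)"
    "B $$ (0,0) = 0 \<Longrightarrow> rank_defect q (m - 1) (sub_blk A 1 1 q q) (sub_blk B 1 1 q q)"
proof -
  \<comment> \<open>The entry x of U at (0,0) is 0 in the first case and 1 in the second.\<close>
  have key: "z \<cdot>\<^sub>m A + B + U * transpose_mat U = blk 0 1 q (0\<^sub>m 0 0) (0\<^sub>m 0 1) (0\<^sub>m 0 q) (0\<^sub>m 1 0) (mat 1 1 (\<lambda>_. B $$ (0,0) + x^2)) (0\<^sub>m 1 q) (0\<^sub>m q 0) (0\<^sub>m q 1)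
     (z \<cdot>\<^sub>m sub_blk A 1 1 q q + sub_blk B 1 1 q q + U' * transpose_mat U')"
    if U': "U' \<in> carrier_mat q k" and U: "U = mat (Suc q) (Suc k) (\<lambda>(i,j). if i = 0 \<and> j = 0 then x else if i = 0 \<or> j = 0 then 0 else U' $$ (i-1,j-1))" for z x k U U'
  proof (rule eq_matI)
    let ?R = "blk 0 1 q (0\<^sub>m 0 0) (0\<^sub>m 0 1) (0\<^sub>m 0 q) (0\<^sub>m 1 0) (mat 1 1 (\<lambda>_. B $$ (0,0) + x^2)) (0\<^sub>m 1 q) (0\<^sub>m q 0) (0\<^sub>m q 1)
     (z \<cdot>\<^sub>m sub_blk A 1 1 q q + sub_blk B 1 1 q q + U' * transpose_mat U')"
    fix i j assume "i < dim_row ?R" "j < dim_col ?R"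
    then have ij: "i < Suc q" "j < Suc q" by auto
    have Uc: "U \<in> carrier_mat (Suc q) (Suc k)" using U by simp
    have uu: "(U * transpose_mat U) $$ (i,j) = (\<Sum>l<Suc k. U $$ (i,l) * U $$ (j,l))"
      using ij Uc by (subst mult_index[of _ "Suc q" "Suc k" _ "Suc q"]) auto
    have uu': "(U' * transpose_mat U') $$ (x,y) = (\<Sum>l<k. U' $$ (x,l) * U' $$ (y,l))" if "x < q" "y < q" for x y
      using that U' by (subst mult_index[of _ q k _ q]) auto
    show "(z \<cdot>\<^sub>m A + B + U * transpose_mat U) $$ (i,j) = ?R $$ (i,j)"
      using ij A B zA zB Uc uu U uu' U'
      by (cases i; cases j) (auto simp: blk_01q_index sub_blk_def sum.lessThan_Suc_shift power2_eq_square simp del: index_mult_mat(1) sum.lessThan_Suc)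
  qed (use A B U in auto)
  have det: "det (blk 0 1 q (0\<^sub>m 0 0) (0\<^sub>m 0 1) (0\<^sub>m 0 q) (0\<^sub>m 1 0) (mat 1 1 (\<lambda>_. y)) (0\<^sub>m 1 q) (0\<^sub>m q 0) (0\<^sub>m q 1) M) = y * det M"
    if "M \<in> carrier_mat q q" for y and M :: "complex mat"
    using that by (subst blk_det_upper) (auto simp: det_single)
  {
    assume b: "B $$ (0,0) \<noteq> 0"
    show "rank_defect q m (sub_blk A 1 1 q q) (sub_blk B 1 1 q q)"
      unfolding rank_defect_def
    proof (intro allI impI ballI)
      fix z k and U' :: "complex mat" assume k: "k < m" and U': "U' \<in> carrier_mat q k"
      let ?U = "mat (Suc q) k (\<lambda>(i,j). if i = 0 then 0 else U' $$ (i-1,j))"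
      let ?V = "mat (Suc q) (Suc k) (\<lambda>(i,j). if i = 0 \<and> j = 0 then 0 else if i = 0 \<or> j = 0 then 0 else U' $$ (i-1,j-1))"
      \<comment> \<open>A zero column is added so that \<open>key\<close> applies, while only the k
        columns of \<open>?U\<close> count against m.\<close>
      have "?U * transpose_mat ?U = ?V * transpose_mat ?V"
      proof (rule eq_matI)
        fix i j assume "i < dim_row (?V * transpose_mat ?V)" "j < dim_col (?V * transpose_mat ?V)"
        then have ij: "i < Suc q" "j < Suc q" by auto
        show "(?U * transpose_mat ?U) $$ (i,j) = (?V * transpose_mat ?V) $$ (i,j)"
          using ij mult_index[of ?U "Suc q" k "transpose_mat ?U" "Suc q" i j] mult_index[of ?V "Suc q" "Suc k" "transpose_mat ?V" "Suc q" i j]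
          by (cases i; cases j) (auto simp: sum.lessThan_Suc_shift simp del: index_mult_mat(1) sum.lessThan_Suc)
      qed auto
      moreover have "det (z \<cdot>\<^sub>m A + B + ?U * transpose_mat ?U) = 0" by (rule rank_defectD[OF rd k]) simp
      ultimately show "det (z \<cdot>\<^sub>m sub_blk A 1 1 q q + sub_blk B 1 1 q q + U' * transpose_mat U') = 0"
        using key[OF U', of ?V 0 z] det[of "z \<cdot>\<^sub>m sub_blk A 1 1 q q + sub_blk B 1 1 q q + U' * transpose_mat U'" "B $$ (0,0)"] b U' by auto
    qed
  }
  assume b: "B $$ (0,0) = 0"
  show "rank_defect q (m-1) (sub_blk A 1 1 q q) (sub_blk B 1 1 q q)"
    unfolding rank_defect_def
  proof (intro allI impI ballI)
    fix z k and U' :: "complex mat" assume k: "k < m - 1" and U': "U' \<in> carrier_mat q k"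
    let ?V = "mat (Suc q) (Suc k) (\<lambda>(i,j). if i = 0 \<and> j = 0 then 1 else if i = 0 \<or> j = 0 then 0 else U' $$ (i-1,j-1))"
    have "Suc k < m" using k by simp
    then have "det (z \<cdot>\<^sub>m A + B + ?V * transpose_mat ?V) = 0" by (rule rank_defectD[OF rd]) simp
    then show "det (z \<cdot>\<^sub>m sub_blk A 1 1 q q + sub_blk B 1 1 q q + U' * transpose_mat U') = 0"
      using key[OF U', of ?V 1 z] det[of "z \<cdot>\<^sub>m sub_blk A 1 1 q q + sub_blk B 1 1 q q + U' * transpose_mat U'" "1"] b U' by auto
  qed
qed

text \<open>U is extended by zero in the coordinates 0 and q + 1. The resulting matrix is block
  antitriangular with both corners equal to the nonzero \<open>B $$ (0, Suc q)\<close>, so its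
  determinant vanishes exactly with that of the core.\<close>

lemma rank_defect_hyperbolic:
  assumes A: "A \<in> carrier_mat (Suc (Suc q)) (Suc (Suc q))" "transpose_mat A = A"
    and B: "B \<in> carrier_mat (Suc (Suc q)) (Suc (Suc q))" "transpose_mat B = B"
    and zA: "\<And>i. i < Suc (Suc q) \<Longrightarrow> A $$ (0,i) = 0"
    and zB: "\<And>i. i < Suc q \<Longrightarrow> B $$ (0,i) = 0" "B $$ (0, Suc q) \<noteq> 0"
    and rd: "rank_defect (Suc (Suc q)) m A B"
  shows "rank_defect q m (sub_blk A 1 1 q q) (sub_blk B 1 1 q q)"
  unfolding rank_defect_def
proof (intro allI impI ballI)
  fix z k and U' :: "complex mat" assume k: "k < m" and U': "U' \<in> carrier_mat q k"
  let ?n = "Suc (Suc q)"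
  let ?U = "mat ?n k (\<lambda>(i,j). if i = 0 \<or> i = Suc q then 0 else U' $$ (i-1,j))"
  let ?M = "z \<cdot>\<^sub>m A + B + ?U * transpose_mat ?U"
  let ?N = "z \<cdot>\<^sub>m sub_blk A 1 1 q q + sub_blk B 1 1 q q + U' * transpose_mat U'"
  let ?b = "mat 1 1 (\<lambda>_. B $$ (0, Suc q))"
  have d0: "det ?M = 0" by (rule rank_defectD[OF rd k]) simp
  have Mc: "?M \<in> carrier_mat ?n ?n" using A B by auto
  have uu: "(?U * transpose_mat ?U) $$ (i,j) = (\<Sum>l<k. ?U $$ (i,l) * ?U $$ (j,l))" if "i < ?n" "j < ?n" for i j
    using that by (subst mult_index[of _ ?n k _ ?n]) auto
  have uu': "(U' * transpose_mat U') $$ (x,y) = (\<Sum>l<k. U' $$ (x,l) * U' $$ (y,l))" if "x < q" "y < q" for x y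
    using that U' by (subst mult_index[of _ q k _ q]) auto
  have zA': "A $$ (i,0) = 0" if "i < ?n" for i using sym_index[OF A(2,1), of i 0] zA that by auto
  have zB': "B $$ (i,0) = 0" if "i < Suc q" for i using sym_index[OF B(2,1), of i 0] zB that by auto
  have zB'': "B $$ (Suc q,0) = B $$ (0, Suc q)" using sym_index[OF B(2,1), of "Suc q" 0] by auto
  have e: "sub_blk ?M 0 0 1 1 = 0\<^sub>m 1 1" "sub_blk ?M 0 1 1 q = 0\<^sub>m 1 q" "sub_blk ?M 1 0 q 1 = 0\<^sub>m q 1"
    "sub_blk ?M 0 (1+q) 1 1 = ?b" "sub_blk ?M (1+q) 0 1 1 = ?b" "sub_blk ?M 1 1 q q = ?N"
    using A B zA zB zA' zB' zB'' U' by (auto intro!: eq_matI simp: sub_blk_def uu uu' simp del: index_mult_mat(1))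
  have Ms: "?M = blk 1 q 1 (0\<^sub>m 1 1) (0\<^sub>m 1 q) ?b (0\<^sub>m q 1) ?N (sub_blk ?M 1 (1+q) q 1) ?b (sub_blk ?M (1+q) 1 1 q) (sub_blk ?M (1+q) (1+q) 1 1)"
    using blk_split[of ?M 1 q 1] Mc unfolding e by simp
  have "?N \<in> carrier_mat q q" using U' by auto
  then have "det ?M = anti_sign 1 q * det ?b * det ?N * det ?b"
    by (subst Ms, subst blk_det_anti) auto
  then show "det ?N = 0" using d0 anti_sign_sq[of 1 q, where 'a=complex] zB(2) by (auto simp: det_single)
qed

text \<open>W fixes the first unit vector, so the new row 0 is the old row 0 times W; X and V are
  the free parameters with which it gets normalized.\<close>

lemma cmat_first_row:
  assumes M: "M \<in> carrier_mat (Suc q) (Suc q)" and X: "X \<in> carrier_mat 1 q" and V: "V \<in> carrier_mat q q"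
  defines "W \<equiv> blk 0 1 q (0\<^sub>m 0 0) (0\<^sub>m 0 1) (0\<^sub>m 0 q) (0\<^sub>m 1 0) (1\<^sub>m 1) X (0\<^sub>m q 0) (0\<^sub>m q 1) V :: complex mat"
  shows "cmat W M $$ (0,0) = M $$ (0,0)"
    "j < q \<Longrightarrow> cmat W M $$ (0,Suc j) = M $$ (0,0) * X $$ (0,j) + (\<Sum>l<q. M $$ (0,Suc l) * V $$ (l,j))"
proof -
  have Wc: "W \<in> carrier_mat (Suc q) (Suc q)" using blk_carrier[of 0 1 q] unfolding W_def by simp
  have w0: "W $$ (0,0) = 1" "\<And>x. x < q \<Longrightarrow> W $$ (Suc x,0) = 0" "\<And>j. j < q \<Longrightarrow> W $$ (0,Suc j) = X $$ (0,j)"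
    "\<And>x j. x < q \<Longrightarrow> j < q \<Longrightarrow> W $$ (Suc x,Suc j) = V $$ (x,j)"
    by (auto simp: W_def blk_01q_index)
  have row: "(\<Sum>x<Suc q. W $$ (x,0) * M $$ (x,y)) = M $$ (0,y)" for y
    using w0 by (simp add: sum.lessThan_Suc_shift del: sum.lessThan_Suc)
  show "cmat W M $$ (0,0) = M $$ (0,0)"
    using w0 by (subst cmat_index[OF M Wc]) (simp_all add: row del: sum.lessThan_Suc, simp add: sum.lessThan_Suc_shift del: sum.lessThan_Suc)
  show "cmat W M $$ (0,Suc j) = M $$ (0,0) * X $$ (0,j) + (\<Sum>l<q. M $$ (0,Suc l) * V $$ (l,j))" if "j < q"
    using w0 that by (subst cmat_index[OF M Wc]) (simp_all add: row del: sum.lessThan_Suc, simp add: sum.lessThan_Suc_shift del: sum.lessThan_Suc)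
qed

text \<open>A kernel vector of A is moved to coordinate 0, and its row in B decides. A zero row
  splits off a zero summand; a nonzero diagonal entry is a pivot and splits off a regular one;
  otherwise the vector is isotropic and forms a hyperbolic plane with another one. The induction is
  strong since the last case removes two coordinates.\<close>

theorem rank_defect_has_pattern:
  assumes "A \<in> carrier_mat n n" "transpose_mat A = A" "B \<in> carrier_mat n n" "transpose_mat B = B" "rank_defect n m A B"
  shows "\<exists>a. has_pattern n m a A B"
  using assms
proof (induction n arbitrary: m A B rule: less_induct)
  case (less n m A B)
  show ?case
  proof (cases "m = 0")
    case True
    have "has_pattern n m 0 A B"
      by (rule has_patternI[of "1\<^sub>m n" _ "{}" "{..<n}"]) (use True in auto)
    then show ?thesis by blast
  next
    case False
    have dA: "det A = 0" using rank_defect_det_lead[OF less.prems(1,3,5)] False by simp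
    then have "n \<noteq> 0" using less.prems(1) by (metis det_dim_zero zero_neq_one)
    then obtain q where n: "n = Suc q" using not0_implies_Suc by blast
    obtain w where w: "w \<in> carrier_vec n" "w \<noteq> 0\<^sub>v n" "A *\<^sub>v w = 0\<^sub>v n"
      using dA det_0_iff_vec_prod_zero[OF less.prems(1)] by blast
    obtain W where W: "W \<in> carrier_mat n n" "det W \<noteq> 0" "col W 0 = w"
      using column_completion[OF w(1,2), of 0] n by auto
    define A1 B1 where AB1: "A1 = cmat W A" "B1 = cmat W B"
    have c1: "A1 \<in> carrier_mat (Suc q) (Suc q)" "B1 \<in> carrier_mat (Suc q) (Suc q)" using W n AB1 by auto
    have s1: "transpose_mat A1 = A1" "transpose_mat B1 = B1" using cmat_sym less.prems W AB1 by blast+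
    have r1: "rank_defect (Suc q) m A1 B1" using rank_defect_cmat[OF less.prems(1,3) W(1,2) less.prems(5)] n AB1 by simp
    have back1: "has_pattern n m a A1 B1 \<Longrightarrow> has_pattern n m a A B" for a
      unfolding AB1 using has_pattern_cmat[OF less.prems(1,3) W(1,2)] .
    have zA: "A1 $$ (i,0) = 0" if "i < Suc q" for i
    proof -
      have AW: "(A * W) $$ (x,0) = 0" if "x < n" for x
      proof -
        have "(A * W) $$ (x,0) = (A *\<^sub>v col W 0) $ x" using that W less.prems n by simp
        then show ?thesis using W(3) w(3) that by simp
      qed
      have "A1 $$ (i,0) = (transpose_mat W * (A * W)) $$ (i,0)"
        unfolding AB1 cmat_def using W less.prems by (subst assoc_mult_mat[of _ n n _ n _ n]) auto
      also have "\<dots> = (\<Sum>x<n. transpose_mat W $$ (i,x) * (A * W) $$ (x,0))"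
        using W less.prems that n by (intro mult_index[of _ n n _ n]) auto
      also have "\<dots> = 0" using AW by (simp del: index_mult_mat(1))
      finally show ?thesis .
    qed
    have zA': "A1 $$ (0,i) = 0" if "i < Suc q" for i
      using zA[OF that] sym_index[OF s1(1) c1(1), of 0 i] that by simp
    show ?thesis
    proof (cases "B1 $$ (0,0) = 0 \<and> (\<forall>i<q. B1 $$ (0,Suc i) = 0)")
      case True
      then have zB: "\<And>i. i < q \<Longrightarrow> B1 $$ (0,Suc i) = 0" "\<And>i. i < q \<Longrightarrow> B1 $$ (Suc i,0) = 0" "B1 $$ (0,0) = 0"
        using sym_index[OF s1(2) c1(2), of "Suc _" 0] by auto
      have "rank_defect q (m-1) (sub_blk A1 1 1 q q) (sub_blk B1 1 1 q q)"
        by (rule rank_defect_split(2)[OF c1 zA' zA zB(1,2) r1 zB(3)])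
      then obtain a where "has_pattern q (m-1) a (sub_blk A1 1 1 q q) (sub_blk B1 1 1 q q)"
        using less.IH[of q "sub_blk A1 1 1 q q" "sub_blk B1 1 1 q q" "m-1"] n
          transpose_sub_blk[OF c1(1) s1(1), of 1 q 1 q] transpose_sub_blk[OF c1(2) s1(2), of 1 q 1 q] by auto
      from has_pattern_split(2)[OF c1 zA' zA zB(1,2) this zB(3)] show ?thesis
        using False n back1 by auto
    next
      case nz: False
      \<comment> \<open>If the diagonal entry is nonzero, X clears the rest of the row and V is the
        identity; if it is zero, V turns the rest of the row into the last unit vector.\<close>
      have "\<exists>X V. X \<in> carrier_mat 1 q \<and> V \<in> carrier_mat q q \<and> det V \<noteq> 0 \<and>
        (B1 $$ (0,0) \<noteq> 0 \<longrightarrow> (\<forall>j<q. B1 $$ (0,0) * X $$ (0,j) + (\<Sum>l<q. B1 $$ (0,Suc l) * V $$ (l,j)) = 0)) \<and>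
        (B1 $$ (0,0) = 0 \<longrightarrow> (\<forall>j<q. B1 $$ (0,0) * X $$ (0,j) + (\<Sum>l<q. B1 $$ (0,Suc l) * V $$ (l,j)) = (if Suc j = q then 1 else 0)))"
      proof (cases "B1 $$ (0,0) = 0")
        case False
        show ?thesis
          by (rule exI[of _ "mat 1 q (\<lambda>(_,j). - B1 $$ (0,Suc j) / B1 $$ (0,0))"], rule exI[of _ "1\<^sub>m q"])
            (use False in \<open>auto simp: if_distrib[where f="\<lambda>x. _ * x"] cong: if_cong\<close>)
      next
        case True
        let ?f = "vec q (\<lambda>i. B1 $$ (0, Suc i))"
        from nz True obtain i where i: "i < q" "B1 $$ (0,Suc i) \<noteq> 0" by auto
        then have "?f \<noteq> 0\<^sub>v q" by (auto dest!: arg_cong[of _ _ "\<lambda>v. v $ i"])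
        \<comment> \<open>T maps the last unit vector to the row of B, so its inverse maps the row
          back to that unit vector; the transpose of the inverse is the V wanted.\<close>
        then obtain T where T: "T \<in> carrier_mat q q" "det T \<noteq> 0" "col T (q - 1) = ?f"
          using column_completion[of ?f q "q-1"] i by auto
        obtain V where V: "V \<in> carrier_mat q q" "V * T = 1\<^sub>m q" "det V \<noteq> 0" using det_nz_inverse[OF T(1,2)] by metis
        have "(\<Sum>l<q. B1 $$ (0,Suc l) * transpose_mat V $$ (l,j)) = (if Suc j = q then 1 else 0)" if j: "j < q" for j
        proof -
          have "T $$ (l,q-1) = B1 $$ (0,Suc l)" if "l < q" for l
          proof -
            have "T $$ (l,q-1) = col T (q-1) $ l" using T(1) i that by simp
            then show ?thesis unfolding T(3) using that by simp
          qed
          then have "(\<Sum>l<q. B1 $$ (0,Suc l) * transpose_mat V $$ (l,j)) = (V * T) $$ (j,q-1)"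
            using mult_index[OF V(1) T(1) j, of "q-1"] V(1) j by (auto intro!: sum.cong simp: mult.commute)
          then show ?thesis using V(2) j by auto
        qed
        then show ?thesis using True V by (intro exI[of _ "0\<^sub>m 1 q"] exI[of _ "transpose_mat V"]) (auto simp: det_transpose[of V q])
      qed
      then obtain X V where XV: "X \<in> carrier_mat 1 q" "V \<in> carrier_mat q q" "det V \<noteq> 0"
        "B1 $$ (0,0) \<noteq> 0 \<Longrightarrow> (\<forall>j<q. B1 $$ (0,0) * X $$ (0,j) + (\<Sum>l<q. B1 $$ (0,Suc l) * V $$ (l,j)) = 0)"
        "B1 $$ (0,0) = 0 \<Longrightarrow> (\<forall>j<q. B1 $$ (0,0) * X $$ (0,j) + (\<Sum>l<q. B1 $$ (0,Suc l) * V $$ (l,j)) = (if Suc j = q then 1 else 0))"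
        by (elim exE conjE) (rule that; blast)
      define W2 where "W2 = blk 0 1 q (0\<^sub>m 0 0) (0\<^sub>m 0 1) (0\<^sub>m 0 q) (0\<^sub>m 1 0) (1\<^sub>m 1) X (0\<^sub>m q 0) (0\<^sub>m q 1) V"
      have W2: "W2 \<in> carrier_mat (Suc q) (Suc q)" "det W2 \<noteq> 0"
        unfolding W2_def using blk_carrier[of 0 1 q] XV by (simp_all add: blk_det_upper)
      define A2 B2 where AB2: "A2 = cmat W2 A1" "B2 = cmat W2 B1"
      have c2: "A2 \<in> carrier_mat (Suc q) (Suc q)" "B2 \<in> carrier_mat (Suc q) (Suc q)" using W2 AB2 by auto
      have s2: "transpose_mat A2 = A2" "transpose_mat B2 = B2" using cmat_sym[OF c1(1) W2(1) s1(1)] cmat_sym[OF c1(2) W2(1) s1(2)] AB2 by auto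
      have r2: "rank_defect (Suc q) m A2 B2" using rank_defect_cmat[OF c1 W2 r1] AB2 by simp
      have back2: "has_pattern (Suc q) m a A2 B2 \<Longrightarrow> has_pattern n m a A B" for a
        using has_pattern_cmat[OF c1 W2, of m a] back1[of a] n AB2 by simp
      \<comment> \<open>Row 0 of A is zero and stays zero for every choice of X and V.\<close>
      have zA2: "A2 $$ (0,i) = 0" if "i < Suc q" for i
        using that cmat_first_row[OF c1(1) XV(1,2), folded W2_def] zA' unfolding AB2 by (cases i) auto
      have zA2': "A2 $$ (i,0) = 0" if "i < Suc q" for i
        using sym_index[OF s2(1) c2(1), of i 0] that zA2 by auto
      note rB = cmat_first_row[OF c1(2) XV(1,2), folded W2_def, folded AB2]
      have ts: "transpose_mat (sub_blk A2 1 1 k k) = sub_blk A2 1 1 k k" "transpose_mat (sub_blk B2 1 1 k k) = sub_blk B2 1 1 k k" if "Suc k \<le> Suc q" for k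
        using transpose_sub_blk[OF c2(1) s2(1), of 1 k 1 k] transpose_sub_blk[OF c2(2) s2(2), of 1 k 1 k] that by auto
      show ?thesis
      proof (cases "B1 $$ (0,0) = 0")
        case False
        have zB: "\<And>i. i < q \<Longrightarrow> B2 $$ (0,Suc i) = 0" using rB XV(4)[OF False] by auto
        then have zB': "\<And>i. i < q \<Longrightarrow> B2 $$ (Suc i,0) = 0" using sym_index[OF s2(2) c2(2), of "Suc _" 0] by auto
        have "rank_defect q m (sub_blk A2 1 1 q q) (sub_blk B2 1 1 q q)"
          by (rule rank_defect_split(1)[OF c2 zA2 zA2' zB zB' r2]) (use False rB in auto)
        then obtain a where "has_pattern q m a (sub_blk A2 1 1 q q) (sub_blk B2 1 1 q q)"
          using less.IH[of q "sub_blk A2 1 1 q q" "sub_blk B2 1 1 q q" m] n ts[of q] by auto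
        from has_pattern_split(1)[OF c2 zA2 zA2' zB zB' this] show ?thesis using back2 by auto
      next
        case True
        with nz have "q \<noteq> 0" by auto
        then obtain k where q: "q = Suc k" using not0_implies_Suc by blast
        have zB: "B2 $$ (0,i) = 0" if "i < Suc k" for i using that True rB XV(5)[OF True] q by (cases i) auto
        have zB': "B2 $$ (0,Suc k) \<noteq> 0" using True rB(2)[of k] XV(5)[OF True] q by auto
        note c2' = c2[unfolded q] note r2' = r2[unfolded q]
        have "rank_defect k m (sub_blk A2 1 1 k k) (sub_blk B2 1 1 k k)"
          by (rule rank_defect_hyperbolic[OF c2'(1) s2(1) c2'(2) s2(2) zA2 zB zB' r2']) (use q in auto)
        then obtain a where "has_pattern k m a (sub_blk A2 1 1 k k) (sub_blk B2 1 1 k k)"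
          using less.IH[of k "sub_blk A2 1 1 k k" "sub_blk B2 1 1 k k" m] n q ts[of k] by auto
        from has_pattern_hyperbolic[OF c2'(1) s2(1) c2'(2) s2(2) zA2 zB this] show ?thesis using back2 q by auto
      qed
    qed
  qed
qed

section \<open>Limits of pairs of matrices\<close>

definition matlim :: "nat \<Rightarrow> (nat \<Rightarrow> complex mat) \<Rightarrow> complex mat \<Rightarrow> bool" where
  "matlim n F A \<longleftrightarrow> (\<forall>k. F k \<in> carrier_mat n n) \<and> A \<in> carrier_mat n n \<and>
     (\<forall>i<n. \<forall>j<n. (\<lambda>k. F k $$ (i,j)) \<longlonglongrightarrow> A $$ (i,j))"

text \<open>Sequential closure under entrywise convergence of both coefficients;
  \<open>closure_of_sym_pencils\<close> identifies it with the topological closure.\<close>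

definition adh :: "nat \<Rightarrow> (complex mat \<times> complex mat) set \<Rightarrow> (complex mat \<times> complex mat) set" where
  "adh n X = {(A,B). \<exists>F G. matlim n F A \<and> matlim n G B \<and> (\<forall>k. (F k, G k) \<in> X)}"

lemma matlimD:
  assumes "matlim n F A"
  shows "F k \<in> carrier_mat n n" "A \<in> carrier_mat n n" "i < n \<Longrightarrow> j < n \<Longrightarrow> (\<lambda>k. F k $$ (i,j)) \<longlonglongrightarrow> A $$ (i,j)"
  using assms unfolding matlim_def by auto

lemma matlimI:
  assumes "\<And>k. F k \<in> carrier_mat n n" "A \<in> carrier_mat n n" "\<And>i j. i < n \<Longrightarrow> j < n \<Longrightarrow> (\<lambda>k. F k $$ (i,j)) \<longlonglongrightarrow> A $$ (i,j)"
  shows "matlim n F A"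
  using assms unfolding matlim_def by auto

lemma matlim_const: "A \<in> carrier_mat n n \<Longrightarrow> matlim n (\<lambda>_. A) A"
  by (auto intro!: matlimI)

lemma matlim_cmat:
  assumes "matlim n F A" "W \<in> carrier_mat n l"
  shows "matlim l (\<lambda>k. cmat W (F k)) (cmat W A)"
proof (rule matlimI)
  fix i j assume ij: "i < l" "j < l"
  show "(\<lambda>k. cmat W (F k) $$ (i,j)) \<longlonglongrightarrow> cmat W A $$ (i,j)"
    using ij assms(2) matlimD[OF assms(1)]
    by (simp add: cmat_index[of _ n W l]) (intro tendsto_intros; simp)
qed (use assms in \<open>auto dest: matlimD\<close>)

lemma adhI:
  assumes "matlim n F A" "matlim n G B" "\<And>k. (F k, G k) \<in> X"
  shows "(A,B) \<in> adh n X"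
  using assms unfolding adh_def by auto

lemma adhE:
  assumes "(A,B) \<in> adh n X"
  obtains F G where "matlim n F A" "matlim n G B" "\<forall>k. (F k, G k) \<in> X"
  using assms unfolding adh_def by auto

lemma adh_carrier: "(A,B) \<in> adh n X \<Longrightarrow> A \<in> carrier_mat n n" "(A,B) \<in> adh n X \<Longrightarrow> B \<in> carrier_mat n n"
  by (auto elim!: adhE dest: matlimD)

lemma subset_adh:
  assumes "(A,B) \<in> X" "A \<in> carrier_mat n n" "B \<in> carrier_mat n n"
  shows "(A,B) \<in> adh n X"
  by (rule adhI[of n "\<lambda>_. A" A "\<lambda>_. B" B]) (use assms in \<open>auto intro: matlim_const\<close>)

lemma adh_eps:
  assumes "A \<in> carrier_mat n n" "B \<in> carrier_mat n n"
   "\<And>e::real. e > 0 \<Longrightarrow> \<exists>A'\<in>carrier_mat n n. \<exists>B'\<in>carrier_mat n n. (A',B') \<in> X \<and>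
      (\<forall>i<n. \<forall>j<n. dist (A' $$ (i,j)) (A $$ (i,j)) < e \<and> dist (B' $$ (i,j)) (B $$ (i,j)) < e)"
  shows "(A,B) \<in> adh n X"
proof -
  have "\<forall>k. \<exists>P. fst P \<in> carrier_mat n n \<and> snd P \<in> carrier_mat n n \<and> P \<in> X \<and>
      (\<forall>i<n. \<forall>j<n. dist (fst P $$ (i,j)) (A $$ (i,j)) < inverse (real (Suc k)) \<and> dist (snd P $$ (i,j)) (B $$ (i,j)) < inverse (real (Suc k)))"
  proof
    fix k
    obtain A' B' where "A'\<in>carrier_mat n n" "B'\<in>carrier_mat n n" "(A',B') \<in> X"
      "(\<forall>i<n. \<forall>j<n. dist (A' $$ (i,j)) (A $$ (i,j)) < inverse (real (Suc k)) \<and> dist (B' $$ (i,j)) (B $$ (i,j)) < inverse (real (Suc k)))"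
      using assms(3)[of "inverse (real (Suc k))"] by auto
    then show "\<exists>P. fst P \<in> carrier_mat n n \<and> snd P \<in> carrier_mat n n \<and> P \<in> X \<and>
      (\<forall>i<n. \<forall>j<n. dist (fst P $$ (i,j)) (A $$ (i,j)) < inverse (real (Suc k)) \<and> dist (snd P $$ (i,j)) (B $$ (i,j)) < inverse (real (Suc k)))"
      by (intro exI[of _ "(A',B')"]) auto
  qed
  from choice[OF this] obtain P where P0: "\<forall>k. fst (P k) \<in> carrier_mat n n \<and> snd (P k) \<in> carrier_mat n n \<and> P k \<in> X \<and>
      (\<forall>i<n. \<forall>j<n. dist (fst (P k) $$ (i,j)) (A $$ (i,j)) < inverse (real (Suc k)) \<and> dist (snd (P k) $$ (i,j)) (B $$ (i,j)) < inverse (real (Suc k)))" ..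
  have P: "\<And>k. fst (P k) \<in> carrier_mat n n" "\<And>k. snd (P k) \<in> carrier_mat n n" "\<And>k. P k \<in> X"
    "\<And>k i j. i < n \<Longrightarrow> j < n \<Longrightarrow> dist (fst (P k) $$ (i,j)) (A $$ (i,j)) < inverse (real (Suc k))"
    "\<And>k i j. i < n \<Longrightarrow> j < n \<Longrightarrow> dist (snd (P k) $$ (i,j)) (B $$ (i,j)) < inverse (real (Suc k))"
    using P0 by auto
  have lim: "f \<longlonglongrightarrow> l" if "\<And>k. dist (f k) l < inverse (real (Suc k))" for f and l :: complex
  proof -
    have "(\<lambda>k. dist (f k) l) \<longlonglongrightarrow> 0"
      by (rule tendsto_sandwich[OF _ _ tendsto_const LIMSEQ_inverse_real_of_nat])
        (use that less_imp_le in \<open>auto intro!: always_eventually\<close>)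
    then show ?thesis by (rule tendsto_dist_iff[THEN iffD2])
  qed
  show ?thesis
    by (rule adhI[of n "\<lambda>k. fst (P k)" A "\<lambda>k. snd (P k)" B])
      (use P assms lim in \<open>auto intro!: matlimI\<close>)
qed

lemma finite_eventually_close:
  fixes F :: "nat \<Rightarrow> complex mat"
  assumes "matlim n F A" "e > 0"
  shows "eventually (\<lambda>k. \<forall>i<n. \<forall>j<n. dist (F k $$ (i,j)) (A $$ (i,j)) < e) sequentially"
proof -
  have "eventually (\<lambda>k. \<forall>i\<in>{..<n}. \<forall>j\<in>{..<n}. dist (F k $$ (i,j)) (A $$ (i,j)) < e) sequentially"
    using assms by (intro eventually_ball_finite ballI) (auto intro!: tendstoD matlimD(3))
  then show ?thesis by (auto elim: eventually_mono)
qed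

text \<open>Idempotence allows perturbations one after another: each has to approach only pairs that
  are themselves limits.\<close>

lemma adh_adh: "adh n (adh n X) \<subseteq> adh n X"
proof (clarify)
  fix A B assume AB: "(A,B) \<in> adh n (adh n X)"
  show "(A,B) \<in> adh n X"
  proof (rule adh_eps)
    fix e :: real assume e: "e > 0"
    obtain F G where FG: "matlim n F A" "matlim n G B" "\<forall>k. (F k, G k) \<in> adh n X" using AB by (rule adhE)
    obtain k where k: "\<forall>i<n. \<forall>j<n. dist (F k $$ (i,j)) (A $$ (i,j)) < e/2" "\<forall>i<n. \<forall>j<n. dist (G k $$ (i,j)) (B $$ (i,j)) < e/2"
      using eventually_happens[OF eventually_conj[OF finite_eventually_close[OF FG(1), of "e/2"] finite_eventually_close[OF FG(2), of "e/2"]]] e by auto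
    obtain F' G' where FG': "matlim n F' (F k)" "matlim n G' (G k)" "\<forall>k. (F' k, G' k) \<in> X" using FG(3)[rule_format, of k] by (rule adhE)
    obtain l where l: "\<forall>i<n. \<forall>j<n. dist (F' l $$ (i,j)) (F k $$ (i,j)) < e/2" "\<forall>i<n. \<forall>j<n. dist (G' l $$ (i,j)) (G k $$ (i,j)) < e/2"
      using eventually_happens[OF eventually_conj[OF finite_eventually_close[OF FG'(1), of "e/2"] finite_eventually_close[OF FG'(2), of "e/2"]]] e by auto
    have "dist (F' l $$ (i,j)) (A $$ (i,j)) < e" "dist (G' l $$ (i,j)) (B $$ (i,j)) < e" if "i < n" "j < n" for i j
      using that k l by (metis dist_triangle_half_l dist_commute)+
    then show "\<exists>A'\<in>carrier_mat n n. \<exists>B'\<in>carrier_mat n n. (A',B') \<in> X \<and>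
      (\<forall>i<n. \<forall>j<n. dist (A' $$ (i,j)) (A $$ (i,j)) < e \<and> dist (B' $$ (i,j)) (B $$ (i,j)) < e)"
      using FG' by (intro bexI[of _ "F' l"] bexI[of _ "G' l"]) (auto dest: matlimD)
  qed (use AB in \<open>auto dest: adh_carrier\<close>)
qed

section \<open>Sets of pairs closed under congruence\<close>

definition cong_closed :: "nat \<Rightarrow> (complex mat \<times> complex mat) set \<Rightarrow> bool" where
  "cong_closed n X \<longleftrightarrow> X \<subseteq> carrier_mat n n \<times> carrier_mat n n \<and>
    (\<forall>W\<in>carrier_mat n n. det W \<noteq> 0 \<longrightarrow> (\<forall>(A,B)\<in>X. (cmat W A, cmat W B) \<in> X))"

lemma cong_closedD:
  assumes "cong_closed n X" "W \<in> carrier_mat n n" "det W \<noteq> 0" "(A,B) \<in> X"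
  shows "(cmat W A, cmat W B) \<in> X"
  using assms unfolding cong_closed_def by fast

lemma cong_closed_carrier:
  assumes "cong_closed n X" "(A,B) \<in> X"
  shows "A \<in> carrier_mat n n" "B \<in> carrier_mat n n"
  using assms unfolding cong_closed_def by auto

lemma cong_closed_adh:
  assumes "cong_closed n X"
  shows "cong_closed n (adh n X)"
  unfolding cong_closed_def
proof (intro conjI ballI impI)
  show "adh n X \<subseteq> carrier_mat n n \<times> carrier_mat n n" by (auto dest: adh_carrier)
  fix W :: "complex mat" and P assume W: "W \<in> carrier_mat n n" "det W \<noteq> 0" and P: "P \<in> adh n X"
  obtain A B where AB: "P = (A,B)" by (cases P)
  then obtain F G where FG: "matlim n F A" "matlim n G B" "\<And>k. (F k, G k) \<in> X" using P by (auto elim: adhE)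
  then have "(cmat W A, cmat W B) \<in> adh n X"
    by (intro adhI[of n "\<lambda>k. cmat W (F k)" _ "\<lambda>k. cmat W (G k)"] matlim_cmat cong_closedD[OF assms W]) (use W in auto)
  then show "case P of (A,B) \<Rightarrow> (cmat W A, cmat W B) \<in> adh n X" using AB by simp
qed

lemma cmat_cancel:
  fixes W :: "complex mat"
  assumes "A \<in> carrier_mat n n" "W \<in> carrier_mat n n" "V \<in> carrier_mat n n" "W * V = 1\<^sub>m n"
  shows "cmat V (cmat W A) = A"
  using assms by (simp add: cmat_cmat[of _ n W n V n])

text \<open>The licence for choosing coordinates: membership may be checked after any invertible
  congruence.\<close>

lemma cong_closed_back:
  assumes "cong_closed n X" "W \<in> carrier_mat n n" "det W \<noteq> 0" "A \<in> carrier_mat n n" "B \<in> carrier_mat n n"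
    "(cmat W A, cmat W B) \<in> X"
  shows "(A,B) \<in> X"
proof -
  obtain V where V: "V \<in> carrier_mat n n" "W * V = 1\<^sub>m n" "V * W = 1\<^sub>m n" "det V \<noteq> 0"
    using det_nz_inverse[OF assms(2,3)] by metis
  show ?thesis using cong_closedD[OF assms(1) V(1,4) assms(6)] cmat_cancel[OF _ assms(2) V(1,2)] assms(4,5) by simp
qed

section \<open>Perturbation to invertible matrices\<close>

lemma null_sequence_avoiding:
  assumes "finite (S :: complex set)"
  obtains t :: "nat \<Rightarrow> complex" where "t \<longlonglongrightarrow> 0" "\<And>k. t k \<notin> S"
proof -
  let ?f = "\<lambda>k. of_real (inverse (real (Suc k))) :: complex"
  have "inj ?f" by (auto simp: inj_def)
  then have "finite (?f -` S)" using assms by (intro finite_vimageI) auto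
  then obtain K where K: "\<And>k. k \<in> ?f -` S \<Longrightarrow> k < K" by (metis finite_nat_set_iff_bounded)
  have "?f \<longlonglongrightarrow> of_real 0" by (intro tendsto_of_real LIMSEQ_inverse_real_of_nat)
  then have "(\<lambda>k. ?f (k + K)) \<longlonglongrightarrow> 0" using LIMSEQ_ignore_initial_segment[of ?f 0 K] by simp
  moreover have "?f (k + K) \<notin> S" for k using K[of "k+K"] by auto
  ultimately show ?thesis using that by blast
qed

text \<open>The determinant is a polynomial in t; were it zero, \<open>rank_defect_det_lead\<close>
  would give \<open>det E = 0\<close>.\<close>

lemma det_pencil_finite:
  fixes E :: "complex mat"
  assumes "E \<in> carrier_mat n n" "A \<in> carrier_mat n n" "det E \<noteq> 0"
  shows "finite {t. det (t \<cdot>\<^sub>m E + A) = 0}"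
proof -
  let ?p = "det (pencil E A)"
  have ev: "poly ?p t = det (t \<cdot>\<^sub>m E + A)" for t
    using assms det_eval_mat[of "pencil E A" n t] by (simp add: eval_pencil)
  have "?p \<noteq> 0"
  proof
    assume "?p = 0"
    then have "rank_defect n 1 E A"
      using ev assms unfolding rank_defect_def
    proof (intro allI impI ballI)
      fix z k and U :: "complex mat" assume "k < (1::nat)" "U \<in> carrier_mat n k"
      then have "z \<cdot>\<^sub>m E + A + U * transpose_mat U = z \<cdot>\<^sub>m E + A" using assms
        by (intro eq_matI) (auto simp: scalar_prod_def)
      then show "det (z \<cdot>\<^sub>m E + A + U * transpose_mat U) = 0" using ev[of z] \<open>?p = 0\<close> by simp
    qed
    then show False using rank_defect_det_lead[OF assms(1,2), of 1] assms(3) by simp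
  qed
  then show ?thesis using poly_roots_finite[of ?p] ev by simp
qed

lemma invertible_perturbation:
  fixes E :: "complex mat"
  assumes "E \<in> carrier_mat n n" "A \<in> carrier_mat n n" "det E \<noteq> 0"
  obtains t where "t \<longlonglongrightarrow> 0" "\<And>k. det (t k \<cdot>\<^sub>m E + A) \<noteq> 0"
  using null_sequence_avoiding[OF det_pencil_finite[OF assms]] by auto

section \<open>Density of simultaneously diagonalizable pairs with simple eigenvalues\<close>

definition dmat :: "nat \<Rightarrow> (nat \<Rightarrow> complex) \<Rightarrow> complex mat" where
  "dmat n \<mu> = mat n n (\<lambda>(i,j). if i = j then - \<mu> i else 0)"

lemma dmat_carrier[simp]: "dmat n \<mu> \<in> carrier_mat n n" by (simp add: dmat_def)

text \<open>The minus sign in \<open>dmat\<close> makes the values \<mu>_i the roots of the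
  determinant of the pencil.\<close>

definition diag_pairs :: "nat \<Rightarrow> (complex mat \<times> complex mat) set" where
  "diag_pairs n = {(cmat W (1\<^sub>m n), cmat W (dmat n \<mu>)) | W \<mu>. W \<in> carrier_mat n n \<and> det W \<noteq> 0 \<and> inj_on \<mu> {..<n}}"

lemma cong_closed_orbit:
  assumes "\<And>x. x \<in> I \<Longrightarrow> K x \<in> carrier_mat n n" "\<And>x. x \<in> I \<Longrightarrow> L x \<in> carrier_mat n n"
  shows "cong_closed n {(cmat W (K x), cmat W (L x)) | W x. W \<in> carrier_mat n n \<and> det W \<noteq> 0 \<and> x \<in> I}"
  unfolding cong_closed_def
proof (intro conjI ballI impI)
  fix V :: "complex mat" and P assume V: "V \<in> carrier_mat n n" "det V \<noteq> 0"
    and P: "P \<in> {(cmat W (K x), cmat W (L x)) | W x. W \<in> carrier_mat n n \<and> det W \<noteq> 0 \<and> x \<in> I}"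
  then obtain W x where W: "P = (cmat W (K x), cmat W (L x))" "W \<in> carrier_mat n n" "det W \<noteq> 0" "x \<in> I" by auto
  have "cmat V (cmat W (K x)) = cmat (W * V) (K x)" "cmat V (cmat W (L x)) = cmat (W * V) (L x)"
    using cmat_cmat[OF assms(1)[OF W(4)] W(2) V(1)] cmat_cmat[OF assms(2)[OF W(4)] W(2) V(1)] by auto
  moreover have "W * V \<in> carrier_mat n n" "det (W * V) \<noteq> 0" using V W by (auto simp: det_mult[of _ n])
  ultimately show "case P of (A,B) \<Rightarrow> (cmat V A, cmat V B) \<in> {(cmat W (K x), cmat W (L x)) | W x. W \<in> carrier_mat n n \<and> det W \<noteq> 0 \<and> x \<in> I}"
    using W by auto
qed auto

lemma cong_closed_diag_pairs: "cong_closed n (diag_pairs n)"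
  using cong_closed_orbit[of "{\<mu>. inj_on \<mu> {..<n}}" "\<lambda>_. 1\<^sub>m n" n "dmat n"] by (simp add: diag_pairs_def)

text \<open>Equal values are separated by adding t times the index; two different indices collide
  for a single t only.\<close>

lemma diag_in_adh: 
  assumes "W \<in> carrier_mat n n" "det W \<noteq> 0"
  shows "(cmat W (1\<^sub>m n), cmat W (dmat n \<mu>)) \<in> adh n (diag_pairs n)"
proof -
  \<comment> \<open>The pairs with i = j contribute 0 / 0 = 0 to the excluded set, which a null
    sequence can avoid as well.\<close>
  let ?S = "(\<lambda>(i,j). (\<mu> i - \<mu> j) / (of_nat j - of_nat i)) ` ({..<n} \<times> {..<n})"
  obtain t where t: "t \<longlonglongrightarrow> 0" "\<And>k. t k \<notin> ?S"
    by (rule null_sequence_avoiding[of ?S]) auto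
  have inj: "inj_on (\<lambda>i. \<mu> i + t k * of_nat i) {..<n}" for k
  proof (rule inj_onI, rule ccontr)
    fix i j assume ij: "i \<in> {..<n}" "j \<in> {..<n}" "\<mu> i + t k * of_nat i = \<mu> j + t k * of_nat j" "i \<noteq> j"
    then have "t k = (\<mu> i - \<mu> j) / (of_nat j - of_nat i)" by (simp add: field_simps)
    then show False using t(2)[of k] ij by auto
  qed
  have "matlim n (\<lambda>k. dmat n (\<lambda>i. \<mu> i + t k * of_nat i)) (dmat n \<mu>)"
  proof (rule matlimI)
    fix i j assume ij: "i < n" "j < n"
    have "(\<lambda>k. - (\<mu> i + t k * of_nat i)) \<longlonglongrightarrow> - (\<mu> i + 0 * of_nat i)" by (intro tendsto_intros t)
    then show "(\<lambda>k. dmat n (\<lambda>i. \<mu> i + t k * of_nat i) $$ (i,j)) \<longlonglongrightarrow> dmat n \<mu> $$ (i,j)"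
      using ij by (auto simp: dmat_def)
  qed auto
  then show ?thesis
    using assms inj by (intro adhI[of n "\<lambda>_. cmat W (1\<^sub>m n)" _ "\<lambda>k. cmat W (dmat n (\<lambda>i. \<mu> i + t k * of_nat i))"] matlim_const matlim_cmat)
      (auto simp: diag_pairs_def)
qed

lemma cmat_split_scalar:
  fixes W :: "complex mat"
  assumes "W \<in> carrier_mat q q" "N \<in> carrier_mat q q"
  shows "cmat (blk 0 1 q (0\<^sub>m 0 0) (0\<^sub>m 0 1) (0\<^sub>m 0 q) (0\<^sub>m 1 0) (mat 1 1 (\<lambda>_. s)) (0\<^sub>m 1 q) (0\<^sub>m q 0) (0\<^sub>m q 1) W)
     (blk 0 1 q (0\<^sub>m 0 0) (0\<^sub>m 0 1) (0\<^sub>m 0 q) (0\<^sub>m 1 0) (mat 1 1 (\<lambda>_. y)) (0\<^sub>m 1 q) (0\<^sub>m q 0) (0\<^sub>m q 1) N) =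
     blk 0 1 q (0\<^sub>m 0 0) (0\<^sub>m 0 1) (0\<^sub>m 0 q) (0\<^sub>m 1 0) (mat 1 1 (\<lambda>_. s^2 * y)) (0\<^sub>m 1 q) (0\<^sub>m q 0) (0\<^sub>m q 1) (cmat W N)"
proof -
  have e: "transpose_mat (mat 1 1 (\<lambda>_. s)) * mat 1 1 (\<lambda>_. y) * mat 1 1 (\<lambda>_. s) = mat 1 1 (\<lambda>_. s^2 * y)"
    by (rule eq_matI) (auto simp: scalar_prod_def power2_eq_square)
  show ?thesis
    using assms cmat_blk_upper[of "0\<^sub>m 0 0" 0 "0\<^sub>m 0 1" 1 "0\<^sub>m 0 q" q "mat 1 1 (\<lambda>_. s)" "0\<^sub>m 1 q" W "mat 1 1 (\<lambda>_. y)" "0\<^sub>m 0 q" "0\<^sub>m q 0" "0\<^sub>m 1 q" "0\<^sub>m q 1" N]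
      mult_carrier_mat[OF assms(2,1)]
      mult_carrier_mat[OF transpose_carrier_mat[THEN iffD2, OF assms(1)] mult_carrier_mat[OF assms(2,1)]]
    by (simp add: cmat_def assoc_mult_mat[of _ q q _ q _ q] e[simplified] )
qed

text \<open>Once A is invertible, an eigenvector of \<open>A^{-1} B\<close> gives a coordinate in
  which row 0 of B is a multiple of row 0 of A. If it is not isotropic for A, it splits off
  orthogonally; if it is, both diagonal entries are first perturbed in the same ratio. The steps are
  proved in reverse, from split pairs back to general ones.\<close>

lemma sym_pair_in_adh_diag:
  assumes "A \<in> carrier_mat n n" "transpose_mat A = A" "B \<in> carrier_mat n n" "transpose_mat B = B"
  shows "(A,B) \<in> adh n (diag_pairs n)"
  using assms
proof (induction n arbitrary: A B)
  case 0
  have e: "A = cmat (1\<^sub>m 0) (1\<^sub>m 0)" "B = cmat (1\<^sub>m 0) (dmat 0 (\<lambda>_. 0))" using 0 by (auto intro!: eq_matI simp: dmat_def)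
  show ?case unfolding e by (rule diag_in_adh) auto
next
  case (Suc q)
  let ?n = "Suc q" let ?C = "adh ?n (diag_pairs ?n)"
  have cc: "cong_closed ?n ?C" by (intro cong_closed_adh cong_closed_diag_pairs)
  have lim: "(A,B) \<in> ?C" if "matlim ?n F A" "matlim ?n G B" "\<And>k. (F k, G k) \<in> ?C" for A B F G
    using adhI[OF that] adh_adh by blast
  let ?bl = "\<lambda>y N. blk 0 1 q (0\<^sub>m 0 0) (0\<^sub>m 0 1) (0\<^sub>m 0 q) (0\<^sub>m 1 0) (mat 1 1 (\<lambda>_. y)) (0\<^sub>m 1 q) (0\<^sub>m q 0) (0\<^sub>m q 1) N :: complex mat"
  have blc: "?bl y N \<in> carrier_mat ?n ?n" for y N using blk_carrier[of 0 1 q] by simp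
  have step4: "(?bl c A', ?bl (- \<mu> * c) B') \<in> ?C"
    if c: "c \<noteq> 0" and A': "A' \<in> carrier_mat q q" "transpose_mat A' = A'" "B' \<in> carrier_mat q q" "transpose_mat B' = B'" for c \<mu> A' B'
  proof -
    obtain F G where FG: "matlim q F A'" "matlim q G B'" "\<forall>k. (F k, G k) \<in> diag_pairs q"
      using Suc.IH[OF A'] by (rule adhE)
    show ?thesis
    proof (rule lim[of "\<lambda>k. ?bl c (F k)" _ "\<lambda>k. ?bl (- \<mu> * c) (G k)"])
      have bl_lim: "matlim ?n (\<lambda>k. ?bl y (H k)) (?bl y M)" if "matlim q H M" for y H M
      proof (rule matlimI)
        fix i j assume "i < ?n" "j < ?n"
        then show "(\<lambda>k. ?bl y (H k) $$ (i,j)) \<longlonglongrightarrow> ?bl y M $$ (i,j)"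
          using matlimD(3)[OF that] by (cases i; cases j) (auto simp: blk_01q_index)
      qed (use blc in auto)
      show "matlim ?n (\<lambda>k. ?bl c (F k)) (?bl c A')" "matlim ?n (\<lambda>k. ?bl (- \<mu> * c) (G k)) (?bl (- \<mu> * c) B')"
        using bl_lim FG by auto
      fix k
      obtain W \<nu> where W: "F k = cmat W (1\<^sub>m q)" "G k = cmat W (dmat q \<nu>)" "W \<in> carrier_mat q q" "det W \<noteq> 0"
        using FG(3)[rule_format, of k] by (auto simp: diag_pairs_def)
      \<comment> \<open>The square root scales the split coordinate, whose diagonal entry in A is c
        instead of 1.\<close>
      let ?W = "?bl (csqrt c) W"
      let ?\<nu> = "\<lambda>i. if i = 0 then \<mu> else \<nu> (i - 1)"
      have "1\<^sub>m ?n = ?bl 1 (1\<^sub>m q)"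
        by (rule eq_matI) (auto simp: blk_def)
      then have "cmat ?W (1\<^sub>m ?n) = ?bl c (F k)"
        using cmat_split_scalar[OF W(3) one_carrier_mat, of "csqrt c" 1] W(1) by simp
      moreover have "dmat ?n ?\<nu> = ?bl (-\<mu>) (dmat q \<nu>)"
      proof (rule eq_matI)
        fix i j assume "i < dim_row (?bl (-\<mu>) (dmat q \<nu>))" "j < dim_col (?bl (-\<mu>) (dmat q \<nu>))"
        then show "dmat ?n ?\<nu> $$ (i,j) = ?bl (-\<mu>) (dmat q \<nu>) $$ (i,j)"
          by (cases i; cases j) (auto simp: blk_01q_index dmat_def)
      qed (auto simp: dmat_def)
      then have "cmat ?W (dmat ?n ?\<nu>) = ?bl (- \<mu> * c) (G k)"
        using cmat_split_scalar[OF W(3) dmat_carrier, of "csqrt c" "-\<mu>" \<nu>] W(2) by (simp add: mult.commute)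
      moreover have "det ?W \<noteq> 0" using c W by (subst blk_det_upper) (auto simp: det_single)
      ultimately show "(?bl c (F k), ?bl (- \<mu> * c) (G k)) \<in> ?C"
        using diag_in_adh[OF blc, of "csqrt c" W ?\<nu>] by simp
    qed
  qed
  have step3: "(A,B) \<in> ?C" if A: "A \<in> carrier_mat ?n ?n" "transpose_mat A = A" and B: "B \<in> carrier_mat ?n ?n" "transpose_mat B = B"
    and c: "A $$ (0,0) \<noteq> 0" and e: "\<And>j. j < ?n \<Longrightarrow> B $$ (0,j) = - \<mu> * A $$ (0,j)" for A B \<mu>
  proof -
    let ?X = "mat 1 q (\<lambda>(_,j). - A $$ (0,Suc j) / A $$ (0,0))"
    define W2 where "W2 = (blk 0 1 q (0\<^sub>m 0 0) (0\<^sub>m 0 1) (0\<^sub>m 0 q) (0\<^sub>m 1 0) (1\<^sub>m 1) ?X (0\<^sub>m q 0) (0\<^sub>m q 1) (1\<^sub>m q) :: complex mat)"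
    have W2: "W2 \<in> carrier_mat ?n ?n" "det W2 \<noteq> 0"
      unfolding W2_def using blk_carrier[of 0 1 q] by (simp_all add: blk_det_upper)
    have X: "?X \<in> carrier_mat 1 q" by simp
    have s1: "(\<Sum>l<q. M $$ (0,Suc l) * 1\<^sub>m q $$ (l,j)) = M $$ (0,Suc j)" if "j < q" for M :: "complex mat" and j
      using that by (simp add: if_distrib[where f="\<lambda>x. _ * x"] cong: if_cong)
    note rA = cmat_first_row[OF A(1) X one_carrier_mat, folded W2_def] 
    note rB = cmat_first_row[OF B(1) X one_carrier_mat, folded W2_def]
    let ?A2 = "cmat W2 A" and ?B2 = "cmat W2 B"
    have c2: "?A2 \<in> carrier_mat ?n ?n" "?B2 \<in> carrier_mat ?n ?n" using W2 by auto
    have sy: "transpose_mat ?A2 = ?A2" "transpose_mat ?B2 = ?B2" using cmat_sym[OF A(1) W2(1) A(2)] cmat_sym[OF B(1) W2(1) B(2)] .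
    have zA: "?A2 $$ (0,Suc j) = 0" if "j < q" for j using rA(2)[OF that] s1[OF that, of A] c that by simp
    have zB: "?B2 $$ (0,Suc j) = 0" if "j < q" for j using rB(2)[OF that] s1[OF that, of B] c that e[of 0] e[of "Suc j"] by simp
    have zA': "?A2 $$ (Suc j,0) = 0" if "j < q" for j using sym_index[OF sy(1) c2(1), of "Suc j" 0] zA that by simp
    have zB': "?B2 $$ (Suc j,0) = 0" if "j < q" for j using sym_index[OF sy(2) c2(2), of "Suc j" 0] zB that by simp
    have bl: "M = ?bl (M $$ (0,0)) (sub_blk M 1 1 q q)" if "M \<in> carrier_mat ?n ?n" "\<And>j. j < q \<Longrightarrow> M $$ (0,Suc j) = 0" "\<And>j. j < q \<Longrightarrow> M $$ (Suc j,0) = 0" for M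
    proof (rule eq_matI)
      fix i j assume "i < dim_row (?bl (M $$ (0,0)) (sub_blk M 1 1 q q))" "j < dim_col (?bl (M $$ (0,0)) (sub_blk M 1 1 q q))"
      then show "M $$ (i,j) = ?bl (M $$ (0,0)) (sub_blk M 1 1 q q) $$ (i,j)"
        using that by (cases i; cases j) (auto simp: blk_01q_index sub_blk_def)
    qed (use that in auto)
    have "(?A2, ?B2) \<in> ?C"
      using step4[of "A $$ (0,0)" "sub_blk ?A2 1 1 q q" "sub_blk ?B2 1 1 q q" \<mu>] c
        bl[OF c2(1) zA zA'] bl[OF c2(2) zB zB'] rA(1) rB(1) e[of 0]
        transpose_sub_blk[OF c2(1) sy(1), of 1 q 1 q] transpose_sub_blk[OF c2(2) sy(2), of 1 q 1 q] by auto
    then show ?thesis using cong_closed_back[OF cc W2 A(1) B(1)] by simp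
  qed
  have step2: "(A,B) \<in> ?C" if A: "A \<in> carrier_mat ?n ?n" "transpose_mat A = A" and B: "B \<in> carrier_mat ?n ?n" "transpose_mat B = B"
    and e: "\<And>j. j < ?n \<Longrightarrow> B $$ (0,j) = - \<mu> * A $$ (0,j)" for A B \<mu>
  proof (cases "A $$ (0,0) = 0")
    case False
    then show ?thesis using step3 A B e by blast
  next
    case True
    obtain t :: "nat \<Rightarrow> complex" where t: "t \<longlonglongrightarrow> 0" and t0: "\<And>k. t k \<notin> {0}"
      by (rule null_sequence_avoiding[of "{0}"]) auto
    \<comment> \<open>Adding t at (0,0) in A and -\<mu> t at (0,0) in B keeps the two first rows
      proportional.\<close>
    let ?E = "\<lambda>M x. mat ?n ?n (\<lambda>(i,j). M $$ (i,j) + (if i = 0 \<and> j = 0 then x else 0)) :: complex mat"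
    have Elim: "matlim ?n (\<lambda>k. ?E M (c * t k)) M" if "M \<in> carrier_mat ?n ?n" for M c
    proof (rule matlimI)
      fix i j assume ij: "i < ?n" "j < ?n"
      have "(\<lambda>k. M $$ (i,j) + c * t k) \<longlonglongrightarrow> M $$ (i,j) + c * 0" by (intro tendsto_intros t)
      then show "(\<lambda>k. ?E M (c * t k) $$ (i,j)) \<longlonglongrightarrow> M $$ (i,j)"
        using ij by (cases "i = 0 \<and> j = 0") auto
    qed (use that in auto)
    have Es: "transpose_mat (?E M x) = ?E M x" if "M \<in> carrier_mat ?n ?n" "transpose_mat M = M" for M x
      by (rule eq_matI) (use sym_index[OF that(2,1)] in auto)
    show ?thesis
    proof (rule lim[of "\<lambda>k. ?E A (1 * t k)" _ "\<lambda>k. ?E B (-\<mu> * t k)"])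
      show "matlim ?n (\<lambda>k. ?E A (1 * t k)) A" "matlim ?n (\<lambda>k. ?E B (-\<mu> * t k)) B" using Elim A B by blast+
      fix k
      have "t k \<noteq> 0" using t0[of k] by simp
      then show "(?E A (1 * t k), ?E B (-\<mu> * t k)) \<in> ?C"
        using True e Es[OF A] Es[OF B] by (intro step3[where \<mu>=\<mu>]) (auto simp: algebra_simps)
    qed
  qed
  have step1: "(A,B) \<in> ?C" if A: "A \<in> carrier_mat ?n ?n" "transpose_mat A = A" and B: "B \<in> carrier_mat ?n ?n" "transpose_mat B = B"
    and d: "det A \<noteq> 0" for A B
  proof -
    obtain V where V: "V \<in> carrier_mat ?n ?n" "A * V = 1\<^sub>m ?n" "V * A = 1\<^sub>m ?n" "det V \<noteq> 0"
      using det_nz_inverse[OF A(1) d] by metis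
    let ?M = "V * B"
    have Mc: "?M \<in> carrier_mat ?n ?n" using V B by auto
    obtain \<mu> where "eigenvalue ?M \<mu>" using spectrum_non_empty[OF Mc] by (auto simp: spectrum_def)
    then obtain v where v: "v \<in> carrier_vec ?n" "v \<noteq> 0\<^sub>v ?n" "?M *\<^sub>v v = \<mu> \<cdot>\<^sub>v v"
      using Mc by (auto simp: eigenvalue_def eigenvector_def)
    have Bv: "B *\<^sub>v v = \<mu> \<cdot>\<^sub>v (A *\<^sub>v v)"
    proof -
      have "A *\<^sub>v (?M *\<^sub>v v) = B *\<^sub>v v"
        using A V B v assoc_mult_mat_vec[OF V(1) B(1) v(1)] assoc_mult_mat_vec[OF A(1) V(1), of "B *\<^sub>v v"]
          mult_mat_vec_carrier[OF B(1) v(1)] by simp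
      then show ?thesis using v A by (simp add: mult_mat_vec[of _ ?n ?n])
    qed
    obtain W where W: "W \<in> carrier_mat ?n ?n" "det W \<noteq> 0" "col W 0 = v"
      using column_completion[OF v(1,2), of 0] by auto
    have sy: "transpose_mat (cmat W A) = cmat W A" "transpose_mat (cmat W B) = cmat W B"
      using cmat_sym[OF A(1) W(1) A(2)] cmat_sym[OF B(1) W(1) B(2)] .
    have col0: "cmat W M $$ (i,0) = (\<Sum>x<?n. W $$ (x,i) * (M *\<^sub>v v) $ x)" if "M \<in> carrier_mat ?n ?n" "i < ?n" for M i
    proof -
      have "cmat W M = transpose_mat W * (M * W)"
        unfolding cmat_def using W that by (intro assoc_mult_mat[of _ ?n ?n _ ?n _ ?n]) auto
      then have "cmat W M $$ (i,0) = (\<Sum>x<?n. transpose_mat W $$ (i,x) * (M * W) $$ (x,0))"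
        using W that mult_index[of "transpose_mat W" ?n ?n "M * W" ?n i 0] by simp
      then show ?thesis using W that by (auto intro!: sum.cong)
    qed
    \<comment> \<open>The eigenvector equation reads \<open>B v = \<mu> A v\<close>, whereas
      \<open>step2\<close> counts the ratio with the opposite sign.\<close>
    have "cmat W B $$ (0,j) = - (- \<mu>) * cmat W A $$ (0,j)" if "j < ?n" for j
    proof -
      have "cmat W B $$ (0,j) = cmat W B $$ (j,0)" "cmat W A $$ (0,j) = cmat W A $$ (j,0)"
        using sym_index[OF sy(1), of ?n 0 j] sym_index[OF sy(2), of ?n 0 j] W that by auto
      then show ?thesis using col0[OF A(1) that] col0[OF B(1) that] Bv A v
        by (simp add: sum_distrib_left mult_ac del: sum.lessThan_Suc)
    qed
    then have "(cmat W A, cmat W B) \<in> ?C"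
      using sy W by (intro step2[where \<mu>="-\<mu>"]) auto
    then show ?thesis using cong_closed_back[OF cc W(1,2) A(1) B(1)] by simp
  qed
  obtain t where t: "t \<longlonglongrightarrow> 0" "\<And>k. det (t k \<cdot>\<^sub>m 1\<^sub>m ?n + A) \<noteq> 0"
    by (rule invertible_perturbation[of "1\<^sub>m ?n" ?n A]) (use Suc.prems in auto)
  show ?case
  proof (rule lim[of "\<lambda>k. t k \<cdot>\<^sub>m 1\<^sub>m ?n + A" _ "\<lambda>_. B"])
    show "matlim ?n (\<lambda>k. t k \<cdot>\<^sub>m 1\<^sub>m ?n + A) A"
    proof (rule matlimI)
      fix i j assume ij: "i < ?n" "j < ?n"
      have "(\<lambda>k. t k * 1\<^sub>m ?n $$ (i,j) + A $$ (i,j)) \<longlonglongrightarrow> 0 * 1\<^sub>m ?n $$ (i,j) + A $$ (i,j)" by (intro tendsto_intros t)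
      then show "(\<lambda>k. (t k \<cdot>\<^sub>m 1\<^sub>m ?n + A) $$ (i,j)) \<longlonglongrightarrow> A $$ (i,j)" using ij Suc.prems by simp
    qed (use Suc.prems in auto)
    show "matlim ?n (\<lambda>_. B) B" using Suc.prems by (intro matlim_const) auto
    fix k
    show "(t k \<cdot>\<^sub>m 1\<^sub>m ?n + A, B) \<in> ?C"
    proof (rule step1)
      show "transpose_mat (t k \<cdot>\<^sub>m 1\<^sub>m ?n + A) = t k \<cdot>\<^sub>m 1\<^sub>m ?n + A"
        using sym_index[OF Suc.prems(2,1)] Suc.prems by (intro eq_matI) auto
    qed (use Suc.prems t in auto)
  qed
qed

section \<open>Pencils with a pattern are limits of generic ones\<close>

text \<open>\<open>KA\<close> and \<open>KB\<close> are the coefficients of \<open>K\<^sub>a\<close>, \<open>m = n - r\<close>, after a permutation of coordinates that interleaves the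
  blocks \<open>M\<^sub>d\<close>, so that their shape does not depend on the division of \<open>a\<close> by \<open>m\<close>; the \<open>\<mu>\<^sub>i\<close> are indexed from \<open>0\<close>.\<close>

definition KA :: "nat \<Rightarrow> nat \<Rightarrow> nat \<Rightarrow> complex mat" where
  "KA n m a = mat n n (\<lambda>(x,y). if x + y + 1 = n + m \<and> (n \<le> x + a \<or> n \<le> y + a) \<or> x = y \<and> m + a \<le> x \<and> x + a < n then 1 else 0)"

definition KB :: "nat \<Rightarrow> nat \<Rightarrow> nat \<Rightarrow> (nat \<Rightarrow> complex) \<Rightarrow> complex mat" where
  "KB n m a \<mu> = mat n n (\<lambda>(x,y). if x + y + 1 = n \<and> (x < a \<or> y < a) then 1
     else if x = y \<and> m + a \<le> x \<and> x + a < n then - \<mu> (x - (m + a)) else 0)"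

lemma K_carrier[simp]: "KA n m a \<in> carrier_mat n n" "KB n m a \<mu> \<in> carrier_mat n n"
  by (auto simp: KA_def KB_def)

lemma K_sym: "transpose_mat (KA n m a) = KA n m a" "transpose_mat (KB n m a \<mu>) = KB n m a \<mu>"
  by (rule eq_matI; auto simp: KA_def KB_def add.commute)+

definition normal_pairs :: "nat \<Rightarrow> nat \<Rightarrow> nat \<Rightarrow> (complex mat \<times> complex mat) set" where
  "normal_pairs n m a = {(cmat W (KA n m a), cmat W (KB n m a \<mu>)) | W \<mu>. W \<in> carrier_mat n n \<and> det W \<noteq> 0 \<and> inj_on \<mu> {..<n-m-2*a}}"

lemma cong_closed_normal_pairs: "cong_closed n (normal_pairs n m a)"
  using cong_closed_orbit[of "{\<mu>. inj_on \<mu> {..<n-m-2*a}}" "\<lambda>_. KA n m a" n "KB n m a"] by (simp add: normal_pairs_def)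

section \<open>Block form of the staircase pair\<close>

definition Jm :: "nat \<Rightarrow> complex mat" where
  "Jm p = mat p p (\<lambda>(i,j). if i + j + 1 = p then 1 else 0)"

text \<open>The piece of the antidiagonal \<open>x + y + 1 = n + m\<close> of \<open>KA\<close> that
  couples the last p coordinates to the core.\<close>

definition Hm :: "nat \<Rightarrow> nat \<Rightarrow> nat \<Rightarrow> complex mat" where
  "Hm p q m = mat p q (\<lambda>(i,j). if i + j + 1 = m then 1 else 0)"

lemma Jm_carrier[simp]: "Jm p \<in> carrier_mat p p" by (simp add: Jm_def)
lemma Hm_carrier[simp]: "Hm p q m \<in> carrier_mat p q" by (simp add: Hm_def)
lemma Jm_dim[simp]: "dim_row (Jm p) = p" "dim_col (Jm p) = p" by (simp_all add: Jm_def)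
lemma Hm_dim[simp]: "dim_row (Hm p q m) = p" "dim_col (Hm p q m) = q" by (simp_all add: Hm_def)
lemma K_dim[simp]: "dim_row (KA n m a) = n" "dim_col (KA n m a) = n" "dim_row (KB n m a \<mu>) = n" "dim_col (KB n m a \<mu>) = n"
  by (simp_all add: KA_def KB_def)
lemma Jm_sym[simp]: "transpose_mat (Jm p) = Jm p" by (rule eq_matI) (auto simp: Jm_def)

lemma Jm_mult:
  assumes "M \<in> carrier_mat p l" "i < p" "j < l"
  shows "(Jm p * M) $$ (i,j) = M $$ (p-1-i, j)"
proof -
  have "(Jm p * M) $$ (i,j) = (\<Sum>x<p. Jm p $$ (i,x) * M $$ (x,j))" using assms by (intro mult_index) auto
  also have "\<dots> = (\<Sum>x<p. if x = p-1-i then M $$ (x,j) else 0)"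
    using assms by (intro sum.cong) (auto simp: Jm_def)
  also have "\<dots> = M $$ (p-1-i,j)" using assms by simp
  finally show ?thesis .
qed

lemma Jm_sq: "Jm p * Jm p = 1\<^sub>m p"
  by (rule eq_matI) (auto simp: Jm_mult[of _ p p] simp del: index_mult_mat(1), auto simp: Jm_def)

lemma blk_cases:
  assumes "i < p+q+(s::nat)"
  obtains (1) "i < p" | (2) k where "k < q" "i = p + k" | (3) k where "k < s" "i = p + q + k"
proof -
  consider "i < p" | "p \<le> i" "i < p+q" | "p+q \<le> i" by linarith
  then show thesis
  proof cases
    case 1 then show ?thesis using that(1) by simp
  next
    case 2 then show ?thesis using that(2)[of "i-p"] by simp
  next
    case 3 then show ?thesis using that(3)[of "i-(p+q)"] assms by simp
  qed
qed

lemma blk_index: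
  "i < p \<Longrightarrow> j < p \<Longrightarrow> blk p q s a b c d e f g h k $$ (i,j) = a $$ (i,j)"
  "i < p \<Longrightarrow> j < q \<Longrightarrow> blk p q s a b c d e f g h k $$ (i,p+j) = b $$ (i,j)"
  "i < p \<Longrightarrow> j < s \<Longrightarrow> blk p q s a b c d e f g h k $$ (i,p+q+j) = c $$ (i,j)"
  "i < q \<Longrightarrow> j < p \<Longrightarrow> blk p q s a b c d e f g h k $$ (p+i,j) = d $$ (i,j)"
  "i < q \<Longrightarrow> j < q \<Longrightarrow> blk p q s a b c d e f g h k $$ (p+i,p+j) = e $$ (i,j)"
  "i < q \<Longrightarrow> j < s \<Longrightarrow> blk p q s a b c d e f g h k $$ (p+i,p+q+j) = f $$ (i,j)"
  "i < s \<Longrightarrow> j < p \<Longrightarrow> blk p q s a b c d e f g h k $$ (p+q+i,j) = g $$ (i,j)"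
  "i < s \<Longrightarrow> j < q \<Longrightarrow> blk p q s a b c d e f g h k $$ (p+q+i,p+j) = h $$ (i,j)"
  "i < s \<Longrightarrow> j < s \<Longrightarrow> blk p q s a b c d e f g h k $$ (p+q+i,p+q+j) = k $$ (i,j)"
  by (auto simp: blk_def)

text \<open>Removing p coordinates at each end leaves a staircase with the same m and with a - p, in
  B as in A; this self-similarity carries the induction on a. The bound p \<le> m keeps A zero on
  the first layer, so that A couples the last layer to the core only.\<close>

lemma KA_blk:
  assumes "p \<le> a" "p \<le> m" "m + 2 * a \<le> p + q + p"
  shows "KA (p+q+p) m a = blk p q p (0\<^sub>m p p) (0\<^sub>m p q) (0\<^sub>m p p) (0\<^sub>m q p) (KA q m (a-p)) (transpose_mat (Hm p q m)) (0\<^sub>m p p) (Hm p q m) (0\<^sub>m p p)"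
    (is "_ = ?R")
proof -
  obtain b where a: "a = p + b" using assms(1) by (auto simp: le_iff_add)
  obtain l where m: "m = p + l" using assms(2) by (auto simp: le_iff_add)
  have mq: "p + l + 2 * b \<le> q" using assms(3) a m by simp
  show ?thesis
  proof (rule eq_matI)
    fix i j assume "i < dim_row ?R" "j < dim_col ?R"
    then have i: "i < p+q+p" and j: "j < p+q+p" by auto
    show "KA (p+q+p) m a $$ (i,j) = ?R $$ (i,j)"
      using i
    proof (cases rule: blk_cases)
      case 1
      show ?thesis using j by (cases rule: blk_cases) (use 1 mq in \<open>simp_all add: blk_index KA_def a m\<close>)
    next
      case (2 k)
      show ?thesis using j
      proof (cases rule: blk_cases)
        case 1
        then show ?thesis using 2 mq by (simp add: blk_index KA_def a m)
      next
        case (2 l')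
        have e: "(p+k) + (p+l') + 1 = (p+q+p) + (p+l) \<longleftrightarrow> k + l' + 1 = q + (p + l)"
          "p+q+p \<le> p+k+(p+b) \<longleftrightarrow> q \<le> k+b" "p+q+p \<le> p+l'+(p+b) \<longleftrightarrow> q \<le> l'+b"
          "p+l+(p+b) \<le> p+k \<longleftrightarrow> p+l+b \<le> k" "p+k+(p+b) < p+q+p \<longleftrightarrow> k + b < q" by auto
        show ?thesis using \<open>k < q\<close> \<open>i = p + k\<close> 2 unfolding KA_def a m by (simp add: blk_index e)
      next
        case (3 l')
        have e: "(p+k) + (p+q+l') + 1 = (p+q+p) + (p+l) \<longleftrightarrow> k + l' + 1 = p + l" by auto
        show ?thesis using \<open>k < q\<close> \<open>i = p + k\<close> 3 unfolding KA_def a m Hm_def by (simp add: blk_index e; simp add: add.commute)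
      qed
    next
      case (3 k)
      show ?thesis using j
      proof (cases rule: blk_cases)
        case 1
        then show ?thesis using 3 mq by (simp add: blk_index KA_def a m)
      next
        case (2 l')
        have e: "(p+q+k) + (p+l') + 1 = (p+q+p) + (p+l) \<longleftrightarrow> k + l' + 1 = p + l" by auto
        show ?thesis using \<open>k < p\<close> \<open>i = p + q + k\<close> 2 unfolding KA_def a m Hm_def by (simp add: blk_index e)
      next
        case (3 l')
        then show ?thesis using \<open>k < p\<close> \<open>i = p + q + k\<close> mq by (simp add: blk_index KA_def a m)
      qed
    qed
  qed (simp_all add: KA_def)
qed

lemma KB_blk:
  assumes "p \<le> a" "p \<le> m" "m + 2 * a \<le> p + q + p"
  shows "KB (p+q+p) m a \<mu> = blk p q p (0\<^sub>m p p) (0\<^sub>m p q) (Jm p) (0\<^sub>m q p) (KB q m (a-p) \<mu>) (0\<^sub>m q p) (Jm p) (0\<^sub>m p q) (0\<^sub>m p p)"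
    (is "_ = ?R")
proof -
  obtain b where a: "a = p + b" using assms(1) by (auto simp: le_iff_add)
  obtain l where m: "m = p + l" using assms(2) by (auto simp: le_iff_add)
  have mq: "p + l + 2 * b \<le> q" using assms(3) a m by simp
  show ?thesis
  proof (rule eq_matI)
    fix i j assume "i < dim_row ?R" "j < dim_col ?R"
    then have i: "i < p+q+p" and j: "j < p+q+p" by auto
    show "KB (p+q+p) m a \<mu> $$ (i,j) = ?R $$ (i,j)"
      using i
    proof (cases rule: blk_cases)
      case 1
      show ?thesis using j by (cases rule: blk_cases) (use 1 mq in \<open>simp_all add: blk_index KB_def Jm_def a m\<close>)
    next
      case (2 k)
      show ?thesis using j
      proof (cases rule: blk_cases)
        case 1
        then show ?thesis using 2 mq by (simp add: blk_index KB_def a m)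
      next
        case (2 l')
        have e: "(p+k) + (p+l') + 1 = (p+q+p) \<longleftrightarrow> k + l' + 1 = q" "p+k < p+b \<longleftrightarrow> k < b" "p+l' < p+b \<longleftrightarrow> l' < b"
          "p+l+(p+b) \<le> p+k \<longleftrightarrow> p+l+b \<le> k" "p+k+(p+b) < p+q+p \<longleftrightarrow> k + b < q"
          "p+k-(p+l+(p+b)) = k-(p+l+b)" by auto
        show ?thesis using \<open>k < q\<close> \<open>i = p + k\<close> 2 unfolding KB_def a m by (simp add: blk_index e; auto simp: ac_simps)
      next
        case (3 l')
        then show ?thesis using \<open>k < q\<close> \<open>i = p + k\<close> mq by (simp add: blk_index KB_def a m)
      qed
    next
      case (3 k)
      show ?thesis using j
      proof (cases rule: blk_cases)
        case 1
        then show ?thesis using 3 mq by (simp add: blk_index KB_def Jm_def a m)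
      next
        case (2 l')
        then show ?thesis using \<open>k < p\<close> \<open>i = p + q + k\<close> mq by (simp add: blk_index KB_def a m)
      next
        case (3 l')
        then show ?thesis using \<open>k < p\<close> \<open>i = p + q + k\<close> mq by (simp add: blk_index KB_def a m)
      qed
    qed
  qed (simp_all add: KB_def)
qed

text \<open>\<open>KA\<close> is the matrix of an involution s of the coordinates from m on: the
  diagonal part is fixed and the rest is reflected along the antidiagonal
  \<open>x + y + 1 = q + m\<close>. Its square is therefore the projection onto these
  coordinates.\<close>

lemma KA_sq:
  assumes "m + 2 * a \<le> q"
  shows "KA q m a * KA q m a = mat q q (\<lambda>(i,j). if i = j \<and> m \<le> i then 1 else 0)"
proof (rule eq_matI)
  fix i j assume "i < dim_row (mat q q (\<lambda>(i,j). if i = j \<and> m \<le> i then 1 else 0::complex))" "j < dim_col (mat q q (\<lambda>(i,j). if i = j \<and> m \<le> i then 1 else 0::complex))"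
  then have ij: "i < q" "j < q" by auto
  define s where "s i = (if m + a \<le> i \<and> i + a < q then i else q + m - 1 - i)" for i
  have K: "KA q m a $$ (x,y) = (if m \<le> x \<and> y = s x then 1 else 0)" if "x < q" "y < q" for x y
    using that assms by (auto simp: KA_def s_def)
  have s: "s x < q" "m \<le> s x" "s (s x) = x" if "m \<le> x" "x < q" for x
    using that assms by (auto simp: s_def)
  have "(KA q m a * KA q m a) $$ (i,j) = (\<Sum>x<q. KA q m a $$ (i,x) * KA q m a $$ (x,j))"
    using ij by (intro mult_index) auto
  also have "\<dots> = (\<Sum>x<q. if x = s i then (if m \<le> i \<and> j = s (s i) then 1 else 0) else 0)"
    using ij s by (intro sum.cong) (auto simp: K)
  also have "\<dots> = (if i = j \<and> m \<le> i then 1 else 0)" using s ij by auto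
  finally show "(KA q m a * KA q m a) $$ (i,j) = mat q q (\<lambda>(i,j). if i = j \<and> m \<le> i then 1 else 0) $$ (i,j)" using ij by simp
qed auto

lemma KA_low: "i < m \<Longrightarrow> m + 2 * a \<le> q \<Longrightarrow> i < q \<Longrightarrow> j < q \<Longrightarrow> KA q m a $$ (i,j) = 0"
  by (auto simp: KA_def)

text \<open>In \<open>hypA\<close> and \<open>hypB\<close> the first layer meets only the last one,
  and only in B, through \<open>Jm\<close>. K is the core, H the coupling of the last layer to the
  core, and t the form on the last layer.\<close>

definition hypA :: "nat \<Rightarrow> nat \<Rightarrow> complex mat \<Rightarrow> complex mat \<Rightarrow> complex mat \<Rightarrow> complex mat" where
  "hypA p q K H t = blk p q p (0\<^sub>m p p) (0\<^sub>m p q) (0\<^sub>m p p) (0\<^sub>m q p) K (transpose_mat H) (0\<^sub>m p p) H t"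

definition hypB :: "nat \<Rightarrow> nat \<Rightarrow> complex mat \<Rightarrow> complex mat \<Rightarrow> complex mat \<Rightarrow> complex mat" where
  "hypB p q K H t = blk p q p (0\<^sub>m p p) (0\<^sub>m p q) (Jm p) (0\<^sub>m q p) K (transpose_mat H) (Jm p) H t"

lemma hyp_carrier[simp]: "hypA p q K H t \<in> carrier_mat (p+q+p) (p+q+p)" "hypB p q K H t \<in> carrier_mat (p+q+p) (p+q+p)"
  by (simp_all add: hypA_def hypB_def)

lemma matlim_hyp:
  assumes "matlim q K1 K" "\<And>k. H1 k \<in> carrier_mat p q" "H \<in> carrier_mat p q"
    "\<And>i j. i < p \<Longrightarrow> j < q \<Longrightarrow> (\<lambda>k. H1 k $$ (i,j)) \<longlonglongrightarrow> H $$ (i,j)"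
  shows "matlim (p+q+p) (\<lambda>k. hypA p q (K1 k) (H1 k) t) (hypA p q K H t)"
    "matlim (p+q+p) (\<lambda>k. hypB p q (K1 k) (H1 k) t) (hypB p q K H t)"
proof -
  have d: "dim_row (H1 k) = p" "dim_col (H1 k) = q" "dim_row H = p" "dim_col H = q" for k using assms(2)[of k] assms(3) by auto
  show "matlim (p+q+p) (\<lambda>k. hypA p q (K1 k) (H1 k) t) (hypA p q K H t)"
    by (rule matlimI) (use matlimD(3)[OF assms(1)] assms(4) d in \<open>auto simp: hypA_def blk_def\<close>)
  show "matlim (p+q+p) (\<lambda>k. hypB p q (K1 k) (H1 k) t) (hypB p q K H t)"
    by (rule matlimI) (use matlimD(3)[OF assms(1)] assms(4) d in \<open>auto simp: hypB_def blk_def\<close>)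
qed

lemma mat_add_rearrange:
  fixes a :: "complex mat"
  assumes "a \<in> carrier_mat p q" "b \<in> carrier_mat p q" "c \<in> carrier_mat p q" "d \<in> carrier_mat p q"
  shows "a + b + (c + d) = a + c + b + d" "a + b + c + d = a + c + b + d" "a + (- (a + b) + b) = 0\<^sub>m p q" "- (a + b) + (a + b) = 0\<^sub>m p q"
    "(-1/2) \<cdot>\<^sub>m (a + b + c + d) + (a + b) + ((-1/2) \<cdot>\<^sub>m (a + b + c + d) + c + d) = 0\<^sub>m p q"
    "transpose_mat (- (a + b)) = - (transpose_mat a + transpose_mat b)"
  by (rule eq_matI; use assms in \<open>auto simp: field_simps\<close>)+

text \<open>Congruence by \<open>e\<^sub>3 \<mapsto> e\<^sub>3 + X e\<^sub>2\<close>; the constant terms in the last block row are cleared using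
  the hyperbolic pair \<open>J\<close>.\<close>

lemma hyp_shear:
  assumes C: "cong_closed (p+q+p) C"
    and K: "K1 \<in> carrier_mat q q" "K2 \<in> carrier_mat q q" "transpose_mat K1 = K1" "transpose_mat K2 = K2"
    and H: "H \<in> carrier_mat p q" "\<rho> \<in> carrier_mat p q" "\<tau> \<in> carrier_mat p p" "\<sigma> \<in> carrier_mat p p" "transpose_mat \<sigma> = \<sigma>"
    and X: "X \<in> carrier_mat q p"
    and new: "(hypA p q K1 (H + transpose_mat X * K1) (transpose_mat X * K1 * X + H * X + transpose_mat X * transpose_mat H + \<tau>), hypB p q K2 (0\<^sub>m p q) (0\<^sub>m p p)) \<in> C"
  shows "(hypA p q K1 H \<tau>, hypB p q K2 \<rho> \<sigma>) \<in> C"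
proof -
  let ?D = "transpose_mat X * K2 * X + transpose_mat X * transpose_mat \<rho> + \<rho> * X + \<sigma>"
  \<comment> \<open>Multiples of the first layer are added to the core by \<open>Y2\<close> and to
    the last layer by \<open>Y3\<close>. The first layer meets only \<open>Jm\<close>, so A is
    unaffected while the coupling and the last diagonal block of B are cancelled; that block
    receives \<open>Y3\<close> and its transpose, hence the factor 1/2.\<close>
  define Y2 where "Y2 = Jm p * (- (transpose_mat X * K2 + \<rho>))"
  define Y3 where "Y3 = Jm p * ((-1/2) \<cdot>\<^sub>m ?D)"
  have Yc: "Y2 \<in> carrier_mat p q" "Y3 \<in> carrier_mat p p" using X K H unfolding Y2_def Y3_def by (auto intro!: carrier_matI)
  have Dc: "?D \<in> carrier_mat p p" using X K H by auto
  have JY2: "Jm p * Y2 = - (transpose_mat X * K2 + \<rho>)"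
    unfolding Y2_def using X K H by (subst assoc_mult_mat[of _ p p _ p _ q, symmetric]) (auto simp: Jm_sq)
  have JY3: "Jm p * Y3 = (-1/2) \<cdot>\<^sub>m ?D"
    unfolding Y3_def using Dc by (subst assoc_mult_mat[of _ p p _ p _ p, symmetric]) (auto simp: Jm_sq)
  have tXK: "transpose_mat (transpose_mat X * M) = transpose_mat M * X" if "M \<in> carrier_mat q l" for M l
    using X that by (subst transpose_mult[of _ p q _ l]) auto
  have Y2J: "transpose_mat Y2 * Jm p = - (K2 * X + transpose_mat \<rho>)"
  proof -
    have "transpose_mat Y2 * Jm p = transpose_mat (Jm p * Y2)"
      using Yc by (subst transpose_mult[of _ p p _ q]) auto
    also have "\<dots> = - (K2 * X + transpose_mat \<rho>)" unfolding JY2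
      using mat_add_rearrange(6)[of "transpose_mat X * K2" p q \<rho> \<rho> \<rho>] X K H tXK[OF K(2)] by simp
    finally show ?thesis .
  qed
  have Dsym: "transpose_mat ?D = ?D"
  proof -
    have c: "transpose_mat X * K2 * X \<in> carrier_mat p p" "transpose_mat X * transpose_mat \<rho> \<in> carrier_mat p p" "\<rho> * X \<in> carrier_mat p p" using X K H by auto
    have "transpose_mat (transpose_mat X * K2 * X) = transpose_mat X * K2 * X"
      using cmat_sym[OF K(2) X K(4)] by (simp add: cmat_def)
    moreover have "transpose_mat (transpose_mat X * transpose_mat \<rho>) = \<rho> * X" using tXK[of "transpose_mat \<rho>" p] H by simp
    moreover have "transpose_mat (\<rho> * X) = transpose_mat X * transpose_mat \<rho>" using X H by (subst transpose_mult[of _ p q _ p]) auto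
    moreover have "transpose_mat (a + b + c + \<sigma>) = transpose_mat a + transpose_mat b + transpose_mat c + \<sigma>"
      if "a \<in> carrier_mat p p" "b \<in> carrier_mat p p" "c \<in> carrier_mat p p" for a b c
      using that H sym_index[OF H(5,4)] by (intro eq_matI) auto
    ultimately have "transpose_mat ?D = transpose_mat X * K2 * X + \<rho> * X + transpose_mat X * transpose_mat \<rho> + \<sigma>"
      using c by simp
    also have "\<dots> = ?D" by (rule mat_add_rearrange(2)[OF c(1,3,2) H(4)])
    finally show ?thesis .
  qed
  have Y3J: "transpose_mat Y3 * Jm p = (-1/2) \<cdot>\<^sub>m ?D"
  proof -
    have "transpose_mat Y3 * Jm p = transpose_mat (Jm p * Y3)"
      using Yc by (subst transpose_mult[of _ p p _ p]) auto
    also have "\<dots> = (-1/2) \<cdot>\<^sub>m transpose_mat ?D" unfolding JY3 by (rule eq_matI) auto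
    finally show ?thesis unfolding Dsym .
  qed
  let ?W = "blk p q p (1\<^sub>m p) Y2 Y3 (0\<^sub>m q p) (1\<^sub>m q) X (0\<^sub>m p p) (0\<^sub>m p q) (1\<^sub>m p)"
  have W: "?W \<in> carrier_mat (p+q+p) (p+q+p)" "det ?W \<noteq> 0"
    using blk_det_unit[OF one_carrier_mat Yc one_carrier_mat X one_carrier_mat] by simp_all
  have XK: "transpose_mat X * K1 \<in> carrier_mat p q" "K1 * X \<in> carrier_mat q p" "H * X \<in> carrier_mat p p" "transpose_mat X * transpose_mat H \<in> carrier_mat p p"
    "transpose_mat X * K1 * X \<in> carrier_mat p p" using X K H by auto
  have XK2: "transpose_mat X * K2 \<in> carrier_mat p q" "K2 * X \<in> carrier_mat q p" "\<rho> * X \<in> carrier_mat p p" "transpose_mat X * transpose_mat \<rho> \<in> carrier_mat p p"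
    "transpose_mat X * K2 * X \<in> carrier_mat p p" using X K H by auto
  have d1: "transpose_mat X * (K1 * X + transpose_mat H) = transpose_mat X * K1 * X + transpose_mat X * transpose_mat H"
    using X K H XK by (subst mult_add_distrib_mat[of _ p q _ p]) (auto simp: assoc_mult_mat[of _ p q _ q _ p])
  have d2: "transpose_mat X * (K2 * X + transpose_mat \<rho>) = transpose_mat X * K2 * X + transpose_mat X * transpose_mat \<rho>"
    using X K H XK2 by (subst mult_add_distrib_mat[of _ p q _ p]) (auto simp: assoc_mult_mat[of _ p q _ q _ p])
  have tH: "transpose_mat (H + transpose_mat X * K1) = K1 * X + transpose_mat H"
    using X H K XK tXK[OF K(1)] by (simp add: transpose_add[of _ p q] comm_add_mat[of _ q p])
  have "cmat ?W (hypA p q K1 H \<tau>) = blk p q p (0\<^sub>m p p) (0\<^sub>m p q) (0\<^sub>m p p) (0\<^sub>m q p) K1 (K1 * X + transpose_mat H)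
      (0\<^sub>m p p) (transpose_mat X * K1 + H) (transpose_mat X * (K1 * X + transpose_mat H) + (H * X + \<tau>))"
    unfolding hypA_def using Yc X K H XK
    by (subst cmat_blk_upper) (auto simp: left_add_zero_mat[of _ p p] left_add_zero_mat[of _ p q] left_add_zero_mat[of _ q p])
  also have "transpose_mat X * K1 + H = H + transpose_mat X * K1" using XK H by (simp add: comm_add_mat[of _ p q])
  also have "transpose_mat X * (K1 * X + transpose_mat H) + (H * X + \<tau>) = transpose_mat X * K1 * X + H * X + transpose_mat X * transpose_mat H + \<tau>"
    unfolding d1 by (rule mat_add_rearrange(1)[OF XK(5,4,3) H(3)])
  finally have eA: "cmat ?W (hypA p q K1 H \<tau>) = hypA p q K1 (H + transpose_mat X * K1) (transpose_mat X * K1 * X + H * X + transpose_mat X * transpose_mat H + \<tau>)"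
    unfolding hypA_def tH by simp
  have "cmat ?W (hypB p q K2 \<rho> \<sigma>) = blk p q p (0\<^sub>m p p) (0\<^sub>m p q) (Jm p) (0\<^sub>m q p) K2 (transpose_mat Y2 * Jm p + (K2 * X + transpose_mat \<rho>))
      (Jm p) (transpose_mat X * K2 + (Jm p * Y2 + \<rho>)) (transpose_mat Y3 * Jm p + transpose_mat X * (K2 * X + transpose_mat \<rho>) + (Jm p * Y3 + \<rho> * X + \<sigma>))"
    unfolding hypB_def using Yc X K H XK2
    by (subst cmat_blk_upper) (auto simp: left_add_zero_mat[of _ p p] left_add_zero_mat[of _ p q] left_add_zero_mat[of _ q p])
  also have "transpose_mat Y2 * Jm p + (K2 * X + transpose_mat \<rho>) = transpose_mat (0\<^sub>m p q)"
    unfolding Y2J using mat_add_rearrange(4)[of "K2 * X" q p "transpose_mat \<rho>" "K2 * X" "K2 * X"] XK2 H by simp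
  also have "transpose_mat X * K2 + (Jm p * Y2 + \<rho>) = 0\<^sub>m p q"
    unfolding JY2 by (rule mat_add_rearrange(3)[OF XK2(1) H(2) H(2) H(2)])
  also have "transpose_mat Y3 * Jm p + transpose_mat X * (K2 * X + transpose_mat \<rho>) + (Jm p * Y3 + \<rho> * X + \<sigma>) = 0\<^sub>m p p"
    unfolding Y3J JY3 d2 by (rule mat_add_rearrange(5)[OF XK2(5,4,3) H(4)])
  finally have eB: "cmat ?W (hypB p q K2 \<rho> \<sigma>) = hypB p q K2 (0\<^sub>m p q) (0\<^sub>m p p)"
    unfolding hypB_def .
  show ?thesis
    by (rule cong_closed_back[OF C W]) (use new eA eB in auto)
qed

lemma hyp_core:
  assumes C: "cong_closed (p+q+p) C" and V: "V \<in> carrier_mat q q" "det V \<noteq> 0"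
    and K: "K1 \<in> carrier_mat q q" "K2 \<in> carrier_mat q q"
    and H: "H \<in> carrier_mat p q" "\<rho> \<in> carrier_mat p q" "\<tau> \<in> carrier_mat p p" "\<sigma> \<in> carrier_mat p p"
    and new: "(hypA p q (cmat V K1) (H * V) \<tau>, hypB p q (cmat V K2) (\<rho> * V) \<sigma>) \<in> C"
  shows "(hypA p q K1 H \<tau>, hypB p q K2 \<rho> \<sigma>) \<in> C"
proof -
  let ?W = "blk p q p (1\<^sub>m p) (0\<^sub>m p q) (0\<^sub>m p p) (0\<^sub>m q p) V (0\<^sub>m q p) (0\<^sub>m p p) (0\<^sub>m p q) (1\<^sub>m p)"
  have W: "?W \<in> carrier_mat (p+q+p) (p+q+p)" "det ?W \<noteq> 0"
    using V blk_det_unit[of "1\<^sub>m p" p "0\<^sub>m p q" q "0\<^sub>m p p" p V "0\<^sub>m q p" "1\<^sub>m p"] by simp_all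
  have c: "H * V \<in> carrier_mat p q" "\<rho> * V \<in> carrier_mat p q" using H V by auto
  have t: "transpose_mat (H * V) = transpose_mat V * transpose_mat H" "transpose_mat (\<rho> * V) = transpose_mat V * transpose_mat \<rho>"
    using H V by (auto simp: transpose_mult[of _ p q])
  have "cmat ?W (hypA p q K1 H \<tau>) = hypA p q (cmat V K1) (H * V) \<tau>"
    unfolding hypA_def cmat_def[of V] t using V K H c
    by (subst cmat_blk_upper) (auto simp: left_add_zero_mat[of _ p p] left_add_zero_mat[of _ p q] left_add_zero_mat[of _ q p])
  moreover have "cmat ?W (hypB p q K2 \<rho> \<sigma>) = hypB p q (cmat V K2) (\<rho> * V) \<sigma>"
    unfolding hypB_def cmat_def[of V] t using V K H c
    by (subst cmat_blk_upper) (auto simp: left_add_zero_mat[of _ p p] left_add_zero_mat[of _ p q] left_add_zero_mat[of _ q p])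
  ultimately show ?thesis
    using new cong_closed_back[OF C W, of "hypA p q K1 H \<tau>" "hypB p q K2 \<rho> \<sigma>"] by simp
qed

text \<open>The last layer is transformed by the transpose of E; the first layer has to follow by
  \<open>Jm E^{-1} Jm\<close> for B to keep its corner \<open>Jm\<close>.\<close>

lemma hyp_scale:
  assumes C: "cong_closed (p+q+p) C" and E: "E \<in> carrier_mat p p" "det E \<noteq> 0"
    and K: "K1 \<in> carrier_mat q q" "K2 \<in> carrier_mat q q"
    and H: "H \<in> carrier_mat p q" "\<tau> \<in> carrier_mat p p"
    and new: "(hypA p q K1 (E * H) (E * \<tau> * transpose_mat E), hypB p q K2 (0\<^sub>m p q) (0\<^sub>m p p)) \<in> C"
  shows "(hypA p q K1 H \<tau>, hypB p q K2 (0\<^sub>m p q) (0\<^sub>m p p)) \<in> C"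
proof -
  obtain F where F: "F \<in> carrier_mat p p" "E * F = 1\<^sub>m p" "F * E = 1\<^sub>m p" "det F \<noteq> 0" by (rule det_nz_inverse[OF E])
  let ?V1 = "Jm p * F * Jm p"
  let ?W = "blk p q p ?V1 (0\<^sub>m p q) (0\<^sub>m p p) (0\<^sub>m q p) (1\<^sub>m q) (0\<^sub>m q p) (0\<^sub>m p p) (0\<^sub>m p q) (transpose_mat E)"
  have dJ: "det (Jm p) \<noteq> 0" by (rule inverse_det_nz[OF _ _ Jm_sq]) auto
  have V1: "?V1 \<in> carrier_mat p p" using F by (auto intro!: carrier_matI)
  have JF: "Jm p * F \<in> carrier_mat p p" using F by (auto intro!: carrier_matI)
  have dV1: "det ?V1 \<noteq> 0" using F dJ by (simp add: det_mult[OF JF Jm_carrier] det_mult[OF Jm_carrier F(1)])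
  have W: "?W \<in> carrier_mat (p+q+p) (p+q+p)" "det ?W \<noteq> 0"
    using V1 E dV1 blk_det_unit[of ?V1 p "0\<^sub>m p q" q "0\<^sub>m p p" p "1\<^sub>m q" "0\<^sub>m q p" "transpose_mat E"] by (simp_all add: det_transpose[of E p])
  have c: "E * H \<in> carrier_mat p q" "E * \<tau> \<in> carrier_mat p p" using H E by auto
  have EJV: "E * Jm p * ?V1 = Jm p"
  proof -
    have FJ: "F * Jm p \<in> carrier_mat p p" using F by (auto intro!: carrier_matI)
    have "?V1 = Jm p * (F * Jm p)" by (rule assoc_mult_mat[OF Jm_carrier F(1) Jm_carrier])
    then have "Jm p * ?V1 = F * Jm p"
      using assoc_mult_mat[OF Jm_carrier Jm_carrier FJ] left_mult_one_mat[OF FJ] by (simp add: Jm_sq)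
    moreover have "E * Jm p * ?V1 = E * (Jm p * ?V1)" by (rule assoc_mult_mat[OF E(1) Jm_carrier V1])
    ultimately show ?thesis using assoc_mult_mat[OF E(1) F(1) Jm_carrier[of p]] F by simp
  qed
  have VJE: "transpose_mat ?V1 * Jm p * transpose_mat E = Jm p"
  proof -
    have "transpose_mat (E * Jm p * ?V1) = transpose_mat ?V1 * transpose_mat (E * Jm p)"
      by (rule transpose_mult[of _ p p _ p]) (use E V1 in auto)
    also have "transpose_mat (E * Jm p) = Jm p * transpose_mat E"
      using E by (subst transpose_mult[of _ p p _ p]) auto
    finally show ?thesis unfolding EJV
      using assoc_mult_mat[OF transpose_carrier_mat[THEN iffD2, OF V1] Jm_carrier transpose_carrier_mat[THEN iffD2, OF E(1)]] by simp
  qed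
  have tEH: "transpose_mat (E * H) = transpose_mat H * transpose_mat E"
    using E H by (subst transpose_mult[of _ p p _ q]) auto
  have "cmat ?W (hypA p q K1 H \<tau>) = hypA p q K1 (E * H) (E * \<tau> * transpose_mat E)"
    unfolding hypA_def tEH using V1 E K H c
    by (subst cmat_blk_upper) (auto simp: left_add_zero_mat[of _ p p] left_add_zero_mat[of _ p q] left_add_zero_mat[of _ q p] assoc_mult_mat[of _ p p _ p _ p])
  moreover have "cmat ?W (hypB p q K2 (0\<^sub>m p q) (0\<^sub>m p p)) = hypB p q K2 (0\<^sub>m p q) (0\<^sub>m p p)"
    unfolding hypB_def using V1 E K
    by (subst cmat_blk_upper) (auto simp: VJE EJV)
  ultimately show ?thesis
    using new cong_closed_back[OF C W, of "hypA p q K1 H \<tau>" "hypB p q K2 (0\<^sub>m p q) (0\<^sub>m p p)"] by simp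
qed

lemma sub_blk_dim[simp]: "dim_row (sub_blk M i j k l) = k" "dim_col (sub_blk M i j k l) = l"
  by (simp_all add: sub_blk_def)

lemma Hm_KA: 
  assumes "m + 2 * a \<le> q"
  shows "Hm p q m * KA q m a = 0\<^sub>m p q"
proof (rule eq_matI)
  fix i j assume "i < dim_row (0\<^sub>m p q :: complex mat)" "j < dim_col (0\<^sub>m p q :: complex mat)"
  then have ij: "i < p" "j < q" by auto
  have "(Hm p q m * KA q m a) $$ (i,j) = (\<Sum>x<q. Hm p q m $$ (i,x) * KA q m a $$ (x,j))"
    using ij by (intro mult_index) auto
  also have "\<dots> = 0" using ij assms by (intro sum.neutral) (auto simp: Hm_def KA_low)
  finally show "(Hm p q m * KA q m a) $$ (i,j) = 0\<^sub>m p q $$ (i,j)" using ij by simp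
qed auto

lemma Hm_Hm:
  assumes "p \<le> m" "m \<le> q"
  shows "Hm p q m * transpose_mat (Hm p q m) = 1\<^sub>m p"
proof (rule eq_matI)
  fix i j assume "i < dim_row (1\<^sub>m p :: complex mat)" "j < dim_col (1\<^sub>m p :: complex mat)"
  then have ij: "i < p" "j < p" by auto
  have "(Hm p q m * transpose_mat (Hm p q m)) $$ (i,j) = (\<Sum>x<q. Hm p q m $$ (i,x) * transpose_mat (Hm p q m) $$ (x,j))"
    using ij by (intro mult_index) auto
  also have "\<dots> = (\<Sum>x<q. if x = m - 1 - i then (if i = j then 1 else 0) else 0)"
    using ij assms by (intro sum.cong) (auto simp: Hm_def)
  also have "\<dots> = (if i = j then 1 else 0)" using ij assms by auto
  finally show "(Hm p q m * transpose_mat (Hm p q m)) $$ (i,j) = 1\<^sub>m p $$ (i,j)" using ij by simp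
qed auto

text \<open>The coordinates below m lie in the radical of K, and F changes vectors only by
  combinations of these.\<close>

lemma core_unipotent:
  assumes K: "K \<in> carrier_mat q q" "transpose_mat K = K" and F: "F \<in> carrier_mat q q"
    and low: "\<And>i j. i < q \<Longrightarrow> j < m \<Longrightarrow> j < q \<Longrightarrow> K $$ (i,j) = 0"
    and high: "\<And>i j. m \<le> i \<Longrightarrow> i < q \<Longrightarrow> j < q \<Longrightarrow> F $$ (i,j) = (if i = j then 1 else 0)"
  shows "cmat F K = K"
proof -
  have KF: "K * F = K"
  proof (rule eq_matI)
    fix i j assume "i < dim_row K" "j < dim_col K"
    then have ij: "i < q" "j < q" using K by auto
    have "(K * F) $$ (i,j) = (\<Sum>x<q. K $$ (i,x) * F $$ (x,j))" using ij by (intro mult_index[OF K(1) F])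
    also have "\<dots> = (\<Sum>x<q. if x = j then K $$ (i,j) else 0)"
    proof (rule sum.cong[OF refl])
      fix x assume x: "x \<in> {..<q}"
      show "K $$ (i,x) * F $$ (x,j) = (if x = j then K $$ (i,j) else 0)"
        using low[of i x] high[of x j] ij x by (cases "x < m") auto
    qed
    also have "\<dots> = K $$ (i,j)" using ij by simp
    finally show "(K * F) $$ (i,j) = K $$ (i,j)" .
  qed (use K F in auto)
  have "transpose_mat F * K = transpose_mat (K * F)" using transpose_mult[OF K(1) F] K(2) by simp
  then show ?thesis unfolding cmat_def KF using K KF by simp
qed

lemma transpose_uminus: "transpose_mat (- M) = - transpose_mat (M :: complex mat)"
  by (rule eq_matI) auto

lemma transpose_sum4:
  assumes "a \<in> carrier_mat p q" "b \<in> carrier_mat p q" "c \<in> carrier_mat p q" "d \<in> carrier_mat p q"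
  shows "transpose_mat (a + b + c + d) = transpose_mat a + transpose_mat b + transpose_mat c + transpose_mat d"
  by (rule eq_matI) (use assms in auto)

text \<open>Only \<tau> is left to be removed. The rows of \<open>Hm\<close> lie in the radical of
  the core, so a shear along them disturbs neither the core nor \<open>Hm\<close>; because
  \<open>Hm Hm^T = 1\<close>, each of the two mixed terms contributes -\<tau>/2.\<close>

lemma hyp_normal_1:
  assumes p: "p = min a m" and n: "m + 2 * a \<le> p+q+p" and mu: "inj_on \<mu> {..<p+q+p-m-2*a}"
    and t: "\<tau> \<in> carrier_mat p p" "transpose_mat \<tau> = \<tau>"
  shows "(hypA p q (KA q m (a-p)) (Hm p q m) \<tau>, hypB p q (KB q m (a-p) \<mu>) (0\<^sub>m p q) (0\<^sub>m p p)) \<in> adh (p+q+p) (normal_pairs (p+q+p) m a)"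
proof -
  let ?n = "p+q+p" let ?C = "adh ?n (normal_pairs ?n m a)"
  let ?K = "KA q m (a-p)" let ?H = "Hm p q m"
  have cc: "cong_closed ?n ?C" by (intro cong_closed_adh cong_closed_normal_pairs)
  have mq: "m + 2 * (a - p) \<le> q" "p \<le> m" "p \<le> a" "m \<le> q" using n p by auto
  have e: "hypA p q ?K ?H (0\<^sub>m p p) = KA ?n m a" "hypB p q (KB q m (a-p) \<mu>) (0\<^sub>m p q) (0\<^sub>m p p) = KB ?n m a \<mu>"
    unfolding KA_blk[OF mq(3,2) n] KB_blk[OF mq(3,2) n] hypA_def hypB_def by auto
  have base: "(hypA p q ?K ?H (0\<^sub>m p p), hypB p q (KB q m (a-p) \<mu>) (0\<^sub>m p q) (0\<^sub>m p p)) \<in> ?C"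
    unfolding e
    by (rule subset_adh) (use mu in \<open>auto simp: normal_pairs_def intro!: exI[of _ "1\<^sub>m ?n"] exI[of _ \<mu>]\<close>)
  define X where "X = transpose_mat ((-1/2) \<cdot>\<^sub>m (\<tau> * ?H))"
  have tH: "\<tau> * ?H \<in> carrier_mat p q" using t by (auto intro!: carrier_matI)
  have X: "X \<in> carrier_mat q p" using tH by (auto simp: X_def)
  have Xt: "transpose_mat X = (-1/2) \<cdot>\<^sub>m (\<tau> * ?H)" by (simp add: X_def)
  have XK: "transpose_mat X * ?K = 0\<^sub>m p q"
  proof -
    have "\<tau> * ?H * ?K = \<tau> * (?H * ?K)" by (rule assoc_mult_mat[OF t(1) Hm_carrier K_carrier(1)])
    also have "\<dots> = 0\<^sub>m p q" unfolding Hm_KA[OF mq(1)] using t by simp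
    finally show ?thesis unfolding Xt using mult_smult_assoc_mat[OF tH K_carrier(1), of "-1/2" m "a-p"] by simp
  qed
  have XH: "transpose_mat X * transpose_mat ?H = (-1/2) \<cdot>\<^sub>m \<tau>"
  proof -
    have "\<tau> * ?H * transpose_mat ?H = \<tau> * (?H * transpose_mat ?H)"
      by (rule assoc_mult_mat[OF t(1) Hm_carrier]) auto
    also have "\<dots> = \<tau>" unfolding Hm_Hm[OF mq(2,4)] using t by simp
    finally show ?thesis unfolding Xt using mult_smult_assoc_mat[OF tH, of "transpose_mat ?H" p "-1/2"] by simp
  qed
  have HX: "?H * X = (-1/2) \<cdot>\<^sub>m \<tau>"
  proof -
    have "?H * X = transpose_mat (transpose_mat X * transpose_mat ?H)"
      using X by (subst transpose_mult[of _ p q _ p]) auto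
    also have "\<dots> = (-1/2) \<cdot>\<^sub>m transpose_mat \<tau>" unfolding XH by (rule eq_matI) auto
    finally show ?thesis using t by simp
  qed
  have s1: "?H + transpose_mat X * ?K = ?H" unfolding XK by (rule eq_matI) auto
  have s2: "transpose_mat X * ?K * X + ?H * X + transpose_mat X * transpose_mat ?H + \<tau> = 0\<^sub>m p p"
    unfolding XK HX XH using X t left_mult_zero_mat[OF X, of p] by (intro eq_matI) auto
  show ?thesis
    by (rule hyp_shear[OF cc _ _ _ _ _ _ t(1) _ _ X]) (use base s1 s2 in \<open>auto simp: K_sym\<close>)
qed

text \<open>H lives in the columns below m, and its columns from m - p to m - 1 form an invertible
  block, which a scaling of the last layer turns into that of \<open>Hm\<close>. If p < m, then p =
  a, so the core matrices are \<open>KA q m 0\<close> and \<open>KB q m 0\<close>; these vanish on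
  all coordinates below m, and the columns before m - p can be cleared by a change of the
  core.\<close>

lemma hyp_normal_2:
  assumes p: "p = min a m" and n: "m + 2 * a \<le> p+q+p" and mu: "inj_on \<mu> {..<p+q+p-m-2*a}"
    and t: "\<tau> \<in> carrier_mat p p" "transpose_mat \<tau> = \<tau>"
    and H: "H \<in> carrier_mat p q" "\<And>i j. i < p \<Longrightarrow> m \<le> j \<Longrightarrow> j < q \<Longrightarrow> H $$ (i,j) = 0"
    and Hl: "det (sub_blk H 0 (m-p) p p) \<noteq> 0"
  shows "(hypA p q (KA q m (a-p)) H \<tau>, hypB p q (KB q m (a-p) \<mu>) (0\<^sub>m p q) (0\<^sub>m p p)) \<in> adh (p+q+p) (normal_pairs (p+q+p) m a)"
proof -
  let ?n = "p+q+p" let ?C = "adh ?n (normal_pairs ?n m a)"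
  let ?K = "KA q m (a-p)" 
  have cc: "cong_closed ?n ?C" by (intro cong_closed_adh cong_closed_normal_pairs)
  have mq: "m + 2 * (a - p) \<le> q" "p \<le> m" "p \<le> a" "m \<le> q" using n p by auto
  let ?L = "sub_blk H 0 (m-p) p p"
  obtain Li where Li: "Li \<in> carrier_mat p p" "?L * Li = 1\<^sub>m p" "Li * ?L = 1\<^sub>m p" "det Li \<noteq> 0"
    by (rule det_nz_inverse[OF sub_blk_carrier Hl])
  define E where "E = Jm p * Li"
  have dJ: "det (Jm p) \<noteq> 0" by (rule inverse_det_nz[OF _ _ Jm_sq]) auto
  have E: "E \<in> carrier_mat p p" "det E \<noteq> 0" using Li dJ by (auto simp: E_def det_mult[of _ p] intro!: carrier_matI)
  have EL: "E * ?L = Jm p"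
    unfolding E_def using assoc_mult_mat[OF Jm_carrier Li(1) sub_blk_carrier] Li by simp
  have EHc: "E * H \<in> carrier_mat p q" using E H by auto
  have EH1: "(E * H) $$ (i,j) = 0" if "i < p" "m \<le> j" "j < q" for i j
    using mult_index[OF E(1) H(1) that(1,3)] H(2) that by simp
  have EH2: "(E * H) $$ (i,m-p+j) = (if i + j + 1 = p then 1 else 0)" if "i < p" "j < p" for i j
  proof -
    have "(E * H) $$ (i,m-p+j) = (\<Sum>x<p. E $$ (i,x) * H $$ (x,m-p+j))"
      using that mq by (intro mult_index[OF E(1) H(1)]) auto
    also have "\<dots> = (\<Sum>x<p. E $$ (i,x) * ?L $$ (x,j))" using that by (intro sum.cong) (auto simp: sub_blk_def)
    also have "\<dots> = (E * ?L) $$ (i,j)" using that E(1) by (intro mult_index[symmetric, of _ p p _ p]) auto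
    finally show ?thesis unfolding EL using that by (simp add: Jm_def)
  qed
  have EH3: "(E * H) $$ (i,j) = (if i + j + 1 = m then 1 else 0)" if "i < p" "m - p \<le> j" "j < q" for i j
  proof (cases "j < m")
    case True
    then show ?thesis using EH2[of i "j-(m-p)"] that mq by auto
  next
    case False
    then show ?thesis using EH1[of i j] that mq by auto
  qed
  have Et: "E * \<tau> * transpose_mat E \<in> carrier_mat p p" "transpose_mat (E * \<tau> * transpose_mat E) = E * \<tau> * transpose_mat E"
    using cmat_sym[OF t(1) _ t(2), of "transpose_mat E" p] E t by (auto simp: cmat_def intro!: carrier_matI)
  note concl = hyp_scale[OF cc E K_carrier(1) K_carrier(2) H(1) t(1)]
  show ?thesis
  proof (rule concl)
    show "(hypA p q ?K (E * H) (E * \<tau> * transpose_mat E), hypB p q (KB q m (a-p) \<mu>) (0\<^sub>m p q) (0\<^sub>m p p)) \<in> ?C"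
    proof (cases "p = m")
      case True
      have "E * H = Hm p q m"
        by (rule eq_matI) (use EH3 EHc True in \<open>auto simp: Hm_def simp del: index_mult_mat(1)\<close>)
      then show ?thesis using hyp_normal_1[OF p n mu Et] by simp
    next
      case False
      then have pa: "p = a" "a - p = 0" using p by auto
      \<comment> \<open>Row i of \<open>E * H\<close> has the entry 1 in column m - 1 - i; used as
        pivot, it clears that row before column m - p.\<close>
      define F where "F = mat q q (\<lambda>(i,j). (if i = j then 1 else 0) - (if m - p \<le> i \<and> i < m \<and> j < m - p then (E * H) $$ (m-1-i,j) else 0))"
      have Fc: "F \<in> carrier_mat q q" by (simp add: F_def)
      have dF: "det F \<noteq> 0"
      proof -
        have "det F = prod_list (diag_mat F)"
          by (rule det_lower_triangular[OF _ Fc]) (auto simp: F_def)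
        also have "diag_mat F = map (\<lambda>_. 1) [0..<q]" unfolding diag_mat_def by (auto simp: F_def)
        also have "prod_list \<dots> = 1" by (simp add: map_replicate_const)
        finally show ?thesis by simp
      qed
      have cK: "cmat F (KA q m 0) = KA q m 0"
        by (rule core_unipotent[where m=m, OF K_carrier(1) K_sym(1) Fc]) (auto simp: KA_def F_def)
      have cB: "cmat F (KB q m 0 \<mu>) = KB q m 0 \<mu>"
        by (rule core_unipotent[where m=m, OF K_carrier(2) K_sym(2) Fc]) (auto simp: KB_def F_def)
      have HF: "E * H * F = Hm p q m"
      proof (rule eq_matI)
        fix i j assume "i < dim_row (Hm p q m)" "j < dim_col (Hm p q m)"
        then have ij: "i < p" "j < q" by auto
        have "(E * H * F) $$ (i,j) = (\<Sum>x<q. (E * H) $$ (i,x) * F $$ (x,j))"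
          using ij by (intro mult_index[OF EHc Fc])
        also have "\<dots> = (\<Sum>x<q. (if x = j then (E * H) $$ (i,j) else 0) - (if x = m-1-i then (if j < m - p then (E * H) $$ (i,j) else 0) else 0))"
        proof (rule sum.cong[OF refl])
          fix x assume x: "x \<in> {..<q}"
          show "(E * H) $$ (i,x) * F $$ (x,j) = (if x = j then (E * H) $$ (i,j) else 0) - (if x = m-1-i then (if j < m - p then (E * H) $$ (i,j) else 0) else 0)"
            using EH3[OF ij(1), of x] ij x mq by (auto simp: F_def simp del: index_mult_mat(1))
        qed
        also have "\<dots> = (E * H) $$ (i,j) - (if j < m - p then (E * H) $$ (i,j) else 0)"
          using ij mq by (simp add: sum_subtractf del: index_mult_mat(1))
        also have "\<dots> = Hm p q m $$ (i,j)" using EH3[OF ij(1), of j] ij mq by (auto simp: Hm_def simp del: index_mult_mat(1))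
        finally show "(E * H * F) $$ (i,j) = Hm p q m $$ (i,j)" .
      qed (use EHc Fc in auto)
      show ?thesis
        by (rule hyp_core[OF cc Fc dF _ _ EHc _ Et(1)]) (use hyp_normal_1[OF p n mu Et] HF cK cB pa left_mult_zero_mat[OF Fc, of p] in auto)
    qed
  qed
qed

text \<open>The shear by \<open>X = - K H^T\<close> replaces H by \<open>H (1 - K^2)\<close>. Since
  \<open>K^2\<close> is the projection of \<open>KA_sq\<close>, the columns from m on disappear. The
  invertible block required of H is obtained by a perturbation.\<close>

lemma hyp_normal_3:
  assumes p: "p = min a m" and n: "m + 2 * a \<le> p+q+p" and mu: "inj_on \<mu> {..<p+q+p-m-2*a}"
    and t: "\<tau> \<in> carrier_mat p p" "transpose_mat \<tau> = \<tau>" "\<sigma> \<in> carrier_mat p p" "transpose_mat \<sigma> = \<sigma>"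
    and H: "H \<in> carrier_mat p q" "\<rho> \<in> carrier_mat p q"
  shows "(hypA p q (KA q m (a-p)) H \<tau>, hypB p q (KB q m (a-p) \<mu>) \<rho> \<sigma>) \<in> adh (p+q+p) (normal_pairs (p+q+p) m a)"
proof -
  let ?n = "p+q+p" let ?C = "adh ?n (normal_pairs ?n m a)"
  let ?K = "KA q m (a-p)" let ?K2 = "KB q m (a-p) \<mu>"
  have cc: "cong_closed ?n ?C" by (intro cong_closed_adh cong_closed_normal_pairs)
  have mq: "m + 2 * (a - p) \<le> q" "p \<le> m" "p \<le> a" "m \<le> q" using n p by auto
  have inv: "(hypA p q ?K H \<tau>, hypB p q ?K2 \<rho> \<sigma>) \<in> ?C"
    if H: "H \<in> carrier_mat p q" and Hl: "det (sub_blk H 0 (m-p) p p) \<noteq> 0" for H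
  proof -
    let ?X = "- (?K * transpose_mat H)"
    have KH: "?K * transpose_mat H \<in> carrier_mat q p" using H by (auto intro!: carrier_matI)
    have X: "?X \<in> carrier_mat q p" using KH by auto
    have Xt: "transpose_mat ?X = - (H * ?K)"
    proof -
      have "transpose_mat (?K * transpose_mat H) = H * ?K"
        using H transpose_mult[OF K_carrier(1)[of q m "a-p"], of "transpose_mat H" p] by (simp add: K_sym)
      then have "transpose_mat (- (?K * transpose_mat H)) = - (H * ?K)"
        using transpose_uminus by simp
      then show ?thesis .
    qed
    have HK: "H * ?K \<in> carrier_mat p q" using H by (auto intro!: carrier_matI)
    let ?D = "mat q q (\<lambda>(i,j). if i = j \<and> m \<le> i then 1 else 0) :: complex mat"
    have XK: "transpose_mat ?X * ?K = - (H * ?D)"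
    proof -
      have "- (H * ?K) * ?K = - (H * ?K * ?K)" by (rule uminus_mult_left_mat) (use HK in auto)
      also have "H * ?K * ?K = H * (?K * ?K)" by (rule assoc_mult_mat[OF H K_carrier(1) K_carrier(1)])
      finally show ?thesis unfolding Xt KA_sq[OF mq(1)] .
    qed
    have HD: "(H * ?D) $$ (i,j) = (if m \<le> j then H $$ (i,j) else 0)" if "i < p" "j < q" for i j
    proof -
      have "(H * ?D) $$ (i,j) = (\<Sum>x<q. H $$ (i,x) * ?D $$ (x,j))" using that by (intro mult_index[OF H]) auto
      also have "\<dots> = (\<Sum>x<q. if x = j then (if m \<le> j then H $$ (i,j) else 0) else 0)"
        using that by (intro sum.cong) auto
      finally show ?thesis using that by simp
    qed
    let ?H = "H + transpose_mat ?X * ?K"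
    have Hc: "?H \<in> carrier_mat p q" unfolding XK using H by auto
    have Hi: "?H $$ (i,j) = (if m \<le> j then 0 else H $$ (i,j))" if "i < p" "j < q" for i j
      unfolding XK using that H HD[OF that] by (simp del: index_mult_mat(1))
    have sb: "sub_blk ?H 0 (m-p) p p = sub_blk H 0 (m-p) p p"
      by (rule eq_matI) (use Hi mq in \<open>auto simp: sub_blk_def simp del: index_mult_mat(1) index_add_mat(1)\<close>)
    let ?t = "transpose_mat ?X * ?K * ?X + H * ?X + transpose_mat ?X * transpose_mat H + \<tau>"
    have tc: "transpose_mat ?X * ?K * ?X \<in> carrier_mat p p" "H * ?X \<in> carrier_mat p p" "transpose_mat ?X * transpose_mat H \<in> carrier_mat p p"
      using X H by (auto intro!: carrier_matI)
    have ts: "transpose_mat ?t = ?t"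
    proof -
      have e1: "transpose_mat (transpose_mat ?X * ?K * ?X) = transpose_mat ?X * ?K * ?X"
        using cmat_sym[OF K_carrier(1) X K_sym(1)] by (simp add: cmat_def)
      have e2: "transpose_mat (H * ?X) = transpose_mat ?X * transpose_mat H" by (rule transpose_mult[OF H X])
      then have e3: "transpose_mat (transpose_mat ?X * transpose_mat H) = H * ?X" using transpose_transpose[of "H * ?X"] by (simp only:)
      have "transpose_mat ?t = transpose_mat ?X * ?K * ?X + transpose_mat ?X * transpose_mat H + H * ?X + \<tau>"
        unfolding transpose_sum4[OF tc t(1)] e1 e2 e3 t(2) ..
      also have "\<dots> = ?t" by (rule mat_add_rearrange(2)[OF tc(1,3,2) t(1)])
      finally show ?thesis .
    qed
    have tcc: "?t \<in> carrier_mat p p" using tc t by auto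
    have z: "?H $$ (i,j) = 0" if "i < p" "m \<le> j" "j < q" for i j using Hi[of i j] that by simp
    have "(hypA p q ?K ?H ?t, hypB p q ?K2 (0\<^sub>m p q) (0\<^sub>m p p)) \<in> ?C"
      by (rule hyp_normal_2[OF p n mu tcc ts Hc z]) (use sb Hl in auto)
    then show ?thesis
      by (rule hyp_shear[OF cc K_carrier(1) K_carrier(2) K_sym(1) K_sym(2) H \<open>\<rho> \<in> _\<close> t(1,3,4) X])
  qed
  let ?L = "sub_blk H 0 (m-p) p p"
  obtain s where s: "s \<longlonglongrightarrow> 0" "\<And>k. det (s k \<cdot>\<^sub>m 1\<^sub>m p + ?L) \<noteq> 0"
    by (rule invertible_perturbation[of "1\<^sub>m p" p ?L]) auto
  let ?H = "\<lambda>k. mat p q (\<lambda>(i,j). H $$ (i,j) + (if j = m - p + i then s k else 0))"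
  have "(hypA p q ?K H \<tau>, hypB p q ?K2 \<rho> \<sigma>) \<in> adh ?n ?C"
  proof (rule adhI)
    show "matlim ?n (\<lambda>k. hypA p q ?K (?H k) \<tau>) (hypA p q ?K H \<tau>)"
    proof (rule matlim_hyp(1))
      fix i j assume ij: "i < p" "j < q"
      have "(\<lambda>k. H $$ (i,j) + s k) \<longlonglongrightarrow> H $$ (i,j) + 0" by (intro tendsto_intros s)
      then show "(\<lambda>k. ?H k $$ (i,j)) \<longlonglongrightarrow> H $$ (i,j)" using ij by (cases "j = m - p + i") auto
    qed (use H in \<open>auto intro: matlim_const\<close>)
    show "matlim ?n (\<lambda>_. hypB p q ?K2 \<rho> \<sigma>) (hypB p q ?K2 \<rho> \<sigma>)" by (rule matlim_const) auto
    fix k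
    have "sub_blk (?H k) 0 (m-p) p p = s k \<cdot>\<^sub>m 1\<^sub>m p + ?L"
      by (rule eq_matI) (use mq in \<open>auto simp: sub_blk_def\<close>)
    then show "(hypA p q ?K (?H k) \<tau>, hypB p q ?K2 \<rho> \<sigma>) \<in> ?C"
      using s(2)[of k] by (intro inv) auto
  qed
  then show ?thesis using adh_adh by blast
qed

text \<open>The core is approximated by pairs congruent to staircases, and each of these congruences
  is undone by a change of core coordinates.\<close>

lemma hyp_normal:
  assumes p: "p = min a m" and n: "m + 2 * a \<le> p+q+p"
    and K: "(K1,K2) \<in> adh q (normal_pairs q m (a-p))"
    and t: "\<tau> \<in> carrier_mat p p" "transpose_mat \<tau> = \<tau>" "\<sigma> \<in> carrier_mat p p" "transpose_mat \<sigma> = \<sigma>"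
    and H: "H \<in> carrier_mat p q" "\<rho> \<in> carrier_mat p q"
  shows "(hypA p q K1 H \<tau>, hypB p q K2 \<rho> \<sigma>) \<in> adh (p+q+p) (normal_pairs (p+q+p) m a)"
proof -
  let ?n = "p+q+p" let ?C = "adh ?n (normal_pairs ?n m a)"
  have cc: "cong_closed ?n ?C" by (intro cong_closed_adh cong_closed_normal_pairs)
  obtain F G where FG: "matlim q F K1" "matlim q G K2" "\<forall>k. (F k, G k) \<in> normal_pairs q m (a-p)"
    using K by (rule adhE)
  have "(hypA p q K1 H \<tau>, hypB p q K2 \<rho> \<sigma>) \<in> adh ?n ?C"
  proof (rule adhI[of _ "\<lambda>k. hypA p q (F k) H \<tau>" _ "\<lambda>k. hypB p q (G k) \<rho> \<sigma>"])
    show "matlim ?n (\<lambda>k. hypA p q (F k) H \<tau>) (hypA p q K1 H \<tau>)" using matlim_hyp(1)[OF FG(1), of "\<lambda>_. H" p H \<tau>] H by simp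
    show "matlim ?n (\<lambda>k. hypB p q (G k) \<rho> \<sigma>) (hypB p q K2 \<rho> \<sigma>)" using matlim_hyp(2)[OF FG(2), of "\<lambda>_. \<rho>" p \<rho> \<sigma>] H by simp
    fix k
    obtain W \<mu> where W: "F k = cmat W (KA q m (a-p))" "G k = cmat W (KB q m (a-p) \<mu>)" "W \<in> carrier_mat q q" "det W \<noteq> 0" "inj_on \<mu> {..<q-m-2*(a-p)}"
      using FG(3)[rule_format, of k] unfolding normal_pairs_def by auto
    obtain V where V: "V \<in> carrier_mat q q" "W * V = 1\<^sub>m q" "V * W = 1\<^sub>m q" "det V \<noteq> 0" by (rule det_nz_inverse[OF W(3,4)])
    have c: "cmat V (F k) = KA q m (a-p)" "cmat V (G k) = KB q m (a-p) \<mu>"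
      unfolding W using cmat_cancel[OF _ W(3) V(1,2)] by auto
    have "p+q+p-m-2*a = q-m-2*(a-p)" using p by auto
    then have mu: "inj_on \<mu> {..<p+q+p-m-2*a}" using W(5) by simp
    have "H * V \<in> carrier_mat p q" "\<rho> * V \<in> carrier_mat p q" using H V by auto
    from hyp_normal_3[OF p n mu t this]
    show "(hypA p q (F k) H \<tau>, hypB p q (G k) \<rho> \<sigma>) \<in> ?C"
      by (intro hyp_core[OF cc V(1,4) _ _ H t(1,3)]) (use c W matlimD(1)[OF FG(1)] matlimD(1)[OF FG(2)] in auto)
  qed
  then show ?thesis using adh_adh by blast
qed

section \<open>From a zero pattern to a hyperbolic layer and a core\<close>

lemma cmat_pattern:
  fixes M :: "complex mat"
  assumes M: "M \<in> carrier_mat n n" "\<And>i j. i < s \<Longrightarrow> j < t \<Longrightarrow> M $$ (i,j) = 0" and st: "s \<le> n" "t \<le> n"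
    and W: "W \<in> carrier_mat n n" "\<And>x i. i < s \<Longrightarrow> s \<le> x \<Longrightarrow> x < n \<Longrightarrow> W $$ (x,i) = 0" "\<And>x i. i < t \<Longrightarrow> t \<le> x \<Longrightarrow> x < n \<Longrightarrow> W $$ (x,i) = 0"
    and ij: "i < s" "j < t"
  shows "cmat W M $$ (i,j) = 0"
proof -
  have "W $$ (x,i) * M $$ (x,y) * W $$ (y,j) = 0" if "x < n" "y < n" for x y
    using W(2)[of i x] W(3)[of j y] M(2)[of x y] ij that by (cases "x < s"; cases "y < t") auto
  then have "(\<Sum>y<n. \<Sum>x<n. W $$ (x,i) * M $$ (x,y) * W $$ (y,j)) = 0"
    by (intro sum.neutral ballI) (simp only: lessThan_iff)
  then show ?thesis using ij st by (subst cmat_index[OF M(1) W(1)]) (auto simp only: sum_distrib_right)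
qed

lemma cmat_first_columns:
  fixes M :: "complex mat"
  assumes M: "M \<in> carrier_mat n n" and W: "W \<in> carrier_mat n n" and ij: "i < n" "j < n"
  shows "cmat W M $$ (i,j) = (\<Sum>x<n. W $$ (x,i) * (\<Sum>y<n. M $$ (x,y) * W $$ (y,j)))"
proof -
  have "cmat W M = transpose_mat W * (M * W)" unfolding cmat_def using M W by (intro assoc_mult_mat) auto
  then have "cmat W M $$ (i,j) = (\<Sum>x<n. transpose_mat W $$ (i,x) * (M * W) $$ (x,j))"
    using M W ij mult_index[of "transpose_mat W" n n "M * W" n i j] by simp
  also have "\<dots> = (\<Sum>x<n. W $$ (x,i) * (\<Sum>y<n. M $$ (x,y) * W $$ (y,j)))"
    using M W ij by (intro sum.cong) (auto simp: mult_index[of M n n W n] simp del: index_mult_mat(1))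
  finally show ?thesis .
qed

text \<open>For a = 0 the pair lives on the last n - m coordinates, where every symmetric pair is a
  limit of diagonalizable ones.\<close>

lemma pattern_dense_base:
  assumes A: "A \<in> carrier_mat n n" "transpose_mat A = A" and B: "B \<in> carrier_mat n n" "transpose_mat B = B"
    and mn: "m \<le> n" and z: "\<And>i j. i < m \<Longrightarrow> j < n \<Longrightarrow> A $$ (i,j) = 0 \<and> B $$ (i,j) = 0"
  shows "(A,B) \<in> adh n (normal_pairs n m 0)"
proof -
  obtain s where n: "n = 0 + m + s" using mn by (auto simp: le_iff_add)
  let ?bl = "\<lambda>N. blk 0 m s (0\<^sub>m 0 0) (0\<^sub>m 0 m) (0\<^sub>m 0 s) (0\<^sub>m m 0) (0\<^sub>m m m) (0\<^sub>m m s) (0\<^sub>m s 0) (0\<^sub>m s m) N :: complex mat"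
  have bl: "M = ?bl (sub_blk M m m s s)" if M: "M \<in> carrier_mat n n" "transpose_mat M = M" "\<And>i j. i < m \<Longrightarrow> j < n \<Longrightarrow> M $$ (i,j) = 0" for M
  proof (rule eq_matI)
    fix i j assume "i < dim_row (?bl (sub_blk M m m s s))" "j < dim_col (?bl (sub_blk M m m s s))"
    then have ij: "i < n" "j < n" using n by auto
    show "M $$ (i,j) = ?bl (sub_blk M m m s s) $$ (i,j)"
      using ij M(3)[of i j] M(3)[of j i] sym_index[OF M(2,1), of i j] n by (auto simp: blk_def sub_blk_def)
  qed (use M n in auto)
  have lim: "matlim n (\<lambda>k. ?bl (F k)) (?bl N)" if "matlim s F N" for F N
    by (rule matlimI) (use matlimD(3)[OF that] n in \<open>auto simp: blk_def\<close>)
  have "(sub_blk A m m s s, sub_blk B m m s s) \<in> adh s (diag_pairs s)"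
    by (rule sym_pair_in_adh_diag) (use transpose_sub_blk[OF A, of m s m s] transpose_sub_blk[OF B, of m s m s] n in auto)
  then obtain F G where FG: "matlim s F (sub_blk A m m s s)" "matlim s G (sub_blk B m m s s)" "\<forall>k. (F k, G k) \<in> diag_pairs s"
    by (rule adhE)
  show ?thesis
  proof (rule adhI[of _ "\<lambda>k. ?bl (F k)" _ "\<lambda>k. ?bl (G k)"])
    show "matlim n (\<lambda>k. ?bl (F k)) A" using lim[OF FG(1)] bl[OF A] z by simp
    show "matlim n (\<lambda>k. ?bl (G k)) B" using lim[OF FG(2)] bl[OF B] z by simp
    fix k
    obtain W \<mu> where W: "F k = cmat W (1\<^sub>m s)" "G k = cmat W (dmat s \<mu>)" "W \<in> carrier_mat s s" "det W \<noteq> 0" "inj_on \<mu> {..<s}"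
      using FG(3)[rule_format, of k] unfolding diag_pairs_def by auto
    let ?W = "blk 0 m s (0\<^sub>m 0 0) (0\<^sub>m 0 m) (0\<^sub>m 0 s) (0\<^sub>m m 0) (1\<^sub>m m) (0\<^sub>m m s) (0\<^sub>m s 0) (0\<^sub>m s m) W"
    have Wc: "?W \<in> carrier_mat n n" "det ?W \<noteq> 0" unfolding n using W by (auto simp: blk_det_upper)
    have e: "KA n m 0 = ?bl (1\<^sub>m s)" "KB n m 0 \<mu> = ?bl (dmat s \<mu>)"
      by (rule eq_matI; use n in \<open>auto simp: KA_def KB_def blk_def dmat_def\<close>)+
    have "cmat ?W (?bl N) = ?bl (cmat W N)" if N: "N \<in> carrier_mat s s" for N
    proof -
      have "transpose_mat W * (N * W) = cmat W N" unfolding cmat_def using W N by (intro assoc_mult_mat[symmetric]) auto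
      moreover have "N * W \<in> carrier_mat s s" "transpose_mat W * (N * W) \<in> carrier_mat s s" using W N by auto
      ultimately show ?thesis using W N by (subst cmat_blk_upper) auto
    qed
    then have "?bl (F k) = cmat ?W (KA n m 0)" "?bl (G k) = cmat ?W (KB n m 0 \<mu>)" unfolding e W by auto
    moreover have "n - m - 2 * 0 = s" using n by simp
    ultimately show "(?bl (F k), ?bl (G k)) \<in> normal_pairs n m 0"
      unfolding normal_pairs_def using Wc W(5) by auto
  qed
qed

text \<open>One layer of width p = min a m is made hyperbolic, and the core is left to the
  induction. Every perturbation respects the zero pattern. A is treated before B, because the
  congruence that clears A changes B, whereas a perturbation of B leaves A alone. The steps are
  proved from the last to the first.\<close>

lemma has_pattern_dense:
  assumes "A \<in> carrier_mat n n" "transpose_mat A = A" "B \<in> carrier_mat n n" "transpose_mat B = B"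
    and m: "0 < m" and "m + 2 * a \<le> n" "\<And>i j. i < m + a \<Longrightarrow> j < n - a \<Longrightarrow> A $$ (i,j) = 0 \<and> B $$ (i,j) = 0"
  shows "(A,B) \<in> adh n (normal_pairs n m a)"
  using assms(1-4,6,7)
proof (induction a arbitrary: n A B rule: less_induct)
  case (less a n A B)
  show ?case
  proof (cases "a = 0")
    case True
    have "(A,B) \<in> adh n (normal_pairs n m 0)"
      by (rule pattern_dense_base) (use less.prems True in auto)
    then show ?thesis using True by simp
  next
    case a: False
    define p where "p = min a m"
    define q where "q = n - 2 * p"
    have n: "n = p + q + p" and p: "0 < p" "p \<le> a" "p \<le> m" and mq: "m + 2 * (a - p) \<le> q"
      using less.prems(5) a m by (auto simp: p_def q_def min_def)
    let ?C = "adh n (normal_pairs n m a)"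
    have cc: "cong_closed n ?C" by (intro cong_closed_adh cong_closed_normal_pairs)
    have lim: "(A,B) \<in> ?C" if "matlim n F A" "matlim n G B" "\<And>k. (F k, G k) \<in> ?C" for A B F G
      using adhI[OF that] adh_adh by blast
    define pat where "pat M \<longleftrightarrow> M \<in> carrier_mat n n \<and> transpose_mat M = M \<and> (\<forall>i<m+a. \<forall>j<n-a. M $$ (i,j) = 0)" for M :: "complex mat"
    have patD: "M \<in> carrier_mat n n" "transpose_mat M = M" "\<And>i j. i < m+a \<Longrightarrow> j < n-a \<Longrightarrow> M $$ (i,j) = 0"
       "\<And>i j. i < m+a \<Longrightarrow> j < n-a \<Longrightarrow> M $$ (j,i) = 0" if "pat M" for M
    proof -
      show 1: "M \<in> carrier_mat n n" "transpose_mat M = M" "\<And>i j. i < m+a \<Longrightarrow> j < n-a \<Longrightarrow> M $$ (i,j) = 0" using that by (auto simp: pat_def)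
      show "M $$ (j,i) = 0" if "i < m+a" "j < n-a" for i j
        using sym_index[OF 1(2,1), of j i] 1(3)[OF that] that less.prems(5) by simp
    qed
    have pat_cmat: "pat (cmat W M)" if M: "pat M" and W: "W \<in> carrier_mat n n"
      "\<And>x i. i < m + a \<Longrightarrow> m + a \<le> x \<Longrightarrow> x < n \<Longrightarrow> W $$ (x,i) = 0" "\<And>x i. i < n - a \<Longrightarrow> n - a \<le> x \<Longrightarrow> x < n \<Longrightarrow> W $$ (x,i) = 0" for W M
      unfolding pat_def
    proof (intro conjI allI impI)
      show "transpose_mat (cmat W M) = cmat W M" by (rule cmat_sym[OF patD(1)[OF M] W(1) patD(2)[OF M]])
      fix i j assume ij: "i < m + a" "j < n - a"
      show "cmat W M $$ (i,j) = 0"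
        by (rule cmat_pattern[OF patD(1)[OF M] patD(3)[OF M] _ _ W ij]) (use less.prems(5) in auto)
    qed (use W in auto)
    \<comment> \<open>With the first p columns of A zero and those of B reduced to the corner
      \<open>Jm\<close>, the pair has the form \<open>hypA\<close>, \<open>hypB\<close>, and its
      core has the pattern of m and a - p.\<close>
    have step3: "(A,B) \<in> ?C" if A: "pat A" and B: "pat B" and zA: "\<And>i j. i < n \<Longrightarrow> j < p \<Longrightarrow> A $$ (i,j) = 0"
      and zB: "\<And>i j. i < n - p \<Longrightarrow> j < p \<Longrightarrow> B $$ (i,j) = 0" and JB: "sub_blk B (p+q) 0 p p = Jm p" for A B
    proof -
      have sA: "A = hypA p q (sub_blk A p p q q) (sub_blk A (p+q) p p q) (sub_blk A (p+q) (p+q) p p)"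
      proof -
        have "A = blk p q p (sub_blk A 0 0 p p) (sub_blk A 0 p p q) (sub_blk A 0 (p+q) p p) (sub_blk A p 0 q p) (sub_blk A p p q q) (sub_blk A p (p+q) q p)
          (sub_blk A (p+q) 0 p p) (sub_blk A (p+q) p p q) (sub_blk A (p+q) (p+q) p p)"
          using blk_split[of A p q p] patD(1)[OF A] n by simp
        moreover have z: "sub_blk A 0 0 p p = 0\<^sub>m p p" "sub_blk A p 0 q p = 0\<^sub>m q p" "sub_blk A (p+q) 0 p p = 0\<^sub>m p p"
          using zA n by (auto intro!: eq_matI simp: sub_blk_def)
        moreover have "sub_blk A 0 p p q = transpose_mat (sub_blk A p 0 q p)" "sub_blk A 0 (p+q) p p = transpose_mat (sub_blk A (p+q) 0 p p)"
          "sub_blk A p (p+q) q p = transpose_mat (sub_blk A (p+q) p p q)"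
          using transpose_sub_blk[OF patD(1,2)[OF A], of p q 0 p] transpose_sub_blk[OF patD(1,2)[OF A], of "p+q" p 0 p]
            transpose_sub_blk[OF patD(1,2)[OF A], of "p+q" p p q] n by auto
        ultimately show ?thesis unfolding hypA_def by simp
      qed
      have sB: "B = hypB p q (sub_blk B p p q q) (sub_blk B (p+q) p p q) (sub_blk B (p+q) (p+q) p p)"
      proof -
        have "B = blk p q p (sub_blk B 0 0 p p) (sub_blk B 0 p p q) (sub_blk B 0 (p+q) p p) (sub_blk B p 0 q p) (sub_blk B p p q q) (sub_blk B p (p+q) q p)
          (sub_blk B (p+q) 0 p p) (sub_blk B (p+q) p p q) (sub_blk B (p+q) (p+q) p p)"
          using blk_split[of B p q p] patD(1)[OF B] n by simp
        moreover have z: "sub_blk B 0 0 p p = 0\<^sub>m p p" "sub_blk B p 0 q p = 0\<^sub>m q p"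
          using zB n by (auto intro!: eq_matI simp: sub_blk_def)
        moreover have "sub_blk B 0 p p q = transpose_mat (sub_blk B p 0 q p)" "sub_blk B 0 (p+q) p p = transpose_mat (sub_blk B (p+q) 0 p p)"
          "sub_blk B p (p+q) q p = transpose_mat (sub_blk B (p+q) p p q)"
          using transpose_sub_blk[OF patD(1,2)[OF B], of p q 0 p] transpose_sub_blk[OF patD(1,2)[OF B], of "p+q" p 0 p]
            transpose_sub_blk[OF patD(1,2)[OF B], of "p+q" p p q] n by auto
        ultimately show ?thesis unfolding hypB_def using JB by simp
      qed
      have ts: "transpose_mat (sub_blk A p p q q) = sub_blk A p p q q" "transpose_mat (sub_blk A (p+q) (p+q) p p) = sub_blk A (p+q) (p+q) p p"
        "transpose_mat (sub_blk B p p q q) = sub_blk B p p q q" "transpose_mat (sub_blk B (p+q) (p+q) p p) = sub_blk B (p+q) (p+q) p p"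
        using transpose_sub_blk[OF patD(1,2)[OF A]] transpose_sub_blk[OF patD(1,2)[OF B]] n by auto
      have "(sub_blk A p p q q, sub_blk B p p q q) \<in> adh q (normal_pairs q m (a-p))"
      proof (rule less.IH)
        fix i j assume ij: "i < m + (a - p)" "j < q - (a - p)"
        then have "p + i < m + a" "p + j < n - a" "i < q" "j < q" using p n mq by auto
        then show "sub_blk A p p q q $$ (i,j) = 0 \<and> sub_blk B p p q q $$ (i,j) = 0"
          using patD(3)[OF A] patD(3)[OF B] by (simp add: sub_blk_def)
      qed (use a p mq ts in auto)
      from hyp_normal[OF p_def _ this, of "sub_blk A (p+q) (p+q) p p" "sub_blk B (p+q) (p+q) p p" "sub_blk A (p+q) p p q" "sub_blk B (p+q) p p q"]
      have "(hypA p q (sub_blk A p p q q) (sub_blk A (p+q) p p q) (sub_blk A (p+q) (p+q) p p),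
         hypB p q (sub_blk B p p q q) (sub_blk B (p+q) p p q) (sub_blk B (p+q) (p+q) p p)) \<in> ?C"
        using ts less.prems(5) n by simp
      then show ?thesis using sA sB by simp
    qed
    \<comment> \<open>The invertible corner of B clears the rest of its first p columns by Z and is
      itself turned into \<open>Jm\<close> by V.\<close>
    have step2: "(A,B) \<in> ?C" if A: "pat A" and B: "pat B" and zA: "\<And>i j. i < n \<Longrightarrow> j < p \<Longrightarrow> A $$ (i,j) = 0"
      and dB: "det (sub_blk B (p+q) 0 p p) \<noteq> 0" for A B
    proof -
      let ?b = "sub_blk B (p+q) 0 p p"
      obtain bi where bi: "bi \<in> carrier_mat p p" "?b * bi = 1\<^sub>m p" "bi * ?b = 1\<^sub>m p" "det bi \<noteq> 0"
        by (rule det_nz_inverse[OF sub_blk_carrier dB])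
      define \<beta> where "\<beta> = sub_blk B p 0 q p"
      have bc: "\<beta> \<in> carrier_mat q p" by (simp add: \<beta>_def)
      define Z where "Z = - (\<beta> * bi)"
      have Zc: "Z \<in> carrier_mat q p" using bc bi by (auto simp: Z_def)
      define V where "V = Jm p * bi"
      have Vc: "V \<in> carrier_mat p p" using bi by (auto simp: V_def intro!: carrier_matI)
      have Zb: "Z * ?b = - \<beta>"
      proof -
        have "Z * ?b = - (\<beta> * bi * ?b)" unfolding Z_def by (rule uminus_mult_left_mat) (use bc bi in auto)
        also have "\<beta> * bi * ?b = \<beta> * (bi * ?b)" by (rule assoc_mult_mat[OF bc bi(1) sub_blk_carrier])
        finally show ?thesis using bi bc by simp
      qed
      have Vb: "V * ?b = Jm p" unfolding V_def using assoc_mult_mat[OF Jm_carrier bi(1) sub_blk_carrier] bi by simp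
      have dJ: "det (Jm p) \<noteq> 0" by (rule inverse_det_nz[OF _ _ Jm_sq]) auto
      have dV: "det V \<noteq> 0" using bi dJ by (auto simp: V_def det_mult[of _ p])
      let ?Wt = "blk p q p (1\<^sub>m p) (0\<^sub>m p q) (0\<^sub>m p p) (0\<^sub>m q p) (1\<^sub>m q) Z (0\<^sub>m p p) (0\<^sub>m p q) V"
      define W where "W = transpose_mat ?Wt"
      have Wc: "W \<in> carrier_mat n n" by (simp add: W_def n)
      have "det ?Wt \<noteq> 0" by (rule blk_det_unit) (use Zc Vc dV in auto)
      then have dW: "det W \<noteq> 0" unfolding W_def by (subst det_transpose[of _ "p+q+p"]) auto
      have Wi: "W $$ (x,y) = ?Wt $$ (y,x)" if "x < n" "y < n" for x y using that by (simp add: W_def n)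
      \<comment> \<open>The pattern makes the rows of \<beta> that belong to coordinates before n -
        a vanish; therefore W respects the pattern.\<close>
      have Zlow: "Z $$ (i,k) = 0" if "p + i < n - a" "i < q" "k < p" for i k
      proof -
        have "\<beta> $$ (i,l) = 0" if "l < p" for l
          using patD(4)[OF B, of l "p+i"] that \<open>p + i < n - a\<close> \<open>i < q\<close> p by (simp add: \<beta>_def sub_blk_def)
        then have "(\<beta> * bi) $$ (i,k) = 0" using mult_index[OF bc bi(1) that(2,3)] by simp
        then show ?thesis using that bc bi by (simp add: Z_def)
      qed
      have Wlow: "W $$ (x,i) = 0" if "i < n - a" "i < x" "x < n" for x i
      proof -
        have i: "i < p+q+p" "x < p+q+p" using that n by auto
        have wi: "W $$ (x,i) = ?Wt $$ (i,x)" by (rule Wi) (use that in auto)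
        show ?thesis using i(1)
        proof (cases rule: blk_cases)
          case 1
          show ?thesis using i(2) by (cases rule: blk_cases) (use 1 that wi in \<open>auto simp: blk_index\<close>)
        next
          case (2 k)
          show ?thesis using i(2) by (cases rule: blk_cases) (use 2 that Zlow wi in \<open>auto simp: blk_index\<close>)
        next
          case (3 k)
          then show ?thesis using that n p by auto
        qed
      qed
      have ma: "m + a \<le> n - a" using less.prems(5) by simp
      have pA: "pat (cmat W A)" "pat (cmat W B)"
        by (rule pat_cmat[OF _ Wc]; use A B Wlow ma in simp)+
      have col: "cmat W M $$ (i,j) = (\<Sum>x<n. W $$ (x,i) * M $$ (x,j))" if M: "M \<in> carrier_mat n n" and ij: "i < n" "j < p" for M i j
      proof -
        have "W $$ (y,j) = (if y = j then 1 else 0)" if "y < n" for y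
        proof -
          have y: "y < p+q+p" using that n by simp
          have jn: "j < n" using ij n by simp
          show ?thesis unfolding Wi[OF that jn] using y by (cases rule: blk_cases) (use ij in \<open>auto simp: blk_index\<close>)
        qed
        then have "(\<Sum>y<n. M $$ (x,y) * W $$ (y,j)) = M $$ (x,j)" for x
          using ij n by (simp add: if_distrib[where f="\<lambda>x. _ * x"] cong: if_cong)
        then show ?thesis using cmat_first_columns[OF M Wc ij(1), of j] ij n by simp
      qed
      have zA': "cmat W A $$ (i,j) = 0" if "i < n" "j < p" for i j
        using col[OF patD(1)[OF A] that] zA that by simp
      have colB: "cmat W B $$ (i,j) = (\<Sum>x<p. W $$ (x,i) * B $$ (x,j)) + (\<Sum>x<q. W $$ (p+x,i) * B $$ (p+x,j)) + (\<Sum>x<p. W $$ (p+q+x,i) * B $$ (p+q+x,j))"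
        if "i < n" "j < p" for i j
        using col[OF patD(1)[OF B] that] unfolding n sum3 .
      have B0: "B $$ (x,j) = 0" if "x < p" "j < p" for x j
        using patD(3)[OF B, of x j] that p less.prems(5) by auto
      have zB': "cmat W B $$ (i,j) = 0" if ij: "i < n - p" "j < p" for i j
      proof -
        have i: "i < p + q" using that n by simp
        show ?thesis
        proof (cases "i < p")
          case True
          have "W $$ (p+x,i) = 0" if "x < q" for x using that True n by (simp add: Wi blk_index)
          moreover have "W $$ (p+q+x,i) = 0" if "x < p" for x using that True n by (simp add: Wi blk_index)
          ultimately show ?thesis using colB[of i j] ij B0 by simp
        next
          case False
          define k where "k = i - p"
          have k: "i = p + k" "k < q" using i False by (auto simp: k_def)
          have "(\<Sum>x<q. W $$ (p+x,i) * B $$ (p+x,j)) = (\<Sum>x<q. if x = k then \<beta> $$ (k,j) else 0)"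
            using k ij n by (intro sum.cong) (auto simp: Wi blk_index \<beta>_def sub_blk_def)
          also have "\<dots> = \<beta> $$ (k,j)" using k by simp
          finally have 1: "(\<Sum>x<q. W $$ (p+x,i) * B $$ (p+x,j)) = \<beta> $$ (k,j)" .
          have "(\<Sum>x<p. W $$ (p+q+x,i) * B $$ (p+q+x,j)) = (\<Sum>x<p. Z $$ (k,x) * ?b $$ (x,j))"
            using k ij n by (intro sum.cong) (auto simp: Wi blk_index sub_blk_def)
          also have "\<dots> = (Z * ?b) $$ (k,j)" using k ij by (intro mult_index[symmetric, OF Zc sub_blk_carrier])
          also have "\<dots> = - \<beta> $$ (k,j)" unfolding Zb using k ij bc by simp
          finally show ?thesis using colB[of i j] 1 ij B0 by simp
        qed
      qed
      have JB': "sub_blk (cmat W B) (p+q) 0 p p = Jm p"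
      proof (rule eq_matI)
        fix i j assume "i < dim_row (Jm p)" "j < dim_col (Jm p)"
        then have ij: "i < p" "j < p" by auto
        have "W $$ (p+x,p+q+i) = 0" if "x < q" for x using that ij n by (simp add: Wi blk_index)
        moreover have "(\<Sum>x<p. W $$ (p+q+x,p+q+i) * B $$ (p+q+x,j)) = (\<Sum>x<p. V $$ (i,x) * ?b $$ (x,j))"
          using ij n by (intro sum.cong) (auto simp: Wi blk_index sub_blk_def)
        moreover have "\<dots> = (V * ?b) $$ (i,j)" using ij by (intro mult_index[symmetric, OF Vc sub_blk_carrier])
        ultimately have "cmat W B $$ (p+q+i,j) = Jm p $$ (i,j)"
          using colB[of "p+q+i" j] ij n B0 Vb by simp
        then show "sub_blk (cmat W B) (p+q) 0 p p $$ (i,j) = Jm p $$ (i,j)" using ij by (simp add: sub_blk_def)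
      qed auto
      have "(cmat W A, cmat W B) \<in> ?C"
        by (rule step3[OF pA zA' zB' JB'])
      then show ?thesis by (rule cong_closed_back[OF cc Wc dW patD(1)[OF A] patD(1)[OF B]])
    qed
    \<comment> \<open>Since n - a \<le> p + q, the corner of B lies outside the zero pattern and may
      be perturbed.\<close>
    have step1: "(A,B) \<in> ?C" if A: "pat A" and B: "pat B" and zA: "\<And>i j. i < n \<Longrightarrow> j < p \<Longrightarrow> A $$ (i,j) = 0" for A B
    proof -
      let ?b = "sub_blk B (p+q) 0 p p"
      obtain s where s: "s \<longlonglongrightarrow> 0" "\<And>k. det (s k \<cdot>\<^sub>m 1\<^sub>m p + ?b) \<noteq> 0"
        by (rule invertible_perturbation[of "1\<^sub>m p" p ?b]) auto
      let ?B = "\<lambda>k. mat n n (\<lambda>(i,j). B $$ (i,j) + (if i = p+q+j \<or> j = p+q+i then s k else 0))"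
      show ?thesis
      proof (rule lim[of "\<lambda>_. A" _ ?B])
        show "matlim n (\<lambda>_. A) A" using patD(1)[OF A] by (rule matlim_const)
        show "matlim n ?B B"
        proof (rule matlimI)
          fix i j assume ij: "i < n" "j < n"
          have "(\<lambda>k. B $$ (i,j) + s k) \<longlonglongrightarrow> B $$ (i,j) + 0" by (intro tendsto_intros s)
          then show "(\<lambda>k. ?B k $$ (i,j)) \<longlonglongrightarrow> B $$ (i,j)" using ij by (cases "i = p+q+j \<or> j = p+q+i") auto
        qed (use patD(1)[OF B] in auto)
        fix k
        have pB: "pat (?B k)"
          unfolding pat_def
        proof (intro conjI allI impI)
          show "transpose_mat (?B k) = ?B k"
          proof (rule eq_matI)
            fix i j assume "i < dim_row (?B k)" "j < dim_col (?B k)"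
            then show "transpose_mat (?B k) $$ (i,j) = ?B k $$ (i,j)"
              using sym_index[OF patD(2)[OF B] patD(1)[OF B], of j i] by auto
          qed auto
          fix i j assume ij: "i < m+a" "j < n-a"
          have "m + a \<le> n - a" "n - a \<le> p + q" using less.prems(5) n p by auto
          then show "?B k $$ (i,j) = 0" using ij patD(3)[OF B ij] by auto
        qed auto
        have "sub_blk (?B k) (p+q) 0 p p = s k \<cdot>\<^sub>m 1\<^sub>m p + ?b"
          by (rule eq_matI) (use n p in \<open>auto simp: sub_blk_def\<close>)
        then show "(A, ?B k) \<in> ?C"
          using s(2)[of k] by (intro step2[OF A pB zA]) auto
      qed
    qed
    \<comment> \<open>The last a rows of A, cut to the columns below m + a, are \<open>[X Y]\<close>
      with Y square. If Y is invertible, its columns clear X, in particular the first p \<le> m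
      columns of A.\<close>
    have step0: "(A,B) \<in> ?C" if A: "pat A" and B: "pat B" and dY: "det (sub_blk A (n-a) m a a) \<noteq> 0" for A B
    proof -
      let ?Y = "sub_blk A (n-a) m a a" and ?X = "sub_blk A (n-a) 0 a m"
      obtain yi where yi: "yi \<in> carrier_mat a a" "?Y * yi = 1\<^sub>m a" "yi * ?Y = 1\<^sub>m a" "det yi \<noteq> 0"
        by (rule det_nz_inverse[OF sub_blk_carrier dY])
      define Z where "Z = yi * ?X"
      have Zc: "Z \<in> carrier_mat a m" using yi by (auto simp: Z_def)
      have YZ: "?Y * Z = ?X"
        unfolding Z_def using assoc_mult_mat[OF sub_blk_carrier[of A "n-a" m a a] yi(1) sub_blk_carrier[of A "n-a" 0 a m]] yi by simp
      define W where "W = mat n n (\<lambda>(x,y). (if x = y then 1 else 0) - (if m \<le> x \<and> x < m+a \<and> y < m then Z $$ (x-m,y) else 0))"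
      have Wc: "W \<in> carrier_mat n n" by (simp add: W_def)
      have "det W = prod_list (diag_mat W)"
        by (rule det_lower_triangular[OF _ Wc]) (auto simp: W_def)
      also have "diag_mat W = map (\<lambda>_. 1) [0..<n]" unfolding diag_mat_def by (auto simp: W_def)
      also have "prod_list \<dots> = 1" by (simp add: map_replicate_const)
      finally have dW: "det W \<noteq> 0" by simp
      have ma: "m + a \<le> n - a" using less.prems(5) by simp
      have pA: "pat (cmat W A)" "pat (cmat W B)"
        by (rule pat_cmat[OF _ Wc]; use A B ma in \<open>auto simp: W_def\<close>)+
      obtain l where l: "n = m + a + l" using less.prems(5) by (metis add.assoc add.commute le_iff_add mult_2)
      have inner: "(\<Sum>y<n. A $$ (x,y) * W $$ (y,j)) = 0" if x: "x < n" and j: "j < p" for x j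
      proof -
        have "(\<Sum>y<n. A $$ (x,y) * W $$ (y,j)) = (\<Sum>y<m. A $$ (x,y) * W $$ (y,j)) + (\<Sum>y<a. A $$ (x,m+y) * W $$ (m+y,j)) + (\<Sum>y<l. A $$ (x,m+a+y) * W $$ (m+a+y,j))"
          unfolding l sum3 ..
        also have "(\<Sum>y<m. A $$ (x,y) * W $$ (y,j)) = (\<Sum>y<m. if y = j then A $$ (x,j) else 0)"
          using l p j by (intro sum.cong) (auto simp: W_def)
        also have "\<dots> = A $$ (x,j)" using j p by simp
        also have "(\<Sum>y<a. A $$ (x,m+y) * W $$ (m+y,j)) = - (\<Sum>y<a. A $$ (x,m+y) * Z $$ (y,j))"
          unfolding sum_negf[symmetric] using l p j by (intro sum.cong) (auto simp: W_def)
        also have "(\<Sum>y<l. A $$ (x,m+a+y) * W $$ (m+a+y,j)) = 0"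
          using l p j by (intro sum.neutral) (auto simp: W_def)
        also have "A $$ (x,j) + - (\<Sum>y<a. A $$ (x,m+y) * Z $$ (y,j)) + 0 = 0"
        proof (cases "x < n - a")
          case True
          then show ?thesis using patD(4)[OF A, of _ x] j p by simp
        next
          case False
          define x' where "x' = x - (n - a)"
          have x': "x = (n - a) + x'" "x' < a" using False x by (auto simp: x'_def)
          have "(\<Sum>y<a. A $$ (x,m+y) * Z $$ (y,j)) = (\<Sum>y<a. ?Y $$ (x',y) * Z $$ (y,j))"
            using x' by (intro sum.cong) (auto simp: sub_blk_def)
          also have "\<dots> = (?Y * Z) $$ (x',j)" using x' j p by (intro mult_index[symmetric, OF sub_blk_carrier Zc]) auto
          also have "\<dots> = A $$ (x,j)" unfolding YZ using x' j p by (simp add: sub_blk_def)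
          finally show ?thesis by simp
        qed
        finally show ?thesis .
      qed
      have zA: "cmat W A $$ (i,j) = 0" if "i < n" "j < p" for i j
        using cmat_first_columns[OF patD(1)[OF A] Wc that(1), of j] that n inner[OF _ that(2)] by simp
      have "(cmat W A, cmat W B) \<in> ?C" by (rule step1[OF pA zA])
      then show ?thesis by (rule cong_closed_back[OF cc Wc dW patD(1)[OF A] patD(1)[OF B]])
    qed
    have A: "pat A" and B: "pat B" using less.prems by (auto simp: pat_def)
    let ?Y = "sub_blk A (n-a) m a a"
    obtain s where s: "s \<longlonglongrightarrow> 0" "\<And>k. det (s k \<cdot>\<^sub>m 1\<^sub>m a + ?Y) \<noteq> 0"
      by (rule invertible_perturbation[of "1\<^sub>m a" a ?Y]) auto
    \<comment> \<open>These are the places of the diagonal of Y inside A; the transposed places are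
      changed too, to keep A symmetric.\<close>
    let ?c = "\<lambda>i j. n - a \<le> i \<and> j + n = i + m + a"
    let ?A = "\<lambda>k. mat n n (\<lambda>(i,j). A $$ (i,j) + (if ?c i j \<or> ?c j i then s k else 0))"
    show ?thesis
    proof (rule lim[of ?A _ "\<lambda>_. B"])
      show "matlim n (\<lambda>_. B) B" using patD(1)[OF B] by (rule matlim_const)
      show "matlim n ?A A"
      proof (rule matlimI)
        fix i j assume ij: "i < n" "j < n"
        have "(\<lambda>k. A $$ (i,j) + s k) \<longlonglongrightarrow> A $$ (i,j) + 0" by (intro tendsto_intros s)
        then show "(\<lambda>k. ?A k $$ (i,j)) \<longlonglongrightarrow> A $$ (i,j)" using ij by (cases "?c i j \<or> ?c j i") auto
      qed (use patD(1)[OF A] in auto)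
      fix k
      have ma: "m + a \<le> n - a" using less.prems(5) by simp
      have pA: "pat (?A k)"
        unfolding pat_def
      proof (intro conjI allI impI)
        show "transpose_mat (?A k) = ?A k"
        proof (rule eq_matI)
          fix i j assume "i < dim_row (?A k)" "j < dim_col (?A k)"
          then show "transpose_mat (?A k) $$ (i,j) = ?A k $$ (i,j)" using sym_index[OF patD(2)[OF A] patD(1)[OF A], of j i] by auto
        qed auto
        fix i j assume ij: "i < m+a" "j < n-a"
        then show "?A k $$ (i,j) = 0" using ma patD(3)[OF A ij] by auto
      qed auto
      have "sub_blk (?A k) (n-a) m a a = s k \<cdot>\<^sub>m 1\<^sub>m a + ?Y"
        by (rule eq_matI) (use ma in \<open>auto simp: sub_blk_def\<close>)
      then show "(?A k, B) \<in> ?C"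
        using s(2)[of k] by (intro step0[OF pA B]) auto
    qed
  qed
qed

section \<open>Determinants of bordered pencils\<close>

text \<open>The bound goes column by column because in \<open>border_mat\<close> only the a columns
  taken from the pencil contain \<lambda>.\<close>

lemma degree_det_columns:
  fixes A :: "'a::idom poly mat"
  assumes "A \<in> carrier_mat n n" "\<And>i j. i < n \<Longrightarrow> j < n \<Longrightarrow> degree (A $$ (i,j)) \<le> b j"
  shows "degree (det A) \<le> (\<Sum>j<n. b j)"
proof -
  have "degree (signof p * (\<Prod>i = 0..<n. A $$ (i, p i))) \<le> (\<Sum>j<n. b j)" if p: "p permutes {0..<n}" for p
  proof -
    have pn: "p i < n" if "i < n" for i using p that by (meson atLeastLessThan_iff permutes_in_image zero_le)
    have "degree (\<Prod>i = 0..<n. A $$ (i, p i)) \<le> (\<Sum>i = 0..<n. degree (A $$ (i, p i)))"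
      by (rule order_trans[OF degree_prod_sum_le]) (auto simp: o_def)
    also have "\<dots> \<le> (\<Sum>i = 0..<n. b (p i))" using assms(2) pn by (intro sum_mono) auto
    also have "\<dots> = (\<Sum>i = 0..<n. b i)" using sum.permute[OF p, of b] by (simp add: o_def)
    finally have "degree (\<Prod>i = 0..<n. A $$ (i, p i)) \<le> (\<Sum>j<n. b j)" by (simp add: atLeast0LessThan)
    then show ?thesis by (simp add: sign_def)
  qed
  then show ?thesis unfolding det_def'[OF assms(1)] by (intro degree_sum_le finite_permutations) auto
qed

abbreviation outer :: "complex mat \<Rightarrow> complex poly mat" where
  "outer U \<equiv> const_mat U * transpose_mat (const_mat U)"

lemma outer_const: "U \<in> carrier_mat n k \<Longrightarrow> outer U = const_mat (U * transpose_mat U)"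
proof (rule eq_matI)
  assume U: "U \<in> carrier_mat n k"
  fix i j assume "i < dim_row (const_mat (U * transpose_mat U))" "j < dim_col (const_mat (U * transpose_mat U))"
  then have ij: "i < n" "j < n" using U by auto
  have "outer U $$ (i,j) = (\<Sum>x<k. const_mat U $$ (i,x) * transpose_mat (const_mat U) $$ (x,j))"
    using ij U by (intro mult_index[of _ n k _ n]) auto
  also have "\<dots> = (\<Sum>x<k. [:U $$ (i,x) * U $$ (j,x):])" using ij U by (intro sum.cong) auto
  also have "\<dots> = [:\<Sum>x<k. U $$ (i,x) * U $$ (j,x):]" by (induction k) auto
  also have "(\<Sum>x<k. U $$ (i,x) * U $$ (j,x)) = (U * transpose_mat U) $$ (i,j)"
    using ij U mult_index[of U n k "transpose_mat U" n i j] by auto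
  finally show "outer U $$ (i,j) = const_mat (U * transpose_mat U) $$ (i,j)" using ij U by simp
qed auto

text \<open>The upper right corner of the matrix with blocks P, U, \<open>- U^T\<close> and 1: the
  last a columns of P next to U, cut to the rows in which P vanishes before column n - a.\<close>

definition border_mat :: "nat \<Rightarrow> nat \<Rightarrow> nat \<Rightarrow> complex poly mat \<Rightarrow> complex mat \<Rightarrow> complex poly mat" where
  "border_mat n m a P U = mat (m+a) (m+a) (\<lambda>(i,j). if j < a then P $$ (i, n-a+j) else [:U $$ (i,j-a):])"

text \<open>Bordering \<open>P\<close> by \<open>U\<close> turns \<open>P + U U\<^sup>T\<close> into an antitriangular block matrix.\<close>

lemma pattern_det:
  assumes P: "P \<in> carrier_mat n n" "transpose_mat P = P" and mn: "m + 2 * a \<le> n"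
    and z: "\<And>i j. i < m + a \<Longrightarrow> j < n - a \<Longrightarrow> P $$ (i,j) = 0"
    and U: "U \<in> carrier_mat n m"
  shows "det (P + outer U) = anti_sign (m+a) (n-m-2*a) * (-1)^m * det (sub_blk P (m+a) (m+a) (n-m-2*a) (n-m-2*a)) * (det (border_mat n m a P U))^2"
proof -
  define q where "q = n - m - 2*a"
  define s where "s = m + a"
  have n: "n = s + q + a" and N: "n + m = s + q + s" and na: "n - a = s + q" using mn by (auto simp: q_def s_def)
  let ?V = "const_mat U"
  have V: "?V \<in> carrier_mat n m" using U by auto
  \<comment> \<open>\<open>P + U U^T\<close> is the Schur complement of the block 1 in this matrix,
    and \<open>?T\<close> carries out the elimination.\<close>
  let ?M = "four_block_mat P ?V (- transpose_mat ?V) (1\<^sub>m m)"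
  have Mc: "?M \<in> carrier_mat (s+q+s) (s+q+s)" using P V N four_block_carrier_mat[OF P(1), of "1\<^sub>m m" m m ?V "- transpose_mat ?V"] by simp
  let ?T = "four_block_mat (1\<^sub>m n) (0\<^sub>m n m) (transpose_mat ?V) (1\<^sub>m m)"
  have Tc: "?T \<in> carrier_mat (n+m) (n+m)" by (intro four_block_carrier_mat) auto
  have "?M * ?T = four_block_mat (P * 1\<^sub>m n + ?V * transpose_mat ?V) (P * 0\<^sub>m n m + ?V * 1\<^sub>m m)
     (- transpose_mat ?V * 1\<^sub>m n + 1\<^sub>m m * transpose_mat ?V) (- transpose_mat ?V * 0\<^sub>m n m + 1\<^sub>m m * 1\<^sub>m m)"
    by (rule mult_four_block_mat) (use P V in auto)
  also have "- transpose_mat ?V * 1\<^sub>m n + 1\<^sub>m m * transpose_mat ?V = 0\<^sub>m m n" 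
    using V right_mult_one_mat[of "- transpose_mat ?V" m n] left_mult_one_mat[of "transpose_mat ?V" m n] by (auto intro!: eq_matI)
  also have "- transpose_mat ?V * 0\<^sub>m n m + 1\<^sub>m m * 1\<^sub>m m = 1\<^sub>m m"
    using right_mult_zero_mat[of "- transpose_mat ?V" m n m] V by auto
  also have "P * 0\<^sub>m n m + ?V * 1\<^sub>m m = ?V" using right_mult_zero_mat[OF P(1), of m] right_mult_one_mat[OF V] left_add_zero_mat[OF V] by simp
  also have "P * 1\<^sub>m n + ?V * transpose_mat ?V = P + outer U" using right_mult_one_mat[OF P(1)] by simp
  finally have MT: "?M * ?T = four_block_mat (P + outer U) ?V (0\<^sub>m m n) (1\<^sub>m m)" .
  have dT: "det ?T = 1" by (subst det_four_block_mat_upper_right_zero[of _ n _ m]) (use V in auto)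
  have OU: "P + outer U \<in> carrier_mat n n" using P V by auto
  have "det (?M * ?T) = det (P + outer U)"
    unfolding MT by (subst det_four_block_mat_lower_left_zero[OF OU V refl]) auto
  moreover have "det (?M * ?T) = det ?M * det ?T" by (rule det_mult[of _ "n+m"]) (use Mc Tc N in auto)
  ultimately have D: "det (P + outer U) = det ?M" using dT by simp
  have Mi: "?M $$ (i,j) = (if i < n then if j < n then P $$ (i,j) else ?V $$ (i,j-n) else if j < n then - ?V $$ (j,i-n) else if i = j then 1 else 0)"
    if "i < s+q+s" "j < s+q+s" for i j
    using that P V N by (auto simp: index_mat_four_block)
  have zM: "sub_blk ?M 0 0 s s = 0\<^sub>m s s" "sub_blk ?M 0 s s q = 0\<^sub>m s q" "sub_blk ?M s 0 q s = 0\<^sub>m q s"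
  proof -
    show "sub_blk ?M 0 0 s s = 0\<^sub>m s s" by (rule eq_matI) (use Mi n z na s_def in \<open>auto simp: sub_blk_def\<close>)
    show "sub_blk ?M 0 s s q = 0\<^sub>m s q" by (rule eq_matI) (use Mi n z na s_def in \<open>auto simp: sub_blk_def\<close>)
    show "sub_blk ?M s 0 q s = 0\<^sub>m q s"
    proof (rule eq_matI)
      fix i j assume "i < dim_row (0\<^sub>m q s :: complex poly mat)" "j < dim_col (0\<^sub>m q s :: complex poly mat)"
      then have ij: "i < q" "j < s" by auto
      then show "sub_blk ?M s 0 q s $$ (i,j) = 0\<^sub>m q s $$ (i,j)"
        using Mi[of "s+i" j] n sym_index[OF P(2,1), of "s+i" j] z[of j "s+i"] na s_def by (simp add: sub_blk_def)
    qed auto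
  qed
  have Q: "sub_blk ?M s s q q = sub_blk P s s q q"
    by (rule eq_matI) (use Mi n in \<open>auto simp: sub_blk_def\<close>)
  let ?O = "border_mat n m a P U"
  have Oc: "?O \<in> carrier_mat s s" by (simp add: border_mat_def s_def)
  have O1: "sub_blk ?M 0 (s+q) s s = ?O"
    by (rule eq_matI) (use Mi n na V s_def in \<open>auto simp: sub_blk_def border_mat_def\<close>)
  \<comment> \<open>The last m rows of the lower corner come from \<open>- U^T\<close>, so the lower
    corner is the transpose of the upper one only up to m signs.\<close>
  let ?S = "mat s s (\<lambda>(i,j). if i = j then if i < a then 1 else -1 else 0) :: complex poly mat"
  have dS: "det ?S = (-1)^m"
  proof -
    have "det ?S = prod_list (diag_mat ?S)" by (rule det_lower_triangular[of s]) auto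
    also have "diag_mat ?S = map (\<lambda>i. if i < a then 1 else -1) [0..<s]" unfolding diag_mat_def by auto
    also have "[0..<s] = [0..<a] @ [a..<s]" using upt_add_eq_append[of 0 a m] by (simp add: s_def add.commute)
    also have "prod_list (map (\<lambda>i. if i < a then 1 else -1) ([0..<a] @ [a..<s])) = prod_list (map (\<lambda>_. 1) [0..<a]) * prod_list (map (\<lambda>_. -1 :: complex poly) [a..<s])"
      unfolding map_append prod_list.append by (intro arg_cong2[where f="(*)"] arg_cong[where f=prod_list] map_cong) auto
    also have "\<dots> = (-1)^m" by (simp add: map_replicate_const s_def)
    finally show ?thesis .
  qed
  have O2: "sub_blk ?M (s+q) 0 s s = ?S * transpose_mat ?O"
  proof (rule eq_matI)
    fix i j assume "i < dim_row (?S * transpose_mat ?O)" "j < dim_col (?S * transpose_mat ?O)"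
    then have ij: "i < s" "j < s" using Oc by auto
    have "(?S * transpose_mat ?O) $$ (i,j) = (\<Sum>x<s. ?S $$ (i,x) * transpose_mat ?O $$ (x,j))"
      using ij Oc by (intro mult_index[of _ s s _ s]) auto
    also have "\<dots> = (\<Sum>x<s. if x = i then (if i < a then ?O $$ (j,i) else - ?O $$ (j,i)) else 0)"
      using ij Oc by (intro sum.cong) auto
    also have "\<dots> = (if i < a then ?O $$ (j,i) else - ?O $$ (j,i))" using ij by simp
    also have "\<dots> = ?M $$ (s+q+i,j)"
      using ij Mi[of "s+q+i" j] n V N sym_index[OF P(2,1), of j "s+q+i"] na by (auto simp: border_mat_def s_def)
    finally show "sub_blk ?M (s+q) 0 s s $$ (i,j) = (?S * transpose_mat ?O) $$ (i,j)" using ij by (simp add: sub_blk_def)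
  qed (use Oc in auto)
  have "?M = blk s q s (0\<^sub>m s s) (0\<^sub>m s q) ?O (0\<^sub>m q s) (sub_blk P s s q q) (sub_blk ?M s (s+q) q s)
     (?S * transpose_mat ?O) (sub_blk ?M (s+q) s s q) (sub_blk ?M (s+q) (s+q) s s)"
    using blk_split[OF Mc] unfolding zM Q O1 O2 .
  moreover have "?S * transpose_mat ?O \<in> carrier_mat s s" using Oc by (auto intro!: carrier_matI)
  ultimately have "det ?M = anti_sign s q * det ?O * det (sub_blk P s s q q) * det (?S * transpose_mat ?O)"
    using Oc blk_det_anti[of ?O s "sub_blk P s s q q" q "sub_blk ?M s (s+q) q s" "?S * transpose_mat ?O" "sub_blk ?M (s+q) s s q" "sub_blk ?M (s+q) (s+q) s s"] by simp
  also have "det (?S * transpose_mat ?O) = (-1)^m * det ?O"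
    using Oc dS by (subst det_mult[of _ s]) (auto simp: det_transpose[OF Oc])
  finally show ?thesis unfolding D s_def q_def by (simp add: power2_eq_square mult_ac)
qed

lemma pencil_sym:
  assumes "A \<in> carrier_mat n n" "B \<in> carrier_mat n n" "transpose_mat A = A" "transpose_mat B = B"
  shows "transpose_mat (pencil A B) = pencil A B"
proof (rule eq_matI)
  fix i j assume "i < dim_row (pencil A B)" "j < dim_col (pencil A B)"
  then have ij: "i < n" "j < n" using assms by (auto simp: pencil_def)
  then show "transpose_mat (pencil A B) $$ (i,j) = pencil A B $$ (i,j)"
    using pencil_carrier[OF assms(1,2)] sym_index[OF assms(3,1), of i j] sym_index[OF assms(4,2), of i j]
    by (simp add: pencil_index[OF assms(1,2)])
qed (use assms in \<open>auto simp: pencil_def\<close>)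

lemma cmat_pencil:
  assumes "A \<in> carrier_mat n n" "B \<in> carrier_mat n n" "W \<in> carrier_mat n k"
  shows "cmat (const_mat W) (pencil A B) = pencil (cmat W A) (cmat W B)"
proof (rule eq_matI)
  fix i j assume "i < dim_row (pencil (cmat W A) (cmat W B))" "j < dim_col (pencil (cmat W A) (cmat W B))"
  then have ij: "i < k" "j < k" using assms by (auto simp: pencil_def)
  have sum_pCons: "(\<Sum>x<l. [:f x, g x:]) = [:\<Sum>x<l. f x, \<Sum>x<l. g x:]" for f g :: "nat \<Rightarrow> complex" and l
    by (induction l) auto
  have W: "const_mat W \<in> carrier_mat n k" using assms by auto
  have "cmat (const_mat W) (pencil A B) $$ (i,j) = (\<Sum>y<n. (\<Sum>x<n. [:W $$ (x,i):] * [:B $$ (x,y), A $$ (x,y):]) * [:W $$ (y,j):])"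
    using ij assms by (subst cmat_index[OF pencil_carrier[OF assms(1,2)] W]) (auto simp: pencil_index intro!: sum.cong)
  also have "\<dots> = (\<Sum>y<n. [:(\<Sum>x<n. W $$ (x,i) * B $$ (x,y)) * W $$ (y,j), (\<Sum>x<n. W $$ (x,i) * A $$ (x,y)) * W $$ (y,j):])"
    by (intro sum.cong refl) (simp add: sum_pCons mult.commute)
  also have "\<dots> = [:cmat W B $$ (i,j), cmat W A $$ (i,j):]"
    unfolding sum_pCons using ij cmat_index[OF assms(1,3)] cmat_index[OF assms(2,3)] by simp
  finally show "cmat (const_mat W) (pencil A B) $$ (i,j) = pencil (cmat W A) (cmat W B) $$ (i,j)"
    using ij assms by (subst pencil_index[of _ k k]) auto
qed (use assms in \<open>auto simp: pencil_def\<close>)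

lemma const_mat_mult:
  assumes "A \<in> carrier_mat n k" "B \<in> carrier_mat k l"
  shows "const_mat (A * B) = const_mat A * const_mat B"
proof (rule eq_matI)
  fix i j assume "i < dim_row (const_mat A * const_mat B)" "j < dim_col (const_mat A * const_mat B)"
  then have ij: "i < n" "j < l" using assms by auto
  have s: "(\<Sum>x<k. [:f x:]) = [:\<Sum>x<k. f x:]" for f :: "nat \<Rightarrow> complex" by (induction k) auto
  show "const_mat (A * B) $$ (i,j) = (const_mat A * const_mat B) $$ (i,j)"
    using ij assms mult_index[OF assms ij] mult_index[of "const_mat A" n k "const_mat B" l i j]
    by (simp add: s mult.commute del: index_mult_mat(1))
qed (use assms in auto)

lemma det_const_mat: "A \<in> carrier_mat n n \<Longrightarrow> det (const_mat A) = [:det A:]"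
  by (subst comm_ring_hom.hom_det[symmetric]) (unfold_locales, auto simp: one_pCons)

text \<open>The border moves along with the pencil: \<open>U U^T\<close> becomes the outer product
  of \<open>W^T U\<close>, so the whole sum undergoes one congruence.\<close>

lemma det_cmat_outer:
  assumes A: "A \<in> carrier_mat n n" and B: "B \<in> carrier_mat n n" and W: "W \<in> carrier_mat n n" and U: "U \<in> carrier_mat n k"
  shows "det (pencil (cmat W A) (cmat W B) + outer (transpose_mat W * U)) = [:(det W)^2:] * det (pencil A B + outer U)"
proof -
  have cW: "const_mat W \<in> carrier_mat n n" and cU: "const_mat U \<in> carrier_mat n k" using W U by auto
  have P: "pencil A B \<in> carrier_mat n n" using A B by simp
  have O: "outer U \<in> carrier_mat n n" using cU by auto
  have WU: "const_mat (transpose_mat W * U) = transpose_mat (const_mat W) * const_mat U"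
    using const_mat_mult[of "transpose_mat W" n n U k] W U by (simp add: map_mat_transpose)
  have "outer (transpose_mat W * U) = cmat (const_mat W) (outer U)"
  proof -
    let ?W = "const_mat W" and ?U = "const_mat U"
    have t: "transpose_mat (transpose_mat ?W * ?U) = transpose_mat ?U * ?W"
      using transpose_mult[of "transpose_mat ?W" n n ?U k] cW cU by simp
    have "cmat ?W (?U * transpose_mat ?U) = transpose_mat ?W * ?U * transpose_mat ?U * ?W"
      unfolding cmat_def using assoc_mult_mat[of "transpose_mat ?W" n n ?U k "transpose_mat ?U" n] cW cU by simp
    also have "\<dots> = transpose_mat ?W * ?U * (transpose_mat ?U * ?W)"
      by (rule assoc_mult_mat[of _ n k _ n _ n]) (use cW cU in auto)
    finally show ?thesis unfolding WU t by simp
  qed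
  then have "pencil (cmat W A) (cmat W B) + outer (transpose_mat W * U) = cmat (const_mat W) (pencil A B + outer U)"
    using cmat_add[OF P O cW] cmat_pencil[OF A B W] by simp
  then show ?thesis using cmat_det[of "pencil A B + outer U" n "const_mat W"] P O cW det_const_mat[OF W]
    by (simp add: power2_eq_square)
qed

text \<open>All nonzero entries lie in the last a columns or in the last n - m - a rows, which
  together allow rank n - m.\<close>

lemma pattern_factor:
  fixes P :: "complex poly mat"
  assumes P: "P \<in> carrier_mat n n" and mn: "m + 2 * a \<le> n"
    and z: "\<And>i j. i < m + a \<Longrightarrow> j < n - a \<Longrightarrow> P $$ (i,j) = 0"
  obtains X Y where "X \<in> carrier_mat n (n-m)" "Y \<in> carrier_mat (n-m) n" "P = X * Y"
proof -
  define X where "X = mat n (n-m) (\<lambda>(i,l). if l < a then P $$ (i,n-a+l) else if i = m + l then 1 else 0)"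
  define Y where "Y = mat (n-m) n (\<lambda>(l,j). if l < a then if j = n - a + l then 1 else 0 else if j < n - a then P $$ (m+l,j) else 0)"
  obtain q where n: "n = m + a + q" "a \<le> q" using mn le_add_diff_inverse[of "m+a" n] by (metis add_leD1 add_le_cancel_left add.assoc mult_2)
  have nm: "n - m = a + q + 0" using n by simp
  have X: "X \<in> carrier_mat n (n-m)" and Y: "Y \<in> carrier_mat (n-m) n" by (auto simp: X_def Y_def)
  have "P = X * Y"
  proof (rule eq_matI)
    fix i j assume "i < dim_row (X * Y)" "j < dim_col (X * Y)"
    then have ij: "i < n" "j < n" using X Y by auto
    have "(X * Y) $$ (i,j) = (\<Sum>l<a+q+0. X $$ (i,l) * Y $$ (l,j))" using mult_index[OF X Y ij] nm by simp
    also have "\<dots> = (\<Sum>l<a. X $$ (i,l) * Y $$ (l,j)) + (\<Sum>l<q. X $$ (i,a+l) * Y $$ (a+l,j))" unfolding sum3 by simp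
    also have "(\<Sum>l<a. X $$ (i,l) * Y $$ (l,j)) = (\<Sum>l<a. if l = j - (n-a) then (if n - a \<le> j then P $$ (i,j) else 0) else 0)"
      using ij n by (intro sum.cong) (auto simp: X_def Y_def)
    also have "\<dots> = (if n - a \<le> j then P $$ (i,j) else 0)" using ij n by auto
    also have "(\<Sum>l<q. X $$ (i,a+l) * Y $$ (a+l,j)) = (\<Sum>l<q. if l = i - (m+a) then (if m + a \<le> i \<and> j < n - a then P $$ (i,j) else 0) else 0)"
      using ij n by (intro sum.cong) (auto simp: X_def Y_def)
    also have "\<dots> = (if m + a \<le> i \<and> j < n - a then P $$ (i,j) else 0)" using ij n by auto
    also have "(if n - a \<le> j then P $$ (i,j) else 0) + (if m + a \<le> i \<and> j < n - a then P $$ (i,j) else 0) = P $$ (i,j)"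
      using z[of i j] by auto
    finally show "P $$ (i,j) = (X * Y) $$ (i,j)" ..
  qed (use P X Y in auto)
  then show ?thesis using that X Y by blast
qed

lemma has_pattern_factor:
  assumes A: "A \<in> carrier_mat n n" and B: "B \<in> carrier_mat n n" and pat: "has_pattern n m a A B"
  obtains X Y where "X \<in> carrier_mat n (n-m)" "Y \<in> carrier_mat (n-m) n" "pencil A B = X * Y"
proof -
  obtain W where W: "W \<in> carrier_mat n n" "det W \<noteq> 0"
    "\<And>i j. i < m + a \<Longrightarrow> j < n - a \<Longrightarrow> cmat W A $$ (i,j) = 0 \<and> cmat W B $$ (i,j) = 0" "m + 2 * a \<le> n"
    using has_pattern_initial[OF A B pat] by auto
  obtain V where V: "V \<in> carrier_mat n n" "W * V = 1\<^sub>m n" by (rule det_nz_inverse[OF W(1,2)])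
  let ?P = "pencil (cmat W A) (cmat W B)"
  have c: "cmat W A \<in> carrier_mat n n" "cmat W B \<in> carrier_mat n n" using W by auto
  have P: "?P \<in> carrier_mat n n" using c by simp
  have z: "?P $$ (i,j) = 0" if "i < m + a" "j < n - a" for i j
    using W(3)[OF that] W(4) that by (subst pencil_index[OF c]) auto
  obtain X Y where XY: "X \<in> carrier_mat n (n-m)" "Y \<in> carrier_mat (n-m) n" "?P = X * Y"
    by (rule pattern_factor[OF P W(4) z])
  have "pencil A B = cmat (const_mat V) ?P"
    using cmat_pencil[OF c V(1)] cmat_cancel[OF A W(1) V] cmat_cancel[OF B W(1) V] by simp
  also have "\<dots> = cmat (const_mat V) (X * Y)" by (simp only: XY(3))
  also have "\<dots> = transpose_mat (const_mat V) * X * (Y * const_mat V)"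
    unfolding cmat_def using V XY assoc_mult_mat[of "transpose_mat (const_mat V)" n n X "n-m" Y n]
      assoc_mult_mat[of "transpose_mat (const_mat V) * X" n "n-m" Y n "const_mat V" n] by simp
  finally show ?thesis using that[of "transpose_mat (const_mat V) * X" "Y * const_mat V"] V XY by simp
qed

lemma has_pattern_rank:
  assumes "A \<in> carrier_mat n n" "B \<in> carrier_mat n n" "has_pattern n m a A B"
  shows "pencil_rank (pencil A B) \<le> n - m"
proof -
  obtain X Y where "X \<in> carrier_mat n (n-m)" "Y \<in> carrier_mat (n-m) n" "pencil A B = X * Y"
    by (rule has_pattern_factor[OF assms])
  then show ?thesis using pencil_rank_le_factor[OF pencil_carrier[OF assms(1,2)]] by blast
qed

lemma has_pattern_few_columns:
  assumes "A \<in> carrier_mat n n" "B \<in> carrier_mat n n" "has_pattern n m a A B" "U \<in> carrier_mat n k" "k < m"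
  shows "det (pencil A B + outer U) = 0"
proof -
  obtain X Y where XY: "X \<in> carrier_mat n (n-m)" "Y \<in> carrier_mat (n-m) n" "pencil A B = X * Y"
    by (rule has_pattern_factor[OF assms(1-3)])
  have "m \<le> n" using assms(3) unfolding has_pattern_def by auto
  then show ?thesis unfolding XY(3) using assms(4,5) by (intro low_rank_det[OF XY(1,2), of _ k]) auto
qed

lemma degree_unit_sq: "x^2 = 1 \<Longrightarrow> degree (x :: complex poly) = 0"
  by (metis degree_1 degree_power_eq mult_eq_0_iff power_zero_numeral zero_neq_numeral zero_neq_one)

text \<open>In coordinates adapted to the pattern, signs and the core determinant make up g, and U
  enters only through the border determinant. The factor \<open>(det W)^2\<close> of the change of
  coordinates is absorbed into g.\<close>

lemma has_pattern_det:
  assumes A: "A \<in> carrier_mat n n" "transpose_mat A = A" and B: "B \<in> carrier_mat n n" "transpose_mat B = B"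
    and pat: "has_pattern n m a A B"
  obtains g where "degree g \<le> n - m - 2*a"
    "\<forall>U\<in>carrier_mat n m. \<exists>p. degree p \<le> a \<and> det (pencil A B + outer U) = g * p^2"
proof -
  obtain W where W: "W \<in> carrier_mat n n" "det W \<noteq> 0"
    "\<And>i j. i < m + a \<Longrightarrow> j < n - a \<Longrightarrow> cmat W A $$ (i,j) = 0 \<and> cmat W B $$ (i,j) = 0" "m + 2 * a \<le> n"
    using has_pattern_initial[OF A(1) B(1) pat] by auto
  let ?P = "pencil (cmat W A) (cmat W B)" let ?q = "n - m - 2*a"
  have c: "cmat W A \<in> carrier_mat n n" "cmat W B \<in> carrier_mat n n" using W by auto
  have P: "?P \<in> carrier_mat n n" using c by simp
  have Ps: "transpose_mat ?P = ?P" by (rule pencil_sym[OF c cmat_sym[OF A(1) W(1) A(2)] cmat_sym[OF B(1) W(1) B(2)]])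
  have z: "?P $$ (i,j) = 0" if "i < m + a" "j < n - a" for i j
    using W(3)[OF that] W(4) that by (subst pencil_index[OF c]) auto
  have dP: "degree (?P $$ (i,j)) \<le> 1" if "i < n" "j < n" for i j using that by (subst pencil_index[OF c]) auto
  define h where "h = anti_sign (m+a) ?q * (-1)^m * det (sub_blk ?P (m+a) (m+a) ?q ?q)"
  define g where "g = smult (inverse ((det W)^2)) h"
  have "degree (anti_sign (m+a) ?q :: complex poly) = 0" by (rule degree_unit_sq[OF anti_sign_sq])
  moreover have "degree ((-1)^m :: complex poly) = 0" by (metis degree_unit_sq power_mult power_one mult.commute power2_minus power_one)
  moreover have "degree (det (sub_blk ?P (m+a) (m+a) ?q ?q)) \<le> 1 * ?q"
    by (rule degree_det_le) (use dP W(4) in \<open>auto simp: sub_blk_def\<close>)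
  ultimately have "degree h \<le> ?q"
    unfolding h_def by (intro order_trans[OF degree_mult_le]) (metis (no_types, lifting) add.right_neutral add_0 degree_mult_le le_zero_eq add_mono mult_1)
  then have dg: "degree g \<le> ?q" unfolding g_def using degree_smult_le order_trans by blast
  have "\<exists>p. degree p \<le> a \<and> det (pencil A B + outer U) = g * p^2" if U: "U \<in> carrier_mat n m" for U
  proof -
    let ?U = "transpose_mat W * U"
    have Uc: "?U \<in> carrier_mat n m" using U W by auto
    let ?p = "det (border_mat n m a ?P ?U)"
    have "degree ?p \<le> (\<Sum>j<m+a. if j < a then 1 else 0)"
      by (rule degree_det_columns) (use dP W(4) in \<open>auto simp: border_mat_def\<close>)
    also have "\<dots> = card ({..<m+a} \<inter> {j. j < a})" by (subst sum.If_cases) auto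
    also have "{..<m+a} \<inter> {j. j < a} = {..<a}" by auto
    finally have dp: "degree ?p \<le> a" by simp
    have "[:(det W)^2:] * det (pencil A B + outer U) = h * ?p^2"
      unfolding det_cmat_outer[OF A(1) B(1) W(1) U, symmetric] h_def by (rule pattern_det[OF P Ps W(4) z Uc])
    then have "smult (inverse ((det W)^2)) ([:(det W)^2:] * det (pencil A B + outer U)) = smult (inverse ((det W)^2)) (h * ?p^2)" by simp
    then have "det (pencil A B + outer U) = g * ?p^2" using W(2) by (simp add: g_def)
    then show ?thesis using dp by blast
  qed
  then show ?thesis using that dg by blast
qed

text \<open>A certificate against other patterns: a nonzero determinant with m border columns bounds
  the first parameter of every pattern from above, and the quotient \<open>\<lambda>^(2a)\<close> of
  two such determinants bounds the second from below when the first is m.\<close>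

definition test_pair :: "nat \<Rightarrow> nat \<Rightarrow> nat \<Rightarrow> complex mat \<Rightarrow> complex mat \<Rightarrow> bool" where
  "test_pair n m a A B \<longleftrightarrow> (\<exists>U1\<in>carrier_mat n m. \<exists>U2\<in>carrier_mat n m. det (pencil A B + outer U1) \<noteq> 0 \<and>
     det (pencil A B + outer U2) = det (pencil A B + outer U1) * monom 1 (2*a))"

lemma test_pair_cmat:
  assumes A: "A \<in> carrier_mat n n" and B: "B \<in> carrier_mat n n" and W: "W \<in> carrier_mat n n" "det W \<noteq> 0" and t: "test_pair n m a A B"
  shows "test_pair n m a (cmat W A) (cmat W B)"
proof -
  obtain U1 U2 where U: "U1 \<in> carrier_mat n m" "U2 \<in> carrier_mat n m" "det (pencil A B + outer U1) \<noteq> 0"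
    "det (pencil A B + outer U2) = det (pencil A B + outer U1) * monom 1 (2*a)" using t unfolding test_pair_def by auto
  have "transpose_mat W * U1 \<in> carrier_mat n m" "transpose_mat W * U2 \<in> carrier_mat n m" using U W by auto
  moreover have "det (pencil (cmat W A) (cmat W B) + outer (transpose_mat W * U1)) \<noteq> 0"
    unfolding det_cmat_outer[OF A B W(1) U(1)] using U(3) W(2) by simp
  moreover have "det (pencil (cmat W A) (cmat W B) + outer (transpose_mat W * U2)) = det (pencil (cmat W A) (cmat W B) + outer (transpose_mat W * U1)) * monom 1 (2*a)"
    unfolding det_cmat_outer[OF A B W(1) U(1)] det_cmat_outer[OF A B W(1) U(2)] U(4) by (simp only: mult_ac)
  ultimately show ?thesis unfolding test_pair_def by blast
qed

text \<open>Both determinants share the factor g, which cancels and leaves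
  \<open>p2^2 = p1^2 \<lambda>^(2a)\<close>; the degree bound on \<open>p2\<close> does the
  rest.\<close>

lemma test_pair_pattern:
  assumes A: "A \<in> carrier_mat n n" "transpose_mat A = A" and B: "B \<in> carrier_mat n n" "transpose_mat B = B"
    and t: "test_pair n m a A B" and pat: "has_pattern n m' a' A B"
  shows "m' \<le> m" "m' = m \<Longrightarrow> a \<le> a'"
proof -
  obtain U1 U2 where U: "U1 \<in> carrier_mat n m" "U2 \<in> carrier_mat n m" "det (pencil A B + outer U1) \<noteq> 0"
    "det (pencil A B + outer U2) = det (pencil A B + outer U1) * monom 1 (2*a)" using t unfolding test_pair_def by auto
  show "m' \<le> m" using has_pattern_few_columns[OF A(1) B(1) pat U(1)] U(3) by (meson not_less)
  assume m: "m' = m"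
  obtain g where "degree g \<le> n - m' - 2*a'" and g: "\<forall>U\<in>carrier_mat n m'. \<exists>p. degree p \<le> a' \<and> det (pencil A B + outer U) = g * p^2"
    by (rule has_pattern_det[OF A B pat])
  obtain p1 p2 where p: "det (pencil A B + outer U1) = g * p1^2" "degree p2 \<le> a'" "det (pencil A B + outer U2) = g * p2^2"
    using bspec[OF g, of U1] bspec[OF g, of U2] U(1,2) m by auto
  then have nz: "g \<noteq> 0" "p1 \<noteq> 0" using U(3) by auto
  have "g * p2^2 = g * (p1^2 * monom 1 (2*a))" using U(4) p by (simp add: mult.assoc)
  then have e: "p2^2 = p1^2 * monom 1 (2*a)" using nz by simp
  then have p2: "p2 \<noteq> 0" using nz by (auto simp: monom_eq_0_iff)
  have "2 * degree p2 = 2 * degree p1 + 2 * a"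
    using arg_cong[OF e, of degree] nz p2 by (simp add: degree_power_eq degree_mult_eq monom_eq_0_iff degree_monom_eq)
  then show "a \<le> a'" using p(2) by simp
qed

section \<open>Invariants of the canonical form\<close>

fun bdim :: "'e block \<Rightarrow> nat" where
  "bdim (Block_M d) = 2 * d + 1"
| "bdim (Block_J e l) = l"

fun is_M :: "'e block \<Rightarrow> bool" where
  "is_M (Block_M d) = True" | "is_M (Block_J e l) = False"

fun bdeg :: "'e block \<Rightarrow> nat" where
  "bdeg (Block_M d) = d" | "bdeg (Block_J e l) = 0"

definition tdim :: "'e block list \<Rightarrow> nat" where "tdim bs = sum_list (map bdim bs)"
definition numM :: "'e block list \<Rightarrow> nat" where "numM bs = length (filter is_M bs)"
definition degM :: "'e block list \<Rightarrow> nat" where "degM bs = sum_list (map bdeg bs)"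

lemma map_block_size:
  "tdim (map (map_block f) bs) = tdim bs" "numM (map (map_block f) bs) = numM bs" "degM (map (map_block f) bs) = degM bs"
proof -
  have b: "bdim (map_block f b) = bdim b" "is_M (map_block f b) = is_M b" "bdeg (map_block f b) = bdeg b" for b
    by (cases b; simp)+
  show "tdim (map (map_block f) bs) = tdim bs" "numM (map (map_block f) bs) = numM bs" "degM (map (map_block f) bs) = degM bs"
    by (simp_all add: tdim_def numM_def degM_def b o_def filter_map)
qed

lemma numM_degM_le: "numM bs + 2 * degM bs \<le> tdim bs"
proof (induction bs)
  case (Cons b bs)
  then show ?case by (cases b) (auto simp: tdim_def numM_def degM_def)
qed (auto simp: tdim_def numM_def degM_def)

lemma L_block_carrier: "L_block d \<in> carrier_mat d (d+1)"
  unfolding L_block_def by (rule pencil_carrier) (auto simp: G_mat_def F_mat_def)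

lemma L_block_index:
  assumes "i < d" "j < d + 1"
  shows "L_block d $$ (i,j) = [:if j = i + 1 then 1 else 0, if j = i then 1 else 0:]"
  unfolding L_block_def using assms by (subst pencil_index[of _ d "d+1"]) (auto simp: G_mat_def F_mat_def)

lemma M_block_index:
  assumes "i < 2*d+1" "j < 2*d+1"
  shows "M_block d $$ (i,j) = (if i < d+1 then if j < d+1 then 0 else L_block d $$ (j-(d+1),i)
    else if j < d+1 then L_block d $$ (i-(d+1),j) else 0)"
  unfolding M_block_def using assms L_block_carrier[of d] by (subst index_mat_four_block) auto

lemma M_block_carrier: "M_block d \<in> carrier_mat (2*d+1) (2*d+1)"
  unfolding M_block_def using four_block_carrier_mat[of "0\<^sub>m (d+1) (d+1)" "d+1" "d+1" "0\<^sub>m d d" d d] by (simp add: mult_2)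

lemma block_pencil_carrier: "block_pencil b \<in> carrier_mat (bdim b) (bdim b)"
  by (cases b rule: block_pencil.cases) (auto simp: M_block_carrier J_block_def J_inf_block_def simp del: bdim.simps(1), auto simp: M_block_carrier[simplified])

lemma block_pencil_degree:
  assumes "i < bdim b" "j < bdim b"
  shows "degree (block_pencil b $$ (i,j)) \<le> 1"
proof (cases b rule: block_pencil.cases)
  case (1 d)
  then show ?thesis using assms by (auto simp: M_block_index L_block_index)
qed (use assms in \<open>auto simp: J_block_def J_inf_block_def\<close>)

lemma block_pencil_sym:
  assumes "i < bdim b" "j < bdim b"
  shows "block_pencil b $$ (i,j) = block_pencil b $$ (j,i)"
proof (cases b rule: block_pencil.cases)
  case (1 d)
  then show ?thesis using assms by (auto simp: M_block_index)
qed (use assms in \<open>auto simp: J_block_def J_inf_block_def add.commute\<close>)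

lemma block_diag_Nil: "block_diag [] = 0\<^sub>m 0 0" by (simp add: block_diag_def)

lemma block_diag_carrier: "block_diag bs \<in> carrier_mat (tdim bs) (tdim bs)"
proof (induction bs)
  case (Cons b bs)
  then show ?case using block_pencil_carrier[of b] by (auto simp: block_diag_def tdim_def Let_def)
qed (simp add: block_diag_def tdim_def)

lemma block_diag_Cons:
  "block_diag (b # bs) = four_block_mat (block_pencil b) (0\<^sub>m (bdim b) (tdim bs)) (0\<^sub>m (tdim bs) (bdim b)) (block_diag bs)"
  using block_diag_carrier[of bs] block_pencil_carrier[of b] by (auto simp: block_diag_def Let_def)

lemma tdim_simps[simp]: "tdim [] = 0" "tdim (b # bs) = bdim b + tdim bs" by (auto simp: tdim_def)

lemma block_diag_index:
  "i < bdim b \<Longrightarrow> j < bdim b \<Longrightarrow> block_diag (b # bs) $$ (i,j) = block_pencil b $$ (i,j)"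
  "i < bdim b \<Longrightarrow> j < tdim bs \<Longrightarrow> block_diag (b # bs) $$ (i,bdim b + j) = 0"
  "i < tdim bs \<Longrightarrow> j < bdim b \<Longrightarrow> block_diag (b # bs) $$ (bdim b + i,j) = 0"
  "i < tdim bs \<Longrightarrow> j < tdim bs \<Longrightarrow> block_diag (b # bs) $$ (bdim b + i,bdim b + j) = block_diag bs $$ (i,j)"
  unfolding block_diag_Cons using block_diag_carrier[of bs] block_pencil_carrier[of b] by (auto simp: index_mat_four_block)

lemma add_cases:
  assumes "i < p + (q::nat)"
  obtains (1) "i < p" | (2) k where "k < q" "i = p + k"
  using assms that(1) that(2)[of "i-p"] by (cases "i < p") auto

lemma block_diag_entries:
  "i < tdim bs \<Longrightarrow> j < tdim bs \<Longrightarrow> degree (block_diag bs $$ (i,j)) \<le> 1 \<and> block_diag bs $$ (i,j) = block_diag bs $$ (j,i)"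
proof (induction bs arbitrary: i j)
  case (Cons b bs)
  from Cons.prems have i: "i < bdim b + tdim bs" and j: "j < bdim b + tdim bs" by auto
  from i show ?case
  proof (cases rule: add_cases)
    case 1
    from j show ?thesis
      by (cases rule: add_cases) (use 1 block_pencil_degree block_pencil_sym in \<open>simp_all add: block_diag_index\<close>)
  next
    case (2 k)
    from j show ?thesis
      by (cases rule: add_cases) (use 2 Cons.IH in \<open>simp_all add: block_diag_index\<close>)
  qed
qed simp

section \<open>Coefficient matrices of a pencil\<close>

definition lin_part :: "nat \<Rightarrow> complex poly mat \<Rightarrow> complex mat" where
  "lin_part k P = map_mat (\<lambda>p. coeff p k) P"

lemma lin_part_carrier[simp]: "P \<in> carrier_mat n l \<Longrightarrow> lin_part k P \<in> carrier_mat n l"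
  by (auto simp: lin_part_def)

lemma pencil_lin_part:
  assumes P: "P \<in> carrier_mat n l" and "\<And>i j. i < n \<Longrightarrow> j < l \<Longrightarrow> degree (P $$ (i,j)) \<le> 1"
  shows "pencil (lin_part 1 P) (lin_part 0 P) = P"
proof (rule eq_matI)
  have c: "lin_part 1 P \<in> carrier_mat n l" "lin_part 0 P \<in> carrier_mat n l" using P by simp_all
  fix i j assume "i < dim_row P" "j < dim_col P"
  then have ij: "i < n" "j < l" using P by auto
  have "P $$ (i,j) = [:coeff (P $$ (i,j)) 0, coeff (P $$ (i,j)) 1:]"
    using assms(2)[OF ij] by (intro poly_eqI) (auto simp: coeff_pCons coeff_eq_0 split: nat.split)
  then show "pencil (lin_part 1 P) (lin_part 0 P) $$ (i,j) = P $$ (i,j)"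
    unfolding pencil_index[OF c ij] using ij P by (simp add: lin_part_def)
qed (use P in \<open>auto simp: pencil_def lin_part_def\<close>)

lemma lin_part_pencil:
  assumes "A \<in> carrier_mat n l" "B \<in> carrier_mat n l"
  shows "lin_part 1 (pencil A B) = A" "lin_part 0 (pencil A B) = B"
proof -
  have d: "dim_row (pencil A B) = n" "dim_col (pencil A B) = l" using carrier_matD[OF pencil_carrier[OF assms]] .
  show "lin_part 1 (pencil A B) = A" "lin_part 0 (pencil A B) = B"
    by (rule eq_matI; use assms d in \<open>auto simp: lin_part_def pencil_index\<close>)+
qed

lemma lin_part_sym:
  assumes "P \<in> carrier_mat n n" "\<And>i j. i < n \<Longrightarrow> j < n \<Longrightarrow> P $$ (i,j) = P $$ (j,i)"
  shows "transpose_mat (lin_part k P) = lin_part k P"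
  by (rule eq_matI) (use assms in \<open>auto simp: lin_part_def\<close>)

lemma block_diag_pencil: "pencil (lin_part 1 (block_diag bs)) (lin_part 0 (block_diag bs)) = block_diag bs"
  by (rule pencil_lin_part[OF block_diag_carrier]) (use block_diag_entries in auto)

lemma block_diag_sym: "transpose_mat (lin_part k (block_diag bs)) = lin_part k (block_diag bs)"
  by (rule lin_part_sym[OF block_diag_carrier]) (use block_diag_entries in auto)

section \<open>Coordinates selected block by block\<close>

fun usel :: "(eigval block \<Rightarrow> nat set) \<Rightarrow> eigval block list \<Rightarrow> nat set" where
  "usel s [] = {}"
| "usel s (b # bs) = s b \<union> (+) (bdim b) ` usel s bs"

lemma usel_subset:
  assumes "\<And>b. s b \<subseteq> {..<bdim b}"
  shows "usel s bs \<subseteq> {..<tdim bs}"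
proof (induction bs)
  case (Cons b bs)
  then show ?case using assms[of b] by auto
qed simp

lemma usel_mono: "(\<And>b. s b \<subseteq> t b) \<Longrightarrow> usel s bs \<subseteq> usel t bs"
proof (induction bs)
  case (Cons b bs)
  then show ?case by (auto intro!: imageI)
qed simp

lemma card_usel:
  assumes s: "\<And>b. s b \<subseteq> {..<bdim b}"
  shows "card (usel s bs) = sum_list (map (\<lambda>b. card (s b)) bs)"
proof (induction bs)
  case (Cons b bs)
  have f: "finite (s b)" "finite (usel s bs)" using finite_subset[OF s] finite_subset[OF usel_subset[OF s]] by auto
  have "s b \<inter> (+) (bdim b) ` usel s bs = {}" using s[of b] by auto
  then show ?case using Cons f by (simp add: card_Un_disjoint card_image)
qed simp

lemma usel_zero:
  assumes s: "\<And>b. s b \<subseteq> {..<bdim b}" "\<And>b. t b \<subseteq> {..<bdim b}" and z: "\<And>b i j. i \<in> s b \<Longrightarrow> j \<in> t b \<Longrightarrow> block_pencil b $$ (i,j) = 0"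
  shows "i \<in> usel s bs \<Longrightarrow> j \<in> usel t bs \<Longrightarrow> block_diag bs $$ (i,j) = 0"
proof (induction bs arbitrary: i j)
  case (Cons b bs)
  have st: "usel s bs \<subseteq> {..<tdim bs}" "usel t bs \<subseteq> {..<tdim bs}" by (rule usel_subset[OF s(1)], rule usel_subset[OF s(2)])
  have lt: "\<And>x. x \<in> s b \<Longrightarrow> x < bdim b" "\<And>x. x \<in> t b \<Longrightarrow> x < bdim b" "\<And>x. x \<in> usel s bs \<Longrightarrow> x < tdim bs" "\<And>x. x \<in> usel t bs \<Longrightarrow> x < tdim bs"
    using s(1)[of b] s(2)[of b] st by auto
  have "i \<in> s b \<or> (\<exists>k\<in>usel s bs. i = bdim b + k)" "j \<in> t b \<or> (\<exists>k\<in>usel t bs. j = bdim b + k)" using Cons.prems by auto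
  then show ?case
    by (elim disjE bexE) (use lt z[of i b j] Cons.IH in \<open>simp_all add: block_diag_index\<close>)
qed simp

text \<open>\<open>selN\<close> and \<open>selV\<close> give the sets I and J of the pattern: the
  first d + 1 coordinates of each \<open>M_block d\<close>, and these together with all coordinates
  of the regular blocks. \<open>sel1\<close> and \<open>sel2\<close> are the two ends of the chain
  of \<open>M_block d\<close>, where the border vector is placed.\<close>

fun selN :: "eigval block \<Rightarrow> nat set" where
  "selN (Block_M d) = {..<d+1}" | "selN (Block_J e l) = {}"
fun selV :: "eigval block \<Rightarrow> nat set" where
  "selV (Block_M d) = {..<d+1}" | "selV (Block_J e l) = {..<l}"
fun sel1 :: "eigval block \<Rightarrow> nat set" where
  "sel1 (Block_M d) = {0}" | "sel1 (Block_J e l) = {}"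
fun sel2 :: "eigval block \<Rightarrow> nat set" where
  "sel2 (Block_M d) = {d}" | "sel2 (Block_J e l) = {}"

lemma sel_subset: "selN b \<subseteq> {..<bdim b}" "selV b \<subseteq> {..<bdim b}" "sel1 b \<subseteq> {..<bdim b}" "sel2 b \<subseteq> {..<bdim b}" "selN b \<subseteq> selV b"
  by (cases b; auto)+

lemma card_usel_sel:
  "card (usel selN bs) = numM bs + degM bs" "card (usel selV bs) = tdim bs - degM bs"
  "card (usel sel1 bs) = numM bs" "card (usel sel2 bs) = numM bs"
proof -
  have "sum_list (map (\<lambda>b. card (selN b)) bs) = numM bs + degM bs" "sum_list (map (\<lambda>b. card (selV b)) bs) + degM bs = tdim bs"
    "sum_list (map (\<lambda>b. card (sel1 b)) bs) = numM bs" "sum_list (map (\<lambda>b. card (sel2 b)) bs) = numM bs"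
  proof (induction bs)
    case (Cons b bs)
    { case 1 then show ?case using Cons by (cases b) (auto simp: numM_def degM_def) }
    { case 2 then show ?case using Cons by (cases b) (auto simp: numM_def degM_def) }
    { case 3 then show ?case using Cons by (cases b) (auto simp: numM_def degM_def) }
    { case 4 then show ?case using Cons by (cases b) (auto simp: numM_def degM_def) }
  qed (auto simp: numM_def degM_def)
  then show "card (usel selN bs) = numM bs + degM bs" "card (usel selV bs) = tdim bs - degM bs"
    "card (usel sel1 bs) = numM bs" "card (usel sel2 bs) = numM bs"
    using card_usel[OF sel_subset(1)] card_usel[OF sel_subset(2)] card_usel[OF sel_subset(3)] card_usel[OF sel_subset(4)] by auto
qed

text \<open>Discarding elements of I allows every m up to the number of blocks M. Pencils of rank
  below r rely on this, as they have more than n - r such blocks.\<close>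

lemma block_diag_has_pattern:
  assumes "m \<le> numM bs"
  shows "has_pattern (tdim bs) m (degM bs) (lin_part 1 (block_diag bs)) (lin_part 0 (block_diag bs))"
proof -
  let ?n = "tdim bs"
  have "m + degM bs \<le> card (usel selN bs)" using assms card_usel_sel(1)[of bs] by simp
  then obtain I where I: "I \<subseteq> usel selN bs" "card I = m + degM bs" by (meson obtain_subset_with_card_n)
  have z: "block_diag bs $$ (i,j) = 0" if "i \<in> I" "j \<in> usel selV bs" for i j
  proof (rule usel_zero[OF sel_subset(1) sel_subset(2)])
    fix b i j assume "i \<in> selN b" "j \<in> selV b"
    then show "block_pencil b $$ (i,j) = 0" by (cases b) (auto simp: M_block_index)
  qed (use that I in auto)
  have sub: "I \<subseteq> usel selV bs" "usel selV bs \<subseteq> {..<?n}" using I usel_mono[of selN selV bs, OF sel_subset(5)] usel_subset[OF sel_subset(2), of bs] by auto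
  show ?thesis
  proof (rule has_patternI[of "1\<^sub>m ?n" _ I "usel selV bs"])
    have c: "lin_part k (block_diag bs) \<in> carrier_mat ?n ?n" for k using block_diag_carrier by simp
    show "\<forall>i\<in>I. \<forall>j\<in>usel selV bs. cmat (1\<^sub>m ?n) (lin_part 1 (block_diag bs)) $$ (i,j) = 0 \<and> cmat (1\<^sub>m ?n) (lin_part 0 (block_diag bs)) $$ (i,j) = 0"
    proof (intro ballI)
      fix i j assume ij: "i \<in> I" "j \<in> usel selV bs"
      then have "i < ?n" "j < ?n" using sub by auto
      then show "cmat (1\<^sub>m ?n) (lin_part 1 (block_diag bs)) $$ (i,j) = 0 \<and> cmat (1\<^sub>m ?n) (lin_part 0 (block_diag bs)) $$ (i,j) = 0"
        using cmat_one[OF c[of 1]] cmat_one[OF c[of 0]] z[OF ij] carrier_matD[OF block_diag_carrier[of bs]] by (simp add: lin_part_def)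
    qed
    show "m + 2 * degM bs \<le> ?n" using assms numM_degM_le[of bs] by simp
  qed (use I sub card_usel_sel in auto)
qed

section \<open>Bordered determinants of canonical forms\<close>

definition imat :: "nat \<Rightarrow> nat set \<Rightarrow> complex poly mat" where
  "imat n I = mat n n (\<lambda>(i,j). if i = j \<and> i \<in> I then 1 else 0)"

lemma imat_dim[simp]: "dim_row (imat n I) = n" "dim_col (imat n I) = n"
  by (simp_all add: imat_def)

lemma imat_outer:
  assumes "I \<subseteq> {..<n}" "card I = m"
  obtains U where "U \<in> carrier_mat n m" "outer U = imat n I"
proof -
  have fin: "finite I" using finite_subset[OF assms(1)] by simp
  obtain h where h: "bij_betw h {..<m} I" using ex_bij_betw_nat_finite[OF fin] assms(2) by (auto simp: atLeast0LessThan)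
  let ?U = "mat n m (\<lambda>(i,l). if i = h l then 1 else 0) :: complex mat"
  have "outer ?U = const_mat (?U * transpose_mat ?U)" by (rule outer_const[of _ n m]) simp
  also have "\<dots> = imat n I"
  proof (rule eq_matI)
    fix i j assume "i < dim_row (imat n I)" "j < dim_col (imat n I)"
    then have ij: "i < n" "j < n" by (auto simp: imat_def)
    have "(?U * transpose_mat ?U) $$ (i,j) = (\<Sum>l<m. if i = h l \<and> i = j then 1 else 0)"
      using ij mult_index[of ?U n m "transpose_mat ?U" n i j] by (auto intro!: sum.cong)
    also have "\<dots> = (\<Sum>x\<in>I. if i = x \<and> i = j then 1 else 0)"
      by (rule sum.reindex_bij_betw[OF h])
    also have "\<dots> = (if i = j \<and> i \<in> I then 1 else 0)" using fin by (cases "i = j") auto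
    finally show "const_mat (?U * transpose_mat ?U) $$ (i,j) = imat n I $$ (i,j)" using ij by (auto simp add: imat_def one_pCons)
  qed (auto simp: imat_def)
  finally show ?thesis using that[of ?U] by simp
qed

lemma det_block_diag_imat:
  assumes s: "\<And>b. s b \<subseteq> {..<bdim b}"
  shows "det (block_diag bs + imat (tdim bs) (usel s bs)) = prod_list (map (\<lambda>b. det (block_pencil b + imat (bdim b) (s b))) bs)"
proof (induction bs)
  case Nil
  have "block_diag [] + imat 0 {} \<in> carrier_mat 0 0" by (auto simp: block_diag_Nil imat_def)
  then show ?case by simp
next
  case (Cons b bs)
  have c: "block_pencil b + imat (bdim b) (s b) \<in> carrier_mat (bdim b) (bdim b)" "block_diag bs + imat (tdim bs) (usel s bs) \<in> carrier_mat (tdim bs) (tdim bs)"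
    using block_pencil_carrier block_diag_carrier by (auto simp: imat_def)
  have "block_diag (b # bs) + imat (tdim (b # bs)) (usel s (b # bs)) =
     four_block_mat (block_pencil b + imat (bdim b) (s b)) (0\<^sub>m (bdim b) (tdim bs)) (0\<^sub>m (tdim bs) (bdim b)) (block_diag bs + imat (tdim bs) (usel s bs))"
    (is "_ = ?R")
  proof (rule eq_matI)
    fix i j assume "i < dim_row ?R" "j < dim_col ?R"
    then have i: "i < bdim b + tdim bs" and j: "j < bdim b + tdim bs" using c by auto
    have d: "dim_row (block_diag (b#bs)) = bdim b + tdim bs" "dim_col (block_diag (b#bs)) = bdim b + tdim bs" using block_diag_carrier[of "b#bs"] by auto
    have dd: "dim_row (block_diag bs) = tdim bs" "dim_col (block_diag bs) = tdim bs" "dim_row (block_pencil b) = bdim b" "dim_col (block_pencil b) = bdim b" using block_diag_carrier[of bs] block_pencil_carrier[of b] by auto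
    from i show "(block_diag (b # bs) + imat (tdim (b # bs)) (usel s (b # bs))) $$ (i,j) = ?R $$ (i,j)"
    proof (cases rule: add_cases)
      case 1
      from j show ?thesis
        by (cases rule: add_cases) (use 1 s[of b] in \<open>auto simp: block_diag_index imat_def d dd\<close>)
    next
      case (2 k)
      from j show ?thesis
        by (cases rule: add_cases) (use 2 s[of b] in \<open>auto simp: block_diag_index imat_def d dd\<close>)
    qed
  qed (use block_diag_carrier[of "b#bs"] c in \<open>auto simp: imat_def\<close>)
  then show ?case using c Cons by (simp add: det_four_block_mat_lower_left_zero[of _ "bdim b" _ "tdim bs"])
qed

text \<open>The signs of \<open>pattern_det\<close> for a single block, where m = 1 and the core is
  empty; a polynomial with square 1, hence a constant.\<close>

definition unitM :: "nat \<Rightarrow> complex poly" where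
  "unitM d = anti_sign (1+d) 0 * (-1)"

lemma unitM_sq: "(unitM d)^2 = 1"
  by (simp add: unitM_def power_mult_distrib anti_sign_sq)

lemma det_M_block_imat:
  assumes u: "u < d + 1"
  shows "det (M_block d + imat (2*d+1) {u}) = unitM d * (det (mat (1+d) (1+d) (\<lambda>(i,j). if j < d then [:if i = j + 1 then 1 else 0, if i = j then 1 else 0:] else if i = u then 1 else 0)))^2"
proof -
  let ?n = "2*d+1"
  let ?U = "mat ?n 1 (\<lambda>(i,j). if i = u then 1 else 0) :: complex mat"
  have sy: "transpose_mat (M_block d) = M_block d"
    by (rule eq_matI) (use M_block_carrier[of d] block_pencil_sym[of _ "Block_M d"] in auto)
  have O: "outer ?U = imat ?n {u}"
  proof -
    have "outer ?U = const_mat (?U * transpose_mat ?U)" by (rule outer_const[of _ ?n 1]) simp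
    also have "\<dots> = imat ?n {u}"
      by (rule eq_matI) (auto simp: imat_def scalar_prod_def one_pCons)
    finally show ?thesis .
  qed
  have q: "?n - 1 - 2*d = 0" by simp
  have "sub_blk (M_block d) (1+d) (1+d) 0 0 \<in> carrier_mat 0 0" by simp
  then have d0: "det (sub_blk (M_block d) (1+d) (1+d) 0 0) = 1" by simp
  have B: "border_mat ?n 1 d (M_block d) ?U = mat (1+d) (1+d) (\<lambda>(i,j). if j < d then [:if i = j + 1 then 1 else 0, if i = j then 1 else 0:] else if i = u then 1 else 0)"
    by (rule eq_matI) (use u in \<open>auto simp: border_mat_def M_block_index L_block_index one_pCons\<close>)
  have "det (M_block d + outer ?U) = anti_sign (1+d) (?n-1-2*d) * (-1)^1 * det (sub_blk (M_block d) (1+d) (1+d) (?n-1-2*d) (?n-1-2*d)) * (det (border_mat ?n 1 d (M_block d) ?U))^2"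
    by (rule pattern_det[OF M_block_carrier sy]) (auto simp: M_block_index)
  then show ?thesis unfolding O q d0 B unitM_def by simp
qed

text \<open>A unit vector at the end d of the chain leaves a lower triangular border matrix with d
  diagonal entries \<lambda>.\<close>

lemma det_M_block_last: "det (M_block d + imat (2*d+1) {d}) = unitM d * monom 1 (2*d)"
proof -
  let ?X = "mat (1+d) (1+d) (\<lambda>(i,j). if j < d then [:if i = j + 1 then 1 else 0, if i = j then 1 else 0:] else if i = d then 1 else 0) :: complex poly mat"
  have "det ?X = prod_list (diag_mat ?X)"
    by (rule det_lower_triangular[of "1+d"]) auto
  also have "diag_mat ?X = map (\<lambda>_. monom 1 1) [0..<d] @ [1]"
    unfolding diag_mat_def by (auto simp: monom_altdef)
  also have "prod_list \<dots> = monom 1 d" by (simp add: map_replicate_const monom_power)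
  finally have "(det ?X)^2 = monom 1 (2*d)" by (simp add: monom_power mult.commute)
  then show ?thesis using det_M_block_imat[of d d] by simp
qed

text \<open>With the unit vector at the end 0, moving the last column to the front makes the border
  matrix upper unitriangular; the sign of this cyclic shift enters squared.\<close>

lemma det_M_block_first: "det (M_block d + imat (2*d+1) {0}) = unitM d"
proof -
  let ?X = "mat (1+d) (1+d) (\<lambda>(i,j). if j < d then [:if i = j + 1 then 1 else 0, if i = j then 1 else 0:] else if i = 0 then 1 else 0) :: complex poly mat"
  let ?T = "mat (1+d) (1+d) (\<lambda>(i,j). if j = 0 then if i = 0 then 1 else 0 else [:if i = j then 1 else 0, if i + 1 = j then 1 else 0:]) :: complex poly mat"
  let ?s = "\<lambda>j. if j < d then j + 1 else 0 :: nat"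
  have bij: "bij_betw ?s {..<1+d} {..<1+d}"
    by (rule bij_betwI[of _ _ _ "\<lambda>j. if j = 0 then d else j - 1"]) auto
  have "?X = ?T * perm_mat (1+d) ?s"
  proof (rule eq_matI)
    fix i j assume "i < dim_row (?T * perm_mat (1+d) ?s)" "j < dim_col (?T * perm_mat (1+d) ?s)"
    then have ij: "i < 1+d" "j < 1+d" by (auto simp: perm_mat_def)
    have "(?T * perm_mat (1+d) ?s) $$ (i,j) = (\<Sum>x<1+d. ?T $$ (i,x) * perm_mat (1+d) ?s $$ (x,j))"
      using ij by (intro mult_index) auto
    also have "\<dots> = (\<Sum>x<1+d. if x = ?s j then ?T $$ (i,x) else 0)"
      using ij by (intro sum.cong) (auto simp: perm_mat_def)
    also have "\<dots> = ?T $$ (i, ?s j)" using ij by (subst sum.delta) auto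
    also have "\<dots> = ?X $$ (i,j)" using ij by auto
    finally show "?X $$ (i,j) = (?T * perm_mat (1+d) ?s) $$ (i,j)" ..
  qed (auto simp: perm_mat_def)
  moreover have "det ?T = 1"
  proof -
    have "det ?T = prod_list (diag_mat ?T)" by (rule det_upper_triangular[of _ "1+d"]) auto
    also have "diag_mat ?T = map (\<lambda>_. 1) [0..<1+d]" unfolding diag_mat_def by (auto simp: one_pCons)
    also have "prod_list \<dots> = 1" by (simp add: map_replicate_const)
    finally show ?thesis .
  qed
  ultimately have "(det ?X)^2 = 1" using det_perm_mat_sq[OF bij, where 'a="complex poly"]
    by (simp add: det_mult[of _ "1+d"])
  then show ?thesis using det_M_block_imat[of 0 d] by simp
qed

lemma det_pencil_nz:
  assumes "A \<in> carrier_mat n n" "B \<in> carrier_mat n n" "det A \<noteq> 0 \<or> det B \<noteq> 0"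
  shows "det (pencil A B) \<noteq> 0"
proof
  assume z: "det (pencil A B) = 0"
  have ev: "det (t \<cdot>\<^sub>m A + B) = 0" for t
    using assms det_eval_mat[of "pencil A B" n t] z by (simp add: eval_pencil)
  have "0 \<cdot>\<^sub>m A + B = B" using assms by (intro eq_matI) auto
  then have dB: "det B = 0" using ev[of 0] by simp
  have "det A \<noteq> 0" using dB assms by simp
  then have "finite (UNIV :: complex set)" using det_pencil_finite[OF assms(1,2)] ev by simp
  then show False using infinite_UNIV_char_0 by blast
qed

lemma block_pencil_pencil: "pencil (lin_part 1 (block_pencil b)) (lin_part 0 (block_pencil b)) = block_pencil b"
  by (rule pencil_lin_part[OF block_pencil_carrier]) (use block_pencil_degree in auto)

lemma det_Jm: "det (Jm p) \<noteq> 0" by (rule inverse_det_nz[OF _ _ Jm_sq]) auto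

text \<open>One coefficient is the invertible antidiagonal matrix \<open>Jm\<close>: the leading one
  for a finite eigenvalue, the constant one at infinity.\<close>

lemma det_J_nz: "det (block_pencil (Block_J e l)) \<noteq> 0"
proof -
  have "lin_part (if e = Infinite then 0 else 1) (block_pencil (Block_J e l)) = Jm l"
    by (cases e; rule eq_matI) (auto simp: lin_part_def J_block_def J_inf_block_def Jm_def)
  then have "det (lin_part 1 (block_pencil (Block_J e l))) \<noteq> 0 \<or> det (lin_part 0 (block_pencil (Block_J e l))) \<noteq> 0"
    using det_Jm[of l] by (cases "e = Infinite") auto
  then show ?thesis
    using det_pencil_nz[of "lin_part 1 (block_pencil (Block_J e l))" l "lin_part 0 (block_pencil (Block_J e l))"]
      block_pencil_carrier[of "Block_J e l"] block_pencil_pencil[of "Block_J e l"] by simp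
qed

text \<open>The determinant of a block bordered according to \<open>sel1\<close>; a regular block
  receives no border.\<close>

fun cdet :: "eigval block \<Rightarrow> complex poly" where
  "cdet (Block_M d) = unitM d" | "cdet (Block_J e l) = det (block_pencil (Block_J e l))"

lemma cdet_nz: "cdet b \<noteq> 0"
proof (cases b)
  case (Block_M d)
  then show ?thesis using unitM_sq[of d] by auto
next
  case (Block_J e l)
  then show ?thesis using det_J_nz[of e l] by simp
qed

lemma block_diag_sel_dets:
  "det (block_diag bs + imat (tdim bs) (usel sel1 bs)) = prod_list (map cdet bs)"
  "det (block_diag bs + imat (tdim bs) (usel sel2 bs)) = prod_list (map cdet bs) * monom 1 (2 * degM bs)"
proof -
  have J: "det (block_pencil (Block_J e l) + imat l {}) = cdet (Block_J e l)" for e l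
  proof -
    have "block_pencil (Block_J e l) + imat l {} = block_pencil (Block_J e l)"
      using block_pencil_carrier[of "Block_J e l"] by (intro eq_matI) (auto simp: imat_def)
    then show ?thesis by simp
  qed
  have "det (block_pencil b + imat (bdim b) (sel1 b)) = cdet b" for b
    using det_M_block_first J by (cases b) (auto simp del: block_pencil.simps(2,3))
  then show "det (block_diag bs + imat (tdim bs) (usel sel1 bs)) = prod_list (map cdet bs)"
    using det_block_diag_imat[OF sel_subset(3), of bs] by simp
  have "det (block_pencil b + imat (bdim b) (sel2 b)) = cdet b * monom 1 (2 * bdeg b)" for b
    using det_M_block_last J by (cases b) (auto simp: one_pCons[symmetric] monom_0 simp del: block_pencil.simps(2,3))
  then have "det (block_diag bs + imat (tdim bs) (usel sel2 bs)) = prod_list (map (\<lambda>b. cdet b * monom 1 (2 * bdeg b)) bs)"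
    using det_block_diag_imat[OF sel_subset(4), of bs] by simp
  also have "\<dots> = prod_list (map cdet bs) * monom 1 (2 * degM bs)"
    by (induction bs) (auto simp: degM_def mult_monom add_mult_distrib2 monom_0 one_pCons mult_ac mult_monom[symmetric, of 1 _ 1, simplified])
  finally show "det (block_diag bs + imat (tdim bs) (usel sel2 bs)) = prod_list (map cdet bs) * monom 1 (2 * degM bs)" .
qed

lemma block_diag_test_mats:
  obtains U1 U2 where "U1 \<in> carrier_mat (tdim bs) (numM bs)" "U2 \<in> carrier_mat (tdim bs) (numM bs)"
    "det (block_diag bs + outer U1) = prod_list (map cdet bs)"
    "det (block_diag bs + outer U2) = prod_list (map cdet bs) * monom 1 (2 * degM bs)"
proof -
  obtain U1 where U1: "U1 \<in> carrier_mat (tdim bs) (numM bs)" "outer U1 = imat (tdim bs) (usel sel1 bs)"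
    by (rule imat_outer[OF usel_subset[OF sel_subset(3)] card_usel_sel(3)])
  obtain U2 where U2: "U2 \<in> carrier_mat (tdim bs) (numM bs)" "outer U2 = imat (tdim bs) (usel sel2 bs)"
    by (rule imat_outer[OF usel_subset[OF sel_subset(4)] card_usel_sel(4)])
  show ?thesis using that[OF U1(1) U2(1)] U1(2) U2(2) block_diag_sel_dets[of bs] by simp
qed

lemma block_diag_test_pair: "test_pair (tdim bs) (numM bs) (degM bs) (lin_part 1 (block_diag bs)) (lin_part 0 (block_diag bs))"
proof -
  obtain U1 U2 where U: "U1 \<in> carrier_mat (tdim bs) (numM bs)" "U2 \<in> carrier_mat (tdim bs) (numM bs)"
    "det (block_diag bs + outer U1) = prod_list (map cdet bs)"
    "det (block_diag bs + outer U2) = prod_list (map cdet bs) * monom 1 (2 * degM bs)" by (rule block_diag_test_mats)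
  have "prod_list (map cdet bs) \<noteq> 0" using cdet_nz by (induction bs) auto
  then show ?thesis unfolding test_pair_def block_diag_pencil using U by (intro bexI[of _ U1] bexI[of _ U2]) auto
qed

text \<open>Each form carries a test pair and a pattern with its own numbers. Transported to a
  common pair of matrices, the test pair of one form bounds the pattern of the other, in both
  directions.\<close>

lemma block_diag_invariants:
  assumes "tdim bs = tdim bs'" "W \<in> carrier_mat (tdim bs) (tdim bs)" "det W \<noteq> 0"
    "cmat W (lin_part 1 (block_diag bs)) = lin_part 1 (block_diag bs')" "cmat W (lin_part 0 (block_diag bs)) = lin_part 0 (block_diag bs')"
  shows "numM bs = numM bs' \<and> degM bs = degM bs'"
proof -
  let ?n = "tdim bs"
  let ?A = "lin_part 1 (block_diag bs)" let ?B = "lin_part 0 (block_diag bs)"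
  let ?A' = "lin_part 1 (block_diag bs')" let ?B' = "lin_part 0 (block_diag bs')"
  have c: "?A \<in> carrier_mat ?n ?n" "?B \<in> carrier_mat ?n ?n" "?A' \<in> carrier_mat ?n ?n" "?B' \<in> carrier_mat ?n ?n"
    using block_diag_carrier[of bs] block_diag_carrier[of bs'] assms(1) by simp_all
  have t: "test_pair ?n (numM bs) (degM bs) ?A' ?B'"
    using test_pair_cmat[OF c(1,2) assms(2,3) block_diag_test_pair] assms(4,5) by simp
  have t': "test_pair ?n (numM bs') (degM bs') ?A' ?B'" using block_diag_test_pair[of bs'] assms(1) by simp
  have p': "has_pattern ?n (numM bs') (degM bs') ?A' ?B'" using block_diag_has_pattern[of "numM bs'" bs'] assms(1) by simp
  have pb: "has_pattern ?n (numM bs) (degM bs) ?A ?B" using block_diag_has_pattern[of "numM bs" bs] by simp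
  obtain V where V: "V \<in> carrier_mat ?n ?n" "W * V = 1\<^sub>m ?n" "V * W = 1\<^sub>m ?n" "det V \<noteq> 0" by (rule det_nz_inverse[OF assms(2,3)])
  have "cmat V ?A' = ?A" "cmat V ?B' = ?B" using cmat_cancel[OF _ assms(2) V(1,2)] c assms(4,5) by metis+
  then have p: "has_pattern ?n (numM bs) (degM bs) ?A' ?B'" using has_pattern_cmat[OF c(3,4) V(1,4)] pb by simp
  note l = test_pair_pattern[OF c(3) block_diag_sym c(4) block_diag_sym]
  show ?thesis using l[OF t p'] l[OF t' p] by auto
qed

section \<open>The canonical form \<open>K\<^sub>a\<close>\<close>

text \<open>The block number of a coordinate and its position within that block; the clause for the
  empty list is a dummy value for indices out of range.\<close>

fun lab :: "'e block list \<Rightarrow> nat \<Rightarrow> nat \<times> nat" where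
  "lab [] i = (0, i)"
| "lab (b # bs) i = (if i < bdim b then (0, i) else (let (c,x) = lab bs (i - bdim b) in (Suc c, x)))"

definition labels :: "'e block list \<Rightarrow> (nat \<times> nat) set" where
  "labels bs = (SIGMA c:{..<length bs}. {..<bdim (bs ! c)})"

lemma lab_bij: "bij_betw (lab bs) {..<tdim bs} (labels bs)"
proof (induction bs)
  case Nil
  then show ?case by (simp add: labels_def bij_betw_def)
next
  case (Cons b bs)
  have inj: "inj_on (lab bs) {..<tdim bs}" and img: "lab bs ` {..<tdim bs} = labels bs" using Cons by (auto simp: bij_betw_def)
  have split: "{..<tdim (b # bs)} = {..<bdim b} \<union> (+) (bdim b) ` {..<tdim bs}"
    by (auto elim!: add_cases)
  have l2: "lab (b # bs) (bdim b + k) = (Suc (fst (lab bs k)), snd (lab bs k))" for k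
    by (simp add: case_prod_beta Let_def)
  have i1: "lab (b # bs) ` {..<bdim b} = {0} \<times> {..<bdim b}" by auto
  have i2: "lab (b # bs) ` (+) (bdim b) ` {..<tdim bs} = (\<lambda>(c,x). (Suc c, x)) ` labels bs"
    unfolding img[symmetric] image_image l2 by (simp add: case_prod_beta)
  have "lab (b # bs) ` {..<tdim (b # bs)} = {0} \<times> {..<bdim b} \<union> (\<lambda>(c,x). (Suc c, x)) ` labels bs"
    unfolding split image_Un i1 i2 ..
  also have "\<dots> = labels (b # bs)"
  proof -
    have "(c, x) \<in> {0} \<times> {..<bdim b} \<union> (\<lambda>(c,x). (Suc c, x)) ` labels bs \<longleftrightarrow> (c, x) \<in> labels (b # bs)" for c x
      by (cases c) (auto simp: labels_def image_iff)
    then show ?thesis by (intro subset_antisym subsetI) (metis surj_pair)+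
  qed
  finally have im: "lab (b # bs) ` {..<tdim (b # bs)} = labels (b # bs)" .
  have "inj_on (lab (b # bs)) {..<tdim (b # bs)}"
  proof (rule inj_onI)
    fix i j assume ij: "i \<in> {..<tdim (b # bs)}" "j \<in> {..<tdim (b # bs)}" "lab (b # bs) i = lab (b # bs) j"
    then have i: "i < bdim b + tdim bs" and j: "j < bdim b + tdim bs" by auto
    from i show "i = j"
    proof (cases rule: add_cases)
      case 1
      from j show ?thesis by (cases rule: add_cases) (use 1 ij(3) l2 in auto)
    next
      case (2 k)
      from j show ?thesis
      proof (cases rule: add_cases)
        case 1
        then show ?thesis using 2 ij(3) l2 by auto
      next
        case (2 l)
        then have "lab bs k = lab bs l" using ij(3) \<open>i = bdim b + k\<close> l2 by (simp add: prod_eq_iff)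
        then show ?thesis using inj \<open>k < tdim bs\<close> 2 \<open>i = bdim b + k\<close> by (auto dest: inj_onD)
      qed
    qed
  qed
  then show ?case using im unfolding bij_betw_def by (rule conjI)
qed

definition lab_entry :: "eigval block list \<Rightarrow> nat \<times> nat \<Rightarrow> nat \<times> nat \<Rightarrow> complex poly" where
  "lab_entry bs p q = (if fst p = fst q then block_pencil (bs ! fst p) $$ (snd p, snd q) else 0)"

lemma block_diag_lab:
  "i < tdim bs \<Longrightarrow> j < tdim bs \<Longrightarrow> block_diag bs $$ (i,j) = lab_entry bs (lab bs i) (lab bs j)"
proof (induction bs arbitrary: i j)
  case (Cons b bs)
  from Cons.prems have i: "i < bdim b + tdim bs" and j: "j < bdim b + tdim bs" by auto
  have l2: "lab (b # bs) (bdim b + k) = (Suc (fst (lab bs k)), snd (lab bs k))" for k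
    by (simp add: case_prod_beta Let_def)
  from i show ?case
  proof (cases rule: add_cases)
    case 1
    from j show ?thesis by (cases rule: add_cases) (use 1 in \<open>simp_all add: block_diag_index l2 lab_entry_def del: lab.simps(2), simp_all add: case_prod_beta Let_def\<close>)
  next
    case (2 k)
    from j show ?thesis
    proof (cases rule: add_cases)
      case 1
      then show ?thesis using 2 by (simp add: block_diag_index l2 lab_entry_def del: lab.simps(2)) (simp add: case_prod_beta Let_def)
    next
      case (2 l)
      then show ?thesis using \<open>k < tdim bs\<close> \<open>i = bdim b + k\<close> Cons.IH[of k l]
        unfolding \<open>i = bdim b + k\<close> 2 l2 by (simp add: block_diag_index lab_entry_def)
    qed
  qed
qed simp

definition K_list :: "nat \<Rightarrow> nat \<Rightarrow> nat \<Rightarrow> (nat \<Rightarrow> complex) \<Rightarrow> eigval block list" where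
  "K_list n r a \<mu> = (let \<alpha> = a div (n - r); s = a mod (n - r) in
     replicate s (Block_M (\<alpha> + 1)) @ replicate (n - r - s) (Block_M \<alpha>) @
       map (\<lambda>i. Block_J (Finite (\<mu> i)) 1) [1..<r - 2 * a + 1])"

lemma K_pencil_list: "K_pencil n r a \<mu> = block_diag (K_list n r a \<mu>)"
  by (simp add: K_pencil_def K_list_def Let_def)

lemma K_list_nth:
  assumes "r < n"
  shows "c < n - r \<Longrightarrow> K_list n r a \<mu> ! c = Block_M (if c < a mod (n-r) then a div (n-r) + 1 else a div (n-r))"
    "t < r - 2*a \<Longrightarrow> K_list n r a \<mu> ! (n - r + t) = Block_J (Finite (\<mu> (t+1))) 1"
    "length (K_list n r a \<mu>) = (n - r) + (r - 2*a)"
proof -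
  have s: "a mod (n-r) < n - r" using assms by simp
  show "K_list n r a \<mu> ! c = Block_M (if c < a mod (n-r) then a div (n-r) + 1 else a div (n-r))" if "c < n - r"
    using that s by (auto simp: K_list_def Let_def nth_append)
  show "K_list n r a \<mu> ! (n - r + t) = Block_J (Finite (\<mu> (t+1))) 1" if "t < r - 2*a"
  proof -
    let ?p = "replicate (a mod (n-r)) (Block_M (a div (n-r) + 1)) @ replicate (n - r - a mod (n-r)) (Block_M (a div (n-r))) :: eigval block list"
    let ?q = "map (\<lambda>i. Block_J (Finite (\<mu> i)) 1) [1..<r - 2 * a + 1]"
    have "(?p @ ?q) ! (length ?p + t) = ?q ! t" by (rule nth_append_length_plus)
    moreover have "length ?p = n - r" using s by simp
    moreover have "?q ! t = Block_J (Finite (\<mu> (t+1))) 1" using that by (simp del: upt_Suc)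
    ultimately show ?thesis by (simp add: K_list_def Let_def)
  qed
  show "length (K_list n r a \<mu>) = (n - r) + (r - 2*a)" using s by (simp add: K_list_def Let_def)
qed

lemma K_list_size:
  assumes "r < n" "2 * a \<le> r"
  shows "tdim (K_list n r a \<mu>) = n" "numM (K_list n r a \<mu>) = n - r" "degM (K_list n r a \<mu>) = a"
proof -
  define m where "m = n - r" define \<alpha> where "\<alpha> = a div m" define s where "s = a mod m"
  have s: "s < m" and a: "a = m * \<alpha> + s" using assms by (auto simp: m_def \<alpha>_def s_def)
  have K: "K_list n r a \<mu> = replicate s (Block_M (\<alpha> + 1)) @ replicate (m - s) (Block_M \<alpha>) @ map (\<lambda>i. Block_J (Finite (\<mu> i)) 1) [1..<r - 2 * a + 1]"
    by (simp add: K_list_def Let_def m_def \<alpha>_def s_def)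
  have e: "s * (\<alpha> + 1) + (m - s) * \<alpha> = a" 
  proof -
    have "s * (\<alpha> + 1) + (m - s) * \<alpha> = s + (s + (m - s)) * \<alpha>" by (simp add: algebra_simps)
    then show ?thesis using s a by simp
  qed
  show n2: "numM (K_list n r a \<mu>) = n - r" using s by (simp add: K numM_def m_def filter_map o_def)
  show d: "degM (K_list n r a \<mu>) = a" using e by (simp add: K degM_def sum_list_replicate o_def sum_list_triv)
  have "tdim bs = numM bs + 2 * degM bs + sum_list (map (\<lambda>b. if is_M b then 0 else bdim b) bs)" for bs :: "eigval block list"
  proof (induction bs)
    case (Cons b bs)
    then show ?case by (cases b) (auto simp: numM_def degM_def)
  qed (simp add: numM_def degM_def)
  from this[of "K_list n r a \<mu>"] have "tdim (K_list n r a \<mu>) = (n - r) + 2 * a + (r - 2 * a)"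
    unfolding n2 d by (simp add: K sum_list_replicate o_def sum_list_triv del: upt_Suc)
  then show "tdim (K_list n r a \<mu>) = n" using assms by simp
qed

lemma pencil_KAB_index:
  "x < n \<Longrightarrow> y < n \<Longrightarrow> pencil (KA n m a) (KB n m a \<mu>) $$ (x,y) = [:KB n m a \<mu> $$ (x,y), KA n m a $$ (x,y):]"
  by (rule pencil_index) auto

text \<open>The residue class c modulo m has \<open>a div m\<close> elements below a, and one more
  if \<open>c < a mod m\<close>; \<open>i div m\<close> is the place of i within its class.\<close>

lemma div_bound:
  assumes "0 < m" "i < a"
  shows "i div m < (if i mod m < a mod m then a div m + 1 else a div (m::nat))"
proof -
  have "i div m \<le> a div m" using assms(2) by (simp add: div_le_mono)
  moreover have "i mod m < a mod m" if "i div m = a div m"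
  proof -
    show ?thesis using assms(2) that mult_div_mod_eq[of m i] mult_div_mod_eq[of m a] by (metis add_less_cancel_left)
  qed
  ultimately show ?thesis by (cases "i div m = a div m") auto
qed

text \<open>Every class has exactly one element more below m + a than below a.\<close>

lemma div_bound2:
  assumes "0 < m" "j < m + a"
  shows "j div m \<le> (if j mod m < a mod m then a div m + 1 else a div (m::nat))"
proof (cases "j < m")
  case False
  then have "(j - m) div m < (if (j - m) mod m < a mod m then a div m + 1 else a div m)" using assms by (intro div_bound) auto
  moreover have "j div m = (j - m) div m + 1" "(j - m) mod m = j mod m" using False assms(1) by (auto simp: le_div_geq le_mod_geq)
  ultimately show ?thesis by auto
qed simp

text \<open>Vertex \<open>b\<^sub>j\<close> of the staircase form belongs to the chain of the residue class of \<open>j\<close> modulo \<open>n - r\<close>.\<close>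

lemma K_list_perm:
  assumes r: "r < n" and a: "2 * a \<le> r"
  obtains W where "W \<in> carrier_mat n n" "det W \<noteq> 0"
    "KA n (n-r) a = cmat W (lin_part 1 (block_diag (K_list n r a \<mu>)))"
    "KB n (n-r) a (\<lambda>t. \<mu> (t+1)) = cmat W (lin_part 0 (block_diag (K_list n r a \<mu>)))"
proof -
  define m where "m = n - r"
  let ?bs = "K_list n r a \<mu>"
  \<comment> \<open>The degree of the singular block number c in \<open>K_list\<close>.\<close>
  define d where "d c = (if c < a mod m then a div m + 1 else a div m)" for c
  have m: "0 < m" and mn: "m + 2 * a \<le> n" and rm: "r - 2*a = n - m - 2*a" using r a by (auto simp: m_def)
  have bM: "?bs ! c = Block_M (d c)" if "c < m" for c using K_list_nth(1)[OF r] that by (simp add: m_def d_def)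
  have bJ: "?bs ! (m + t) = Block_J (Finite (\<mu> (t+1))) 1" if "t < n - m - 2*a" for t using K_list_nth(2)[OF r, of t a \<mu>, folded m_def, unfolded rm] that by blast
  have len: "length ?bs = m + (n - m - 2*a)" by (rule K_list_nth(3)[OF r, of a \<mu>, folded m_def, unfolded rm])
  have td: "tdim ?bs = n" by (rule K_list_size(1)[OF r a])
  \<comment> \<open>Coordinates below m + a are counted downwards by j = m + a - 1 - x and fill the
    first d + 1 positions of the chains; those from n - a on are counted upwards by i = x - (n - a)
    and fill the other d positions; those in between are the eigenvalue blocks.\<close>
  define g where "g x = (if x < m + a then ((m+a-1-x) mod m, (m+a-1-x) div m) else if x < n - a then (m + (x - (m+a)), 0)
     else ((x - (n-a)) mod m, d ((x - (n-a)) mod m) + 1 + (x - (n-a)) div m))" for x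
  have gb: "g (m+a-1-j) = (j mod m, j div m)" "m+a-1-j < m + a" if "j < m + a" for j using that by (auto simp: g_def)
  have cases: thesis if "x < n" "\<And>j. j < m + a \<Longrightarrow> x = m+a-1-j \<Longrightarrow> thesis" "\<And>t. t < n - m - 2*a \<Longrightarrow> x = m + a + t \<Longrightarrow> thesis"
    "\<And>i. i < a \<Longrightarrow> x = n - a + i \<Longrightarrow> thesis" for x thesis
  proof -
    consider "x < m + a" | "m + a \<le> x" "x < n - a" | "n - a \<le> x" by linarith
    then show thesis
    proof cases
      case 1 then show ?thesis using that(2)[of "m+a-1-x"] by auto
    next
      case 2 then show ?thesis using that(3)[of "x-(m+a)"] mn by auto
    next
      case 3 then show ?thesis using that(4)[of "x-(n-a)"] that(1) mn by auto
    qed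
  qed
  have gm: "g (m+a+t) = (m + t, 0)" if "t < n - m - 2*a" for t using that by (simp add: g_def)
  have gz: "g (n-a+i) = (i mod m, d (i mod m) + 1 + i div m)" if "i < a" for i
  proof -
    have "\<not> n - a + i < m + a" "\<not> n - a + i < n - a" "n - a + i - (n - a) = i" using mn by linarith+
    then show ?thesis by (simp only: g_def if_False)
  qed
  have db: "j div m \<le> d (j mod m)" if "j < m + a" for j using div_bound2[OF m that] by (simp add: d_def)
  have dz: "i div m < d (i mod m)" if "i < a" for i using div_bound[OF m that] by (simp add: d_def)
  have modm: "i mod m < m" for i using m by simp
  have dm: "i = j" if "i mod m = j mod m" "i div m = j div m" for i j
  proof -
    have "i = m * (i div m) + i mod m" by (rule mult_div_mod_eq[symmetric])
    also have "\<dots> = m * (j div m) + j mod m" unfolding that ..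
    also have "\<dots> = j" by (rule mult_div_mod_eq)
    finally show ?thesis .
  qed
  have sub: "g x \<in> labels ?bs" if "x < n" for x
    using that
  proof (rule cases)
    fix j assume j: "j < m + a" "x = m+a-1-j"
    show ?thesis unfolding j(2) gb(1)[OF j(1)] labels_def using modm[of j] bM[OF modm[of j]] db[OF j(1)] len by (auto simp: less_Suc_eq_le)
  next
    fix t assume t: "t < n - m - 2*a" "x = m + a + t"
    show ?thesis unfolding t(2) gm[OF t(1)] labels_def using bJ[OF t(1)] len t by auto
  next
    fix i assume i: "i < a" "x = n - a + i"
    show ?thesis unfolding i(2) gz[OF i(1)] labels_def using modm[of i] bM[OF modm[of i]] dz[OF i(1)] len by auto
  qed
  have inj: "inj_on g {..<n}"
  proof (rule inj_onI)
    fix x y assume xy: "x \<in> {..<n}" "y \<in> {..<n}" "g x = g y"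
    from xy(1) have "x < n" by simp
    then show "x = y"
    proof (rule cases)
      fix j assume j: "j < m + a" "x = m+a-1-j"
      from xy(2) have "y < n" by simp
      then show ?thesis
      proof (rule cases)
        fix j' assume j': "j' < m + a" "y = m+a-1-j'"
        then show ?thesis using xy(3) j gb(1) dm[of j j'] by auto
      next
        fix t assume t: "t < n - m - 2*a" "y = m + a + t"
        then show ?thesis using xy(3) gb(1)[OF j(1)] j gm[OF t(1)] modm[of j] by auto
      next
        fix i assume i: "i < a" "y = n - a + i"
        then show ?thesis using xy(3) gb(1)[OF j(1)] j gz[OF i(1)] db[OF j(1)] by auto
      qed
    next
      fix t assume t: "t < n - m - 2*a" "x = m + a + t"
      from xy(2) have "y < n" by simp
      then show ?thesis
      proof (rule cases)
        fix j assume j: "j < m + a" "y = m+a-1-j"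
        then show ?thesis using xy(3) gb(1)[OF j(1)] t gm[OF t(1)] modm[of j] by auto
      next
        fix t' assume t': "t' < n - m - 2*a" "y = m + a + t'"
        then show ?thesis using xy(3) t gm by auto
      next
        fix i assume i: "i < a" "y = n - a + i"
        then show ?thesis using xy(3) t gm[OF t(1)] gz[OF i(1)] modm[of i] by auto
      qed
    next
      fix i assume i: "i < a" "x = n - a + i"
      from xy(2) have "y < n" by simp
      then show ?thesis
      proof (rule cases)
        fix j assume j: "j < m + a" "y = m+a-1-j"
        then show ?thesis using xy(3) gb(1)[OF j(1)] i gz[OF i(1)] db[OF j(1)] by auto
      next
        fix t assume t: "t < n - m - 2*a" "y = m + a + t"
        then show ?thesis using xy(3) i gm[OF t(1)] gz[OF i(1)] modm[of i] by auto
      next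
        fix i' assume i': "i' < a" "y = n - a + i'"
        then show ?thesis using xy(3) i gz dm[of i i'] by auto
      qed
    qed
  qed
  have lb: "bij_betw (lab ?bs) {..<n} (labels ?bs)" using lab_bij[of ?bs] td by simp
  have finL: "finite (labels ?bs)" by (auto simp: labels_def)
  have "card (labels ?bs) = n" using bij_betw_same_card[OF lb] by simp
  then have "g ` {..<n} = labels ?bs"
    by (intro card_subset_eq[OF finL]) (use sub card_image[OF inj] in auto)
  then have gbij: "bij_betw g {..<n} (labels ?bs)" using inj by (simp add: bij_betw_def)
  define \<sigma> where "\<sigma> = the_inv_into {..<n} (lab ?bs) \<circ> g"
  have sbij: "bij_betw \<sigma> {..<n} {..<n}" unfolding \<sigma>_def
    by (rule bij_betw_trans[OF gbij bij_betw_the_inv_into[OF lb]])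
  have lab_s: "lab ?bs (\<sigma> x) = g x" if "x < n" for x
    using f_the_inv_into_f_bij_betw[OF lb] sub[OF that] by (simp add: \<sigma>_def)
  have sn: "\<sigma> x < n" if "x < n" for x using sbij that by (auto simp: bij_betw_def)
  have Mb: "lab_entry ?bs (c,k) (c,l) = M_block (d c) $$ (k,l)" if "c < m" for c k l using bM[OF that] by (simp add: lab_entry_def)
  \<comment> \<open>Row i of the block L has \<lambda> at j = i and 1 at j = i + m, the next element
    of the same residue class.\<close>
  have bz: "lab_entry ?bs (j mod m, j div m) (i mod m, d (i mod m) + 1 + i div m) = [:if j = i + m then 1 else 0, if j = i then 1 else 0:]"
    and zb: "lab_entry ?bs (i mod m, d (i mod m) + 1 + i div m) (j mod m, j div m) = [:if j = i + m then 1 else 0, if j = i then 1 else 0:]"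
    if i: "i < a" and j: "j < m + a" for i j
  proof -
    have im: "j = i + m \<longleftrightarrow> j mod m = i mod m \<and> j div m = i div m + 1"
      using m dm[of j "i+m"] by auto
    have ij: "j = i \<longleftrightarrow> j mod m = i mod m \<and> j div m = i div m" using dm[of j i] by blast
    have le: "j div m < d (i mod m) + 1" if "j mod m = i mod m" using db[OF j] that by simp
    show "lab_entry ?bs (j mod m, j div m) (i mod m, d (i mod m) + 1 + i div m) = [:if j = i + m then 1 else 0, if j = i then 1 else 0:]"
    proof (cases "j mod m = i mod m")
      case True
      show ?thesis unfolding True Mb[OF modm] using le[OF True] dz[OF i] im ij True
        by (simp add: M_block_index L_block_index)
    next
      case False
      then show ?thesis using im ij by (auto simp: lab_entry_def)
    qed
    show "lab_entry ?bs (i mod m, d (i mod m) + 1 + i div m) (j mod m, j div m) = [:if j = i + m then 1 else 0, if j = i then 1 else 0:]"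
    proof (cases "j mod m = i mod m")
      case True
      show ?thesis unfolding True Mb[OF modm] using le[OF True] dz[OF i] im ij True
        by (simp add: M_block_index L_block_index)
    next
      case False
      then show ?thesis using im ij by (auto simp: lab_entry_def)
    qed
  qed
  \<comment> \<open>On the staircase side, j = i is the antidiagonal of \<open>KA\<close> and j = i
    + m that of \<open>KB\<close>.\<close>
  have arith: "x + y + 1 = n + m \<longleftrightarrow> j = i" "x + y + 1 = n \<longleftrightarrow> j = i + m" "n \<le> y + a" "j = i + m \<Longrightarrow> x < a" "x \<noteq> y" "\<not> y < a"
    if "i < a" "j < m + a" "x = m+a-1-j" "y = n - a + i" for x y i j
    using that mn by linarith+
  let ?P = "pencil (KA n m a) (KB n m a (\<lambda>t. \<mu> (t+1)))"
  have ent: "?P $$ (x,y) = lab_entry ?bs (g x) (g y)" if xy: "x < n" "y < n" for x y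
    unfolding pencil_KAB_index[OF xy] using xy(1)
  proof (rule cases)
    fix j assume j: "j < m + a" "x = m+a-1-j"
    show "[:KB n m a (\<lambda>t. \<mu> (t+1)) $$ (x,y), KA n m a $$ (x,y):] = lab_entry ?bs (g x) (g y)" using xy(2)
    proof (rule cases)
      fix j' assume j': "j' < m + a" "y = m+a-1-j'"
      have "lab_entry ?bs (g x) (g y) = 0"
        unfolding j(2) j'(2) gb(1)[OF j(1)] gb(1)[OF j'(1)]
      proof (cases "j mod m = j' mod m")
        case True
        show "lab_entry ?bs (j mod m, j div m) (j' mod m, j' div m) = 0"
          unfolding True Mb[OF modm] using db[OF j(1)] db[OF j'(1)] True by (simp add: M_block_index)
      qed (simp add: lab_entry_def)
      then show ?thesis using j j' mn by (auto simp: KA_def KB_def)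
    next
      fix t assume t: "t < n - m - 2*a" "y = m + a + t"
      have "j mod m \<noteq> m + t" using modm[of j] by linarith
      then have "lab_entry ?bs (g x) (g y) = 0" unfolding j(2) t(2) gb(1)[OF j(1)] gm[OF t(1)] by (simp add: lab_entry_def)
      then show ?thesis using j t mn by (auto simp: KA_def KB_def)
    next
      fix i assume i: "i < a" "y = n - a + i"
      have "lab_entry ?bs (g x) (g y) = [:if j = i + m then 1 else 0, if j = i then 1 else 0:]"
        unfolding j(2) i(2) gb(1)[OF j(1)] gz[OF i(1)] by (rule bz[OF i(1) j(1)])
      moreover have "KA n m a $$ (x,y) = (if j = i then 1 else 0)" "KB n m a (\<lambda>t. \<mu> (t+1)) $$ (x,y) = (if j = i + m then 1 else 0)"
        unfolding KA_def KB_def using xy arith[OF i(1) j i(2)] by auto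
      ultimately show ?thesis by simp
    qed
  next
    fix t assume t: "t < n - m - 2*a" "x = m + a + t"
    show "[:KB n m a (\<lambda>t. \<mu> (t+1)) $$ (x,y), KA n m a $$ (x,y):] = lab_entry ?bs (g x) (g y)" using xy(2)
    proof (rule cases)
      fix j assume j: "j < m + a" "y = m+a-1-j"
      have "j mod m \<noteq> m + t" using modm[of j] by linarith
      then have "lab_entry ?bs (g x) (g y) = 0" unfolding j(2) t(2) gb(1)[OF j(1)] gm[OF t(1)] by (simp add: lab_entry_def)
      then show ?thesis using j t mn by (auto simp: KA_def KB_def)
    next
      fix t' assume t': "t' < n - m - 2*a" "y = m + a + t'"
      show ?thesis unfolding t(2) t'(2) gm[OF t(1)] gm[OF t'(1)] using t t' mn bJ[OF t(1)] by (auto simp: KA_def KB_def lab_entry_def J_block_def)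
    next
      fix i assume i: "i < a" "y = n - a + i"
      have "i mod m \<noteq> m + t" using modm[of i] by linarith
      then have "lab_entry ?bs (g x) (g y) = 0" unfolding i(2) t(2) gz[OF i(1)] gm[OF t(1)] by (simp add: lab_entry_def)
      then show ?thesis using i t mn by (auto simp: KA_def KB_def)
    qed
  next
    fix i assume i: "i < a" "x = n - a + i"
    show "[:KB n m a (\<lambda>t. \<mu> (t+1)) $$ (x,y), KA n m a $$ (x,y):] = lab_entry ?bs (g x) (g y)" using xy(2)
    proof (rule cases)
      fix j assume j: "j < m + a" "y = m+a-1-j"
      have "lab_entry ?bs (g x) (g y) = [:if j = i + m then 1 else 0, if j = i then 1 else 0:]"
        unfolding j(2) i(2) gb(1)[OF j(1)] gz[OF i(1)] by (rule zb[OF i(1) j(1)])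
      moreover have "KA n m a $$ (x,y) = (if j = i then 1 else 0)" "KB n m a (\<lambda>t. \<mu> (t+1)) $$ (x,y) = (if j = i + m then 1 else 0)"
        unfolding KA_def KB_def using xy arith[OF i(1) j i(2)] by (auto simp: add.commute[of x y])
      ultimately show ?thesis by simp
    next
      fix t assume t: "t < n - m - 2*a" "y = m + a + t"
      have "i mod m \<noteq> m + t" using modm[of i] by linarith
      then have "lab_entry ?bs (g x) (g y) = 0" unfolding i(2) t(2) gz[OF i(1)] gm[OF t(1)] by (simp add: lab_entry_def)
      then show ?thesis using i t mn by (auto simp: KA_def KB_def)
    next
      fix i' assume i': "i' < a" "y = n - a + i'"
      have "lab_entry ?bs (g x) (g y) = 0"
        unfolding i(2) i'(2) gz[OF i(1)] gz[OF i'(1)]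
      proof (cases "i mod m = i' mod m")
        case True
        show "lab_entry ?bs (i mod m, d (i mod m) + 1 + i div m) (i' mod m, d (i' mod m) + 1 + i' div m) = 0"
          unfolding True Mb[OF modm] using dz[OF i(1)] dz[OF i'(1)] True by (simp add: M_block_index)
      qed (simp add: lab_entry_def)
      then show ?thesis using i i' mn by (auto simp: KA_def KB_def)
    qed
  qed
  have Pent: "?P $$ (x,y) = block_diag ?bs $$ (\<sigma> x, \<sigma> y)" if "x < n" "y < n" for x y
    using ent[OF that] block_diag_lab[of "\<sigma> x" ?bs "\<sigma> y"] sn that lab_s td by simp
  have bc: "block_diag ?bs \<in> carrier_mat n n" using block_diag_carrier[of ?bs] td by simp
  have img: "\<sigma> ` {..<n} \<subseteq> {..<n}" using sbij by (simp add: bij_betw_def)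
  have lin: "cmat (perm_mat n \<sigma>) (lin_part k (block_diag ?bs)) = lin_part k ?P" for k
    unfolding cmat_perm[OF lin_part_carrier[OF bc] img]
    by (rule eq_matI) (use Pent sn bc in \<open>auto simp: lin_part_def pencil_def[of "KA n m a"]\<close>)
  show ?thesis
  proof (rule that[of "perm_mat n \<sigma>"])
    show "KA n (n-r) a = cmat (perm_mat n \<sigma>) (lin_part 1 (block_diag ?bs))"
      unfolding lin lin_part_pencil[OF K_carrier] m_def ..
    show "KB n (n-r) a (\<lambda>t. \<mu> (t+1)) = cmat (perm_mat n \<sigma>) (lin_part 0 (block_diag ?bs))"
      unfolding lin lin_part_pencil[OF K_carrier] m_def ..
  qed (use det_perm_mat_nz[OF sbij] in auto)
qed

section \<open>Orbits and bundles\<close>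

lemma invertible_mat_det:
  fixes W :: "complex mat"
  assumes W: "W \<in> carrier_mat n n"
  shows "invertible_mat W \<longleftrightarrow> det W \<noteq> 0"
proof
  assume "invertible_mat W"
  then obtain V where V: "W * V = 1\<^sub>m n" "V * W = 1\<^sub>m (dim_row V)" using W by (auto simp: invertible_mat_def inverts_mat_def)
  have "dim_col V = n" using arg_cong[OF V(1), of dim_col] by simp
  moreover have "dim_row V = n" using arg_cong[OF V(2), of dim_col] W by simp
  ultimately have "V \<in> carrier_mat n n" by auto
  then show "det W \<noteq> 0" using inverse_det_nz[OF W _ V(1)] by simp
next
  assume "det W \<noteq> 0"
  then obtain V where "V \<in> carrier_mat n n" "W * V = 1\<^sub>m n" "V * W = 1\<^sub>m n" by (rule det_nz_inverse[OF W])
  then show "invertible_mat W" using W unfolding invertible_mat_def inverts_mat_def by auto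
qed

lemma congruence_orbit_pencil:
  assumes A: "A \<in> carrier_mat n n" and B: "B \<in> carrier_mat n n"
  shows "X \<in> congruence_orbit (pencil A B) \<longleftrightarrow> (\<exists>W\<in>carrier_mat n n. det W \<noteq> 0 \<and> X = pencil (cmat W A) (cmat W B))"
proof -
  have d: "dim_row (pencil A B) = n" using carrier_matD(1)[OF pencil_carrier[OF A B]] .
  have eq: "const_mat (transpose_mat W) * pencil A B * const_mat W = pencil (cmat W A) (cmat W B)" if W: "W \<in> carrier_mat n n" for W
  proof -
    have "const_mat (transpose_mat W) = transpose_mat (const_mat W)" by (rule eq_matI) auto
    then show ?thesis using cmat_pencil[OF A B W] by (simp add: cmat_def)
  qed
  have "X \<in> congruence_orbit (pencil A B) \<longleftrightarrow> (\<exists>W. X = const_mat (transpose_mat W) * pencil A B * const_mat W \<and> W \<in> carrier_mat n n \<and> invertible_mat W)"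
    unfolding congruence_orbit_def d by simp
  also have "\<dots> \<longleftrightarrow> (\<exists>W\<in>carrier_mat n n. det W \<noteq> 0 \<and> X = pencil (cmat W A) (cmat W B))"
    using eq invertible_mat_det[where n=n] by metis
  finally show ?thesis .
qed

lemma block_diag_orbit:
  "X \<in> congruence_orbit (block_diag bs) \<longleftrightarrow> (\<exists>W\<in>carrier_mat (tdim bs) (tdim bs). det W \<noteq> 0 \<and>
     X = pencil (cmat W (lin_part 1 (block_diag bs))) (cmat W (lin_part 0 (block_diag bs))))"
  using congruence_orbit_pencil[OF lin_part_carrier[OF block_diag_carrier] lin_part_carrier[OF block_diag_carrier], of X 1 bs 0]
  unfolding block_diag_pencil .

lemma has_pattern_cmat_fwd:
  assumes A: "A \<in> carrier_mat n n" and B: "B \<in> carrier_mat n n" and W: "W \<in> carrier_mat n n" "det W \<noteq> 0"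
    and p: "has_pattern n m a A B"
  shows "has_pattern n m a (cmat W A) (cmat W B)"
proof -
  obtain V where V: "V \<in> carrier_mat n n" "W * V = 1\<^sub>m n" "V * W = 1\<^sub>m n" "det V \<noteq> 0" by (rule det_nz_inverse[OF W])
  have "cmat V (cmat W A) = A" "cmat V (cmat W B) = B" using cmat_cancel[OF A W(1) V(1,2)] cmat_cancel[OF B W(1) V(1,2)] by auto
  then show ?thesis using has_pattern_cmat[OF cmat_carrier[OF W(1)] cmat_carrier[OF W(1)] V(1,4), of m a A B] p by simp
qed

lemma sym_pencilsE:
  assumes "S \<in> sym_pencils n"
  obtains A B where "A \<in> carrier_mat n n" "B \<in> carrier_mat n n" "transpose_mat A = A" "transpose_mat B = B" "S = pencil A B"
  using assms unfolding sym_pencils_def by auto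

lemma canonical_form_dim:
  assumes "S \<in> carrier_mat n n" "canonical_form_of S bs"
  shows "tdim bs = n"
proof -
  obtain W where "W\<in>carrier_mat (tdim bs) (tdim bs)"
     "S = pencil (cmat W (lin_part 1 (block_diag bs))) (cmat W (lin_part 0 (block_diag bs)))"
    using assms(2) unfolding canonical_form_of_def block_diag_orbit by auto
  then have "S \<in> carrier_mat (tdim bs) (tdim bs)" by simp
  then show ?thesis using assms(1) by (metis carrier_matD(1))
qed

text \<open>The bundle of S ranges over all canonical forms of S; since any two of them are
  congruent through S, the number and the total degree of the blocks M depend on S alone.\<close>

lemma canonical_form_unique_invariants:
  assumes S: "S \<in> carrier_mat n n" and c: "canonical_form_of S bs" and c': "canonical_form_of S bs'"
  shows "numM bs = numM bs'" "degM bs = degM bs'"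
proof -
  let ?A = "lin_part 1 (block_diag bs)" let ?B = "lin_part 0 (block_diag bs)"
  let ?A' = "lin_part 1 (block_diag bs')" let ?B' = "lin_part 0 (block_diag bs')"
  have t: "tdim bs = n" "tdim bs' = n" using canonical_form_dim[OF S] c c' by auto
  have cc: "?A \<in> carrier_mat n n" "?B \<in> carrier_mat n n" "?A' \<in> carrier_mat n n" "?B' \<in> carrier_mat n n"
    using block_diag_carrier[of bs] block_diag_carrier[of bs'] t by simp_all
  obtain W where W: "W \<in> carrier_mat n n" "det W \<noteq> 0" "S = pencil (cmat W ?A) (cmat W ?B)"
    using c t unfolding canonical_form_of_def block_diag_orbit by auto
  obtain W' where W': "W' \<in> carrier_mat n n" "det W' \<noteq> 0" "S = pencil (cmat W' ?A') (cmat W' ?B')"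
    using c' t unfolding canonical_form_of_def block_diag_orbit by auto
  have e: "cmat W ?A = cmat W' ?A'" "cmat W ?B = cmat W' ?B'"
  proof -
    have "lin_part 1 S = cmat W ?A" "lin_part 0 S = cmat W ?B" unfolding W(3) by (rule lin_part_pencil[OF cmat_carrier[OF W(1)] cmat_carrier[OF W(1)]])+
    moreover have "lin_part 1 S = cmat W' ?A'" "lin_part 0 S = cmat W' ?B'" unfolding W'(3) by (rule lin_part_pencil[OF cmat_carrier[OF W'(1)] cmat_carrier[OF W'(1)]])+
    ultimately show "cmat W ?A = cmat W' ?A'" "cmat W ?B = cmat W' ?B'" by (auto dest: trans[OF sym])
  qed
  obtain V where V: "V \<in> carrier_mat n n" "W' * V = 1\<^sub>m n" "V * W' = 1\<^sub>m n" "det V \<noteq> 0" by (rule det_nz_inverse[OF W'(1,2)])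
  have "cmat (W * V) ?A = ?A'" "cmat (W * V) ?B = ?B'"
    unfolding cmat_cmat[OF cc(1) W(1) V(1), symmetric] cmat_cmat[OF cc(2) W(1) V(1), symmetric] e
    by (rule cmat_cancel[OF cc(3) W'(1) V(1,2)], rule cmat_cancel[OF cc(4) W'(1) V(1,2)])
  moreover have "W * V \<in> carrier_mat n n" "det (W * V) \<noteq> 0" using W V by (auto simp: det_mult[of _ n])
  ultimately have "numM bs = numM bs' \<and> degM bs = degM bs'" using block_diag_invariants[of bs bs' "W * V"] t by simp
  then show "numM bs = numM bs'" "degM bs = degM bs'" by auto
qed

lemma congruence_bundleI:
  assumes "canonical_form_of S bs" "inj_on f (eigvals bs)" "T \<in> congruence_orbit (block_diag (map (map_block f) bs))"
  shows "T \<in> congruence_bundle S"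
  unfolding congruence_bundle_def by (rule UnionI[OF _ assms(3)]) (use assms in blast)

text \<open>Replacing eigenvalues keeps all block sizes, and these determine the pattern.\<close>

lemma congruence_bundleE:
  assumes "S \<in> carrier_mat n n" "T \<in> congruence_bundle S"
  obtains bs A B where "canonical_form_of S bs" "A \<in> carrier_mat n n" "B \<in> carrier_mat n n" "transpose_mat A = A" "transpose_mat B = B"
    "T = pencil A B" "\<And>m. m \<le> numM bs \<Longrightarrow> has_pattern n m (degM bs) A B"
proof -
  obtain bs f where bs: "canonical_form_of S bs" "T \<in> congruence_orbit (block_diag (map (map_block f) bs))"
    using assms(2) unfolding congruence_bundle_def by auto
  let ?cs = "map (map_block f) bs"
  have t: "tdim ?cs = n" using canonical_form_dim[OF assms(1) bs(1)] by (simp add: map_block_size)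
  let ?A = "lin_part 1 (block_diag ?cs)" let ?B = "lin_part 0 (block_diag ?cs)"
  have cc: "?A \<in> carrier_mat n n" "?B \<in> carrier_mat n n" using block_diag_carrier[of ?cs] t by simp_all
  obtain W where W: "W \<in> carrier_mat n n" "det W \<noteq> 0" "T = pencil (cmat W ?A) (cmat W ?B)"
    using bs(2) t unfolding block_diag_orbit by auto
  have p: "has_pattern n m (degM bs) (cmat W ?A) (cmat W ?B)" if "m \<le> numM bs" for m
    using has_pattern_cmat_fwd[OF cc W(1,2)] block_diag_has_pattern[of m ?cs] that t by (simp add: map_block_size)
  show ?thesis by (rule that[OF bs(1) cmat_carrier[OF W(1)] cmat_carrier[OF W(1)] cmat_sym[OF cc(1) W(1) block_diag_sym] cmat_sym[OF cc(2) W(1) block_diag_sym] W(3) p])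
qed

lemma congruence_bundle_sym:
  assumes "S \<in> carrier_mat n n"
  shows "congruence_bundle S \<subseteq> sym_pencils n"
proof
  fix T assume "T \<in> congruence_bundle S"
  then obtain bs A B where "A \<in> carrier_mat n n" "B \<in> carrier_mat n n" "transpose_mat A = A" "transpose_mat B = B" "T = pencil A B"
    by (rule congruence_bundleE[OF assms])
  then show "T \<in> sym_pencils n" unfolding sym_pencils_def by blast
qed

context
  fixes n r a :: nat and \<mu> :: "nat \<Rightarrow> complex"
  assumes r: "r < n" and a: "2 * a \<le> r"
begin

lemma K_pencil_carrier: "K_pencil n r a \<mu> \<in> carrier_mat n n"
  using block_diag_carrier[of "K_list n r a \<mu>"] K_list_size(1)[OF r a] by (simp add: K_pencil_list)

lemma K_pencil_canonical: "canonical_form_of (K_pencil n r a \<mu>) (K_list n r a \<mu>)"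
proof -
  let ?bs = "K_list n r a \<mu>"
  have "block_diag ?bs \<in> congruence_orbit (block_diag ?bs)"
    unfolding block_diag_orbit
  proof (intro bexI conjI)
    have c: "lin_part k (block_diag ?bs) \<in> carrier_mat (tdim ?bs) (tdim ?bs)" for k using block_diag_carrier by simp
    show "block_diag ?bs = pencil (cmat (1\<^sub>m (tdim ?bs)) (lin_part 1 (block_diag ?bs))) (cmat (1\<^sub>m (tdim ?bs)) (lin_part 0 (block_diag ?bs)))"
      unfolding cmat_one[OF c] block_diag_pencil ..
  qed auto
  then show ?thesis unfolding canonical_form_of_def K_pencil_list by (auto simp: K_list_def Let_def list_all_iff)
qed

text \<open>The canonical form behind T may differ from \<open>K_list\<close>, but it has the same
  number and total degree of blocks M.\<close>

lemma K_bundle_pattern: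
  assumes "T \<in> congruence_bundle (K_pencil n r a \<mu>)"
  obtains A B where "A \<in> carrier_mat n n" "B \<in> carrier_mat n n" "transpose_mat A = A" "transpose_mat B = B"
    "T = pencil A B" "has_pattern n (n-r) a A B"
proof -
  obtain bs A B where *: "canonical_form_of (K_pencil n r a \<mu>) bs" "A \<in> carrier_mat n n" "B \<in> carrier_mat n n" "transpose_mat A = A" "transpose_mat B = B"
    "T = pencil A B" "\<And>m. m \<le> numM bs \<Longrightarrow> has_pattern n m (degM bs) A B"
    by (rule congruence_bundleE[OF K_pencil_carrier assms]) blast
  have "numM bs = n - r" "degM bs = a"
    using canonical_form_unique_invariants[OF K_pencil_carrier *(1) K_pencil_canonical] K_list_size(2,3)[OF r a] by auto
  then show ?thesis using that *(2-7) by simp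
qed

lemma K_in_bundle: "K_pencil n r a \<mu> \<in> congruence_bundle (K_pencil n r a \<mu>)"
proof -
  have "K_pencil n r a \<mu> \<in> congruence_orbit (block_diag (map (map_block id) (K_list n r a \<mu>)))"
    using K_pencil_canonical by (simp add: canonical_form_of_def block.map_id0)
  then show ?thesis by (rule congruence_bundleI[OF K_pencil_canonical inj_on_id])
qed

text \<open>The staircase with eigenvalues \<nu> is congruent to a \<open>K_list\<close> with these
  eigenvalues, which arises from the given one by renaming each \<mu>_i to \<nu>_i; the renaming
  exists because \<mu> is injective, and it is injective because \<nu> is.\<close>

lemma normal_pairs_bundle:
  assumes inj: "inj_on \<mu> {1..r - 2 * a}" and AB: "(A,B) \<in> normal_pairs n (n-r) a"
  shows "pencil A B \<in> congruence_bundle (K_pencil n r a \<mu>)"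
proof -
  let ?m = "n - r"
  obtain W \<nu> where W: "W \<in> carrier_mat n n" "det W \<noteq> 0" "A = cmat W (KA n ?m a)" "B = cmat W (KB n ?m a \<nu>)"
    and nu: "inj_on \<nu> {..<n-?m-2*a}" using AB unfolding normal_pairs_def by auto
  have q: "n - ?m - 2*a = r - 2*a" using r by simp
  \<comment> \<open>\<open>K_list\<close> numbers its eigenvalues from 1, \<open>KB\<close> from
    0.\<close>
  define \<nu>' where "\<nu>' i = \<nu> (i - 1)" for i :: nat
  have nu': "(\<lambda>t. \<nu>' (t+1)) = \<nu>" by (simp add: \<nu>'_def)
  obtain V where V: "V \<in> carrier_mat n n" "det V \<noteq> 0"
    "KA n ?m a = cmat V (lin_part 1 (block_diag (K_list n r a \<nu>')))"
    "KB n ?m a (\<lambda>t. \<nu>' (t+1)) = cmat V (lin_part 0 (block_diag (K_list n r a \<nu>')))"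
    by (rule K_list_perm[OF r a])
  define f where "f e = (case e of Finite z \<Rightarrow> Finite (\<nu>' (inv_into {1..r-2*a} \<mu> z)) | Infinite \<Rightarrow> Infinite)" for e
  have f: "f (Finite (\<mu> i)) = Finite (\<nu>' i)" if "i \<in> {1..r-2*a}" for i
    using inv_into_f_f[OF inj that] by (simp add: f_def)
  have m: "map (map_block f) (K_list n r a \<mu>) = K_list n r a \<nu>'"
  proof -
    have "map (\<lambda>i. Block_J (f (Finite (\<mu> i))) (1::nat)) [1..<r - 2 * a + 1] = map (\<lambda>i. Block_J (Finite (\<nu>' i)) 1) [1..<r - 2 * a + 1]"
      using f by (intro map_cong) auto
    then show ?thesis by (simp add: K_list_def Let_def o_def del: upt_Suc)
  qed
  have ev: "eigvals (K_list n r a \<mu>) \<subseteq> (\<lambda>i. Finite (\<mu> i)) ` {1..r-2*a}"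
    by (auto simp: eigvals_def K_list_def Let_def simp del: upt_Suc)
  have "inj_on f (eigvals (K_list n r a \<mu>))"
  proof (rule inj_on_subset[OF _ ev], rule inj_onI)
    fix x y assume xy: "x \<in> (\<lambda>i. Finite (\<mu> i)) ` {1..r-2*a}" "y \<in> (\<lambda>i. Finite (\<mu> i)) ` {1..r-2*a}" "f x = f y"
    then obtain i j where ij: "i \<in> {1..r-2*a}" "x = Finite (\<mu> i)" "j \<in> {1..r-2*a}" "y = Finite (\<mu> j)" by auto
    then have "\<nu> (i-1) = \<nu> (j-1)" using xy(3) f by (simp add: \<nu>'_def)
    then have "i - 1 = j - 1" using ij q by (intro inj_onD[OF nu]) auto
    then have "i = j" using ij(1,3) by auto
    then show "x = y" using ij by simp
  qed
  moreover have "pencil A B \<in> congruence_orbit (block_diag (map (map_block f) (K_list n r a \<mu>)))"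
    unfolding m block_diag_orbit
  proof (intro bexI conjI)
    have t: "tdim (K_list n r a \<nu>') = n" by (rule K_list_size(1)[OF r a])
    have c: "lin_part k (block_diag (K_list n r a \<nu>')) \<in> carrier_mat n n" for k using block_diag_carrier[of "K_list n r a \<nu>'"] t by simp
    have "A = cmat (V * W) (lin_part 1 (block_diag (K_list n r a \<nu>')))" "B = cmat (V * W) (lin_part 0 (block_diag (K_list n r a \<nu>')))"
      using W(3,4) V(3,4) nu' cmat_cmat[OF c V(1) W(1)] by simp_all
    then show "pencil A B = pencil (cmat (V * W) (lin_part 1 (block_diag (K_list n r a \<nu>')))) (cmat (V * W) (lin_part 0 (block_diag (K_list n r a \<nu>'))))" by simp
    show "det (V * W) \<noteq> 0" using V W by (auto simp: det_mult[of _ n])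
    show "V * W \<in> carrier_mat (tdim (K_list n r a \<nu>')) (tdim (K_list n r a \<nu>'))" using V W t by simp
  qed
  ultimately show ?thesis by (rule congruence_bundleI[OF K_pencil_canonical])
qed

end

section \<open>The topology on symmetric pencils and limits of determinants\<close>

lemma pencil_coords_pencil:
  assumes "A \<in> carrier_mat n n" "B \<in> carrier_mat n n" "i < n" "j < n"
  shows "pencil_coords n (pencil A B) (0,i,j) = B $$ (i,j)" "pencil_coords n (pencil A B) (1,i,j) = A $$ (i,j)"
  using assms by (simp_all add: pencil_coords_def coord_index_def pencil_index)

lemma topspace_sym_pencil_topology: "topspace (sym_pencil_topology n) = sym_pencils n"
proof -
  have "sym_pencils n \<subseteq> pencils n" by (auto simp: sym_pencils_def pencils_def)
  then show ?thesis
    by (auto simp: sym_pencil_topology_def pencil_topology_def topspace_pullback_topology pencil_coords_def)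
qed

lemma openin_sym_pencil_topology:
  "openin (sym_pencil_topology n) T \<longleftrightarrow>
     (\<exists>U. openin (product_topology (\<lambda>_. euclidean) (coord_index n)) U \<and> T = pencil_coords n -` U \<inter> sym_pencils n)"
proof -
  have "sym_pencils n \<subseteq> pencils n" by (auto simp: sym_pencils_def pencils_def)
  then have "pencil_coords n -` U \<inter> pencils n \<inter> sym_pencils n = pencil_coords n -` U \<inter> sym_pencils n" for U by auto
  then show ?thesis
    unfolding sym_pencil_topology_def openin_subtopology pencil_topology_def openin_pullback_topology
    by (auto; metis)
qed

lemma coord_index_cases:
  assumes "p \<in> coord_index n"
  obtains i j where "i < n" "j < n" "p = (0,i,j)" | i j where "i < n" "j < n" "p = (1,i,j)"
proof -
  obtain k i j where "p = (k,i,j)" by (cases p)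
  moreover from this assms have "k = 0 \<or> k = 1" "i < n" "j < n" by (auto simp: coord_index_def)
  ultimately show ?thesis using that by auto
qed

text \<open>In one direction, a box around the coordinates is open since there are finitely many of
  them; in the other, entrywise convergence is convergence in the product topology.\<close>

lemma closure_of_sym_pencils:
  assumes X: "X \<subseteq> sym_pencils n" and A: "A \<in> carrier_mat n n" "transpose_mat A = A" and B: "B \<in> carrier_mat n n" "transpose_mat B = B"
  shows "pencil A B \<in> sym_pencil_topology n closure_of X \<longleftrightarrow>
    (A,B) \<in> adh n {(A',B'). A' \<in> carrier_mat n n \<and> B' \<in> carrier_mat n n \<and> pencil A' B' \<in> X}"
    (is "_ \<longleftrightarrow> _ \<in> adh n ?X")
proof
  have AB: "pencil A B \<in> sym_pencils n" using A B by (auto simp: sym_pencils_def)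
  let ?T = "product_topology (\<lambda>_. euclidean) (coord_index n) :: (nat \<times> nat \<times> nat \<Rightarrow> complex) topology"
  let ?c = "pencil_coords n"
  assume cl: "pencil A B \<in> sym_pencil_topology n closure_of X"
  show "(A,B) \<in> adh n ?X"
  proof (rule adh_eps)
    fix e :: real assume e: "e > 0"
    let ?U = "PiE (coord_index n) (\<lambda>p. ball (?c (pencil A B) p) e) :: (nat \<times> nat \<times> nat \<Rightarrow> complex) set"
    have fin: "finite (coord_index n)" by (simp add: coord_index_def)
    have "openin ?T ?U" unfolding openin_PiE_gen using fin by simp
    then have op: "openin (sym_pencil_topology n) (?c -` ?U \<inter> sym_pencils n)" unfolding openin_sym_pencil_topology by blast
    have mem: "pencil A B \<in> ?c -` ?U \<inter> sym_pencils n" using AB e by (auto simp: pencil_coords_def)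
    have "\<exists>P. P \<in> X \<and> P \<in> ?c -` ?U \<inter> sym_pencils n"
      by (rule cl[unfolded in_closure_of, THEN conjunct2, rule_format, OF conjI[OF mem op]])
    then obtain P where P: "P \<in> X" "P \<in> ?c -` ?U \<inter> sym_pencils n" by (elim exE conjE)
    then have "P \<in> sym_pencils n" by blast
    then obtain A' B' where P': "A' \<in> carrier_mat n n" "B' \<in> carrier_mat n n" "P = pencil A' B'" by (rule sym_pencilsE)
    have d: "dist (?c P p) (?c (pencil A B) p) < e" if "p \<in> coord_index n" for p
      
    proof -
      have "?c P \<in> ?U" using P(2) by blast
      from PiE_mem[OF this that] show ?thesis by (simp add: dist_commute)
    qed
    have "dist (A' $$ (i,j)) (A $$ (i,j)) < e \<and> dist (B' $$ (i,j)) (B $$ (i,j)) < e" if ij: "i < n" "j < n" for i j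
    proof -
      have "(0,i,j) \<in> coord_index n" "(1,i,j) \<in> coord_index n" using ij by (auto simp: coord_index_def)
      from this[THEN d] show ?thesis
        unfolding P'(3) pencil_coords_pencil[OF P'(1,2) ij] pencil_coords_pencil[OF A(1) B(1) ij] by simp
    qed
    moreover have "(A',B') \<in> ?X" using P' P(1) by simp
    ultimately show "\<exists>A'\<in>carrier_mat n n. \<exists>B'\<in>carrier_mat n n. (A',B') \<in> ?X \<and>
      (\<forall>i<n. \<forall>j<n. dist (A' $$ (i,j)) (A $$ (i,j)) < e \<and> dist (B' $$ (i,j)) (B $$ (i,j)) < e)"
      using P'(1,2) by (intro bexI[of _ A'] bexI[of _ B']) auto
  qed (use A B in auto)
next
  have AB: "pencil A B \<in> sym_pencils n" using A B by (auto simp: sym_pencils_def)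
  let ?T = "product_topology (\<lambda>_. euclidean) (coord_index n) :: (nat \<times> nat \<times> nat \<Rightarrow> complex) topology"
  let ?c = "pencil_coords n"
  assume "(A,B) \<in> adh n ?X"
  then obtain F G where FG: "matlim n F A" "matlim n G B" "\<forall>k. (F k, G k) \<in> ?X" by (rule adhE)
  have FX: "pencil (F k) (G k) \<in> X" for k using FG(3) by auto
  have lim: "limitin ?T (\<lambda>k. ?c (pencil (F k) (G k))) (?c (pencil A B)) sequentially"
    unfolding limitin_componentwise
  proof (intro conjI ballI)
    fix p assume "p \<in> coord_index n"
    then show "limitin euclidean (\<lambda>k. ?c (pencil (F k) (G k)) p) (?c (pencil A B) p) sequentially"
    proof (cases rule: coord_index_cases)
      case (1 i j)
      show ?thesis unfolding 1(3) pencil_coords_pencil[OF A(1) B(1) 1(1,2)] pencil_coords_pencil[OF matlimD(1)[OF FG(1)] matlimD(1)[OF FG(2)] 1(1,2)]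
        using matlimD(3)[OF FG(2) 1(1,2)] by simp
    next
      case (2 i j)
      show ?thesis unfolding 2(3) pencil_coords_pencil[OF A(1) B(1) 2(1,2)] pencil_coords_pencil[OF matlimD(1)[OF FG(1)] matlimD(1)[OF FG(2)] 2(1,2)]
        using matlimD(3)[OF FG(1) 2(1,2)] by simp
    qed
  qed (auto simp: pencil_coords_def)
  show "pencil A B \<in> sym_pencil_topology n closure_of X"
    unfolding in_closure_of topspace_sym_pencil_topology
  proof (intro conjI allI impI AB)
    fix T assume T: "pencil A B \<in> T \<and> openin (sym_pencil_topology n) T"
    then obtain U where U: "openin ?T U" "T = ?c -` U \<inter> sym_pencils n" unfolding openin_sym_pencil_topology by auto
    have "eventually (\<lambda>k. ?c (pencil (F k) (G k)) \<in> U) sequentially"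
      by (rule limitinD[OF lim U(1)]) (use T U in auto)
    then obtain k where "?c (pencil (F k) (G k)) \<in> U" using eventually_happens by force
    then show "\<exists>y. y \<in> X \<and> y \<in> T" using FX[of k] X U(2) by auto
  qed
qed

section \<open>Limits of determinants and of their factors\<close>

lemma det_tendsto:
  assumes "\<And>k. F k \<in> carrier_mat n n" "M \<in> carrier_mat n n"
    "\<And>i j. i < n \<Longrightarrow> j < n \<Longrightarrow> (\<lambda>k. F k $$ (i,j)) \<longlonglongrightarrow> (M $$ (i,j) :: complex)"
  shows "(\<lambda>k. det (F k)) \<longlonglongrightarrow> det M"
  unfolding det_def'[OF assms(1)] det_def'[OF assms(2)]
proof (intro tendsto_sum tendsto_mult tendsto_const tendsto_prod)
  fix p i assume "p \<in> {p. p permutes {0..<n}}" "i \<in> {0..<n}"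
  then have "i < n" "p i < n" using permutes_in_image[of p "{0..<n}" i] by auto
  then show "(\<lambda>k. F k $$ (i, p i)) \<longlonglongrightarrow> M $$ (i, p i)" by (rule assms(3))
qed

lemma det_shift_tendsto:
  assumes F: "matlim n F A" and G: "matlim n G B" and U: "U \<in> carrier_mat n l"
  shows "(\<lambda>k. det (z \<cdot>\<^sub>m F k + G k + U * transpose_mat U)) \<longlonglongrightarrow> det (z \<cdot>\<^sub>m A + B + U * transpose_mat U)"
proof (rule det_tendsto)
  note c = matlimD(1)[OF F] matlimD(1)[OF G] matlimD(2)[OF F] matlimD(2)[OF G]
  have UU: "U * transpose_mat U \<in> carrier_mat n n" using U by auto
  show "z \<cdot>\<^sub>m F k + G k + U * transpose_mat U \<in> carrier_mat n n" "z \<cdot>\<^sub>m A + B + U * transpose_mat U \<in> carrier_mat n n" for k using UU by auto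
  fix i j assume ij: "i < n" "j < n"
  have e: "(z \<cdot>\<^sub>m X + Y + U * transpose_mat U) $$ (i,j) = z * X $$ (i,j) + Y $$ (i,j) + (U * transpose_mat U) $$ (i,j)"
    if "X \<in> carrier_mat n n" "Y \<in> carrier_mat n n" for X Y using that UU ij by (simp del: index_mult_mat)
  show "(\<lambda>k. (z \<cdot>\<^sub>m F k + G k + U * transpose_mat U) $$ (i,j)) \<longlonglongrightarrow> (z \<cdot>\<^sub>m A + B + U * transpose_mat U) $$ (i,j)"
    unfolding e[OF c(1,2)] e[OF c(3,4)]
    by (intro tendsto_add tendsto_mult tendsto_const matlimD(3)[OF F ij] matlimD(3)[OF G ij])
qed

lemma poly_det_outer:
  assumes A: "A \<in> carrier_mat n n" and B: "B \<in> carrier_mat n n" and U: "U \<in> carrier_mat n l"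
  shows "poly (det (pencil A B + outer U)) z = det (z \<cdot>\<^sub>m A + B + U * transpose_mat U)"
proof -
  have P: "pencil A B \<in> carrier_mat n n" by (rule pencil_carrier[OF A B])
  have UU: "U * transpose_mat U \<in> carrier_mat n n" using U by auto
  have c: "pencil A B + outer U \<in> carrier_mat n n" unfolding outer_const[OF U] using UU by auto
  have "eval_mat z (pencil A B + outer U) = eval_mat z (pencil A B) + U * transpose_mat U"
    unfolding outer_const[OF U] by (rule eq_matI) (use carrier_matD[OF P] carrier_matD[OF UU] in \<open>auto simp: eval_mat_def simp del: index_mult_mat\<close>)
  then show ?thesis using det_eval_mat[OF c, of z] eval_pencil[OF A B, of z] by simp
qed

lemma rank_defect_limit:
  assumes F: "matlim n F A" and G: "matlim n G B" and rd: "\<And>k. rank_defect n m (F k) (G k)"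
  shows "rank_defect n m A B"
  unfolding rank_defect_def
proof (intro allI impI ballI)
  fix z l and U :: "complex mat" assume l: "l < m" and U: "U \<in> carrier_mat n l"
  have "(\<lambda>k. det (z \<cdot>\<^sub>m F k + G k + U * transpose_mat U)) \<longlonglongrightarrow> det (z \<cdot>\<^sub>m A + B + U * transpose_mat U)"
    by (rule det_shift_tendsto[OF F G U])
  moreover have "(\<lambda>k. det (z \<cdot>\<^sub>m F k + G k + U * transpose_mat U)) = (\<lambda>k. 0)"
    using rank_defectD[OF rd l U] by simp
  ultimately show "det (z \<cdot>\<^sub>m A + B + U * transpose_mat U) = 0" using LIMSEQ_unique tendsto_const by metis
qed

lemma common_convergent_subsequence:
  fixes f :: "nat \<Rightarrow> nat \<Rightarrow> complex"
  assumes b: "\<And>k i. cmod (f k i) \<le> 1"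
  shows "\<exists>r l. strict_mono r \<and> (\<forall>i<N. (\<lambda>k. f (r k) i) \<longlonglongrightarrow> l i)"
proof (induction N)
  case 0
  show ?case by (rule exI[of _ id]) (auto simp: strict_mono_def)
next
  case (Suc N)
  then obtain r l where r: "strict_mono r" "\<And>i. i < N \<Longrightarrow> (\<lambda>k. f (r k) i) \<longlonglongrightarrow> l i" by auto
  have "bounded (range (\<lambda>k. f (r k) N))" using b by (auto simp: bounded_iff)
  then obtain x s where s: "strict_mono s" "((\<lambda>k. f (r k) N) \<circ> s) \<longlonglongrightarrow> x"
    using bounded_imp_convergent_subsequence by blast
  have "strict_mono (r \<circ> s)" using r(1) s(1) by (rule strict_mono_o)
  moreover have "(\<lambda>k. f ((r \<circ> s) k) i) \<longlonglongrightarrow> (l(N := x)) i" if "i < Suc N" for i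
  proof (cases "i = N")
    case True
    then show ?thesis using s(2) by (simp add: o_def)
  next
    case False
    then show ?thesis using LIMSEQ_subseq_LIMSEQ[OF r(2)[of i] s(1)] that by (simp add: o_def)
  qed
  ultimately show ?case by blast
qed

text \<open>Factors may grow or tend to zero while their product converges. Scaled so that the
  absolute values of the coefficients sum to 1, they stay in a compact set of nonzero polynomials of
  bounded degree, and one subsequence serves all of them.\<close>

lemma polys_normalized_subsequence:
  fixes q :: "nat \<Rightarrow> nat \<Rightarrow> complex poly"
  assumes d: "\<And>i k. i < M \<Longrightarrow> degree (q i k) \<le> N i"
  obtains r c h H where "strict_mono r" "\<forall>i<M. \<forall>k. q i k = smult (c i k) (h i k)"
    "\<forall>i<M. H i \<noteq> 0 \<and> degree (H i) \<le> N i" "\<forall>i<M. \<forall>z. (\<lambda>k. poly (h i (r k)) z) \<longlonglongrightarrow> poly (H i) z"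
proof -
  let ?n = "\<lambda>i p. \<Sum>j\<le>N i. cmod (coeff p j)"
  have ex: "\<exists>c h. p = smult c h \<and> degree h \<le> N i \<and> ?n i h = 1" if "degree p \<le> N i" for p i
  proof (cases "p = 0")
    \<comment> \<open>The zero polynomial is represented as 0 times the polynomial 1.\<close>
    case True
    have "?n i 1 = (\<Sum>j\<le>N i. if j = 0 then 1 else 0)" by (rule sum.cong) (auto simp: coeff_1)
    then show ?thesis using True by (intro exI[of _ 0] exI[of _ 1]) auto
  next
    case False
    have "cmod (lead_coeff p) \<le> ?n i p" by (rule member_le_sum) (use that in auto)
    moreover have "0 < cmod (lead_coeff p)" using False by simp
    ultimately have pos: "?n i p > 0" by linarith
    have "?n i (smult (inverse (of_real (?n i p))) p) = inverse (?n i p) * ?n i p"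
      unfolding sum_distrib_left using pos by (intro sum.cong) (auto simp: norm_mult norm_inverse simp del: of_real_sum)
    then show ?thesis using pos that
      by (intro exI[of _ "of_real (?n i p)"] exI[of _ "smult (inverse (of_real (?n i p))) p"]) (auto simp del: of_real_sum)
  qed
  define ch where "ch i k = (SOME ch. q i k = smult (fst ch) (snd ch) \<and> degree (snd ch) \<le> N i \<and> ?n i (snd ch) = 1)" for i k
  have "q i k = smult (fst (ch i k)) (snd (ch i k)) \<and> degree (snd (ch i k)) \<le> N i \<and> ?n i (snd (ch i k)) = 1" if i: "i < M" for i k
  proof -
    obtain c h where "q i k = smult c h" "degree h \<le> N i" "?n i h = 1" using ex[OF d[OF i]] by blast
    then have "\<exists>ch. q i k = smult (fst ch) (snd ch) \<and> degree (snd ch) \<le> N i \<and> ?n i (snd ch) = 1"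
      by (intro exI[of _ "(c,h)"]) simp
    then show ?thesis unfolding ch_def by (rule someI_ex)
  qed
  then have ch: "\<And>i k. i < M \<Longrightarrow> q i k = smult (fst (ch i k)) (snd (ch i k))"
     "\<And>i k. i < M \<Longrightarrow> degree (snd (ch i k)) \<le> N i" "\<And>i k. i < M \<Longrightarrow> ?n i (snd (ch i k)) = 1" by blast+
  define h where "h i k = snd (ch i k)" for i k
  \<comment> \<open>Coefficient j of polynomial i gets the number i + M j; numbers that encode no
    coefficient get the value 0.\<close>
  let ?f = "\<lambda>k l. if l mod M < M \<and> l div M \<le> N (l mod M) then coeff (h (l mod M) k) (l div M) else 0"
  have "cmod (?f k l) \<le> 1" for k l
  proof (cases "l mod M < M \<and> l div M \<le> N (l mod M)")
    case True
    then have "cmod (coeff (h (l mod M) k) (l div M)) \<le> ?n (l mod M) (h (l mod M) k)" by (intro member_le_sum) auto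
    then show ?thesis using True ch(3) by (simp add: h_def)
  next
    case False
    show ?thesis unfolding if_not_P[OF False] by simp
  qed
  then obtain r L where r: "strict_mono r" "\<And>l. l < M * (Suc (\<Sum>i<M. N i)) \<Longrightarrow> (\<lambda>k. ?f (r k) l) \<longlonglongrightarrow> L l"
    using common_convergent_subsequence[of ?f "M * (Suc (\<Sum>i<M. N i))"] by blast
  have lim: "(\<lambda>k. coeff (h i (r k)) j) \<longlonglongrightarrow> L (i + M * j)" if ij: "i < M" "j \<le> N i" for i j
  proof -
    have "N i \<le> (\<Sum>i<M. N i)" using ij(1) by (intro member_le_sum) auto
    then have "j \<le> (\<Sum>i<M. N i)" using ij(2) by simp
    then have "M * j + M \<le> M * (Suc (\<Sum>i<M. N i))" by (metis add.commute mult_Suc_right mult_le_mono2 Suc_le_mono)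
    then have "i + M * j < M * (Suc (\<Sum>i<M. N i))" using ij(1) by linarith
    from r(2)[OF this] show ?thesis using ij by simp
  qed
  define H where "H i = (\<Sum>j\<le>N i. monom (L (i + M * j)) j)" for i
  have cH: "coeff (H i) j = (if j \<le> N i then L (i + M * j) else 0)" for i j
    unfolding H_def coeff_sum by (auto simp: if_distrib cong: if_cong)
  show ?thesis
  proof (rule that[OF r(1), of "\<lambda>i k. fst (ch i k)" h H])
    show "\<forall>i<M. \<forall>k. q i k = smult (fst (ch i k)) (h i k)" using ch(1) by (simp add: h_def)
    have dH: "degree (H i) \<le> N i" for i by (rule degree_le) (simp add: cH)
    show "\<forall>i<M. H i \<noteq> 0 \<and> degree (H i) \<le> N i"
    proof (intro allI impI conjI dH)
      fix i assume i: "i < M"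
      have "(\<lambda>k. ?n i (h i (r k))) \<longlonglongrightarrow> (\<Sum>j\<le>N i. cmod (L (i + M * j)))"
        by (intro tendsto_sum tendsto_norm lim i) auto
      moreover have "(\<lambda>k. ?n i (h i (r k))) = (\<lambda>k. 1)" using ch(3)[OF i] by (simp add: h_def)
      ultimately have "(\<Sum>j\<le>N i. cmod (L (i + M * j))) = 1" using LIMSEQ_unique tendsto_const by metis
      then have "?n i (H i) = 1" by (simp add: cH)
      then show "H i \<noteq> 0" by auto
    qed
    show "\<forall>i<M. \<forall>z. (\<lambda>k. poly (h i (r k)) z) \<longlonglongrightarrow> poly (H i) z"
    proof (intro allI impI)
      fix i z assume i: "i < M"
      have pe: "poly p z = (\<Sum>j\<le>N i. coeff p j * z ^ j)" if "degree p \<le> N i" for p :: "complex poly"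
        using arg_cong[OF poly_as_sum_of_monoms'[OF that], of "\<lambda>p. poly p z"] by (simp add: poly_sum poly_monom)
      have "(\<lambda>k. \<Sum>j\<le>N i. coeff (h i (r k)) j * z ^ j) \<longlonglongrightarrow> (\<Sum>j\<le>N i. coeff (H i) j * z ^ j)"
        by (intro tendsto_sum tendsto_mult tendsto_const) (use lim i cH in auto)
      then show "(\<lambda>k. poly (h i (r k)) z) \<longlonglongrightarrow> poly (H i) z" using pe[OF dH] pe ch(2)[OF i] by (simp add: h_def)
    qed
  qed
qed


text \<open>At a point w that is no root of Q, the scalar c k is eventually the quotient of two
  convergent sequences; so the scalars converge.\<close>

lemma poly_split_scalar_limit:
  assumes lim: "\<And>z. (\<lambda>k. poly (D k) z) \<longlonglongrightarrow> poly E z" and D: "\<And>k. D k = smult (c k) (q k)"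
    and q: "\<And>z. (\<lambda>k. poly (q k) z) \<longlonglongrightarrow> poly Q z" and Q: "Q \<noteq> (0 :: complex poly)"
  obtains \<gamma> where "E = smult \<gamma> Q"
proof -
  have "finite {z. poly Q z = 0}" by (rule poly_roots_finite[OF Q])
  then obtain w where w: "poly Q w \<noteq> 0" using ex_new_if_finite[OF infinite_UNIV_char_0] by blast
  have l: "(\<lambda>k. poly (D k) w / poly (q k) w) \<longlonglongrightarrow> poly E w / poly Q w" by (intro tendsto_divide lim q w)
  have ev: "eventually (\<lambda>k. poly (q k) w \<noteq> 0) sequentially" by (rule tendsto_imp_eventually_ne[OF q w])
  have c: "c \<longlonglongrightarrow> poly E w / poly Q w"
    by (rule Lim_transform_eventually[OF l]) (use ev in \<open>auto simp: D elim: eventually_mono\<close>)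
  have "poly E z = poly (smult (poly E w / poly Q w) Q) z" for z
  proof -
    have "(\<lambda>k. c k * poly (q k) z) \<longlonglongrightarrow> poly E w / poly Q w * poly Q z" by (intro tendsto_mult c q)
    moreover have "(\<lambda>k. c k * poly (q k) z) = (\<lambda>k. poly (D k) z)" by (simp add: D)
    ultimately have "(\<lambda>k. poly (D k) z) \<longlonglongrightarrow> poly E w / poly Q w * poly Q z" by simp
    from LIMSEQ_unique[OF lim this] show ?thesis by simp
  qed
  then have "E = smult (poly E w / poly Q w) Q" unfolding poly_eq_poly_eq_iff[symmetric] by (rule ext)
  then show ?thesis by (rule that)
qed

text \<open>Each member of the sequence has one g for both test matrices, so the normalized limit of
  g serves both as well; the scalars split off by the normalization reappear as two separate
  constants.\<close>

lemma pattern_limit_dets: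
  assumes F: "matlim n F A" and G: "matlim n G B"
    and sym: "\<And>k. transpose_mat (F k) = F k" "\<And>k. transpose_mat (G k) = G k"
    and pat: "\<And>k. has_pattern n m a (F k) (G k)"
    and U: "U1 \<in> carrier_mat n m" "U2 \<in> carrier_mat n m"
  obtains g p1 p2 \<gamma>1 \<gamma>2 where "degree g \<le> n - m - 2*a" "degree p1 \<le> a" "degree p2 \<le> a"
    "det (pencil A B + outer U1) = smult \<gamma>1 (g * p1^2)" "det (pencil A B + outer U2) = smult \<gamma>2 (g * p2^2)"
proof -
  have c: "F k \<in> carrier_mat n n" "G k \<in> carrier_mat n n" for k using matlimD(1)[OF F] matlimD(1)[OF G] by auto
  have AB: "A \<in> carrier_mat n n" "B \<in> carrier_mat n n" using matlimD(2)[OF F] matlimD(2)[OF G] by auto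
  have "\<exists>gpp. degree (fst gpp) \<le> n - m - 2*a \<and> degree (fst (snd gpp)) \<le> a \<and> degree (snd (snd gpp)) \<le> a \<and>
      det (pencil (F k) (G k) + outer U1) = fst gpp * (fst (snd gpp))^2 \<and> det (pencil (F k) (G k) + outer U2) = fst gpp * (snd (snd gpp))^2" for k
  proof -
    obtain g where g: "degree g \<le> n - m - 2*a" "\<forall>U\<in>carrier_mat n m. \<exists>p. degree p \<le> a \<and> det (pencil (F k) (G k) + outer U) = g * p^2"
      by (rule has_pattern_det[OF c(1) sym(1) c(2) sym(2) pat])
    obtain p1 where p1: "degree p1 \<le> a" "det (pencil (F k) (G k) + outer U1) = g * p1^2" using g(2)[rule_format, OF U(1)] by (elim exE conjE)
    obtain p2 where p2: "degree p2 \<le> a" "det (pencil (F k) (G k) + outer U2) = g * p2^2" using g(2)[rule_format, OF U(2)] by (elim exE conjE)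
    show ?thesis by (rule exI[of _ "(g,p1,p2)"]) (simp only: fst_conv snd_conv g(1) p1 p2 simp_thms)
  qed
  then have "\<forall>k. \<exists>gpp. degree (fst gpp) \<le> n - m - 2*a \<and> degree (fst (snd gpp)) \<le> a \<and> degree (snd (snd gpp)) \<le> a \<and>
      det (pencil (F k) (G k) + outer U1) = fst gpp * (fst (snd gpp))^2 \<and> det (pencil (F k) (G k) + outer U2) = fst gpp * (snd (snd gpp))^2" ..
  from choice[OF this] obtain s where s: "\<forall>k. degree (fst (s k)) \<le> n - m - 2*a \<and> degree (fst (snd (s k))) \<le> a \<and> degree (snd (snd (s k))) \<le> a \<and>
      det (pencil (F k) (G k) + outer U1) = fst (s k) * (fst (snd (s k)))^2 \<and> det (pencil (F k) (G k) + outer U2) = fst (s k) * (snd (snd (s k)))^2" ..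
  \<comment> \<open>Index 0 is the common factor g; indices 1 and 2 are the polynomials that belong
    to U1 and U2.\<close>
  define q where "q i k = (if i = 0 then fst (s k) else if i = 1 then fst (snd (s k)) else snd (snd (s k)))" for i k :: nat
  define N where "N i = (if i = 0 then n - m - 2*a else a)" for i :: nat
  have D: "det (pencil (F k) (G k) + outer U1) = q 0 k * (q 1 k)^2" "det (pencil (F k) (G k) + outer U2) = q 0 k * (q 2 k)^2" for k
    using s[rule_format, of k] by (simp_all add: q_def)
  have dq: "degree (q i k) \<le> N i" if "i < 3" for i k using s[rule_format, of k] by (simp add: q_def N_def)
  obtain r c h H where r: "strict_mono r" "\<forall>i<3. \<forall>k. q i k = smult (c i k) (h i k)"
    "\<forall>i<3. H i \<noteq> 0 \<and> degree (H i) \<le> N i" "\<forall>i<3. \<forall>z. (\<lambda>k. poly (h i (r k)) z) \<longlonglongrightarrow> poly (H i) z"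
    by (rule polys_normalized_subsequence[where M=3 and q=q and N=N, OF dq])
  have lim: "(\<lambda>k. poly (det (pencil (F (r k)) (G (r k)) + outer U)) z) \<longlonglongrightarrow> poly (det (pencil A B + outer U)) z" if "U \<in> carrier_mat n m" for U z
    using LIMSEQ_subseq_LIMSEQ[OF det_shift_tendsto[OF F G that] r(1), of z]
    unfolding poly_det_outer[OF AB that] poly_det_outer[OF c that] by (simp add: o_def)
  have key: thesis' if i: "i < 3" and Ui: "U \<in> carrier_mat n m" and Di: "\<And>k. det (pencil (F k) (G k) + outer U) = q 0 k * (q i k)^2"
    and t: "\<And>\<gamma>. det (pencil A B + outer U) = smult \<gamma> (H 0 * (H i)^2) \<Longrightarrow> thesis'" for i U thesis'
  proof (rule poly_split_scalar_limit[OF lim[OF Ui]])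
    show "det (pencil (F (r k)) (G (r k)) + outer U) = smult (c 0 (r k) * (c i (r k))^2) (h 0 (r k) * (h i (r k))^2)" for k
    proof -
      have "q 0 (r k) = smult (c 0 (r k)) (h 0 (r k))" "q i (r k) = smult (c i (r k)) (h i (r k))" using r(2) i by auto
      then show ?thesis unfolding Di by (simp add: smult_power mult.commute)
    qed
    show "(\<lambda>k. poly (h 0 (r k) * (h i (r k))^2) z) \<longlonglongrightarrow> poly (H 0 * (H i)^2) z" for z
      using r(4) i by (auto intro!: tendsto_mult tendsto_power)
    show "H 0 * (H i)^2 \<noteq> 0" using r(3) i by simp
    fix \<gamma> assume "det (pencil A B + outer U) = smult \<gamma> (H 0 * (H i)^2)"
    then show thesis' by (rule t)
  qed
  obtain \<gamma>1 where 1: "det (pencil A B + outer U1) = smult \<gamma>1 (H 0 * (H 1)^2)" by (rule key[of 1, OF _ U(1) D(1)]) auto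
  obtain \<gamma>2 where 2: "det (pencil A B + outer U2) = smult \<gamma>2 (H 0 * (H 2)^2)" by (rule key[of 2, OF _ U(2) D(2)]) auto
  have dH: "degree (H 0) \<le> n - m - 2*a" "degree (H 1) \<le> a" "degree (H 2) \<le> a"
    using r(3)[rule_format, of 0] r(3)[rule_format, of 1] r(3)[rule_format, of 2] by (simp_all add: N_def)
  show ?thesis by (rule that[OF dH 1 2])
qed

text \<open>The left side has \<open>deg g + 2 deg p\<close> distinct roots, and each is a root of g
  or of p, which have at most \<open>deg g + deg p\<close> roots.\<close>

lemma distinct_roots_square_factor:
  fixes g p :: "complex poly"
  assumes D: "degree C = 0" "C \<noteq> 0" "C * (\<Prod>x\<in>X. [:- x, 1:]) = smult \<gamma> (g * p^2)" and X: "finite X"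
  shows "degree p = 0" "degree g = card X"
proof -
  let ?D = "C * (\<Prod>x\<in>X. [:- x, 1:])"
  have nz: "(\<Prod>x\<in>X. [:- x, 1:]) \<noteq> (0 :: complex poly)" using X by simp
  have Dn: "smult \<gamma> (g * p^2) \<noteq> 0" using D(2,3) nz by auto
  then have gp: "g \<noteq> 0" "p \<noteq> 0" "\<gamma> \<noteq> 0" by auto
  have "degree (\<Prod>x\<in>X. [:- x, 1:]) = card X" using X by (subst degree_prod_eq_sum_degree) auto
  then have dD: "degree (smult \<gamma> (g * p^2)) = card X" unfolding D(3)[symmetric] using D(1,2) nz by (simp add: degree_mult_eq)
  then have d: "degree g + 2 * degree p = card X" using gp by (simp add: degree_mult_eq degree_power_eq)
  have "X \<subseteq> {x. poly g x = 0} \<union> {x. poly p x = 0}"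
  proof
    fix x assume "x \<in> X"
    then have "poly ?D x = 0" using X by (auto simp: poly_prod)
    then show "x \<in> {x. poly g x = 0} \<union> {x. poly p x = 0}" unfolding D(3) using gp by auto
  qed
  then have "card X \<le> card ({x. poly g x = 0} \<union> {x. poly p x = 0})" by (intro card_mono finite_UnI poly_roots_finite gp)
  also have "\<dots> \<le> card {x. poly g x = 0} + card {x. poly p x = 0}" by (rule card_Un_le)
  also have "\<dots> \<le> degree g + degree p" by (intro add_mono card_poly_roots_bound gp)
  finally show "degree p = 0" "degree g = card X" using d by auto
qed

section \<open>Closures of bundles\<close>

lemma adh_mono: "X \<subseteq> Y \<Longrightarrow> adh n X \<subseteq> adh n Y"
  unfolding adh_def by blast

lemma rank_defect_bound:
  assumes "A \<in> carrier_mat n n" "transpose_mat A = A" "B \<in> carrier_mat n n" "transpose_mat B = B"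
    "rank_defect n (n - r) A B" "r \<le> n"
  obtains a where "2 * a \<le> r" "has_pattern n (n - r) a A B"
proof -
  obtain a where a: "has_pattern n (n - r) a A B" using rank_defect_has_pattern[OF assms(1-5)] by (elim exE)
  then have "n - r + 2 * a \<le> n" unfolding has_pattern_def by (rule conjunct1)
  then show ?thesis using that[OF _ a] assms(6) by linarith
qed

text \<open>Low rank is carried to the limit as \<open>rank_defect\<close> and turned back into a
  rank bound through a pattern, whose zero block yields a factorization.\<close>

lemma closedin_sym_pencils_rank_le:
  assumes r: "r < n"
  shows "closedin (sym_pencil_topology n) (sym_pencils_rank_le n r)"
  unfolding closure_of_subset_eq[symmetric] topspace_sym_pencil_topology
proof (intro conjI subsetI)
  have sub: "sym_pencils_rank_le n r \<subseteq> sym_pencils n" by (auto simp: sym_pencils_rank_le_def)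
  show "P \<in> sym_pencils n" if "P \<in> sym_pencils_rank_le n r" for P using that sub by blast
  fix P assume P: "P \<in> sym_pencil_topology n closure_of sym_pencils_rank_le n r"
  then have "P \<in> sym_pencils n" using in_closure_of[of P "sym_pencil_topology n"] by (simp add: topspace_sym_pencil_topology)
  then obtain A B where AB: "A \<in> carrier_mat n n" "B \<in> carrier_mat n n" "transpose_mat A = A" "transpose_mat B = B" "P = pencil A B" by (rule sym_pencilsE)
  have "(A,B) \<in> adh n {(A',B'). A' \<in> carrier_mat n n \<and> B' \<in> carrier_mat n n \<and> pencil A' B' \<in> sym_pencils_rank_le n r}"
    using P unfolding AB(5) closure_of_sym_pencils[OF sub AB(1,3,2,4)] .
  then obtain F G where FG: "matlim n F A" "matlim n G B"
    "\<forall>k. (F k, G k) \<in> {(A',B'). A' \<in> carrier_mat n n \<and> B' \<in> carrier_mat n n \<and> pencil A' B' \<in> sym_pencils_rank_le n r}" by (rule adhE)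
  have "rank_defect n (n-r) (F k) (G k)" for k
    using FG(3)[rule_format, of k] by (intro rank_defect_pencil) (auto simp: sym_pencils_rank_le_def)
  then have rd: "rank_defect n (n-r) A B" by (rule rank_defect_limit[OF FG(1,2)])
  obtain a where "2 * a \<le> r" "has_pattern n (n-r) a A B" by (rule rank_defect_bound[OF AB(1,3,2,4) rd less_imp_le[OF r]])
  from has_pattern_rank[OF AB(1,2) this(2)] have "pencil_rank P \<le> r" using r AB(5) by simp
  then show "P \<in> sym_pencils_rank_le n r" using \<open>P \<in> sym_pencils n\<close> by (simp add: sym_pencils_rank_le_def)
qed

lemma has_pattern_bundle_closure:
  assumes r: "r < n" and a: "2 * a \<le> r" and inj: "inj_on \<mu> {1..r - 2 * a}"
    and A: "A \<in> carrier_mat n n" "transpose_mat A = A" and B: "B \<in> carrier_mat n n" "transpose_mat B = B"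
    and pat: "has_pattern n (n - r) a A B"
  shows "pencil A B \<in> bundle_closure n (K_pencil n r a \<mu>)"
proof -
  let ?m = "n - r"
  let ?X = "{(A',B'). A' \<in> carrier_mat n n \<and> B' \<in> carrier_mat n n \<and> pencil A' B' \<in> congruence_bundle (K_pencil n r a \<mu>)}"
  obtain W where W: "W \<in> carrier_mat n n" "det W \<noteq> 0"
    "\<And>i j. i < ?m + a \<Longrightarrow> j < n - a \<Longrightarrow> cmat W A $$ (i,j) = 0 \<and> cmat W B $$ (i,j) = 0" "?m + 2 * a \<le> n"
    by (rule has_pattern_initial[OF A(1) B(1) pat]) blast
  have "(cmat W A, cmat W B) \<in> adh n (normal_pairs n ?m a)"
    by (rule has_pattern_dense[OF cmat_carrier[OF W(1)] cmat_sym[OF A(1) W(1) A(2)] cmat_carrier[OF W(1)] cmat_sym[OF B(1) W(1) B(2)] _ W(4,3)])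
      (use r in simp_all)
  then have "(A,B) \<in> adh n (normal_pairs n ?m a)"
    by (rule cong_closed_back[OF cong_closed_adh[OF cong_closed_normal_pairs] W(1,2) A(1) B(1)])
  moreover have "normal_pairs n ?m a \<subseteq> ?X"
    using normal_pairs_bundle[OF r a inj] cong_closed_carrier[OF cong_closed_normal_pairs[of n ?m a]] by auto
  ultimately have "(A,B) \<in> adh n ?X" using adh_mono by blast
  then show ?thesis
    unfolding bundle_closure_def closure_of_sym_pencils[OF congruence_bundle_sym[OF K_pencil_carrier[OF r a]] A B] .
qed

lemma bundle_closure_minimal:
  assumes "congruence_bundle S \<subseteq> bundle_closure n T"
  shows "bundle_closure n S \<subseteq> bundle_closure n T"
  unfolding bundle_closure_def[of n S]
  by (rule closure_of_minimal[OF assms]) (simp add: bundle_closure_def)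

text \<open>The parameter chosen is the total degree of the blocks M of S, because it is shared by
  all members of the bundle, whereas a pattern found from the rank speaks of S alone. It satisfies
  2a \<le> r because S has size n and at least n - r blocks M.\<close>

lemma rank_le_bundle_closure:
  assumes r: "r < n" and S: "S \<in> sym_pencils n" "pencil_rank S \<le> r"
    and inj: "\<And>a. 2 * a \<le> r \<Longrightarrow> inj_on (\<mu> a) {1..r - 2 * a}"
  obtains a where "2 * a \<le> r" "bundle_closure n S \<subseteq> bundle_closure n (K_pencil n r a (\<mu> a))"
proof (cases "\<exists>bs. canonical_form_of S bs")
  \<comment> \<open>The bundle ranges over the canonical forms of S; without any it is empty, and a
    = 0 serves.\<close>
  case False
  then have "congruence_bundle S = {}" by (auto simp: congruence_bundle_def)
  then show ?thesis using that[of 0] by (simp add: bundle_closure_def)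
next
  case True
  obtain A B where AB: "A \<in> carrier_mat n n" "B \<in> carrier_mat n n" "transpose_mat A = A" "transpose_mat B = B" "S = pencil A B" using S(1) by (rule sym_pencilsE)
  have Sc: "S \<in> carrier_mat n n" unfolding AB(5) by (rule pencil_carrier[OF AB(1,2)])
  from True obtain bs where bs: "canonical_form_of S bs" ..
  have t: "tdim bs = n" by (rule canonical_form_dim[OF Sc bs])
  let ?A = "lin_part 1 (block_diag bs)" let ?B = "lin_part 0 (block_diag bs)"
  have cc: "?A \<in> carrier_mat n n" "?B \<in> carrier_mat n n" using block_diag_carrier[of bs] t by simp_all
  obtain W where W: "W \<in> carrier_mat n n" "det W \<noteq> 0" "S = pencil (cmat W ?A) (cmat W ?B)"
    using bs t unfolding canonical_form_of_def block_diag_orbit by auto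
  note C = cmat_carrier[OF W(1), of ?A] cmat_sym[OF cc(1) W(1) block_diag_sym] cmat_carrier[OF W(1), of ?B] cmat_sym[OF cc(2) W(1) block_diag_sym]
  have "rank_defect n (n - r) (cmat W ?A) (cmat W ?B)"
    using S(2) unfolding W(3) by (rule rank_defect_pencil[OF C(1,3)])
  then obtain a' where p: "has_pattern n (n-r) a' (cmat W ?A) (cmat W ?B)" using rank_defect_has_pattern[OF C] by blast
  have "test_pair n (numM bs) (degM bs) (cmat W ?A) (cmat W ?B)"
    using test_pair_cmat[OF cc W(1,2)] block_diag_test_pair[of bs] t by simp
  \<comment> \<open>The pattern obtained from the rank yields, against the test pair of the
    canonical form, at least n - r blocks M.\<close>
  then have m: "n - r \<le> numM bs" by (rule test_pair_pattern(1)[OF C _ p])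
  let ?a = "degM bs"
  have a: "2 * ?a \<le> r" using m numM_degM_le[of bs] t r by linarith
  have "congruence_bundle S \<subseteq> bundle_closure n (K_pencil n r ?a (\<mu> ?a))"
  proof
    fix T assume "T \<in> congruence_bundle S"
    then obtain bs' A' B' where T: "canonical_form_of S bs'" "A' \<in> carrier_mat n n" "B' \<in> carrier_mat n n" "transpose_mat A' = A'" "transpose_mat B' = B'"
      "T = pencil A' B'" "\<And>m. m \<le> numM bs' \<Longrightarrow> has_pattern n m (degM bs') A' B'"
      by (rule congruence_bundleE[OF Sc]) blast
    have e: "numM bs' = numM bs" "degM bs' = ?a" by (rule canonical_form_unique_invariants[OF Sc T(1) bs])+
    have "has_pattern n (n-r) ?a A' B'" using T(7)[of "n-r"] m unfolding e by blast
    then show "T \<in> bundle_closure n (K_pencil n r ?a (\<mu> ?a))"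
      unfolding T(6) by (rule has_pattern_bundle_closure[OF r a inj[OF a] T(2,4,3,5)])
  qed
  then show ?thesis by (rule that[OF a bundle_closure_minimal])
qed

lemma K_list_cdet:
  assumes r: "r < n" and inj: "inj_on \<mu> {1..r - 2 * a}"
  obtains C where "degree C = 0" "C \<noteq> 0"
    "prod_list (map cdet (K_list n r a \<mu>)) = C * (\<Prod>x\<in>\<mu> ` {1..r - 2*a}. [:- x, 1:])"
proof -
  define C where "C = unitM (a div (n-r) + 1) ^ (a mod (n-r)) * unitM (a div (n-r)) ^ (n - r - a mod (n-r))"
  have "C^2 = 1" unfolding C_def
    by (simp add: power_mult_distrib power_even_eq[symmetric] power_mult[symmetric] mult.commute[of _ 2] power_mult unitM_sq del: One_nat_def add_Suc_right)
  then have C: "degree C = 0" "C \<noteq> 0" using degree_unit_sq[of C] by auto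
  have J: "cdet (Block_J (Finite x) 1) = [:- x, 1:]" for x
    using det_single[of "J_block 1 x"] by (simp add: J_block_def)
  have "prod_list (map (\<lambda>i. [:- \<mu> i, 1:]) [1..<r - 2*a + 1]) = (\<Prod>i\<in>set [1..<r - 2*a + 1]. [:- \<mu> i, 1:])"
    by (rule prod.distinct_set_conv_list[symmetric]) simp
  also have "set [1..<r - 2*a + 1] = {1..r - 2*a}" by auto
  also have "(\<Prod>i\<in>{1..r - 2*a}. [:- \<mu> i, 1:]) = (\<Prod>x\<in>\<mu> ` {1..r - 2*a}. [:- x, 1:])"
    by (subst prod.reindex[OF inj]) (simp add: o_def)
  finally have "prod_list (map cdet (K_list n r a \<mu>)) = C * (\<Prod>x\<in>\<mu> ` {1..r - 2*a}. [:- x, 1:])"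
    using J by (simp add: K_list_def Let_def C_def o_def del: upt_Suc cdet.simps(2) One_nat_def)
  then show ?thesis by (rule that[OF C])
qed

text \<open>The r - 2a' simple roots of the first determinant make \<open>p1\<close> constant and
  give g the full degree r - 2a', which must fit into r - 2a. With this degree of g fixed, the
  second determinant leaves degree exactly 2a' for \<open>p2^2\<close>.\<close>

lemma bundle_closures_incomparable:
  assumes r: "r < n" and a: "2 * a \<le> r" and a': "2 * a' \<le> r" and inj: "inj_on \<mu>' {1..r - 2 * a'}"
    and sub: "bundle_closure n (K_pencil n r a' \<mu>') \<subseteq> bundle_closure n (K_pencil n r a \<mu>)"
  shows "a = a'"
proof -
  let ?bs = "K_list n r a' \<mu>'" let ?m = "n - r"
  let ?A = "lin_part 1 (block_diag ?bs)" let ?B = "lin_part 0 (block_diag ?bs)"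
  note sz = K_list_size[OF r a', of \<mu>']
  have cc: "?A \<in> carrier_mat n n" "?B \<in> carrier_mat n n" using block_diag_carrier[of ?bs] sz(1) by simp_all
  have X: "congruence_bundle (K_pencil n r a \<mu>) \<subseteq> sym_pencils n" "congruence_bundle (K_pencil n r a' \<mu>') \<subseteq> sym_pencils n"
    by (rule congruence_bundle_sym[OF K_pencil_carrier[OF r a]], rule congruence_bundle_sym[OF K_pencil_carrier[OF r a']])
  have "congruence_bundle (K_pencil n r a' \<mu>') \<subseteq> bundle_closure n (K_pencil n r a' \<mu>')"
    unfolding bundle_closure_def by (rule closure_of_subset) (simp add: topspace_sym_pencil_topology X)
  then have "pencil ?A ?B \<in> bundle_closure n (K_pencil n r a \<mu>)"
    using K_in_bundle[OF r a', of \<mu>'] sub unfolding block_diag_pencil K_pencil_list[of n r a' \<mu>'] by blast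
  then have "(?A,?B) \<in> adh n {(A',B'). A' \<in> carrier_mat n n \<and> B' \<in> carrier_mat n n \<and> pencil A' B' \<in> congruence_bundle (K_pencil n r a \<mu>)}"
    unfolding bundle_closure_def closure_of_sym_pencils[OF X(1) cc(1) block_diag_sym cc(2) block_diag_sym] .
  then obtain F G where FG: "matlim n F ?A" "matlim n G ?B"
    "\<forall>k. (F k, G k) \<in> {(A',B'). A' \<in> carrier_mat n n \<and> B' \<in> carrier_mat n n \<and> pencil A' B' \<in> congruence_bundle (K_pencil n r a \<mu>)}" by (rule adhE)
  have k: "transpose_mat (F k) = F k \<and> transpose_mat (G k) = G k \<and> has_pattern n ?m a (F k) (G k)" for k
  proof -
    have c: "F k \<in> carrier_mat n n" "G k \<in> carrier_mat n n" "pencil (F k) (G k) \<in> congruence_bundle (K_pencil n r a \<mu>)" using FG(3)[rule_format, of k] by auto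
    obtain A' B' where AB': "A' \<in> carrier_mat n n" "B' \<in> carrier_mat n n" "transpose_mat A' = A'" "transpose_mat B' = B'"
      "pencil (F k) (G k) = pencil A' B'" "has_pattern n ?m a A' B'" by (rule K_bundle_pattern[OF r a c(3)])
    have "F k = A'" "G k = B'" using arg_cong[OF AB'(5), of "lin_part 1"] arg_cong[OF AB'(5), of "lin_part 0"]
      unfolding lin_part_pencil[OF c(1,2)] lin_part_pencil[OF AB'(1,2)] by auto
    then show ?thesis using AB'(3,4,6) by simp
  qed
  then have sym: "\<And>k. transpose_mat (F k) = F k" "\<And>k. transpose_mat (G k) = G k" and pat: "\<And>k. has_pattern n ?m a (F k) (G k)" by blast+
  obtain U1 U2 where U: "U1 \<in> carrier_mat n ?m" "U2 \<in> carrier_mat n ?m"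
    "det (block_diag ?bs + outer U1) = prod_list (map cdet ?bs)"
    "det (block_diag ?bs + outer U2) = prod_list (map cdet ?bs) * monom 1 (2 * a')"
    by (rule block_diag_test_mats[of ?bs, unfolded sz])
  obtain g p1 p2 \<gamma>1 \<gamma>2 where g: "degree g \<le> n - ?m - 2*a" "degree p1 \<le> a" "degree p2 \<le> a"
    "det (pencil ?A ?B + outer U1) = smult \<gamma>1 (g * p1^2)" "det (pencil ?A ?B + outer U2) = smult \<gamma>2 (g * p2^2)"
    by (rule pattern_limit_dets[OF FG(1,2) sym pat U(1,2)])
  obtain C where C: "degree C = 0" "C \<noteq> 0"
    "prod_list (map cdet ?bs) = C * (\<Prod>x\<in>\<mu>' ` {1..r - 2*a'}. [:- x, 1:])" by (rule K_list_cdet[OF r inj])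
  have D1: "C * (\<Prod>x\<in>\<mu>' ` {1..r - 2*a'}. [:- x, 1:]) = smult \<gamma>1 (g * p1^2)"
    using g(4) unfolding block_diag_pencil U(3) C(3) .
  have "degree p1 = 0" and "degree g = card (\<mu>' ` {1..r - 2*a'})"
    by (rule distinct_roots_square_factor[OF C(1,2) D1]; simp)+
  then have p1: "degree p1 = 0" and dg: "degree g = r - 2*a'" using card_image[OF inj] by simp_all
  have "r - 2*a' \<le> r - 2*a" using g(1) dg r by simp
  then have le: "a \<le> a'" using a a' by linarith
  have nz: "smult \<gamma>1 (g * p1^2) \<noteq> 0" unfolding D1[symmetric] using C(2) by simp
  have D2: "smult \<gamma>1 (g * p1^2) * monom 1 (2 * a') = smult \<gamma>2 (g * p2^2)"
    using g(5) unfolding block_diag_pencil U(4) C(3) D1 .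
  then have "smult \<gamma>2 (g * p2^2) \<noteq> 0" using nz by (metis monom_eq_0_iff mult_eq_0_iff one_neq_zero)
  then have "degree (smult \<gamma>2 (g * p2^2)) = degree g + 2 * degree p2" by (auto simp: degree_mult_eq degree_power_eq)
  moreover have "degree (smult \<gamma>1 (g * p1^2) * monom 1 (2 * a')) = degree g + 2 * a'"
    using nz p1 by (auto simp: degree_mult_eq degree_power_eq degree_monom_eq)
  ultimately have "degree g + 2 * degree p2 = degree g + 2 * a'" unfolding D2 by (rule trans[OF HOL.sym])
  then have "degree p2 = a'" by simp
  then show ?thesis using le g(3) by simp
qed

theorem theorem3p2:
  fixes n r :: nat and \<mu> :: "nat \<Rightarrow> nat \<Rightarrow> complex"
  assumes "n \<ge> 2" and "1 \<le> r" and "r \<le> n - 1"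
    and "\<And>a. a \<le> r div 2 \<Longrightarrow> inj_on (\<mu> a) {1..r - 2 * a}"
  shows
    "(\<forall>S \<in> sym_pencils n. pencil_rank S \<le> r \<longrightarrow>
        (\<exists>a \<in> {0..r div 2}. bundle_closure n (K_pencil n r a (\<mu> a)) \<supseteq> bundle_closure n S)) \<and>
     (\<forall>a \<in> {0..r div 2}. \<forall>a' \<in> {0..r div 2}. a \<noteq> a' \<longrightarrow>
        \<not> bundle_closure n (K_pencil n r a (\<mu> a)) \<supseteq> bundle_closure n (K_pencil n r a' (\<mu> a'))) \<and>
     closedin (sym_pencil_topology n) (sym_pencils_rank_le n r) \<and>
     sym_pencils_rank_le n r = (\<Union>a \<in> {0..r div 2}. bundle_closure n (K_pencil n r a (\<mu> a)))"
proof (intro conjI ballI impI)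
  have r: "r < n" using assms by simp
  have a: "2 * a \<le> r" if "a \<in> {0..r div 2}" for a using that by simp
  have inj: "inj_on (\<mu> a) {1..r - 2 * a}" if "2 * a \<le> r" for a using assms(4)[of a] that by simp
  show "\<exists>a \<in> {0..r div 2}. bundle_closure n (K_pencil n r a (\<mu> a)) \<supseteq> bundle_closure n S"
    if S: "S \<in> sym_pencils n" "pencil_rank S \<le> r" for S
  proof -
    obtain a where "2 * a \<le> r" "bundle_closure n S \<subseteq> bundle_closure n (K_pencil n r a (\<mu> a))"
      by (rule rank_le_bundle_closure[OF r S inj])
    then show ?thesis by (intro bexI[of _ a]) auto
  qed
  show "\<not> bundle_closure n (K_pencil n r a (\<mu> a)) \<supseteq> bundle_closure n (K_pencil n r a' (\<mu> a'))"
    if "a \<in> {0..r div 2}" "a' \<in> {0..r div 2}" "a \<noteq> a'" for a a'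
    using bundle_closures_incomparable[OF r a[OF that(1)] a[OF that(2)] inj[OF a[OF that(2)]]] that(3) by blast
  show cl: "closedin (sym_pencil_topology n) (sym_pencils_rank_le n r)" by (rule closedin_sym_pencils_rank_le[OF r])
  show "sym_pencils_rank_le n r = (\<Union>a \<in> {0..r div 2}. bundle_closure n (K_pencil n r a (\<mu> a)))"
  proof (intro subset_antisym subsetI)
    fix P assume P: "P \<in> sym_pencils_rank_le n r"
    then have "P \<in> sym_pencils n" "pencil_rank P \<le> r" by (auto simp: sym_pencils_rank_le_def)
    then obtain A B where AB: "A \<in> carrier_mat n n" "B \<in> carrier_mat n n" "transpose_mat A = A" "transpose_mat B = B" "P = pencil A B" by (elim sym_pencilsE)
    have "rank_defect n (n - r) A B" using \<open>pencil_rank P \<le> r\<close> unfolding AB(5) by (rule rank_defect_pencil[OF AB(1,2)])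
    then obtain b where b: "2 * b \<le> r" "has_pattern n (n - r) b A B"
      by (rule rank_defect_bound[OF AB(1,3,2,4)]) (use r in simp_all)
    have "P \<in> bundle_closure n (K_pencil n r b (\<mu> b))"
      unfolding AB(5) by (rule has_pattern_bundle_closure[OF r b(1) inj[OF b(1)] AB(1,3,2,4) b(2)])
    then show "P \<in> (\<Union>a \<in> {0..r div 2}. bundle_closure n (K_pencil n r a (\<mu> a)))" using b(1) by (intro UN_I[of b]) auto
  next
    fix P assume "P \<in> (\<Union>a \<in> {0..r div 2}. bundle_closure n (K_pencil n r a (\<mu> a)))"
    then obtain b where b: "2 * b \<le> r" "P \<in> bundle_closure n (K_pencil n r b (\<mu> b))" using a by (elim UN_E) blast
    \<comment> \<open>Members of the bundle have a pattern and hence rank at most r; closedness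
      extends this to the closure.\<close>
    have "congruence_bundle (K_pencil n r b (\<mu> b)) \<subseteq> sym_pencils_rank_le n r"
    proof
      fix T assume "T \<in> congruence_bundle (K_pencil n r b (\<mu> b))"
      then obtain A B where AB: "A \<in> carrier_mat n n" "B \<in> carrier_mat n n" "transpose_mat A = A" "transpose_mat B = B"
        "T = pencil A B" "has_pattern n (n-r) b A B" by (rule K_bundle_pattern[OF r b(1)])
      have "pencil_rank T \<le> r" using has_pattern_rank[OF AB(1,2,6)] r AB(5) by simp
      moreover have "T \<in> sym_pencils n" unfolding sym_pencils_def using AB(1-5) by blast
      ultimately show "T \<in> sym_pencils_rank_le n r" by (simp add: sym_pencils_rank_le_def)
    qed
    then have "bundle_closure n (K_pencil n r b (\<mu> b)) \<subseteq> sym_pencils_rank_le n r"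
      unfolding bundle_closure_def by (rule closure_of_minimal[OF _ cl])
    then show "P \<in> sym_pencils_rank_le n r" using b(2) by blast
  qed
qed

end
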